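(* Let $\sigma/2<\rho<\sigma$ and $S=[-\sigma,-\rho]\cup[\rho,\sigma]$. (A) The set $\mathrm{Ext}(PW_S^1)$ consists precisely of the functions $f\in PW_S^1$ such that $\|f\|_1=1$, at least one of the points $\sigma,-\sigma,\rho,-\rho$ belongs to $\mathrm{Sp}(f)$, and $\Lambda(f_-)\cap\Lambda(f_+)=\emptyset$. (B) The set $\mathrm{Exp}(PW_S^1)$ consists precisely of the functions $f\in\mathrm{Ext}(PW_S^1)$ such that $\Omega(f_-)\cap\Omega(f_+)=\emptyset$ and $$\int_{\mathbb R}|f(x)|\,w(x)\,dx=\infty$$ for every nonconstant entire function $w$ with $\mathrm{Type}(w)=0$ and $w(x)\ge 0$ for all $x\in\mathbb R$.
   Context: Fourier transform: $\hat f(t)=\int_{\mathbb R}e^{-2\pi i tx}f(x)\,dx$. For $f\in L^1(\mathbb R)$ the spectrum is $\mathrm{Sp}(f)=\overline{\{t\in\mathbb R:\hat f(t)\neq 0\}}$ (extended to tempered distributions as the support of the distributional Fourier transform). For a closed set $S\subset\mathbb R$, $PW_S^1=\{f\in L^1(\mathbb R):\mathrm{Sp}(f)\subset S\}$, a complex Banach space with the $L^1$-norm $\|\cdot\|_1$. When $S$ is bounded, elements of $PW_S^1$ are identified with (restrictions to $\mathbb R$ of) entire functions of exponential type. For a Banach space $X$, $\mathrm{ball}(X)=\{f\in X:\|f\|\le1\}$. An element of $\mathrm{ball}(X)$ is extreme if it is not an interior point of any line segment contained in $\mathrm{ball}(X)$. An element $f\in\mathrm{ball}(X)$ is an exposed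 point if there is $\phi\in X^*$ with $\|\phi\|=1$ such that $\{g\in\mathrm{ball}(X):\phi(g)=1\}=\{f\}$. $\mathrm{Ext}(PW_S^1)$ and $\mathrm{Exp}(PW_S^1)$ are the sets of extreme and of exposed points of $\mathrm{ball}(PW_S^1)$. For $S=[-\sigma,-\rho]\cup[\rho,\sigma]$, every $f\in PW_S^1$ has a unique representation $f=f_-+f_+$ with $\mathrm{Sp}(f_-)\subset[-\sigma,-\rho]$ and $\mathrm{Sp}(f_+)\subset[\rho,\sigma]$; $f_\pm$ are entire functions. For an entire function $g$: $\Lambda(g)\subset\mathbb C\setminus\mathbb R$ is the set of all $\lambda\in\mathbb C\setminus\mathbb R$ with $g(\lambda)=g(\bar\lambda)=0$; $\Omega(g)\subset\mathbb R$ is the multiset of all $x\in\mathbb R$ at which $g$ has a zero of multiplicity at least $2$, where $x$ is counted with multiplicity $2n(x)$, $n(x)\ge1$ being the integer such that the multiplicity of the zero of $g$ at $x$ is $2n(x)$ or $2n(x)+1$. (If $g\equiv0$, every real point is regarded as belonging to $\Omega(g)$.) The condition $\Omega(f_-)\cap\Omega(f_+)=\emptyset$ means that no point belongs to both. An entire function $f$ has exponential type $d\ge0$, written $\mathrm{Type}(f)=d$, if for every $\varepsilon>0$ there is $C_\varepsilon$ with $|f(z)|\le C_\varepsilon e^{(d+\varepsilon)|z|}$ for all $z\in\mathbb C$, and $|f(z_n)|>e^{(d-\varepsilon)|z_n|}$ for some sequence $|z_n|\to\infty$. *)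

theory Defs
  imports "HOL-Complex_Analysis.Complex_Analysis"
begin

text \<open>The representative \<open>rep_L1 f\<close> is determined only up to a null set, so it may only be used
  under an integral or an almost-everywhere quantifier.\<close>

quotient_type L1 = "real \<Rightarrow> complex" / partial:
  "\<lambda>f g. integrable lborel f \<and> integrable lborel g \<and> (AE x in lborel. f x = g x)"
proof (rule part_equivpI)
  show "\<exists>f::real \<Rightarrow> complex. integrable lborel f \<and> integrable lborel f \<and> (AE x in lborel. f x = f x)"
    by (rule exI[of _ "\<lambda>_. 0"]) simp
  show "symp (\<lambda>f g :: real \<Rightarrow> complex.
          integrable lborel f \<and> integrable lborel g \<and> (AE x in lborel. f x = g x))"
    by (rule sympI) (auto elim: AE_mp)
  show "transp (\<lambda>f g :: real \<Rightarrow> complex.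
          integrable lborel f \<and> integrable lborel g \<and> (AE x in lborel. f x = g x))"
  proof (rule transpI, elim conjE, intro conjI)
    fix f g h :: "real \<Rightarrow> complex"
    assume "AE x in lborel. f x = g x" "AE x in lborel. g x = h x"
    then show "AE x in lborel. f x = h x"
      by eventually_elim simp
  qed
qed

instantiation L1 :: real_normed_vector
begin

lift_definition zero_L1 :: L1 is "\<lambda>_. 0"
  by simp

lift_definition plus_L1 :: "L1 \<Rightarrow> L1 \<Rightarrow> L1" is "\<lambda>f g x. f x + g x"
  by auto

lift_definition uminus_L1 :: "L1 \<Rightarrow> L1" is "\<lambda>f x. - f x"
  by auto

lift_definition minus_L1 :: "L1 \<Rightarrow> L1 \<Rightarrow> L1" is "\<lambda>f g x. f x - g x"
  by auto

lift_definition scaleR_L1 :: "real \<Rightarrow> L1 \<Rightarrow> L1" is "\<lambda>r f x. r *\<^sub>R f x"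
  by auto

lift_definition norm_L1 :: "L1 \<Rightarrow> real" is "\<lambda>f. integral\<^sup>L lborel (\<lambda>x. cmod (f x))"
  by (rule integral_cong_AE) auto

definition dist_L1 :: "L1 \<Rightarrow> L1 \<Rightarrow> real"
  where "dist_L1 f g = norm (f - g)"

definition sgn_L1 :: "L1 \<Rightarrow> L1"
  where "sgn_L1 f = inverse (norm f) *\<^sub>R f"

definition uniformity_L1 :: "(L1 \<times> L1) filter"
  where "uniformity_L1 = (INF e\<in>{0<..}. principal {(f, g). dist f g < e})"

definition open_L1 :: "L1 set \<Rightarrow> bool"
  where "open_L1 U = (\<forall>f\<in>U. eventually (\<lambda>(f', g). f' = f \<longrightarrow> g \<in> U) uniformity)"

instance
proof
  fix f g h :: L1 and a b :: real
  show "f + g + h = f + (g + h)" by transfer (auto simp: add.assoc)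
  show "f + g = g + f" by transfer (auto simp: add.commute)
  show "0 + f = f" by transfer auto
  show "- f + f = 0" by transfer auto
  show "f - g = f + - g" by transfer auto
  show "a *\<^sub>R (f + g) = a *\<^sub>R f + a *\<^sub>R g" by transfer (auto simp: algebra_simps)
  show "(a + b) *\<^sub>R f = a *\<^sub>R f + b *\<^sub>R f" by transfer (auto simp: algebra_simps)
  show "a *\<^sub>R b *\<^sub>R f = (a * b) *\<^sub>R f" by transfer auto
  show "1 *\<^sub>R f = f" by transfer auto
  show "dist f g = norm (f - g)" by (rule dist_L1_def)
  show "sgn f = inverse (norm f) *\<^sub>R f" by (rule sgn_L1_def)
  show "norm (a *\<^sub>R f) = \<bar>a\<bar> * norm f" by transfer simp
  show "norm (f + g) \<le> norm f + norm g"
  proof transfer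
    fix f g :: "real \<Rightarrow> complex"
    assume "integrable lborel f \<and> integrable lborel f \<and> (AE x in lborel. f x = f x)"
      "integrable lborel g \<and> integrable lborel g \<and> (AE x in lborel. g x = g x)"
    then have f: "integrable lborel f" and g: "integrable lborel g" by auto
    have "integral\<^sup>L lborel (\<lambda>x. cmod (f x + g x))
        \<le> integral\<^sup>L lborel (\<lambda>x. cmod (f x) + cmod (g x))"
      using f g by (intro integral_mono) (auto intro: norm_triangle_ineq)
    also have "\<dots> = integral\<^sup>L lborel (\<lambda>x. cmod (f x)) + integral\<^sup>L lborel (\<lambda>x. cmod (g x))"
      using f g by (intro Bochner_Integration.integral_add) auto
    finally show "integral\<^sup>L lborel (\<lambda>x. cmod (f x + g x))
        \<le> integral\<^sup>L lborel (\<lambda>x. cmod (f x)) + integral\<^sup>L lborel (\<lambda>x. cmod (g x))" .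
  qed
  show "norm f = 0 \<longleftrightarrow> f = 0"
  proof transfer
    fix f :: "real \<Rightarrow> complex"
    assume "integrable lborel f \<and> integrable lborel f \<and> (AE x in lborel. f x = f x)"
    then show "integral\<^sup>L lborel (\<lambda>x. cmod (f x)) = 0 \<longleftrightarrow>
        integrable lborel f \<and> integrable lborel (\<lambda>_::real. 0::complex) \<and> (AE x in lborel. f x = 0)"
      using integral_nonneg_eq_0_iff_AE[of lborel "\<lambda>x. cmod (f x)"] by auto
  qed
qed (simp_all add: uniformity_L1_def open_L1_def)

end

lift_definition scaleC_L1 :: "complex \<Rightarrow> L1 \<Rightarrow> L1" is "\<lambda>c f x. c * f x"
  by auto

lift_definition fourier :: "L1 \<Rightarrow> real \<Rightarrow> complex" is
  "\<lambda>f t. integral\<^sup>L lborel (\<lambda>x. exp (- 2 * pi * \<i> * of_real t * of_real x) * f x)"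
proof (elim conjE, rule ext, rule integral_cong_AE)
  fix f g :: "real \<Rightarrow> complex" and t :: real
  assume "integrable lborel f" "integrable lborel g" and eq: "AE x in lborel. f x = g x"
  then have [measurable]: "f \<in> borel_measurable borel" "g \<in> borel_measurable borel"
    by auto
  show "(\<lambda>x. exp (- 2 * pi * \<i> * of_real t * of_real x) * f x) \<in> borel_measurable lborel"
    "(\<lambda>x. exp (- 2 * pi * \<i> * of_real t * of_real x) * g x) \<in> borel_measurable lborel"
    by measurable
  show "AE x in lborel. exp (- 2 * pi * \<i> * of_real t * of_real x) * f x
      = exp (- 2 * pi * \<i> * of_real t * of_real x) * g x"
    using eq by eventually_elim simp
qed

definition Sp :: "L1 \<Rightarrow> real set"
  where "Sp f = closure {t. fourier f t \<noteq> 0}"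

definition PW1 :: "real set \<Rightarrow> L1 set"
  where "PW1 S = {f. Sp f \<subseteq> S}"

definition unit_ball :: "L1 set \<Rightarrow> L1 set"
  where "unit_ball X = X \<inter> cball 0 1"

definition Ext :: "L1 set \<Rightarrow> L1 set"
  where "Ext X = {f. f extreme_point_of unit_ball X}"

text \<open>The dual of a complex subspace \<open>X\<close> of $L^1$. The functionals are total functions of which
  only the values on \<open>X\<close> matter; \<open>dual_norm\<close> is meaningful only for members of \<open>dual X\<close>.\<close>

definition dual :: "L1 set \<Rightarrow> (L1 \<Rightarrow> complex) set"
  where "dual X = {\<phi>.
    (\<forall>f\<in>X. \<forall>g\<in>X. \<phi> (f + g) = \<phi> f + \<phi> g) \<and>
    (\<forall>c. \<forall>f\<in>X. \<phi> (scaleC_L1 c f) = c * \<phi> f) \<and>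
    (\<exists>B. \<forall>f\<in>X. cmod (\<phi> f) \<le> B * norm f)}"

definition dual_norm :: "L1 set \<Rightarrow> (L1 \<Rightarrow> complex) \<Rightarrow> real"
  where "dual_norm X \<phi> = (SUP f\<in>unit_ball X. cmod (\<phi> f))"

definition Exp :: "L1 set \<Rightarrow> L1 set"
  where "Exp X = {f \<in> unit_ball X.
    \<exists>\<phi>\<in>dual X. dual_norm X \<phi> = 1 \<and> {g \<in> unit_ball X. \<phi> g = 1} = {f}}"

text \<open>The entire function that agrees almost everywhere on the real line with a given element of
  $L^1$; it is unique, and it exists for elements with bounded spectrum.\<close>

definition entire_ext :: "L1 \<Rightarrow> complex \<Rightarrow> complex"
  where "entire_ext f = (THE F. F holomorphic_on UNIV \<and>
    (AE x in lborel. rep_L1 f x = F (of_real x)))"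

text \<open>The decomposition $f = f_- + f_+$ for $\mathrm{Sp}(f) \subset [-\sigma,-\rho]\cup[\rho,\sigma]$.
  It exists and is unique when $0 < \rho$; both parts then lie in $L^1$ because there is a
  Schwartz multiplier equal to 1 on one of the intervals and to 0 on the other.\<close>

definition spectral_parts :: "real \<Rightarrow> real \<Rightarrow> L1 \<Rightarrow> L1 \<times> L1"
  where "spectral_parts \<rho> \<sigma> f = (THE p.
    fst p \<in> PW1 {-\<sigma>..-\<rho>} \<and> snd p \<in> PW1 {\<rho>..\<sigma>} \<and> f = fst p + snd p)"

definition neg_part :: "real \<Rightarrow> real \<Rightarrow> L1 \<Rightarrow> complex \<Rightarrow> complex"
  where "neg_part \<rho> \<sigma> f = entire_ext (fst (spectral_parts \<rho> \<sigma> f))"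

definition pos_part :: "real \<Rightarrow> real \<Rightarrow> L1 \<Rightarrow> complex \<Rightarrow> complex"
  where "pos_part \<rho> \<sigma> f = entire_ext (snd (spectral_parts \<rho> \<sigma> f))"

definition Lambda :: "(complex \<Rightarrow> complex) \<Rightarrow> complex set"
  where "Lambda g = {z. z \<notin> \<real> \<and> g z = 0 \<and> g (cnj z) = 0}"

text \<open>The multiset $\Omega(g)$ may be infinite, so it is given by its counting function, which sends
  a zero of multiplicity $2n$ or $2n+1$ to $2n$. The case distinction is needed because \<open>zorder\<close>
  is unspecified for the zero function.\<close>

definition Omega :: "(complex \<Rightarrow> complex) \<Rightarrow> real \<Rightarrow> enat"
  where "Omega g x =
    (if \<forall>z. g z = 0 then \<infinity> else enat (2 * (nat (zorder g (of_real x)) div 2)))"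

definition Omega_points :: "(complex \<Rightarrow> complex) \<Rightarrow> real set"
  where "Omega_points g = {x. Omega g x \<noteq> 0}"

definition has_exp_type :: "(complex \<Rightarrow> complex) \<Rightarrow> real \<Rightarrow> bool"
  where "has_exp_type g d \<longleftrightarrow> g holomorphic_on UNIV \<and> 0 \<le> d \<and>
    (\<forall>\<epsilon>>0.
      (\<exists>C. \<forall>z. cmod (g z) \<le> C * exp ((d + \<epsilon>) * cmod z)) \<and>
      (\<exists>z :: nat \<Rightarrow> complex. filterlim z at_infinity sequentially \<and>
        (\<forall>n. cmod (g (z n)) > exp ((d - \<epsilon>) * cmod (z n)))))"

end

theory Submission
  imports Defs "HOL-Probability.Probability"
begin

text \<open>Both parts of the theorem are instances of one rigidity question: which normalized \<open>g\<close> in the space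
have the same argument as \<open>f\<close> on the real line, in the sense that \<open>g * cnj f\<close> is nonnegative?
If \<open>f\<close> lies inside a segment of the unit ball, then equality in the triangle inequality makes
an endpoint \<open>g\<close> such a function, with \<open>g / f\<close> bounded. If \<open>f\<close> norms the functional given by
integration against \<open>cnj (sgn f)\<close>, then the other functions normed by it are of this kind, with
\<open>g / f\<close> possibly unbounded. Conversely, a bounded real nonconstant multiplier that keeps
\<open>f\<close> in the space splits \<open>f\<close> (\<open>real_multiplier_not_extreme\<close>), and a nonnegative nonconstant one,
bounded or not, shows that \<open>f\<close> is not exposed, because the norm is differentiable at \<open>f\<close> in the
direction of the product (\<open>exposed_imp_rigid\<close>). The multipliers behind the necessary conditions are a
slow cosine if the spectrum avoids the four endpoints, \<open>1 / \<bar>x - \<lambda>\<bar>\<^sup>2\<close> if both parts vanish at \<open>\<lambda>\<close> and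
at \<open>cnj \<lambda>\<close>, or if they have a common double zero at a real \<open>\<lambda>\<close>, and the weight itself if the
weighted integral converges.

For sufficiency, let \<open>f\<close> and \<open>g\<close> have the same argument. The heart of the proof is that the quotient
\<open>g / f\<close> also relates the parts: \<open>g\<^sub>+ f = g f\<^sub>+\<close> and \<open>g\<^sub>- f = g f\<^sub>-\<close> (\<open>same_argument_parts\<close>). After
a reduction to functions that are real on the line, \<open>f = 2 Re p\<close> and \<open>g = 2 Re q\<close> with the spectra of
\<open>p\<close> and \<open>q\<close> in \<open>[\<rho>, \<sigma>]\<close>, and \<open>B = Im (q * cnj p)\<close> has its spectrum in \<open>[\<rho> - \<sigma>, \<sigma> - \<rho>]\<close>. The
hypothesis \<open>\<sigma> < 2 \<rho>\<close> makes this interval shorter than the spectral gap of \<open>f\<close>, and a principle of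
Sturm and Hurwitz type applies: a real function without low frequencies oscillates too fast for
the sign changes of \<open>B * Re p\<close> all to be zeros of \<open>B\<close>. They are zeros of \<open>B\<close>, because where
\<open>Re p\<close> changes sign, \<open>Re q\<close> vanishes too; so \<open>B = 0\<close> (\<open>same_signs_imp_real_ratio\<close>).

Hence a pole of \<open>\<phi> = g / f\<close> is a common zero of \<open>f\<^sub>+\<close> and \<open>f\<^sub>-\<close>. As \<open>\<phi>\<close> is real on the line,
nonreal poles come in conjugate pairs, which the condition on \<open>\<Lambda>\<close> excludes; as \<open>\<phi>\<close> is
nonnegative there, a real pole has even order, which is excluded by the boundedness of \<open>\<phi>\<close> in one
case and by the condition on \<open>\<Omega>\<close> in the other (\<open>same_argument_quotient\<close>). So \<open>\<phi>\<close> is entire.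
Since an endpoint belongs to the spectrum, one part of \<open>f\<close> has exactly the decay that is guaranteed for
the corresponding part of \<open>g\<close>, and \<open>\<phi>\<close> has exponential type zero (\<open>quotient_type0\<close>). If \<open>\<phi>\<close> is bounded on the
line, it is constant by the theorems of Phragmen-Lindelof and Liouville. Otherwise a nonconstant \<open>\<phi>\<close>
would be a weight for which the integral of \<open>\<bar>f\<bar> \<phi> = \<bar>g\<bar>\<close> is finite.

On the Fourier side, the parts of \<open>f\<close> are recognized by their exponential decay in half-planes
(\<open>entire_ext_band\<close>, \<open>spectral_gap_of_decay\<close>), with the inversion theorem obtained from Levy's inversion formula
for probability distributions.\<close>

section \<open>Decay of entire functions in a half-plane\<close>

text \<open>The values of \<open>star p\<close> in the upper half-plane describe \<open>p\<close> in the lower one, so that decay and growth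
  conditions need only be stated for the upper half-plane.\<close>

definition star :: "(complex \<Rightarrow> complex) \<Rightarrow> complex \<Rightarrow> complex"
  where "star p z = cnj (p (cnj z))"

text \<open>For a band-limited function this means that the spectrum lies to the right of \<open>a / (2 * pi)\<close>.
  Negative rates express bounded growth: a spectrum in \<open>[a, b] / (2 * pi)\<close> amounts to \<open>decays a p\<close>
  together with \<open>decays (- b) (star p)\<close>.\<close>

definition decays :: "real \<Rightarrow> (complex \<Rightarrow> complex) \<Rightarrow> bool"
  where "decays a p \<longleftrightarrow> (\<exists>C. \<forall>z. 0 \<le> Im z \<longrightarrow> cmod (p z) \<le> C * exp (- a * Im z))"

lemma star_star [simp]: "star (star p) = p"
  by (simp add: star_def fun_eq_iff)

lemma star_add: "star (\<lambda>z. p z + q z) = (\<lambda>z. star p z + star q z)"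
  and star_mult: "star (\<lambda>z. p z * q z) = (\<lambda>z. star p z * star q z)"
  by (simp_all add: star_def fun_eq_iff)

lemma star_of_real: "star p (complex_of_real x) = cnj (p (of_real x))"
  by (simp add: star_def)

lemma holomorphic_star:
  assumes "p holomorphic_on UNIV"
  shows "star p holomorphic_on UNIV"
proof -
  have "cnj \<circ> p \<circ> cnj holomorphic_on UNIV"
    by (rule holomorphic_on_compose_cnj_cnj) (use assms in \<open>auto intro: holomorphic_on_subset\<close>)
  then show ?thesis by (simp add: o_def star_def [abs_def])
qed

lemma decaysE:
  assumes "decays a p"
  obtains C where "C \<ge> 0" "\<And>z. 0 \<le> Im z \<Longrightarrow> cmod (p z) \<le> C * exp (- a * Im z)"
proof -
  obtain C where C: "\<And>z. 0 \<le> Im z \<Longrightarrow> cmod (p z) \<le> C * exp (- a * Im z)"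
    using assms by (auto simp: decays_def)
  have "0 \<le> C" using order_trans[OF norm_ge_zero C[of 0]] by simp
  then show ?thesis using C that by blast
qed

lemma decaysI: "(\<And>z. 0 \<le> Im z \<Longrightarrow> cmod (p z) \<le> C * exp (- a * Im z)) \<Longrightarrow> decays a p"
  by (auto simp: decays_def)

lemma decays_mult:
  assumes "decays a p" "decays b q"
  shows "decays (a + b) (\<lambda>z. p z * q z)"
proof -
  obtain C where C: "C \<ge> 0" "\<And>z. 0 \<le> Im z \<Longrightarrow> cmod (p z) \<le> C * exp (- a * Im z)"
    using assms(1) by (elim decaysE) blast
  obtain D where D: "D \<ge> 0" "\<And>z. 0 \<le> Im z \<Longrightarrow> cmod (q z) \<le> D * exp (- b * Im z)"
    using assms(2) by (elim decaysE) blast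
  show ?thesis
  proof (rule decaysI[of _ "C * D"])
    fix z assume z: "0 \<le> Im z"
    have "cmod (p z * q z) \<le> (C * exp (- a * Im z)) * (D * exp (- b * Im z))"
      unfolding norm_mult using C D z by (intro mult_mono) auto
    also have "\<dots> = C * D * exp (- (a + b) * Im z)"
      by (simp add: exp_add[symmetric] algebra_simps)
    finally show "cmod (p z * q z) \<le> C * D * exp (- (a + b) * Im z)" .
  qed
qed

lemma decays_add:
  assumes "decays a p" "decays a q"
  shows "decays a (\<lambda>z. p z + q z)"
proof -
  obtain C where C: "C \<ge> 0" "\<And>z. 0 \<le> Im z \<Longrightarrow> cmod (p z) \<le> C * exp (- a * Im z)"
    using assms(1) by (elim decaysE) blast
  obtain D where D: "D \<ge> 0" "\<And>z. 0 \<le> Im z \<Longrightarrow> cmod (q z) \<le> D * exp (- a * Im z)"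
    using assms(2) by (elim decaysE) blast
  show ?thesis
  proof (rule decaysI[of _ "C + D"])
    fix z assume z: "0 \<le> Im z"
    show "cmod (p z + q z) \<le> (C + D) * exp (- a * Im z)"
      using norm_triangle_ineq[of "p z" "q z"] C(2)[OF z] D(2)[OF z] by (simp add: algebra_simps)
  qed
qed

lemma decays_mono:
  assumes "decays b p" "a \<le> b"
  shows "decays a p"
proof -
  obtain C where C: "C \<ge> 0" "\<And>z. 0 \<le> Im z \<Longrightarrow> cmod (p z) \<le> C * exp (- b * Im z)"
    using assms(1) by (elim decaysE) blast
  show ?thesis
  proof (rule decaysI[of _ C])
    fix z assume z: "0 \<le> Im z"
    have "cmod (p z) \<le> C * exp (- b * Im z)" by (rule C(2)[OF z])
    also have "\<dots> \<le> C * exp (- a * Im z)" using C(1) z assms(2)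
      by (intro mult_left_mono) (auto intro: mult_right_mono)
    finally show "cmod (p z) \<le> C * exp (- a * Im z)" .
  qed
qed

lemma decays_const: "decays 0 (\<lambda>_. c)"
  by (rule decaysI[of _ "cmod c"]) simp

lemma decays_cmult: "decays a p \<Longrightarrow> decays a (\<lambda>z. c * p z)"
  using decays_mult[OF decays_const[of c]] by simp

lemma decays_exp: "decays c (\<lambda>z. exp (\<i> * of_real c * z))"
  by (rule decaysI[of _ 1]) simp

text \<open>\<open>zor_poly\<close> is a local factor at \<open>y\<close>; gluing it to the quotient away from \<open>y\<close> makes the
  factorization global.\<close>

lemma entire_factor_zero:
  assumes p: "p holomorphic_on UNIV" and "p w \<noteq> 0"
  obtains n :: nat and q where "q holomorphic_on UNIV" "q y \<noteq> 0"
    "\<And>z. p z = (z - y) ^ n * q z"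
proof -
  define n where "n = nat (zorder p y)"
  define g where "g = zor_poly p y"
  obtain r where r: "r > 0" "g holomorphic_on cball y r"
    "\<And>u. u \<in> cball y r \<Longrightarrow> p u = g u * (u - y) ^ n \<and> g u \<noteq> 0"
    using zorder_exist_zero[where z = y, OF p open_UNIV connected_UNIV UNIV_I] assms(2)
    unfolding n_def g_def by blast
  define q where "q z = (if z = y then g y else p z / (z - y) ^ n)" for z
  have 1: "q holomorphic_on (UNIV - {y})"
  proof -
    have "(\<lambda>z. p z / (z - y) ^ n) holomorphic_on (UNIV - {y})"
      by (intro holomorphic_intros holomorphic_on_subset[OF p]) auto
    then show ?thesis by (rule holomorphic_transform) (simp add: q_def)
  qed
  have 2: "q holomorphic_on ball y r"
  proof -
    have "g holomorphic_on ball y r" using r(2) by (rule holomorphic_on_subset) auto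
    then show ?thesis
      by (rule holomorphic_transform) (use r(3) in \<open>auto simp: q_def\<close>)
  qed
  have "q holomorphic_on ((UNIV - {y}) \<union> ball y r)"
    using 1 2 by (rule holomorphic_on_Un) auto
  moreover have "(UNIV - {y}) \<union> ball y r = UNIV" using r(1) by auto
  ultimately have "q holomorphic_on UNIV" by simp
  moreover have "q y \<noteq> 0" using r(1) r(3)[of y] by (simp add: q_def)
  moreover have "p z = (z - y) ^ n * q z" for z
    using r(1) r(3)[of y] by (cases "z = y") (auto simp: q_def)
  ultimately show ?thesis using that by blast
qed

lemma entire_divide_zero:
  assumes p: "p holomorphic_on UNIV" and "p y = 0"
  obtains q where "q holomorphic_on UNIV" "\<And>z. p z = (z - y) * q z"
proof -
  define q where "q = (\<lambda>z. if z = y then deriv p y else (p z - p y) / (z - y))"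
  have "q holomorphic_on UNIV" unfolding q_def using p by (intro pole_lemma) auto
  moreover have "p z = (z - y) * q z" for z using assms(2) by (auto simp: q_def)
  ultimately show ?thesis using that by blast
qed

lemma entire_eq_on_reals:
  assumes p: "p holomorphic_on UNIV" and q: "q holomorphic_on UNIV"
    and eq: "\<And>x::real. x \<noteq> c \<Longrightarrow> p (of_real x) = q (of_real x)"
  shows "p = q"
proof
  fix w
  let ?U = "complex_of_real ` (UNIV - {c})"
  have lim: "complex_of_real (c + 1) islimpt ?U"
  proof -
    have "(c + 1) islimpt {c<..<c+2}" by (rule open_imp_islimpt) auto
    then have "complex_of_real (c + 1) islimpt complex_of_real ` {c<..<c+2}"
      by (intro islimpt_isCont_image) (simp_all add: eventually_at_filter del: of_real_add)
    then show ?thesis by (rule islimpt_subset) auto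
  qed
  have "p w - q w = 0"
    by (rule analytic_continuation[of "\<lambda>z. p z - q z" UNIV ?U "complex_of_real (c + 1)"])
      (use p q lim eq in \<open>auto intro!: holomorphic_intros\<close>)
  then show "p w = q w" by simp
qed

section \<open>Schwarz and Harnack estimates in the upper half-plane\<close>

text \<open>This identity makes \<open>(z - w) / (z - cnj w)\<close> the Cayley map of the upper half-plane onto the disk
  that sends \<open>w\<close> to \<open>0\<close>.\<close>

lemma cayley_ident:
  fixes z w :: complex
  shows "(cmod (z - cnj w))\<^sup>2 - (cmod (z - w))\<^sup>2 = 4 * Im z * Im w"
  unfolding cmod_power2 by (simp add: power2_eq_square algebra_simps)

lemma Im_less_cayley:
  assumes "Im z > 0" "Im w > 0"
  shows "cmod (z - w) < cmod (z - cnj w)"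
proof -
  have "0 < Im z * Im w" using assms by simp
  then have "(cmod (z - w))\<^sup>2 < (cmod (z - cnj w))\<^sup>2" using cayley_ident[of z w] by linarith
  then show ?thesis by (rule power2_less_imp_less) simp
qed

text \<open>The Schwarz lemma, transported from the disk by the Cayley map that sends \<open>w\<close> to \<open>0\<close>.\<close>

lemma upper_half_plane_Schwarz:
  assumes F: "F holomorphic_on {z. Im z > 0}"
    and bd: "\<And>z. Im z > 0 \<Longrightarrow> cmod (F z) \<le> 1"
    and w: "Im w > 0" "F w = 0" and z: "Im z > 0"
  shows "cmod (F z) \<le> cmod (z - w) / cmod (z - cnj w)"
proof -
  \<comment> \<open>The inverse of the Cayley map.\<close>
  define T where "T \<zeta> = (w - cnj w * \<zeta>) / (1 - \<zeta>)" for \<zeta>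
  have T: "Im (T \<zeta>) > 0" if "cmod \<zeta> < 1" for \<zeta>
  proof -
    have ne: "1 - \<zeta> \<noteq> 0" using that by auto
    have "Im (T \<zeta>) = Im ((w - cnj w * \<zeta>) * cnj (1 - \<zeta>)) / (cmod (1 - \<zeta>))\<^sup>2"
      by (simp add: T_def complex_div_cnj[of _ "1 - \<zeta>"])
    also have "Im ((w - cnj w * \<zeta>) * cnj (1 - \<zeta>)) = Im w * (1 - (cmod \<zeta>)\<^sup>2)"
      unfolding cmod_power2 by (simp add: algebra_simps power2_eq_square)
    finally show ?thesis using w(1) that ne
      by (simp add: abs_square_less_1)
  qed
  have holT: "T holomorphic_on ball 0 1"
    unfolding T_def by (intro holomorphic_intros) auto
  define \<zeta>0 where "\<zeta>0 = (z - w) / (z - cnj w)"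
  have ne: "z - cnj w \<noteq> 0" using w z by (auto simp: complex_eq_iff)
  have \<zeta>0: "cmod \<zeta>0 < 1"
    using Im_less_cayley[OF z w(1)] ne by (simp add: \<zeta>0_def norm_divide)
  have ne2: "w - cnj w \<noteq> 0" using w by (auto simp: complex_eq_iff)
  have T0: "T \<zeta>0 = z"
  proof -
    have "1 - \<zeta>0 = (w - cnj w) / (z - cnj w)" using ne by (simp add: \<zeta>0_def field_simps)
    moreover have "w - cnj w * \<zeta>0 = z * (w - cnj w) / (z - cnj w)"
      using ne by (simp add: \<zeta>0_def field_simps)
    ultimately show ?thesis using ne ne2 by (simp add: T_def)
  qed
  \<comment> \<open>Scaling by \<open>c\<close> gives the strict bound by 1 that the Schwarz lemma asks for.\<close>
  have "c * cmod (F z) \<le> cmod \<zeta>0" if c: "0 < c" "c < 1" for c :: real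
  proof -
    have "(\<lambda>\<zeta>. of_real c * F (T \<zeta>)) holomorphic_on ball 0 1"
    proof -
      have "T ` ball 0 1 \<subseteq> {z. Im z > 0}" using T by auto
      from holomorphic_on_compose_gen[OF holT F this]
      show ?thesis by (intro holomorphic_intros) (simp add: o_def)
    qed
    moreover have "cmod (of_real c * F (T \<zeta>)) < 1" if "cmod \<zeta> < 1" for \<zeta>
    proof -
      have "c * cmod (F (T \<zeta>)) \<le> c * 1" using bd[OF T[OF that]] c by (intro mult_left_mono) auto
      moreover have "cmod (of_real c * F (T \<zeta>)) = c * cmod (F (T \<zeta>))"
        using c by (simp add: norm_mult)
      ultimately show ?thesis using c by linarith
    qed
    moreover have "of_real c * F (T 0) = 0" using w by (simp add: T_def)
    ultimately have "cmod (of_real c * F (T \<zeta>0)) \<le> cmod \<zeta>0"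
      using \<zeta>0 by (intro Schwarz_Lemma(1)) auto
    then show ?thesis using c by (simp add: T0 norm_mult)
  qed
  then have "cmod (F z) \<le> cmod \<zeta>0" by (rule field_le_mult_one_interval)
  then show ?thesis by (simp add: \<zeta>0_def norm_divide)
qed

text \<open>The Schwarz-Pick inequality: a self-map of the half-plane does not increase the Cayley distance
  between \<open>z\<close> and \<open>w\<close>, and a bound on the distance of \<open>m z\<close> from \<open>m w\<close> bounds \<open>m z\<close>.\<close>

lemma Herglotz_growth_strict:
  assumes m: "m holomorphic_on {z. Im z > 0}"
    and pos: "\<And>z. Im z > 0 \<Longrightarrow> Im (m z) > 0"
    and z: "Im z > 0" and w: "Im w > 0"
  shows "cmod (m z) \<le> cmod (m w) * ((cmod (z - cnj w))\<^sup>2 / (Im z * Im w))"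
proof -
  define F where "F u = (m u - m w) / (m u - cnj (m w))" for u
  have ne: "m u - cnj (m w) \<noteq> 0" if "Im u > 0" for u
    using pos[OF that] pos[OF w] by (auto simp: complex_eq_iff)
  have "F holomorphic_on {z. Im z > 0}"
    unfolding F_def using ne by (intro holomorphic_intros m) auto
  moreover have "cmod (F u) \<le> 1" if "Im u > 0" for u
    using Im_less_cayley[OF pos[OF that] pos[OF w]] ne[OF that]
    by (simp add: F_def norm_divide)
  moreover have "F w = 0" by (simp add: F_def)
  ultimately have le: "cmod (F z) \<le> cmod (z - w) / cmod (z - cnj w)"
    using w z by (intro upper_half_plane_Schwarz) auto
  define d where "d = cmod (z - w) / cmod (z - cnj w)"
  have ne3: "cmod (z - cnj w) > 0" using Im_less_cayley[OF z w] norm_ge_zero[of "z - w"] by linarith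
  have d: "0 \<le> d" "d < 1" using Im_less_cayley[OF z w] ne3 by (auto simp: d_def)
  have d2: "1 - d\<^sup>2 = 4 * Im z * Im w / (cmod (z - cnj w))\<^sup>2"
  proof -
    have "1 - d\<^sup>2 = ((cmod (z - cnj w))\<^sup>2 - (cmod (z - w))\<^sup>2) / (cmod (z - cnj w))\<^sup>2"
      using ne3 by (simp add: d_def power_divide diff_divide_distrib)
    then show ?thesis by (simp add: cayley_ident)
  qed
  have "cmod (m z - m w) \<le> d * cmod (m z - cnj (m w))"
    using le ne[OF z] by (simp add: F_def d_def norm_divide field_simps)
  also have "\<dots> \<le> d * (cmod (m z) + cmod (m w))"
    using d norm_triangle_ineq4[of "m z" "cnj (m w)"] by (intro mult_left_mono) auto
  finally have "cmod (m z) - cmod (m w) \<le> d * (cmod (m z) + cmod (m w))"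
    using norm_triangle_ineq2[of "m z" "m w"] by linarith
  then have "cmod (m z) * (1 - d) \<le> cmod (m w) * (1 + d)" by (simp add: algebra_simps)
  then have "cmod (m z) * (1 - d) * (1 + d) \<le> cmod (m w) * (1 + d) * (1 + d)"
    using d by (intro mult_right_mono) auto
  \<comment> \<open>As \<open>d < 1\<close>, the square of \<open>1 + d\<close> may be replaced by 4.\<close>
  also have "\<dots> \<le> cmod (m w) * 4"
  proof -
    have "(1 + d) * (1 + d) \<le> 2 * 2" using d by (intro mult_mono) auto
    then show ?thesis by (simp add: mult.assoc mult_left_mono)
  qed
  finally have "cmod (m z) * (1 - d\<^sup>2) \<le> cmod (m w) * 4"
    by (simp add: algebra_simps power2_eq_square)
  then show ?thesis unfolding d2 using z w ne3 by (simp add: field_simps)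
qed

text \<open>Functions with values in the closed half-plane are limits of \<open>m + \<i> d\<close> with \<open>d\<close> tending to 0.\<close>

lemma Herglotz_growth:
  assumes m: "m holomorphic_on {z. Im z > 0}"
    and nonneg: "\<And>z. Im z > 0 \<Longrightarrow> Im (m z) \<ge> 0"
    and z: "Im z > 0" and w: "Im w > 0"
  shows "cmod (m z) \<le> cmod (m w) * ((cmod (z - cnj w))\<^sup>2 / (Im z * Im w))"
proof (rule field_le_epsilon)
  fix e :: real assume e: "0 < e"
  define K where "K = (cmod (z - cnj w))\<^sup>2 / (Im z * Im w)"
  have K: "K \<ge> 0" using z w by (simp add: K_def)
  define d where "d = e / (K + 1)"
  have d: "d > 0" using e K by (simp add: d_def)
  have "cmod (m z + \<i> * d) \<le> cmod (m w + \<i> * d) * K"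
    unfolding K_def using nonneg d
    by (intro Herglotz_growth_strict[of "\<lambda>z. m z + \<i> * d"] holomorphic_intros m z w)
      (auto intro: add_nonneg_pos)
  also have "\<dots> \<le> (cmod (m w) + d) * K"
    using norm_triangle_ineq[of "m w" "\<i> * d"] d K
    by (intro mult_right_mono) (auto simp: norm_mult)
  finally have "cmod (m z) \<le> cmod (m w) * K + d * (K + 1)"
    using norm_triangle_ineq4[of "m z + \<i> * d" "\<i> * d"] d by (simp add: norm_mult algebra_simps)
  also have "d * (K + 1) = e" using K by (simp add: d_def)
  finally show "cmod (m z) \<le> cmod (m w) * ((cmod (z - cnj w))\<^sup>2 / (Im z * Im w)) + e"
    by (simp add: K_def)
qed

text \<open>Subtracting the real constant \<open>Re (m w)\<close> leaves the imaginary parts alone and makes \<open>m w\<close> purely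
  imaginary, so that the growth estimate compares imaginary parts only.\<close>

lemma Harnack_upper_half_plane:
  assumes m: "m holomorphic_on {z. Im z > 0}"
    and nonneg: "\<And>z. Im z > 0 \<Longrightarrow> Im (m z) \<ge> 0"
    and z: "Im z > 0" and w: "Im w > 0"
  shows "Im (m z) \<le> Im (m w) * ((cmod (z - cnj w))\<^sup>2 / (Im z * Im w))"
proof -
  define n where "n u = m u - of_real (Re (m w))" for u
  have "cmod (n z) \<le> cmod (n w) * ((cmod (z - cnj w))\<^sup>2 / (Im z * Im w))"
    unfolding n_def using nonneg
    by (intro Herglotz_growth[of "\<lambda>u. m u - of_real (Re (m w))"] holomorphic_intros m z w) auto
  moreover have "cmod (n w) = Im (m w)"
    using nonneg[OF w] by (simp add: n_def cmod_eq_Im)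
  moreover have "Im (m z) \<le> cmod (n z)"
    using abs_Im_le_cmod[of "n z"] by (simp add: n_def)
  ultimately show ?thesis by simp
qed

section \<open>Integrals along the real line and narrow-band weights\<close>

lemma integrable_inverse_quadratic: "integrable lborel (\<lambda>x::real. C / (1 + x\<^sup>2))"
proof -
  have "integrable lborel (\<lambda>x::real. inverse (1 + x\<^sup>2))"
    using integrable_inverse_1_plus_square by (simp add: set_integrable_def einterval_def)
  then have "integrable lborel (\<lambda>x::real. C * inverse (1 + x\<^sup>2))" by simp
  then show ?thesis by (simp add: divide_inverse)
qed

lemma entire_continuous: "p holomorphic_on UNIV \<Longrightarrow> continuous_on A p"
  by (meson continuous_on_subset holomorphic_on_imp_continuous_on subset_UNIV)

lemma entire_real_continuous:
  "p holomorphic_on UNIV \<Longrightarrow> continuous_on A (\<lambda>x::real. p (of_real x))"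
  using continuous_on_compose[of A complex_of_real p]
  by (simp add: o_def entire_continuous continuous_on_of_real_id)

lemma entire_real_measurable [measurable (raw)]:
  "p holomorphic_on UNIV \<Longrightarrow> (\<lambda>x::real. p (of_real x)) \<in> borel_measurable borel"
  by (rule borel_measurable_continuous_onI) (rule entire_real_continuous)

text \<open>Quadratic decay lets the integration path be closed by large half-circles.\<close>

lemma integral_upper_half_plane_zero:
  assumes p: "p holomorphic_on UNIV"
    and bd: "\<And>z. 0 \<le> Im z \<Longrightarrow> cmod (p z) \<le> C / (1 + (cmod z)\<^sup>2)"
  shows "integrable lborel (\<lambda>x. p (of_real x))" "(LINT x|lborel. p (of_real x)) = 0"
proof -
  have C: "C \<ge> 0" using order_trans[OF norm_ge_zero bd[of 0]] by simp
  have bd': "cmod (p (of_real x)) \<le> C / (1 + x\<^sup>2)" for x :: real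
    using bd[of "of_real x"] by simp
  have [measurable]: "(\<lambda>x::real. p (of_real x)) \<in> borel_measurable borel"
    using p by (rule entire_real_measurable)
  show int: "integrable lborel (\<lambda>x. p (of_real x))"
    by (rule Bochner_Integration.integrable_bound[OF integrable_inverse_quadratic[of C]])
      (use bd' C in \<open>auto simp: add_nonneg_nonneg\<close>)
  have seq: "(\<lambda>n. LINT x|lborel. indicator {- real (Suc n)..real (Suc n)} x *\<^sub>R p (of_real x))
      \<longlonglongrightarrow> (LINT x|lborel. p (of_real x))"
  proof (rule integral_dominated_convergence[where w = "\<lambda>x. C / (1 + x\<^sup>2)"])
    show "AE x in lborel. (\<lambda>n. indicator {- real (Suc n)..real (Suc n)} x *\<^sub>R p (of_real x))
        \<longlonglongrightarrow> p (of_real x)"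
    proof (rule AE_I2)
      fix x :: real
      obtain N :: nat where N: "\<bar>x\<bar> \<le> real N" using real_arch_simple by blast
      have "eventually (\<lambda>n. indicator {- real (Suc n)..real (Suc n)} x *\<^sub>R p (of_real x)
          = p (of_real x)) sequentially"
        using eventually_ge_at_top[of N] by eventually_elim (use N in \<open>auto simp: indicator_def\<close>)
      then show "(\<lambda>n. indicator {- real (Suc n)..real (Suc n)} x *\<^sub>R p (of_real x))
          \<longlonglongrightarrow> p (of_real x)" by (rule tendsto_eventually)
    qed
    show "AE x in lborel. norm (indicator {- real (Suc n)..real (Suc n)} x *\<^sub>R p (of_real x))
        \<le> C / (1 + x\<^sup>2)" for n
      by (rule AE_I2) (use bd' C in \<open>auto simp: indicator_def add_nonneg_nonneg\<close>)
  qed (auto intro: integrable_inverse_quadratic)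
  have le: "cmod (LINT x|lborel. indicator {- real (Suc n)..real (Suc n)} x *\<^sub>R p (of_real x))
      \<le> C * pi / real (Suc n)" for n
  proof -
    define R where "R = real (Suc n)"
    have R: "R > 0" by (simp add: R_def)
    let ?l = "linepath (complex_of_real (-R)) (of_real R)"
    let ?c = "part_circlepath 0 R 0 pi"
    have hol: "(p has_contour_integral 0) (?l +++ ?c)"
      by (rule Cauchy_theorem_convex_simple[OF p]) (auto intro!: valid_path_join)
    have il: "p contour_integrable_on ?l"
      by (intro contour_integrable_continuous_linepath entire_continuous p)
    have ic: "p contour_integrable_on ?c"
      by (intro contour_integrable_continuous_part_circlepath entire_continuous p)
    have "contour_integral ?l p + contour_integral ?c p = 0"
      using contour_integral_unique[OF hol] il ic by (simp add: contour_integral_join)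
    then have "cmod (contour_integral ?l p) = cmod (contour_integral ?c p)"
      by (metis add_eq_0_iff norm_minus_cancel)
    also have "\<dots> \<le> (C / (1 + R\<^sup>2)) * R * \<bar>pi - 0\<bar>"
    proof (rule contour_integral_bound_part_circlepath[OF ic])
      fix z assume z: "z \<in> path_image ?c"
      then have "cmod z = R" using in_path_image_part_circlepath[OF z] R by simp
      moreover have "0 \<le> Im z"
      proof -
        obtain t where "t \<in> closed_segment 0 pi" "z = 0 + R * cis t"
          using z unfolding path_image_part_circlepath' by auto
        then show ?thesis using R by (auto simp: closed_segment_eq_real_ivl intro!: mult_nonneg_nonneg sin_ge_zero)
      qed
      ultimately show "cmod (p z) \<le> C / (1 + R\<^sup>2)" using bd[of z] by simp
    qed (use C R in \<open>auto simp: add_nonneg_nonneg\<close>)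
    also have "\<dots> \<le> C * pi / R"
    proof -
      have "1 + R * R > 0" using R by (simp add: add_pos_pos)
      then have "R / (1 + R\<^sup>2) \<le> 1 / R" using R by (simp add: divide_simps power2_eq_square)
      then have "(C * pi) * (R / (1 + R\<^sup>2)) \<le> (C * pi) * (1 / R)" using C by (intro mult_left_mono) auto
      then show ?thesis by (simp add: mult_ac)
    qed
    also have "contour_integral ?l p = integral {-R..R} (\<lambda>x. p (of_real x))"
      using R by (subst contour_integral_linepath_Reals_eq) auto
    also have "\<dots> = (LINT x:{-R..R}|lborel. p (of_real x))"
      by (rule set_borel_integral_eq_integral(2)[symmetric], unfold set_integrable_def)
        (rule borel_integrable_atLeastAtMost'[unfolded set_integrable_def], rule entire_real_continuous[OF p])
    finally show ?thesis by (simp add: R_def set_lebesgue_integral_def)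
  qed
  have "(\<lambda>n. LINT x|lborel. indicator {- real (Suc n)..real (Suc n)} x *\<^sub>R p (of_real x)) \<longlonglongrightarrow> 0"
  proof (rule Lim_null_comparison)
    show "\<forall>\<^sub>F n in sequentially. norm (LINT x|lborel. indicator {- real (Suc n)..real (Suc n)} x *\<^sub>R p (of_real x))
      \<le> C * pi / real (Suc n)" using le by simp
    show "(\<lambda>n. C * pi / real (Suc n)) \<longlonglongrightarrow> 0"
      by (rule LIMSEQ_Suc[OF lim_const_over_n])
  qed
  with seq show "(LINT x|lborel. p (of_real x)) = 0" by (rule LIMSEQ_unique)
qed

definition csinc :: "complex \<Rightarrow> complex"
  where "csinc z = (if z = 0 then 1 else sin z / z)"

lemma holomorphic_csinc: "csinc holomorphic_on UNIV"
proof -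
  have "(\<lambda>z::complex. if z = 0 then deriv sin 0 else (sin z - sin 0) / (z - 0)) holomorphic_on UNIV"
    by (rule pole_lemma) (auto intro: holomorphic_intros)
  moreover have "deriv sin (0::complex) = 1"
    by (rule DERIV_imp_deriv) (auto intro!: derivative_eq_intros)
  moreover have "(\<lambda>z::complex. if z = 0 then deriv sin 0 else (sin z - sin 0) / (z - 0)) = csinc"
    using calculation(2) by (intro ext) (simp only: csinc_def sin_zero diff_zero)
  ultimately show ?thesis by simp
qed

lemma cmod_exp_i_le: "cmod (exp (\<i> * z)) \<le> exp \<bar>Im z\<bar>" "cmod (exp (- (\<i> * z))) \<le> exp \<bar>Im z\<bar>"
  by auto

lemma cmod_sin_le: "cmod (sin z) \<le> exp \<bar>Im z\<bar>"
proof -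
  have "cmod (exp (\<i> * z) - exp (- (\<i> * z))) \<le> exp \<bar>Im z\<bar> + exp \<bar>Im z\<bar>"
    by (rule norm_triangle_le_diff) (intro add_mono cmod_exp_i_le)
  then show ?thesis by (simp add: sin_exp_eq norm_divide norm_mult)
qed

lemma cmod_cos_le: "cmod (cos z) \<le> exp \<bar>Im z\<bar>"
proof -
  have "cmod (exp (\<i> * z) + exp (- (\<i> * z))) \<le> exp \<bar>Im z\<bar> + exp \<bar>Im z\<bar>"
    by (rule norm_triangle_le) (intro add_mono cmod_exp_i_le)
  then show ?thesis by (simp add: cos_exp_eq norm_divide)
qed

lemma cmod_csinc_le: "cmod (csinc z) \<le> 2 * exp \<bar>Im z\<bar> / (1 + cmod z)"
proof -
  have "cmod (sin z - sin 0) \<le> exp \<bar>Im z\<bar> * cmod (z - 0)"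
  proof (rule field_differentiable_bound[of "closed_segment 0 z" sin cos])
    fix u assume "u \<in> closed_segment 0 z"
    then obtain t where t: "0 \<le> t" "t \<le> 1" "u = of_real t * z"
      by (auto simp: closed_segment_def scaleR_conv_of_real)
    have "\<bar>Im u\<bar> \<le> \<bar>Im z\<bar>" using t by (simp add: abs_mult mult_left_le_one_le)
    then show "cmod (cos u) \<le> exp \<bar>Im z\<bar>" using cmod_cos_le[of u] by (simp add: order_trans)
  qed (auto intro!: derivative_eq_intros)
  then have 1: "cmod (csinc z) \<le> exp \<bar>Im z\<bar>"
    by (auto simp: csinc_def norm_divide field_simps)
  have "csinc z * z = sin z" by (simp add: csinc_def)
  then have 2: "cmod (csinc z) * cmod z \<le> exp \<bar>Im z\<bar>"
    using cmod_sin_le[of z] by (metis norm_mult)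
  have "cmod (csinc z) * (1 + cmod z) \<le> 2 * exp \<bar>Im z\<bar>" using 1 2 by (simp add: algebra_simps)
  moreover have "1 + cmod z > 0" by (simp add: add_pos_nonneg)
  ultimately show ?thesis by (simp add: field_simps)
qed

lemma csinc_of_real: "csinc (of_real x) = of_real (if x = 0 then 1 else sin x / x)"
  by (simp add: csinc_def sin_of_real)

text \<open>Powers of \<open>csinc (e z)\<close> with small \<open>e\<close> are convergence factors: they decay polynomially along the
  line, while \<open>n e\<close> bounds the exponential growth that they contribute off the line.\<close>

lemma cmod_csinc_power_le:
  assumes "e > 0"
  shows "cmod (csinc (of_real e * z) ^ n) \<le> 2 ^ n * exp (real n * e * \<bar>Im z\<bar>) / (1 + e * cmod z) ^ n"
proof -
  have "cmod (csinc (of_real e * z)) \<le> 2 * exp \<bar>e * Im z\<bar> / (1 + e * cmod z)"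
    using cmod_csinc_le[of "of_real e * z"] assms by (simp add: norm_mult)
  then have "cmod (csinc (of_real e * z)) ^ n \<le> (2 * exp (e * \<bar>Im z\<bar>) / (1 + e * cmod z)) ^ n"
    using assms by (intro power_mono) (auto simp: abs_mult)
  also have "\<dots> = 2 ^ n * exp (real n * e * \<bar>Im z\<bar>) / (1 + e * cmod z) ^ n"
    by (simp add: power_divide power_mult_distrib exp_of_nat_mult[symmetric] mult.assoc)
  finally show ?thesis by (simp add: norm_power)
qed

lemma holomorphic_csinc_power: "(\<lambda>z. csinc (of_real e * z) ^ n) holomorphic_on UNIV"
proof -
  have "(\<lambda>z. csinc (of_real e * z)) holomorphic_on UNIV"
    using holomorphic_on_compose[of "\<lambda>z. of_real e * z" UNIV csinc]
    by (auto simp: o_def intro!: holomorphic_intros holomorphic_on_subset[OF holomorphic_csinc])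
  then show ?thesis by (rule holomorphic_intros)
qed

text \<open>This turns bounds by convergence factors into bounds by a fixed integrable function.\<close>

lemma one_plus_square_le:
  fixes e r :: real
  assumes "e > 0" "r \<ge> 0"
  shows "1 / (1 + e * r)\<^sup>2 \<le> (1 + 1 / e\<^sup>2) / (1 + r\<^sup>2)"
proof -
  have er: "e * r \<ge> 0" using assms by simp
  then have "0 < 1 + e * r" by linarith
  then have pos: "(1 + e * r)\<^sup>2 > 0" "1 + r\<^sup>2 > 0" "e * r \<ge> 0"
    using er by (auto simp: add_pos_nonneg simp del: zero_less_power2 intro!: zero_less_power)
  have 1: "1 \<le> (1 + e * r)\<^sup>2" using pos by (intro one_le_power) auto
  have "(e * r)\<^sup>2 \<le> (1 + e * r)\<^sup>2" using pos by (intro power_mono) auto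
  then have 2: "e\<^sup>2 * r\<^sup>2 \<le> (1 + e * r)\<^sup>2" by (simp add: power_mult_distrib)
  have "1 + r\<^sup>2 \<le> (1 + 1 / e\<^sup>2) * (1 + e * r)\<^sup>2"
  proof -
    have "r\<^sup>2 \<le> (1 / e\<^sup>2) * (1 + e * r)\<^sup>2" using 2 assms by (simp add: field_simps)
    then show ?thesis using 1 by (simp add: distrib_right)
  qed
  then show ?thesis using pos by (simp add: divide_simps mult.commute)
qed

section \<open>Rational functions that preserve a half-plane\<close>

text \<open>If the zeros and the poles of a rational function interlace on the real line, then it maps the upper
  half-plane into itself or into the lower one. Distributing a finite set of points
  alternately over numerator and denominator achieves this.\<close>

lemma alternating_product:
  fixes A :: "real set"
  assumes "finite A"
  obtains N D where "N \<union> D = A" "N \<inter> D = {}"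
    "(\<forall>z. Im z > 0 \<longrightarrow> 0 \<le> Im ((\<Prod>y\<in>N. z - of_real y) / (\<Prod>y\<in>D. z - of_real y))) \<or>
     (\<forall>z. Im z > 0 \<longrightarrow> Im ((\<Prod>y\<in>N. z - of_real y) / (\<Prod>y\<in>D. z - of_real y)) \<le> 0)"
proof -
  define m where "m N D z = (\<Prod>y\<in>N. z - complex_of_real y) / (\<Prod>y\<in>D. z - of_real y)" for N D z
  \<comment> \<open>Adding the points in increasing order, the induction must remember more than the sign of
    the imaginary part: how the argument of \<open>f z\<close> compares with that of \<open>z - y\<close> or of its inverse, for \<open>y\<close> to the right of \<open>A\<close>.\<close>
  define up where "up A f \<longleftrightarrow> (\<forall>z. Im z > 0 \<longrightarrow> 0 \<le> Im (f z) \<and>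
      (\<forall>y. (\<forall>a\<in>A. a \<le> y) \<longrightarrow> Im (f z * cnj (z - complex_of_real y)) \<le> 0))"
    for A :: "real set" and f
  define down where "down A f \<longleftrightarrow> (\<forall>z. Im z > 0 \<longrightarrow> Im (f z) \<le> 0 \<and>
      (\<forall>y. (\<forall>a\<in>A. a \<le> y) \<longrightarrow> 0 \<le> Im (f z * (z - complex_of_real y))))"
    for A :: "real set" and f
  have "\<exists>N D. N \<union> D = A \<and> N \<inter> D = {} \<and> (up A (m N D) \<or> down A (m N D))"
    using assms
  proof (induction rule: finite_linorder_max_induct)
    case empty
    have "up {} (m {} {})" by (auto simp: up_def m_def)
    then show ?case by blast
  next
    case (insert b A)
    then obtain N D where ND: "N \<union> D = A" "N \<inter> D = {}" and ud: "up A (m N D) \<or> down A (m N D)"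
      by blast
    have fin: "finite N" "finite D" using ND insert.hyps(1) by (metis finite_Un)+
    have b: "b \<notin> N" "b \<notin> D" using insert.hyps ND by auto
    have bA: "\<forall>a\<in>A. a \<le> b" using insert.hyps by auto
    show ?case
    proof (cases "up A (m N D)")
      case True
      have eq: "m N (insert b D) z = m N D z / (z - of_real b)" for z
        using fin b by (simp add: m_def field_simps)
      have "down (insert b A) (m N (insert b D))"
        unfolding down_def
      proof (intro allI impI conjI)
        fix z :: complex assume z: "Im z > 0"
        have ne: "z - of_real b \<noteq> 0" using z by (auto simp: complex_eq_iff)
        have "m N (insert b D) z = m N D z * cnj (z - of_real b) / of_real ((cmod (z - of_real b))\<^sup>2)"
          unfolding eq by (rule complex_div_cnj)
        then have "Im (m N (insert b D) z) = Im (m N D z * cnj (z - of_real b)) / (cmod (z - of_real b))\<^sup>2"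
          by (simp only: Im_divide_of_real)
        moreover have "Im (m N D z * cnj (z - of_real b)) \<le> 0"
          using True z bA by (auto simp: up_def)
        ultimately show neg: "Im (m N (insert b D) z) \<le> 0"
          by (simp add: divide_nonpos_nonneg)
        fix y assume y: "\<forall>a\<in>insert b A. a \<le> y"
        have "m N (insert b D) z * (z - of_real y)
            = m N D z - of_real (y - b) * m N (insert b D) z"
          unfolding eq using ne by (simp add: field_simps)
        then have "Im (m N (insert b D) z * (z - of_real y))
            = Im (m N D z) - (y - b) * Im (m N (insert b D) z)" by simp
        moreover have "Im (m N D z) \<ge> 0" using True z by (auto simp: up_def)
        moreover have "(y - b) * Im (m N (insert b D) z) \<le> 0"
          using y neg by (intro mult_nonneg_nonpos) auto
        ultimately show "0 \<le> Im (m N (insert b D) z * (z - of_real y))" by linarith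
      qed
      moreover have "N \<union> insert b D = insert b A" "N \<inter> insert b D = {}" using ND b by auto
      ultimately show ?thesis by blast
    next
      case False
      with ud have down: "down A (m N D)" by simp
      have eq: "m (insert b N) D z = m N D z * (z - of_real b)" for z
        using fin b by (simp add: m_def field_simps)
      have "up (insert b A) (m (insert b N) D)"
        unfolding up_def
      proof (intro allI impI conjI)
        fix z :: complex assume z: "Im z > 0"
        show pos: "0 \<le> Im (m (insert b N) D z)"
          unfolding eq using down z bA by (auto simp: down_def)
        fix y assume y: "\<forall>a\<in>insert b A. a \<le> y"
        define v where "v = z - of_real b"
        have vv: "v * cnj v = of_real ((cmod v)\<^sup>2)"
          by (rule complex_norm_square[symmetric])
        have "cnj (z - of_real y) = cnj v - of_real (y - b)" by (simp add: v_def)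
        then have "m (insert b N) D z * cnj (z - of_real y)
            = m N D z * (v * cnj v) - of_real (y - b) * m (insert b N) D z"
          unfolding eq v_def[symmetric] by (simp add: algebra_simps)
        then have "m (insert b N) D z * cnj (z - of_real y)
            = of_real ((cmod v)\<^sup>2) * m N D z - of_real (y - b) * m (insert b N) D z"
          unfolding vv by (simp only: mult.commute)
        then have "Im (m (insert b N) D z * cnj (z - of_real y))
            = (cmod v)\<^sup>2 * Im (m N D z) - (y - b) * Im (m (insert b N) D z)"
          by (simp only: Im_complex_of_real minus_complex.simps times_complex.simps Re_complex_of_real)
        moreover have "(cmod v)\<^sup>2 * Im (m N D z) \<le> 0"
          using down z by (intro mult_nonneg_nonpos) (auto simp: down_def)
        moreover have "0 \<le> (y - b) * Im (m (insert b N) D z)"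
          using y pos by (intro mult_nonneg_nonneg) auto
        ultimately show "Im (m (insert b N) D z * cnj (z - of_real y)) \<le> 0" by linarith
      qed
      moreover have "insert b N \<union> D = insert b A" "insert b N \<inter> D = {}" using ND b by auto
      ultimately show ?thesis by blast
    qed
  qed
  then obtain N D where "N \<union> D = A" "N \<inter> D = {}" "up A (m N D) \<or> down A (m N D)" by blast
  then show ?thesis using that unfolding up_def down_def m_def by blast
qed

section \<open>Phragmen-Lindelof principles and exponential type zero\<close>

lemma max_modulus_open:
  assumes "p holomorphic_on U" "continuous_on (closure U) p" "open U" "bounded U"
    and "\<And>z. z \<in> closure U \<Longrightarrow> z \<notin> U \<Longrightarrow> cmod (p z) \<le> B" "w \<in> U"
  shows "cmod (p w) \<le> B"
  by (rule maximum_modulus_frontier[of p U]) (use assms in \<open>auto simp: interior_open frontier_def\<close>)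

text \<open>A bound that blows up at the real axis extends across it, by the maximum principle on a
  circle of radius 1 around the real point \<open>Re z\<close>.\<close>

lemma bound_near_real_axis:
  assumes X: "X holomorphic_on UNIV" and K: "K \<ge> 0" and a: "a \<ge> 0"
    and bd: "\<And>z. Im z \<noteq> 0 \<Longrightarrow> cmod (X z) \<le> K * exp (a * \<bar>Im z\<bar>) * (1 + cmod z)\<^sup>2 / \<bar>Im z\<bar>"
  shows "cmod (X z) \<le> 8 * exp a * K * exp (a * \<bar>Im z\<bar>) * (1 + cmod z)\<^sup>2"
proof (cases "\<bar>Im z\<bar> < 1")
  case False
  define E where "E = K * exp (a * \<bar>Im z\<bar>) * (1 + cmod z)\<^sup>2"
  have E: "E \<ge> 0" using K by (simp add: E_def)
  have "cmod (X z) \<le> E / \<bar>Im z\<bar>" using bd[of z] False by (simp add: E_def)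
  also have "\<dots> \<le> E / 1" using False E by (intro divide_left_mono) auto
  also have "\<dots> \<le> (8 * exp a) * E"
  proof -
    have "1 * E \<le> (8 * exp a) * E" using E a one_le_exp_iff[of a] by (intro mult_right_mono) linarith+
    then show ?thesis by simp
  qed
  finally show ?thesis by (simp add: E_def mult_ac)
next
  case True
  define x where "x = Re z"
  \<comment> \<open>On the circle, the extra factor has modulus \<open>2 * \<bar>Im u\<bar>\<close> and compensates the singular bound; in its
    interior above and below the centre, the modulus is at least 1.\<close>
  define H where "H u = X u * ((u - of_real x)\<^sup>2 - 1)" for u
  define M where "M = 2 * K * exp a * (2 + \<bar>x\<bar>)\<^sup>2"
  have "cmod (H z) \<le> M"
  proof (rule max_modulus_open[where p = H and U = "ball (of_real x) 1" and w = z])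
    show "H holomorphic_on ball (of_real x) 1" unfolding H_def
      by (intro holomorphic_intros holomorphic_on_subset[OF X]) auto
    show "continuous_on (closure (ball (of_real x) 1)) H" unfolding H_def
      by (intro continuous_intros entire_continuous X)
    show "z \<in> ball (of_real x) 1"
      using True by (simp add: dist_norm x_def cmod_eq_Im norm_minus_commute)
    fix u :: complex
    assume "u \<in> closure (ball (of_real x) 1)" "u \<notin> ball (of_real x) 1"
    then have u: "cmod (u - of_real x) = 1" by (auto simp: dist_norm norm_minus_commute)
    have un: "cmod u \<le> 1 + \<bar>x\<bar>" using norm_triangle_sub[of u "of_real x"] u by simp
    have ui: "\<bar>Im u\<bar> \<le> 1" using abs_Im_le_cmod[of "u - of_real x"] u by simp
    define v where "v = u - of_real x"
    have "v * cnj v = 1" using u unfolding v_def[symmetric] by (simp only: complex_norm_square[symmetric]) simp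
    then have "v\<^sup>2 - 1 = v * (v - cnj v)" by (simp add: power2_eq_square algebra_simps)
    then have "cmod (v\<^sup>2 - 1) = cmod (v - cnj v)" using u by (simp add: norm_mult v_def)
    also have "\<dots> = 2 * \<bar>Im u\<bar>" by (simp add: complex_diff_cnj v_def norm_mult)
    finally have v: "cmod ((u - of_real x)\<^sup>2 - 1) = 2 * \<bar>Im u\<bar>" by (simp add: v_def)
    show "cmod (H u) \<le> M"
    proof (cases "Im u = 0")
      case True
      then show ?thesis using v K by (simp add: H_def norm_mult M_def)
    next
      case False
      have "cmod (H u) \<le> (K * exp (a * \<bar>Im u\<bar>) * (1 + cmod u)\<^sup>2 / \<bar>Im u\<bar>) * (2 * \<bar>Im u\<bar>)"
        unfolding H_def norm_mult v by (intro mult_right_mono bd False) auto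
      also have "\<dots> = 2 * K * exp (a * \<bar>Im u\<bar>) * (1 + cmod u)\<^sup>2" using False by simp
      also have "\<dots> \<le> 2 * K * exp a * (2 + \<bar>x\<bar>)\<^sup>2"
        using K un ui a by (intro mult_mono power_mono) (auto simp: mult_left_le)
      finally show ?thesis by (simp add: M_def)
    qed
  qed auto
  moreover have "cmod (X z) \<le> cmod (H z)"
  proof -
    have "(z - of_real x)\<^sup>2 - 1 = of_real (- (1 + (Im z)\<^sup>2))"
      by (simp add: x_def complex_eq_iff power2_eq_square)
    then have "cmod ((z - of_real x)\<^sup>2 - 1) = 1 + (Im z)\<^sup>2"
      using sum_squares_ge_zero[of 1 "Im z"]
      by (simp only: norm_of_real abs_minus_cancel) (simp add: power2_eq_square)
    then have "cmod (H z) = cmod (X z) * (1 + (Im z)\<^sup>2)" by (simp add: H_def norm_mult)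
    then show ?thesis by (simp add: algebra_simps)
  qed
  moreover have "M \<le> 8 * exp a * K * exp (a * \<bar>Im z\<bar>) * (1 + cmod z)\<^sup>2"
  proof -
    have "2 + \<bar>x\<bar> \<le> 2 * (1 + cmod z)" using abs_Re_le_cmod[of z] by (simp add: x_def)
    then have "(2 + \<bar>x\<bar>)\<^sup>2 \<le> (2 * (1 + cmod z))\<^sup>2" by (intro power_mono) auto
    also have "\<dots> = 4 * (1 + cmod z)\<^sup>2" by (simp only: power_mult_distrib) simp
    finally have "M \<le> 2 * K * exp a * (4 * (1 + cmod z)\<^sup>2)" unfolding M_def
      using K by (intro mult_left_mono) auto
    also have "\<dots> = 8 * exp a * K * 1 * (1 + cmod z)\<^sup>2" by simp
    also have "\<dots> \<le> 8 * exp a * K * exp (a * \<bar>Im z\<bar>) * (1 + cmod z)\<^sup>2"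
      using K a by (intro mult_right_mono mult_left_mono) auto
    finally show ?thesis .
  qed
  ultimately show ?thesis by linarith
qed

lemma limit_at_right_le:
  fixes f :: "real \<Rightarrow> real"
  assumes "(f \<longlongrightarrow> l) (at_right 0)" "\<And>d. d > 0 \<Longrightarrow> f d \<le> M"
  shows "l \<le> M"
proof (rule tendsto_upperbound[OF assms(1)])
  show "\<forall>\<^sub>F d in at_right 0. f d \<le> M"
    using eventually_at_right_less[of "0::real"] by eventually_elim (rule assms(2))
qed simp

text \<open>In a sector of slopes at most \<open>1/2\<close>, the real part of \<open>z ^ 3\<close> is comparable to the cube of the modulus,
  so that \<open>exp (- d * z ^ 3)\<close> defeats growth of order two for every \<open>d > 0\<close>.\<close>

lemma Phragmen_Lindelof_sector:
  assumes p: "p holomorphic_on UNIV"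
    and ab: "a < b" "\<bar>a\<bar> \<le> 1/2" "\<bar>b\<bar> \<le> 1/2"
    and growth: "\<And>z. 0 \<le> Re z \<Longrightarrow> a * Re z \<le> Im z \<Longrightarrow> Im z \<le> b * Re z \<Longrightarrow>
      cmod (p z) \<le> exp (C * (1 + cmod z)\<^sup>2)"
    and rays: "\<And>z. 0 \<le> Re z \<Longrightarrow> Im z = a * Re z \<or> Im z = b * Re z \<Longrightarrow> cmod (p z) \<le> M"
    and M: "M > 0"
    and z: "0 \<le> Re z" "a * Re z \<le> Im z" "Im z \<le> b * Re z"
  shows "cmod (p z) \<le> M"
proof (cases "Im z = a * Re z \<or> Im z = b * Re z")
  case True
  then show ?thesis using rays z by blast
next
  case False
  have main: "cmod (p z * exp (- of_real d * z ^ 3)) \<le> M" if d: "d > 0" for d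
  proof -
    have cube: "(cmod u) ^ 3 / 32 \<le> Re (u ^ 3)"
      if u: "0 \<le> Re u" "a * Re u \<le> Im u" "Im u \<le> b * Re u" for u
    proof -
      have ar: "\<bar>a * Re u\<bar> \<le> Re u / 2" "\<bar>b * Re u\<bar> \<le> Re u / 2"
        using mult_right_mono[OF ab(2) u(1)] mult_right_mono[OF ab(3) u(1)] u(1)
        by (auto simp: abs_mult)
      then have iu: "\<bar>Im u\<bar> \<le> Re u / 2" using u by linarith
      have "(Im u)\<^sup>2 = \<bar>Im u\<bar>\<^sup>2" by simp
      also have "\<dots> \<le> (Re u / 2)\<^sup>2" using iu by (intro power_mono) auto
      finally have iu2: "(Im u)\<^sup>2 \<le> (Re u)\<^sup>2 / 4" by (simp add: power_divide)
      have "Re (u ^ 3) = Re u * ((Re u)\<^sup>2 - 3 * (Im u)\<^sup>2)"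
        by (simp add: power3_eq_cube power2_eq_square algebra_simps)
      moreover have "Re u * ((Re u)\<^sup>2 - 3 * (Im u)\<^sup>2) \<ge> Re u * ((Re u)\<^sup>2 / 4)"
        using iu2 u(1) by (intro mult_left_mono) auto
      moreover have "(cmod u) ^ 3 \<le> (2 * Re u) ^ 3"
        using cmod_le[of u] iu u(1) by (intro power_mono) auto
      ultimately show ?thesis by (simp add: power3_eq_cube power2_eq_square)
    qed
    have "eventually (\<lambda>R::real. C * (1 + R)\<^sup>2 - d * (R ^ 3 / 32) \<le> ln M) at_top"
    proof -
      have "filterlim (\<lambda>R::real. C * (1 + R)\<^sup>2 - d * (R ^ 3 / 32)) at_bot at_top"
        using d by real_asymp
      then show ?thesis by (simp add: filterlim_at_bot)
    qed
    then obtain R where R: "R > cmod z" "C * (1 + R)\<^sup>2 - d * (R ^ 3 / 32) \<le> ln M"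
      using eventually_happens'[OF _ eventually_conj[OF eventually_gt_at_top[of "cmod z"]]]
      by (metis (no_types, lifting) trivial_limit_at_top_linorder)
    define U where "U = {u. cmod u < R \<and> a * Re u < Im u \<and> Im u < b * Re u}"
    have U1: "U \<subseteq> {u. cmod u \<le> R \<and> a * Re u \<le> Im u \<and> Im u \<le> b * Re u}"
      by (auto simp: U_def)
    have "closed {u. cmod u \<le> R \<and> a * Re u \<le> Im u \<and> Im u \<le> b * Re u}"
      by (intro closed_Collect_conj closed_Collect_le continuous_intros)
    then have clU: "closure U \<subseteq> {u. cmod u \<le> R \<and> a * Re u \<le> Im u \<and> Im u \<le> b * Re u}"
      using U1 by (rule closure_minimal[rotated])
    show ?thesis
    proof (rule max_modulus_open[where U = U and w = z and p = "\<lambda>z. p z * exp (- of_real d * z ^ 3)"])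
      show "(\<lambda>z. p z * exp (- of_real d * z ^ 3)) holomorphic_on U"
        by (intro holomorphic_intros holomorphic_on_subset[OF p]) auto
      show "continuous_on (closure U) (\<lambda>z. p z * exp (- of_real d * z ^ 3))"
        by (intro continuous_intros entire_continuous p)
      show "open U" unfolding U_def
        by (intro open_Collect_conj open_Collect_less continuous_intros)
      show "bounded U" by (rule bounded_subset[of "cball 0 R"]) (auto simp: U_def)
      show "z \<in> U" using z False R by (auto simp: U_def)
      fix u assume u: "u \<in> closure U" "u \<notin> U"
      have u': "cmod u \<le> R" "a * Re u \<le> Im u" "Im u \<le> b * Re u" using clU u by auto
      have "0 \<le> (b - a) * Re u" using u' by (simp add: algebra_simps)
      then have re: "0 \<le> Re u" using ab(1) by (simp add: zero_le_mult_iff)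
      have ex: "cmod (exp (- of_real d * u ^ 3)) = exp (- d * Re (u ^ 3))" by simp
      show "cmod (p u * exp (- of_real d * u ^ 3)) \<le> M"
      proof (cases "cmod u = R")
        case True
        have "cmod (p u * exp (- of_real d * u ^ 3)) \<le> exp (C * (1 + R)\<^sup>2) * exp (- d * (R ^ 3 / 32))"
          unfolding norm_mult ex
        proof (intro mult_mono)
          show "cmod (p u) \<le> exp (C * (1 + R)\<^sup>2)" using growth[OF re u'(2,3)] True by simp
          show "exp (- d * Re (u ^ 3)) \<le> exp (- d * (R ^ 3 / 32))"
            using cube[OF re u'(2,3)] d True by simp
        qed auto
        also have "\<dots> = exp (C * (1 + R)\<^sup>2 - d * (R ^ 3 / 32))" by (simp add: exp_add[symmetric])
        also have "\<dots> \<le> exp (ln M)" using R by simp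
        finally show ?thesis using M by simp
      next
        case False
        then have "Im u = a * Re u \<or> Im u = b * Re u" using u u' by (auto simp: U_def)
        then have "cmod (p u) \<le> M" using rays re by blast
        moreover have "exp (- d * Re (u ^ 3)) \<le> 1"
          using cube[OF re u'(2,3)] d
            zero_le_mult_iff[of d "Re (u ^ 3)"] order_trans[of 0 "cmod u ^ 3 / 32"] by simp
        ultimately have "cmod (p u) * exp (- d * Re (u ^ 3)) \<le> M * 1"
          using M by (intro mult_mono) auto
        then show ?thesis by (simp only: norm_mult ex mult_1_right)
      qed
    qed
  qed
  have "((\<lambda>d. cmod (p z * exp (- of_real d * z ^ 3))) \<longlongrightarrow> cmod (p z * exp (- of_real 0 * z ^ 3))) (at_right 0)"
    by (intro tendsto_intros)
  then have "cmod (p z * exp (- of_real 0 * z ^ 3)) \<le> M"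
    by (rule limit_at_right_le) (rule main)
  then show ?thesis by simp
qed

text \<open>The maximum principle applies to \<open>(p / M) ^ n\<close> divided by \<open>z + \<i>\<close>, which tends to 0 at infinity because
  \<open>p\<close> is bounded. Letting \<open>n\<close> grow removes the effect of the divisor.\<close>

lemma bounded_upper_half_plane_principle:
  assumes p: "p holomorphic_on UNIV"
    and K: "\<And>z. 0 \<le> Im z \<Longrightarrow> cmod (p z) \<le> K"
    and real: "\<And>x::real. cmod (p (of_real x)) \<le> M" and M: "M > 0"
    and z: "0 \<le> Im z"
  shows "cmod (p z) \<le> M"
proof (cases "Im z = 0")
  case True
  then have "z = of_real (Re z)" by (simp add: complex_eq_iff)
  then show ?thesis using real by metis
next
  case False
  with z have z: "Im z > 0" by simp
  have K0: "K \<ge> 0" using order_trans[OF norm_ge_zero K[of 0]] by simp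
  have pow: "(cmod (p z) / M) ^ n \<le> cmod (z + \<i>)" for n
  proof -
    define q where "q u = (p u / of_real M) ^ n / (u + \<i>)" for u
    define R where "R = max (cmod z + 1) ((K / M) ^ n + 1)"
    have R: "R > cmod z" "(K / M) ^ n \<le> R - 1" by (auto simp: R_def)
    define U where "U = {u. cmod u < R \<and> 0 < Im u}"
    have "closed {u. cmod u \<le> R \<and> 0 \<le> Im u}"
      by (intro closed_Collect_conj closed_Collect_le continuous_intros)
    then have clU: "closure U \<subseteq> {u. cmod u \<le> R \<and> 0 \<le> Im u}"
      by (intro closure_minimal) (auto simp: U_def)
    have ne: "u + \<i> \<noteq> 0" if "0 \<le> Im u" for u using that by (auto simp: complex_eq_iff)
    have "cmod (q z) \<le> 1"
    proof (rule max_modulus_open[where U = U and w = z and p = q])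
      show "q holomorphic_on U" unfolding q_def
        by (intro holomorphic_intros holomorphic_on_subset[OF p]) (use ne M in \<open>auto simp: U_def\<close>)
      show "continuous_on (closure U) q" unfolding q_def
        by (intro continuous_intros entire_continuous p) (use ne M clU in auto)
      show "open U" unfolding U_def
        by (intro open_Collect_conj open_Collect_less continuous_intros)
      show "bounded U" by (rule bounded_subset[of "cball 0 R"]) (auto simp: U_def)
      show "z \<in> U" using z R by (auto simp: U_def)
      fix u assume u: "u \<in> closure U" "u \<notin> U"
      have u': "cmod u \<le> R" "0 \<le> Im u" using clU u by auto
      have qn: "cmod (q u) = (cmod (p u) / M) ^ n / cmod (u + \<i>)"
        using M by (simp add: q_def norm_divide norm_power)
      have pos: "cmod (u + \<i>) > 0" using ne[OF u'(2)] by simp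
      show "cmod (q u) \<le> 1"
      proof (cases "Im u = 0")
        case True
        then have ur: "u = of_real (Re u)" by (simp add: complex_eq_iff)
        have "cmod (p u) / M \<le> 1" using real[of "Re u"] ur M by simp
        then have "(cmod (p u) / M) ^ n \<le> 1" using M by (intro power_le_one) auto
        moreover have "1 \<le> cmod (u + \<i>)" using abs_Im_le_cmod[of "u + \<i>"] True by simp
        ultimately show ?thesis unfolding qn divide_le_eq_1_pos[OF pos] by linarith
      next
        case False
        then have "cmod u = R" using u u' by (auto simp: U_def)
        then have "R - 1 \<le> cmod (u + \<i>)" using norm_triangle_ineq2[of u "-\<i>"] by simp
        moreover have "(cmod (p u) / M) ^ n \<le> (K / M) ^ n"
          using K[OF u'(2)] M by (intro power_mono divide_right_mono) auto
        ultimately show ?thesis unfolding qn divide_le_eq_1_pos[OF pos] using R by linarith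
      qed
    qed
    moreover have "cmod (z + \<i>) > 0" using ne[of z] z by simp
    moreover have "cmod (q z) = (cmod (p z) / M) ^ n / cmod (z + \<i>)"
      using M by (simp add: q_def norm_divide norm_power)
    ultimately show ?thesis by (simp only: divide_le_eq_1_pos)
  qed
  show ?thesis
  proof (rule ccontr)
    assume "\<not> ?thesis"
    then have "cmod (p z) / M > 1" using M by simp
    then obtain n where "(cmod (p z) / M) ^ n > cmod (z + \<i>)" using real_arch_pow by blast
    with pow[of n] show False by simp
  qed
qed

definition type0_upper :: "(complex \<Rightarrow> complex) \<Rightarrow> bool"
  where "type0_upper p \<longleftrightarrow> (\<forall>e>0. \<exists>C. \<forall>z. 0 \<le> Im z \<longrightarrow> cmod (p z) \<le> C * exp (e * cmod z))"

text \<open>In steep directions \<open>\<bar>z\<bar>\<close> is comparable to \<open>Im z\<close>; in the flat sector along the positive real axis,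
  \<open>p z * exp (\<i> * e * z)\<close> is bounded on both rays, hence inside.\<close>

lemma type0_upper_sector:
  assumes p: "p holomorphic_on UNIV" and t: "type0_upper p"
    and real: "\<And>x::real. cmod (p (of_real x)) \<le> M" and M: "M > 0" and e: "e > 0"
  shows "\<exists>K. \<forall>z. 0 \<le> Re z \<longrightarrow> 0 \<le> Im z \<longrightarrow> cmod (p z) \<le> K * exp (e * Im z)"
proof -
  \<comment> \<open>Exponent \<open>e / 3\<close>, because \<open>\<bar>z\<bar>\<close> is at most \<open>3 * Im z\<close> in steep directions.\<close>
  define h where "h = e / 3"
  have h: "h > 0" using e by (simp add: h_def)
  obtain C0 where C0: "\<And>z. 0 \<le> Im z \<Longrightarrow> cmod (p z) \<le> C0 * exp (h * cmod z)"
    using t h by (auto simp: type0_upper_def)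
  define C where "C = max (max 1 M) C0"
  have C: "C \<ge> 1" "C \<ge> M" and Cb: "cmod (p z) \<le> C * exp (h * cmod z)" if "0 \<le> Im z" for z
    using order_trans[OF C0[OF that], of "C * exp (h * cmod z)"] by (auto simp: C_def)
  have C1: "C \<ge> 1" "C \<ge> M" by (auto simp: C_def)
  have steep: "cmod (p z) \<le> C * exp (e * Im z)" if z: "0 \<le> Re z" "0 \<le> Im z" "Re z / 2 \<le> Im z" for z
  proof -
    have "cmod z \<le> 3 * Im z" using cmod_le[of z] z by auto
    then have "h * cmod z \<le> h * (3 * Im z)" using h by (intro mult_left_mono) auto
    then have "h * cmod z \<le> e * Im z" by (simp add: h_def)
    then have "C * exp (h * cmod z) \<le> C * exp (e * Im z)" using C1 by simp
    with Cb[OF z(2)] show ?thesis by linarith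
  qed
  have flat: "cmod (p z) \<le> C * exp (e * Im z)" if z: "0 \<le> Re z" "0 \<le> Im z" "Im z \<le> Re z / 2" for z
  proof -
    have nrm: "cmod (p u * exp (\<i> * of_real e * u)) = cmod (p u) * exp (- (e * Im u))" for u
      by (simp add: norm_mult)
    have "cmod (p z * exp (\<i> * of_real e * z)) \<le> C"
    proof (rule Phragmen_Lindelof_sector[where a = 0 and b = "1/2" and C = "ln C + h"
          and p = "\<lambda>z. p z * exp (\<i> * of_real e * z)"])
      show "(\<lambda>z. p z * exp (\<i> * of_real e * z)) holomorphic_on UNIV"
        by (intro holomorphic_intros p)
      fix u :: complex
      { assume u: "0 \<le> Re u" "0 * Re u \<le> Im u" "Im u \<le> 1/2 * Re u"
        then have "cmod (p u * exp (\<i> * of_real e * u)) \<le> C * exp (h * cmod u) * 1"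
          unfolding nrm using Cb[of u] e C1 by (intro mult_mono) auto
        also have "\<dots> = exp (ln C + h * cmod u)" using C1 by (simp add: exp_add)
        also have "\<dots> \<le> exp ((ln C + h) * (1 + cmod u)\<^sup>2)"
        proof -
          have "1 \<le> (1 + cmod u)\<^sup>2" by (intro one_le_power) auto
          then have 1: "ln C * 1 \<le> ln C * (1 + cmod u)\<^sup>2" using C1 by (intro mult_left_mono) auto
          have "cmod u \<le> (1 + cmod u)\<^sup>2"
            using norm_ge_zero[of u] zero_le_power2[of "cmod u"]
            by (simp add: power2_eq_square algebra_simps add_nonneg_nonneg)
          then have 2: "h * cmod u \<le> h * (1 + cmod u)\<^sup>2" using h by (intro mult_left_mono) auto
          show ?thesis using 1 2 by (simp add: distrib_right)
        qed
        finally show "cmod (p u * exp (\<i> * of_real e * u)) \<le> exp ((ln C + h) * (1 + cmod u)\<^sup>2)" . }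
      { assume u: "0 \<le> Re u" "Im u = 0 * Re u \<or> Im u = 1/2 * Re u"
        show "cmod (p u * exp (\<i> * of_real e * u)) \<le> C"
        proof (cases "Im u = 0")
          case True
          then have "u = of_real (Re u)" by (simp add: complex_eq_iff)
          then have "cmod (p u) \<le> M" using real by metis
          then show ?thesis unfolding nrm using True C1 by simp
        next
          case False
          with u have "Im u = Re u / 2" by simp
          then have "cmod (p u) \<le> C * exp (e * Im u)" using u by (intro steep) auto
          then have "cmod (p u) * exp (- (e * Im u)) \<le> C * exp (e * Im u) * exp (- (e * Im u))"
            by (intro mult_right_mono) auto
          moreover have "C * exp (e * Im u) * exp (- (e * Im u)) = C" by (simp add: exp_minus)
          ultimately show ?thesis unfolding nrm by linarith
        qed }
    qed (use z C1 in auto)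
    then show ?thesis unfolding nrm by (simp add: exp_minus field_simps)
  qed
  show ?thesis using steep flat by (intro exI[of _ C]) (meson linear)
qed

text \<open>Treating the left quadrant by reflection, \<open>p z * exp (\<i> * e * z)\<close> is bounded in the half-plane, hence by its bound
  on the line, and then \<open>e\<close> tends to 0.\<close>

lemma type0_upper_bounded:
  assumes p: "p holomorphic_on UNIV" and t: "type0_upper p"
    and real: "\<And>x::real. cmod (p (of_real x)) \<le> M"
    and z: "0 \<le> Im z"
  shows "cmod (p z) \<le> M"
proof (rule field_le_epsilon)
  fix d :: real assume d: "0 < d"
  have M0: "M \<ge> 0" using order_trans[OF norm_ge_zero real[of 0]] .
  define N where "N = M + d"
  have N: "N > 0" "\<And>x::real. cmod (p (of_real x)) \<le> N"
    using d M0 real by (auto simp: N_def intro: add_increasing2)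
  \<comment> \<open>Reflection in the imaginary axis.\<close>
  define p' where "p' z = star p (- z)" for z
  have p'cm: "cmod (p' z) = cmod (p (- cnj z))" for z by (simp add: p'_def star_def)
  have p': "p' holomorphic_on UNIV"
  proof -
    have "(\<lambda>z. - z) holomorphic_on (UNIV :: complex set)" by (intro holomorphic_intros)
    moreover have "star p holomorphic_on (\<lambda>z. - z) ` UNIV"
      by (rule holomorphic_on_subset[OF holomorphic_star[OF p]]) simp
    ultimately have "(star p \<circ> (\<lambda>z. - z)) holomorphic_on UNIV" by (rule holomorphic_on_compose)
    then show ?thesis by (simp add: o_def p'_def [abs_def])
  qed
  have t': "type0_upper p'"
    unfolding type0_upper_def p'cm
  proof (intro allI impI)
    fix e :: real assume "e > 0"
    then obtain C where C: "\<And>z. 0 \<le> Im z \<Longrightarrow> cmod (p z) \<le> C * exp (e * cmod z)"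
      using t by (auto simp: type0_upper_def)
    show "\<exists>C. \<forall>z. 0 \<le> Im z \<longrightarrow> cmod (p (- cnj z)) \<le> C * exp (e * cmod z)"
      using C[of "- cnj _"] by (intro exI[of _ C]) auto
  qed
  have real': "cmod (p' (of_real x)) \<le> N" for x :: real
    using N(2)[of "-x"] by (simp add: p'cm)
  have main: "cmod (p z) * exp (- (e * Im z)) \<le> N" if e: "e > 0" for e
  proof -
    obtain K1 where K1: "\<And>z. 0 \<le> Re z \<Longrightarrow> 0 \<le> Im z \<Longrightarrow> cmod (p z) \<le> K1 * exp (e * Im z)"
      using type0_upper_sector[OF p t N(2) N(1) e] by blast
    obtain K2 where K2: "\<And>z. 0 \<le> Re z \<Longrightarrow> 0 \<le> Im z \<Longrightarrow> cmod (p' z) \<le> K2 * exp (e * Im z)"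
      using type0_upper_sector[OF p' t' real' N(1) e] by blast
    have nrm: "cmod (p u * exp (\<i> * of_real e * u)) = cmod (p u) * exp (- (e * Im u))" for u
      by (simp add: norm_mult)
    have "cmod (p z * exp (\<i> * of_real e * z)) \<le> N"
    proof (rule bounded_upper_half_plane_principle[where K = "max K1 K2" and
          p = "\<lambda>z. p z * exp (\<i> * of_real e * z)"])
      show "(\<lambda>z. p z * exp (\<i> * of_real e * z)) holomorphic_on UNIV"
        by (intro holomorphic_intros p)
      fix u :: complex assume u: "0 \<le> Im u"
      have "cmod (p u) \<le> max K1 K2 * exp (e * Im u)"
      proof (cases "0 \<le> Re u")
        case True
        have "K1 * exp (e * Im u) \<le> max K1 K2 * exp (e * Im u)" by (intro mult_right_mono) auto
        with K1[OF True u] show ?thesis by linarith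
      next
        case False
        have "K2 * exp (e * Im u) \<le> max K1 K2 * exp (e * Im u)" by (intro mult_right_mono) auto
        moreover have "cmod (p u) \<le> K2 * exp (e * Im u)"
          using K2[of "- cnj u"] False u by (simp add: p'cm)
        ultimately show ?thesis by linarith
      qed
      then have "cmod (p u) * exp (- (e * Im u)) \<le> max K1 K2 * exp (e * Im u) * exp (- (e * Im u))"
        by (intro mult_right_mono) auto
      moreover have "max K1 K2 * exp (e * Im u) * exp (- (e * Im u)) = max K1 K2"
        by (simp add: exp_minus)
      ultimately show "cmod (p u * exp (\<i> * of_real e * u)) \<le> max K1 K2"
        unfolding nrm by linarith
    next
      show "cmod (p (of_real x) * exp (\<i> * of_real e * of_real x)) \<le> N" for x :: real
        using N(2)[of x] by (simp add: norm_mult)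
    qed (use N z in auto)
    then show ?thesis unfolding nrm .
  qed
  have "((\<lambda>e. cmod (p z) * exp (- (e * Im z))) \<longlongrightarrow> cmod (p z) * exp (- (0 * Im z))) (at_right 0)"
    by (intro tendsto_intros)
  then have "cmod (p z) * exp (- (0 * Im z)) \<le> N"
    by (rule limit_at_right_le) (rule main)
  then show "cmod (p z) \<le> M + d" by (simp add: N_def)
qed

definition type0 :: "(complex \<Rightarrow> complex) \<Rightarrow> bool"
  where "type0 p \<longleftrightarrow> (\<forall>e>0. \<exists>C. \<forall>z. cmod (p z) \<le> C * exp (e * cmod z))"

text \<open>The bound on the line holds in both half-planes, and Liouville applies.\<close>

lemma type0_bounded_constant:
  assumes p: "p holomorphic_on UNIV" and t: "type0 p"
    and real: "\<And>x::real. cmod (p (of_real x)) \<le> M"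
  obtains c where "\<And>z. p z = c"
proof -
  have "type0_upper p" unfolding type0_upper_def
  proof (intro allI impI)
    fix e :: real assume "e > 0"
    then obtain C where "\<And>z. cmod (p z) \<le> C * exp (e * cmod z)"
      using t by (auto simp: type0_def)
    then show "\<exists>C. \<forall>z. 0 \<le> Im z \<longrightarrow> cmod (p z) \<le> C * exp (e * cmod z)" by blast
  qed
  then have 1: "cmod (p z) \<le> M" if "0 \<le> Im z" for z
    using type0_upper_bounded[OF p _ real that] by blast
  have 2: "cmod (star p z) \<le> M" if "0 \<le> Im z" for z
  proof (rule type0_upper_bounded[OF holomorphic_star[OF p] _ _ that])
    show "type0_upper (star p)" unfolding type0_upper_def
    proof (intro allI impI)
      fix e :: real assume "e > 0"
      then obtain C where "\<And>z. cmod (p z) \<le> C * exp (e * cmod z)"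
        using t by (auto simp: type0_def)
      from this[of "cnj _"] show "\<exists>C. \<forall>z. 0 \<le> Im z \<longrightarrow> cmod (star p z) \<le> C * exp (e * cmod z)"
        by (auto simp: star_def)
    qed
  qed (use real in \<open>simp add: star_def\<close>)
  have "cmod (p z) \<le> M" for z
    using 1[of z] 2[of "cnj z"] by (cases "0 \<le> Im z") (auto simp: star_def)
  then have "bounded (range p)" by (auto simp: bounded_iff)
  with p show ?thesis using Liouville_theorem[of p] that by (auto simp: constant_on_def)
qed

section \<open>Quotients of functions of exponential type\<close>

lemma convex_upper_half_plane: "convex {z. Im z > 0}" "open {z. Im z > 0}" "interior {z. Im z > 0} = {z. Im z > 0}"
  using convex_halfspace_Im_gt[of 0] open_halfspace_Im_gt[of 0] by (auto simp: interior_open)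

lemma le_at_point:
  fixes q :: "complex \<Rightarrow> complex"
  assumes "q holomorphic_on U" "open U" "v \<in> U"
    and "\<And>z. z \<in> U \<Longrightarrow> z \<noteq> v \<Longrightarrow> cmod (q z) \<le> B"
  shows "cmod (q v) \<le> B"
proof -
  have "(q \<longlongrightarrow> q v) (at v)"
    using assms(1-3) by (metis continuous_on_eq_continuous_at holomorphic_on_imp_continuous_on isCont_def)
  then have "((\<lambda>z. cmod (q z)) \<longlongrightarrow> cmod (q v)) (at v)" by (rule tendsto_norm)
  then show ?thesis
  proof (rule tendsto_upperbound)
    show "\<forall>\<^sub>F z in at v. cmod (q z) \<le> B"
      using eventually_at_in_open[OF assms(2,3)] by eventually_elim (use assms(4) in auto)
  qed simp
qed

text \<open>If \<open>\<phi>\<close> is a quotient of bounded functions, its denominator may be taken without zeros: among all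
  admissible denominators a normal family argument provides one of maximal modulus at \<open>w\<close>, and dividing out
  a Blaschke factor would increase that value. This takes the place of the inner-outer factorization.\<close>

lemma zero_free_denominator:
  assumes ph: "\<phi> holomorphic_on {z. Im z > 0}" and F: "F holomorphic_on {z. Im z > 0}"
    and bF: "\<And>z. Im z > 0 \<Longrightarrow> cmod (F z) \<le> 1"
    and bG: "\<And>z. Im z > 0 \<Longrightarrow> cmod (\<phi> z * F z) \<le> 1"
    and w: "Im w > 0" "F w \<noteq> 0"
  obtains g where "g holomorphic_on {z. Im z > 0}" "cmod (F w) \<le> cmod (g w)"
    "\<And>z. Im z > 0 \<Longrightarrow> g z \<noteq> 0" "\<And>z. Im z > 0 \<Longrightarrow> cmod (g z) \<le> 1"
    "\<And>z. Im z > 0 \<Longrightarrow> cmod (\<phi> z * g z) \<le> 1"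
proof -
  let ?U = "{z. Im z > 0}"
  define H where "H = {h. h holomorphic_on ?U \<and> (\<forall>z\<in>?U. cmod (h z) \<le> 1 \<and> cmod (\<phi> z * h z) \<le> 1)}"
  define V where "V = (\<lambda>h. cmod (h w)) ` H"
  have FH: "F \<in> H" using F bF bG by (auto simp: H_def)
  have V: "V \<noteq> {}" "bdd_above V"
    using FH w by (auto simp: V_def H_def intro!: bdd_aboveI[of _ 1])
  define s where "s = Sup V"
  have le_s: "cmod (h w) \<le> s" if "h \<in> H" for h
    unfolding s_def using that V by (intro cSup_upper) (auto simp: V_def)
  have "\<exists>h\<in>H. s - 1 / real (Suc n) < cmod (h w)" for n
  proof -
    have "s - 1 / real (Suc n) < Sup V" by (simp add: s_def)
    then show ?thesis using less_cSup_iff[OF V] by (auto simp: V_def)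
  qed
  then obtain h where h: "\<And>n. h n \<in> H" "\<And>n. s - 1 / real (Suc n) < cmod (h n w)"
    by metis
  obtain g r where g: "g holomorphic_on ?U" "strict_mono r"
      "\<And>z. z \<in> ?U \<Longrightarrow> (\<lambda>n. h (r n) z) \<longlonglongrightarrow> g z"
  proof (rule Montel[of ?U H h])
    show "open ?U" by (rule convex_upper_half_plane)
    show "\<exists>B. \<forall>h\<in>H. \<forall>z\<in>K. cmod (h z) \<le> B" if "K \<subseteq> ?U" for K
      using that by (intro exI[of _ 1]) (auto simp: H_def)
  qed (use h in \<open>auto simp: H_def\<close>)
  have gU: "cmod (g z) \<le> 1" "cmod (\<phi> z * g z) \<le> 1" if z: "Im z > 0" for z
  proof -
    have l: "(\<lambda>n. h (r n) z) \<longlonglongrightarrow> g z" using g(3) z by simp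
    have hb: "cmod (h n z) \<le> 1" "cmod (\<phi> z * h n z) \<le> 1" for n
      using h(1)[of n] z by (auto simp: H_def)
    show "cmod (g z) \<le> 1"
      by (rule LIMSEQ_le_const2[OF tendsto_norm[OF l]]) (use hb in auto)
    show "cmod (\<phi> z * g z) \<le> 1"
      by (rule LIMSEQ_le_const2[OF tendsto_norm[OF tendsto_mult_left[OF l]]]) (use hb in auto)
  qed
  have gs: "s \<le> cmod (g w)"
  proof (rule LIMSEQ_le)
    show "(\<lambda>n. cmod (h (r n) w)) \<longlonglongrightarrow> cmod (g w)" using g(3) w by (intro tendsto_norm) auto
    have "(\<lambda>n. s - 1 / real (Suc n)) \<longlonglongrightarrow> s - 0"
      by (intro tendsto_intros LIMSEQ_Suc[OF lim_const_over_n])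
    then have "((\<lambda>n. s - 1 / real (Suc n)) \<circ> r) \<longlonglongrightarrow> s - 0"
      using g(2) by (rule LIMSEQ_subseq_LIMSEQ)
    then show "(\<lambda>n. s - 1 / real (Suc (r n))) \<longlonglongrightarrow> s" by (simp add: o_def)
    show "\<exists>N. \<forall>n\<ge>N. s - 1 / real (Suc (r n)) \<le> cmod (h (r n) w)"
      using h(2) by (auto intro: less_imp_le)
  qed
  have Fg: "cmod (F w) \<le> cmod (g w)" using le_s[OF FH] gs by simp
  then have gw: "g w \<noteq> 0" using w by auto
  have nz: "g v \<noteq> 0" if v: "Im v > 0" for v
  proof
    assume gv: "g v = 0"
    \<comment> \<open>The Blaschke factor of the zero \<open>v\<close> is divided out of \<open>g\<close>.\<close>
    define q where "q z = (if z = v then deriv g v else (g z - g v) / (z - v)) * (z - cnj v)" for z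
    have q: "q holomorphic_on ?U"
      unfolding q_def by (intro holomorphic_intros pole_lemma g) (use v in \<open>simp add: convex_upper_half_plane\<close>)
    have qz: "q z = g z * (z - cnj v) / (z - v)" if "z \<noteq> v" for z
      using that gv by (simp add: q_def)
    have bl: "cmod (f z * (z - cnj v) / (z - v)) \<le> 1"
      if "f holomorphic_on ?U" "f v = 0" "\<And>z. Im z > 0 \<Longrightarrow> cmod (f z) \<le> 1" "Im z > 0" "z \<noteq> v" for f z
    proof -
      have pos: "cmod (z - cnj v) > 0" using Im_less_cayley[OF \<open>Im z > 0\<close> v] norm_ge_zero[of "z - v"] by linarith
      have "cmod (f z) \<le> cmod (z - v) / cmod (z - cnj v)"
        using that v by (intro upper_half_plane_Schwarz) auto
      then have "cmod (f z) * cmod (z - cnj v) \<le> cmod (z - v)" using pos by (simp add: field_simps)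
      moreover have "cmod (z - v) > 0" using that(5) by simp
      ultimately show ?thesis by (simp only: norm_mult norm_divide divide_le_eq_1_pos)
    qed
    have "q \<in> H"
    proof -
      have 1: "cmod (q z) \<le> 1" if "z \<in> ?U" "z \<noteq> v" for z
        using bl[OF g(1) gv gU(1), of z] that by (simp add: qz)
      have 2: "cmod (\<phi> z * q z) \<le> 1" if "z \<in> ?U" "z \<noteq> v" for z
        using bl[of "\<lambda>z. \<phi> z * g z" z] that gU gv
        by (simp add: qz holomorphic_on_mult ph g(1) mult.assoc)
      have 3: "cmod (q v) \<le> 1"
        by (rule le_at_point[OF q]) (use 1 v convex_upper_half_plane in auto)
      have 4: "cmod (\<phi> v * q v) \<le> 1"
        by (rule le_at_point[of "\<lambda>z. \<phi> z * q z" ?U])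
          (use 2 v convex_upper_half_plane in \<open>auto intro!: holomorphic_intros ph q\<close>)
      show ?thesis unfolding H_def using q 1 2 3 4 by blast
    qed
    then have "cmod (q w) \<le> cmod (g w)" using le_s gs by (meson order_trans)
    moreover have "w \<noteq> v" using gv gw by auto
    moreover have "cmod (q w) = cmod (g w) * cmod (w - cnj v) / cmod (w - v)"
      using calculation(2) by (simp add: qz norm_mult norm_divide)
    ultimately have "cmod (g w) * cmod (w - cnj v) / cmod (w - v) \<le> cmod (g w)" "cmod (w - v) > 0"
      by simp_all
    then have "cmod (g w) * cmod (w - cnj v) \<le> cmod (g w) * cmod (w - v)"
      by (simp add: divide_le_eq)
    then show False using Im_less_cayley[OF w(1) v] gw by simp
  qed
  show ?thesis using that[of g] g(1) Fg nz gU by blast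
qed

text \<open>A zero-free denominator has a logarithm whose real part is nonpositive, so that Harnack bounds the
  denominator from below by its value at the single point \<open>w\<close>.\<close>

lemma quotient_growth_upper:
  assumes ph: "\<phi> holomorphic_on {z. Im z > 0}" and F: "F holomorphic_on {z. Im z > 0}"
    and bF: "\<And>z. Im z > 0 \<Longrightarrow> cmod (F z) \<le> 1"
    and bG: "\<And>z. Im z > 0 \<Longrightarrow> cmod (\<phi> z * F z) \<le> 1"
    and w: "Im w > 0" "F w \<noteq> 0" and z: "Im z > 0"
  shows "cmod (\<phi> z) \<le> exp (- ln (cmod (F w)) * ((cmod (z - cnj w))\<^sup>2 / (Im z * Im w)))"
proof -
  let ?U = "{z. Im z > 0}"
  obtain g where g: "g holomorphic_on ?U" "cmod (F w) \<le> cmod (g w)"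
    "\<And>z. Im z > 0 \<Longrightarrow> g z \<noteq> 0" "\<And>z. Im z > 0 \<Longrightarrow> cmod (g z) \<le> 1"
    "\<And>z. Im z > 0 \<Longrightarrow> cmod (\<phi> z * g z) \<le> 1"
    using zero_free_denominator[OF ph F bF bG w] by blast
  obtain L where L: "L holomorphic_on ?U" "\<And>z. z \<in> ?U \<Longrightarrow> g z = exp (L z)"
    using contractible_imp_holomorphic_log[OF g(1) convex_imp_contractible[OF convex_upper_half_plane(1)]]
      g(3) by auto
  have cg: "cmod (g z) = exp (Re (L z))" if "Im z > 0" for z using L(2) that by simp
  define K where "K = (cmod (z - cnj w))\<^sup>2 / (Im z * Im w)"
  have K: "K \<ge> 0" using z w by (simp add: K_def)
  have "Im (- \<i> * L z) \<le> Im (- \<i> * L w) * K"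
    unfolding K_def
  proof (rule Harnack_upper_half_plane[OF _ _ z w(1)])
    show "(\<lambda>z. - \<i> * L z) holomorphic_on ?U" by (intro holomorphic_intros L)
    show "0 \<le> Im (- \<i> * L u)" if "Im u > 0" for u
      using g(4)[OF that] cg[OF that] by simp
  qed
  then have 1: "- Re (L z) \<le> - Re (L w) * K" by simp
  have "ln (cmod (F w)) \<le> Re (L w)"
    using g(2) w cg[OF w(1)] by (metis ln_exp ln_le_cancel_iff exp_gt_zero zero_less_norm_iff)
  then have 2: "- Re (L w) * K \<le> - ln (cmod (F w)) * K" using K by (intro mult_right_mono) auto
  have "cmod (\<phi> z) * cmod (g z) \<le> 1" using g(5)[OF z] by (simp add: norm_mult)
  then have "cmod (\<phi> z) \<le> exp (- Re (L z))" by (simp add: cg[OF z] exp_minus field_simps)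
  also have "\<dots> \<le> exp (- ln (cmod (F w)) * K)" using 1 2 by simp
  finally show ?thesis by (simp add: K_def)
qed

text \<open>Steep directions suffice: the two remaining sectors along the real axis are so narrow that growth of
  order two is controlled there by the bounding rays.\<close>

lemma type0_from_steep_directions:
  assumes p: "p holomorphic_on UNIV" and B: "B \<ge> 0"
    and growth: "\<And>z. cmod (p z) \<le> exp (B * (1 + cmod z)\<^sup>2)"
    and steep: "\<And>e. e > 0 \<Longrightarrow> \<exists>K. \<forall>z. \<bar>Re z\<bar> \<le> 2 * \<bar>Im z\<bar> \<longrightarrow> cmod (p z) \<le> K * exp (e * cmod z)"
  shows "type0 p"
  unfolding type0_def
proof (intro allI impI)
  fix e :: real assume e: "e > 0"
  obtain K0 where K0: "\<And>z. \<bar>Re z\<bar> \<le> 2 * \<bar>Im z\<bar> \<Longrightarrow> cmod (p z) \<le> K0 * exp (e/2 * cmod z)"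
    using steep[of "e/2"] e by auto
  define K where "K = max 1 K0"
  have K: "K \<ge> 1" by (simp add: K_def)
  have st: "cmod (p z) \<le> K * exp (e/2 * cmod z)" if "\<bar>Re z\<bar> \<le> 2 * \<bar>Im z\<bar>" for z
  proof -
    have "K0 * exp (e/2 * cmod z) \<le> K * exp (e/2 * cmod z)" by (intro mult_right_mono) (auto simp: K_def)
    with K0[OF that] show ?thesis by linarith
  qed
  have flat: "cmod (q z) \<le> K * exp (e * Re z)"
    if q: "q holomorphic_on UNIV" "\<And>z. cmod (q z) \<le> exp (B * (1 + cmod z)\<^sup>2)"
      "\<And>z. \<bar>Re z\<bar> \<le> 2 * \<bar>Im z\<bar> \<Longrightarrow> cmod (q z) \<le> K * exp (e/2 * cmod z)"
    and z: "0 \<le> Re z" "2 * \<bar>Im z\<bar> \<le> Re z" for q z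
  proof -
    have nrm: "cmod (q u * exp (- of_real e * u)) = cmod (q u) * exp (- (e * Re u))" for u
      by (simp add: norm_mult)
    have "cmod (q z * exp (- of_real e * z)) \<le> K"
    proof (rule Phragmen_Lindelof_sector[where a = "-1/2" and b = "1/2" and C = B
          and p = "\<lambda>z. q z * exp (- of_real e * z)"])
      show "(\<lambda>z. q z * exp (- of_real e * z)) holomorphic_on UNIV" by (intro holomorphic_intros q)
      fix u :: complex
      { assume "0 \<le> Re u"
        then have "cmod (q u) * exp (- (e * Re u)) \<le> exp (B * (1 + cmod u)\<^sup>2) * 1"
          using q(2)[of u] e by (intro mult_mono) auto
        then show "cmod (q u * exp (- of_real e * u)) \<le> exp (B * (1 + cmod u)\<^sup>2)" unfolding nrm by simp }
      { assume u: "0 \<le> Re u" "Im u = -1/2 * Re u \<or> Im u = 1/2 * Re u"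
        then have ri: "\<bar>Re u\<bar> \<le> 2 * \<bar>Im u\<bar>" "\<bar>Im u\<bar> \<le> Re u" by auto
        have "cmod u \<le> 2 * Re u" using cmod_le[of u] ri u(1) by linarith
        then have "e/2 * cmod u \<le> e/2 * (2 * Re u)" using e by (intro mult_left_mono) auto
        then have "K * exp (e/2 * cmod u) \<le> K * exp (e * Re u)" using K by simp
        then have "cmod (q u) \<le> K * exp (e * Re u)" using q(3)[OF ri(1)] by linarith
        then have "cmod (q u) * exp (- (e * Re u)) \<le> K * exp (e * Re u) * exp (- (e * Re u))"
          by (intro mult_right_mono) auto
        moreover have "K * exp (e * Re u) * exp (- (e * Re u)) = K" by (simp add: exp_minus)
        ultimately show "cmod (q u * exp (- of_real e * u)) \<le> K" unfolding nrm by linarith }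
    qed (use z K in auto)
    then have "cmod (q z) * exp (- (e * Re z)) * exp (e * Re z) \<le> K * exp (e * Re z)"
      unfolding nrm by (intro mult_right_mono) auto
    moreover have "cmod (q z) * exp (- (e * Re z)) * exp (e * Re z) = cmod (q z)" by (simp add: exp_minus)
    ultimately show ?thesis by linarith
  qed
  have "cmod (p z) \<le> K * exp (e * cmod z)" for z
  proof (cases "\<bar>Re z\<bar> \<le> 2 * \<bar>Im z\<bar>")
    case True
    have "K * exp (e/2 * cmod z) \<le> K * exp (e * cmod z)" using K e by simp
    with st[OF True] show ?thesis by linarith
  next
    case False
    have q: "(\<lambda>z. p (- z)) holomorphic_on UNIV"
    proof -
      have "(\<lambda>z. - z) holomorphic_on (UNIV :: complex set)" by (intro holomorphic_intros)
      moreover have "p holomorphic_on (\<lambda>z. - z) ` UNIV" by (rule holomorphic_on_subset[OF p]) simp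
      ultimately have "(p \<circ> (\<lambda>z. - z)) holomorphic_on UNIV" by (rule holomorphic_on_compose)
      then show ?thesis by (simp add: o_def)
    qed
    have "cmod (p z) \<le> K * exp (e * \<bar>Re z\<bar>)"
    proof (cases "0 \<le> Re z")
      case True
      then show ?thesis using flat[OF p growth st, of z] False by auto
    next
      case F2: False
      have "cmod (p (- (- z))) \<le> K * exp (e * Re (- z))"
        using False F2 growth[of "- _"] st[of "- _"] by (intro flat[OF q]) auto
      then show ?thesis using F2 by simp
    qed
    also have "\<dots> \<le> K * exp (e * cmod z)" using K e abs_Re_le_cmod[of z] by simp
    finally show ?thesis .
  qed
  then show "\<exists>C. \<forall>z. cmod (p z) \<le> C * exp (e * cmod z)" by blast
qed

text \<open>The denominator \<open>F\<close> decays at the rate \<open>a\<close> and at no better one, so that, normalized by \<open>exp (- \<i> a z)\<close>, its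
  modulus has logarithm at least \<open>- d * Im w\<close> at some point \<open>w\<close>, for any given \<open>d > 0\<close>. With this \<open>w\<close>,
  the bound on the quotient has the form \<open>exp (d * (\<bar>z\<bar> + c)\<^sup>2 / Im z)\<close>, which is small growth in steep directions.\<close>

lemma quotient_type0:
  assumes ph: "\<phi> holomorphic_on UNIV" and sym: "star \<phi> = \<phi>"
    and F: "F holomorphic_on UNIV" "decays a F" "decays (- b) (star F)"
    and G: "decays a G" "decays (- b) (star G)" and GF: "\<And>z. G z = \<phi> z * F z"
    and sharp: "\<And>d. d > 0 \<Longrightarrow> \<not> decays (a + d) F"
  shows "type0 \<phi>"
proof -
  define ex where "ex z = exp (\<i> * of_real (- a) * z)" for z
  have exd: "decays (- a) ex" unfolding ex_def by (rule decays_exp)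
  have exh: "ex holomorphic_on UNIV" unfolding ex_def by (intro holomorphic_intros)
  have exn: "cmod (ex z) = exp (a * Im z)" for z by (simp add: ex_def)
  have "decays 0 (\<lambda>z. F z * ex z)" "decays 0 (\<lambda>z. G z * ex z)"
    using decays_mult[OF F(2) exd] decays_mult[OF G(1) exd] by simp_all
  then obtain C1 C2 where C12: "\<And>z. 0 \<le> Im z \<Longrightarrow> cmod (F z * ex z) \<le> C1"
      "\<And>z. 0 \<le> Im z \<Longrightarrow> cmod (G z * ex z) \<le> C2"
    by (auto simp: decays_def)
  obtain D1 where D1: "D1 \<ge> 0" "\<And>z. 0 \<le> Im z \<Longrightarrow> cmod (star F z) \<le> D1 * exp (b * Im z)"
    using F(3) by (elim decaysE) auto
  obtain D2 where D2: "D2 \<ge> 0" "\<And>z. 0 \<le> Im z \<Longrightarrow> cmod (star G z) \<le> D2 * exp (b * Im z)"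
    using G(2) by (elim decaysE) auto
  define C where "C = Max {1, C1, C2, D1 * exp (\<bar>a\<bar> + \<bar>b\<bar>), D2 * exp (\<bar>a\<bar> + \<bar>b\<bar>)}"
  have Cge: "1 \<le> C" "C1 \<le> C" "C2 \<le> C" "D1 * exp (\<bar>a\<bar> + \<bar>b\<bar>) \<le> C" "D2 * exp (\<bar>a\<bar> + \<bar>b\<bar>) \<le> C"
    unfolding C_def by (rule Max_ge; simp)+
  have low: "cmod (q z * ex z) \<le> C"
    if "\<And>z. 0 \<le> Im z \<Longrightarrow> cmod (star q z) \<le> D * exp (b * Im z)" "D * exp (\<bar>a\<bar> + \<bar>b\<bar>) \<le> C"
      "D \<ge> 0" "-1 \<le> Im z" "Im z \<le> 0" for q D z
  proof -
    have "cmod (q z) \<le> D * exp (b * (- Im z))" using that(1)[of "cnj z"] that by (simp add: star_def)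
    then have "cmod (q z * ex z) \<le> D * exp (b * (- Im z)) * exp (a * Im z)"
      unfolding norm_mult exn by (intro mult_right_mono) auto
    also have "\<dots> = D * exp ((a - b) * Im z)" by (simp add: exp_add[symmetric] algebra_simps)
    also have "\<dots> \<le> D * exp (\<bar>a\<bar> + \<bar>b\<bar>)"
    proof -
      have "(a - b) * Im z \<le> \<bar>a - b\<bar> * \<bar>Im z\<bar>" by (metis abs_ge_self abs_mult)
      also have "\<dots> \<le> \<bar>a - b\<bar> * 1" using that by (intro mult_left_mono) auto
      finally show ?thesis using \<open>D \<ge> 0\<close> by (intro mult_left_mono) auto
    qed
    finally show ?thesis using that by linarith
  qed
  have FC: "cmod (F z * ex z) \<le> C" if "-1 \<le> Im z" for z
    using low[OF D1(2) Cge(4) D1(1) that] C12(1)[of z] Cge(2) by linarith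
  have GC: "cmod (G z * ex z) \<le> C" if "-1 \<le> Im z" for z
    using low[OF D2(2) Cge(5) D2(1) that] C12(2)[of z] Cge(3) by linarith
  define F1 where "F1 z = F z * ex z / of_real C" for z
  have F1h: "F1 holomorphic_on UNIV" unfolding F1_def using Cge by (intro holomorphic_intros F exh) auto
  have F1b: "cmod (F1 z) \<le> 1" "cmod (\<phi> z * F1 z) \<le> 1" if "-1 \<le> Im z" for z
    using FC[OF that] GC[OF that] Cge(1) by (auto simp: F1_def norm_divide norm_mult GF mult.assoc)
  have sharp1: "\<exists>w. Im w > 0 \<and> F1 w \<noteq> 0 \<and> - ln (cmod (F1 w)) \<le> d * Im w" if d: "d > 0" for d
  proof -
    obtain w where w: "0 \<le> Im w" "cmod (F w) > C * exp (- (a + d) * Im w)"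
      using sharp[OF d] by (auto simp: decays_def not_le)
    have "C * exp (- (a + d) * Im w) * exp (a * Im w) < cmod (F w) * exp (a * Im w)"
      using w by simp
    moreover have "C * exp (- (a + d) * Im w) * exp (a * Im w) = C * exp (- (d * Im w))"
      by (simp add: mult.assoc exp_add[symmetric] algebra_simps)
    ultimately have "C * exp (- (d * Im w)) < cmod (F w) * exp (a * Im w)" by linarith
    moreover have "cmod (F1 w) = cmod (F w) * exp (a * Im w) / C"
      using Cge(1) by (simp add: F1_def norm_mult norm_divide exn)
    ultimately have lt: "exp (- (d * Im w)) < cmod (F1 w)"
      using Cge(1) by (simp add: pos_less_divide_eq mult.commute)
    have "Im w \<noteq> 0" using lt F1b(1)[of w] w by auto
    moreover have "F1 w \<noteq> 0" using lt exp_gt_zero[of "- (d * Im w)"] by auto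
    moreover have "- (d * Im w) \<le> ln (cmod (F1 w))"
      using lt calculation by (metis ln_exp ln_le_cancel_iff exp_gt_zero less_imp_le zero_less_norm_iff)
    ultimately show ?thesis using w by (intro exI[of _ w]) auto
  qed
  have half: "\<exists>c\<ge>0. \<forall>z. Im z > 0 \<longrightarrow> cmod (\<phi> z) \<le> exp (d * (cmod z + c)\<^sup>2 / Im z)" if d: "d > 0" for d
  proof -
    obtain w where w: "Im w > 0" "F1 w \<noteq> 0" "- ln (cmod (F1 w)) \<le> d * Im w"
      using sharp1[OF d] by blast
    have "cmod (\<phi> z) \<le> exp (d * (cmod z + cmod w)\<^sup>2 / Im z)" if z: "Im z > 0" for z
    proof -
      have "cmod (\<phi> z) \<le> exp (- ln (cmod (F1 w)) * ((cmod (z - cnj w))\<^sup>2 / (Im z * Im w)))"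
        by (rule quotient_growth_upper) (use ph F1h F1b w z in \<open>auto elim: holomorphic_on_subset\<close>)
      also have "- ln (cmod (F1 w)) * ((cmod (z - cnj w))\<^sup>2 / (Im z * Im w))
          \<le> d * Im w * ((cmod z + cmod w)\<^sup>2 / (Im z * Im w))"
      proof (intro mult_mono divide_right_mono power_mono)
        show "cmod (z - cnj w) \<le> cmod z + cmod w" using norm_triangle_ineq4[of z "cnj w"] by simp
      qed (use w z d in auto)
      also have "\<dots> = d * (cmod z + cmod w)\<^sup>2 / Im z" using w by simp
      finally show ?thesis by simp
    qed
    then show ?thesis by (intro exI[of _ "cmod w"]) auto
  qed
  have symcm: "cmod (\<phi> (cnj z)) = cmod (\<phi> z)" for z
    using arg_cong[OF sym, of "\<lambda>f. cmod (f z)"] by (simp add: star_def)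
  have both: "\<exists>c\<ge>0. \<forall>z. Im z \<noteq> 0 \<longrightarrow> cmod (\<phi> z) \<le> exp (d * (cmod z + c)\<^sup>2 / \<bar>Im z\<bar>)" if d: "d > 0" for d
  proof -
    obtain c where c: "c \<ge> 0" "\<And>z. Im z > 0 \<Longrightarrow> cmod (\<phi> z) \<le> exp (d * (cmod z + c)\<^sup>2 / Im z)"
      using half[OF d] by blast
    have "cmod (\<phi> z) \<le> exp (d * (cmod z + c)\<^sup>2 / \<bar>Im z\<bar>)" if "Im z \<noteq> 0" for z
      using c(2)[of z] c(2)[of "cnj z"] that symcm[of z] by (cases "Im z > 0") auto
    with c(1) show ?thesis by blast
  qed
  \<comment> \<open>Near the real axis these bounds fail. But \<open>F1\<close> and \<open>\<phi> * F1\<close> are bounded by 1 already above the line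
    \<open>Im z = -1\<close>, and in that half-plane the same estimate yields growth of order two.\<close>
  obtain B where B: "B \<ge> 0" "\<And>z. cmod (\<phi> z) \<le> exp (B * (1 + cmod z)\<^sup>2)"
  proof -
    obtain w where w: "Im w > 0" "F1 w \<noteq> 0" using sharp1[of 1] by auto
    define A where "A = - ln (cmod (F1 w)) / (1 + Im w)"
    have "cmod (F1 w) \<le> 1" using F1b(1)[of w] w by simp
    then have "ln (cmod (F1 w)) \<le> 0" using w by simp
    then have A: "A \<ge> 0" unfolding A_def using w by (intro divide_nonneg_pos) auto
    define c where "c = 1 + cmod (w + \<i>)"
    have c: "c \<ge> 1" by (simp add: c_def)
    have shift: "(\<lambda>z. f (z - \<i>)) holomorphic_on {z. Im z > 0}" if "f holomorphic_on UNIV" for f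
    proof -
      have "(\<lambda>z. z - \<i>) holomorphic_on {z. Im z > 0}" by (intro holomorphic_intros)
      moreover have "f holomorphic_on (\<lambda>z. z - \<i>) ` {z. Im z > 0}" by (rule holomorphic_on_subset[OF that]) simp
      ultimately have "(f \<circ> (\<lambda>z. z - \<i>)) holomorphic_on {z. Im z > 0}" by (rule holomorphic_on_compose)
      then show ?thesis by (simp add: o_def)
    qed
    have up: "cmod (\<phi> z) \<le> exp (A * c\<^sup>2 * (1 + cmod z)\<^sup>2)" if z: "0 \<le> Im z" for z
    proof -
      have "cmod (\<phi> ((z + \<i>) - \<i>)) \<le> exp (- ln (cmod (F1 ((w + \<i>) - \<i>))) *
          ((cmod ((z + \<i>) - cnj (w + \<i>)))\<^sup>2 / (Im (z + \<i>) * Im (w + \<i>))))"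
        by (rule quotient_growth_upper[OF shift[OF ph] shift[OF F1h]]) (use F1b w z in auto)
      also have "- ln (cmod (F1 ((w + \<i>) - \<i>))) * ((cmod ((z + \<i>) - cnj (w + \<i>)))\<^sup>2 / (Im (z + \<i>) * Im (w + \<i>)))
          = A * ((cmod ((z + \<i>) - cnj (w + \<i>)))\<^sup>2 / (1 + Im z))"
        by (simp add: A_def add.commute)
      also have "\<dots> \<le> A * ((c * (1 + cmod z))\<^sup>2 / 1)"
      proof (intro mult_left_mono frac_le power_mono A)
        have "cmod ((z + \<i>) - cnj (w + \<i>)) \<le> (cmod z + 1) + cmod (w + \<i>)"
          using norm_triangle_ineq4[of "z + \<i>" "cnj (w + \<i>)"] norm_triangle_ineq[of z \<i>]
          by (simp del: complex_cnj_add)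
        also have "\<dots> \<le> c * (1 + cmod z)"
          using mult_nonneg_nonneg[of "cmod (w + \<i>)" "cmod z"] by (simp add: c_def algebra_simps)
        finally show "cmod ((z + \<i>) - cnj (w + \<i>)) \<le> c * (1 + cmod z)" .
      qed (use z in auto)
      finally show ?thesis by (simp add: power_mult_distrib mult.assoc)
    qed
    show ?thesis
    proof (rule that[of "A * c\<^sup>2"])
      show "cmod (\<phi> z) \<le> exp (A * c\<^sup>2 * (1 + cmod z)\<^sup>2)" for z
        using up[of z] up[of "cnj z"] symcm[of z] by (cases "0 \<le> Im z") auto
    qed (use A in auto)
  qed
  show ?thesis
  proof (rule type0_from_steep_directions[OF ph B])
    fix e :: real assume e: "e > 0"
    obtain c where c: "c \<ge> 0" "\<And>z. Im z \<noteq> 0 \<Longrightarrow> cmod (\<phi> z) \<le> exp (e / 3 * (cmod z + c)\<^sup>2 / \<bar>Im z\<bar>)"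
      using both[of "e/3"] e by auto
    define K where "K = max (exp (B * 4)) (exp (e * (2 * c + c\<^sup>2)))"
    have "cmod (\<phi> z) \<le> K * exp (e * cmod z)" if z: "\<bar>Re z\<bar> \<le> 2 * \<bar>Im z\<bar>" for z
    proof (cases "cmod z \<le> 1")
      case True
      have "(1 + cmod z)\<^sup>2 \<le> 2\<^sup>2" using True by (intro power_mono) auto
      then have "exp (B * (1 + cmod z)\<^sup>2) \<le> exp (B * 4)" using B(1) by (auto intro: mult_left_mono)
      also have "\<dots> \<le> K" by (simp add: K_def)
      also have "K \<le> K * exp (e * cmod z)"
      proof -
        have "K * 1 \<le> K * exp (e * cmod z)" using e by (intro mult_left_mono) (auto simp: K_def le_max_iff_disj)
        then show ?thesis by simp
      qed
      finally show ?thesis using B(2)[of z] by linarith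
    next
      case False
      have n3: "cmod z \<le> 3 * \<bar>Im z\<bar>" using cmod_le[of z] z by linarith
      have i0: "\<bar>Im z\<bar> > 0" using n3 False by linarith
      have "e / 3 * (cmod z + c)\<^sup>2 / \<bar>Im z\<bar> \<le> e / 3 * (cmod z + c)\<^sup>2 / (cmod z / 3)"
        using n3 False e by (intro divide_left_mono mult_pos_pos) auto
      also have "\<dots> = e * (cmod z + 2 * c + c\<^sup>2 / cmod z)"
      proof -
        have "r \<noteq> 0 \<Longrightarrow> e / 3 * (r + c)\<^sup>2 / (r / 3) = e * (r + 2 * c + c\<^sup>2 / r)" for r :: real
          by (simp add: divide_simps power2_eq_square) (simp add: algebra_simps)
        moreover have "cmod z \<noteq> 0" using False by auto
        ultimately show ?thesis by blast
      qed
      also have "\<dots> \<le> e * (cmod z + 2 * c + c\<^sup>2 / 1)"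
        using e False by (intro mult_left_mono add_left_mono divide_left_mono) auto
      finally have "exp (e / 3 * (cmod z + c)\<^sup>2 / \<bar>Im z\<bar>) \<le> exp (e * (2 * c + c\<^sup>2)) * exp (e * cmod z)"
        by (simp add: exp_add[symmetric] algebra_simps)
      also have "\<dots> \<le> K * exp (e * cmod z)" by (intro mult_right_mono) (auto simp: K_def)
      finally show ?thesis using c(2)[of z] i0 by auto
    qed
    then show "\<exists>K. \<forall>z. \<bar>Re z\<bar> \<le> 2 * \<bar>Im z\<bar> \<longrightarrow> cmod (\<phi> z) \<le> K * exp (e * cmod z)" by blast
  qed
qed

section \<open>Sign changes of real entire functions\<close>

lemma entire_mult_eq_0:
  assumes p: "p holomorphic_on UNIV" and q: "q holomorphic_on UNIV"
    and zero: "\<And>z. p z * q z = 0" and w: "p w \<noteq> 0"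
  shows "q z = 0"
proof -
  have "continuous_on UNIV p" using p by (rule entire_continuous)
  then have U: "open (p -` (- {0}))" by (rule open_vimage[rotated]) auto
  show ?thesis
  proof (rule analytic_continuation_open[OF U open_UNIV _ connected_UNIV _ q, of "\<lambda>_. 0"])
    show "p -` (- {0}) \<noteq> {}" using w by auto
    show "q z = 0" if "z \<in> p -` (- {0})" for z using zero[of z] that by auto
  qed auto
qed

lemma entire_real_imp_star:
  assumes p: "p holomorphic_on UNIV" and real: "\<And>x::real. x \<noteq> c \<Longrightarrow> p (of_real x) \<in> \<real>"
  shows "star p = p"
proof (rule entire_eq_on_reals[OF holomorphic_star[OF p] p])
  show "star p (of_real x) = p (of_real x)" if "x \<noteq> c" for x
    using real[OF that] by (simp add: star_def Reals_cnj_iff)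
qed

lemma star_real: "star p = p \<Longrightarrow> p (of_real x) \<in> \<real>"
  by (metis Reals_cnj_iff star_of_real)

text \<open>On a bounded interval the sign of a real entire function is that of a constant times the product over its
  zeros of odd order. The induction removes one zero at a time.\<close>

lemma real_entire_sign_changes:
  fixes s :: "complex \<Rightarrow> complex"
  assumes "s holomorphic_on UNIV" "s w \<noteq> 0" "star s = s"
  shows "\<exists>A c. finite A \<and> \<bar>c\<bar> = 1 \<and>
    (\<forall>x\<in>{-R..R::real}. 0 \<le> c * Re (s (of_real x)) * (\<Prod>y\<in>A. x - y)) \<and>
    (\<forall>y\<in>A. \<exists>n q. odd n \<and> q holomorphic_on UNIV \<and> q (of_real y) \<noteq> 0 \<and>
        (\<forall>z. s z = (z - of_real y) ^ n * q z))"
proof -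
  have fin: "finite {x\<in>{-R..R}. f (complex_of_real x) = 0}"
    if f: "f holomorphic_on UNIV" "f w \<noteq> 0" for f w
  proof -
    let ?K = "complex_of_real ` {-R..R}"
    have "compact ?K" by (intro compact_continuous_image continuous_intros) auto
    then have "finite {z\<in>?K. f z = 0}"
    proof (cases "f constant_on UNIV")
      case True
      then obtain c where "\<And>z. f z = c" unfolding constant_on_def by blast
      then have "f z \<noteq> 0" for z using f(2) by metis
      then show ?thesis by simp
    next
      case False
      then show ?thesis
        using holomorphic_compact_finite_zeros[OF f(1) open_UNIV connected_UNIV \<open>compact ?K\<close> subset_UNIV]
        by blast
    qed
    moreover have "of_real ` {x\<in>{-R..R}. f (complex_of_real x) = 0} \<subseteq> {z\<in>?K. f z = 0}" by auto
    ultimately have "finite (complex_of_real ` {x\<in>{-R..R}. f (complex_of_real x) = 0})"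
      by (rule finite_subset[rotated])
    then show ?thesis by (rule finite_imageD) (auto simp: inj_on_def)
  qed
  show ?thesis
    using assms
  proof (induction "card {x\<in>{-R..R}. s (complex_of_real x) = 0}" arbitrary: s w)
    case 0
    note f0 = fin[OF 0(2,3)]
    then have nz: "s (of_real x) \<noteq> 0" if "x \<in> {-R..R}" for x using 0(1) that by auto
    have re: "s (of_real x) = of_real (Re (s (of_real x)))" for x
      using star_real[OF 0(4), of x] by (simp add: of_real_Re)
    have cont: "continuous_on {-R..R} (\<lambda>x. Re (s (of_real x)))"
      by (intro continuous_intros entire_real_continuous 0)
    have "(\<forall>x\<in>{-R..R}. Re (s (of_real x)) > 0) \<or> (\<forall>x\<in>{-R..R}. Re (s (of_real x)) < 0)"
    proof (rule ccontr)
      assume "\<not> ?thesis"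
      then obtain x y where xy: "x \<in> {-R..R}" "y \<in> {-R..R}" "Re (s (of_real x)) \<le> 0" "0 \<le> Re (s (of_real y))"
        by (meson not_less)
      have "connected ((\<lambda>x. Re (s (of_real x))) ` {-R..R})"
        by (intro connected_continuous_image cont) auto
      then have "0 \<in> (\<lambda>x. Re (s (of_real x))) ` {-R..R}"
        by (rule connectedD_interval[OF _ imageI[OF xy(1), of "\<lambda>x. Re (s (of_real x))"]
              imageI[OF xy(2), of "\<lambda>x. Re (s (of_real x))"] xy(3,4)])
      then obtain x where "x \<in> {-R..R}" "Re (s (of_real x)) = 0" by auto
      then show False using nz[of x] re[of x] by simp
    qed
    then have "\<exists>c. \<bar>c\<bar> = 1 \<and> (\<forall>x\<in>{-R..R}. 0 \<le> c * Re (s (of_real x)))"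
    proof
      assume "\<forall>x\<in>{-R..R}. Re (s (of_real x)) > 0"
      then show ?thesis by (intro exI[of _ 1]) (auto intro: less_imp_le)
    next
      assume "\<forall>x\<in>{-R..R}. Re (s (of_real x)) < 0"
      then show ?thesis by (intro exI[of _ "-1"]) (auto intro: less_imp_le)
    qed
    then obtain c where "\<bar>c\<bar> = 1" "\<forall>x\<in>{-R..R}. 0 \<le> c * Re (s (of_real x))" by blast
    then show ?case by (intro exI[of _ "{}"] exI[of _ c]) auto
  next
    case (Suc k)
    note fs = fin[OF Suc.prems(1,2)]
    obtain y where y: "y \<in> {-R..R}" "s (of_real y) = 0"
    proof -
      have "card {x\<in>{-R..R}. s (complex_of_real x) = 0} \<noteq> 0" using Suc.hyps(2) by linarith
      then have "{x\<in>{-R..R}. s (complex_of_real x) = 0} \<noteq> {}" by (metis card.empty)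
      then show ?thesis using that by auto
    qed
    obtain n s1 where s1: "s1 holomorphic_on UNIV" "s1 (of_real y) \<noteq> 0"
      "\<And>z. s z = (z - of_real y) ^ n * s1 z"
      using entire_factor_zero[OF Suc.prems(1,2), of "of_real y"] by metis
    have "{x\<in>{-R..R}. s1 (of_real x) = 0} = {x\<in>{-R..R}. s (of_real x) = 0} - {y}"
      using s1 y by auto
    then have card: "k = card {x\<in>{-R..R}. s1 (of_real x) = 0}"
      using fs y Suc.hyps(2) by simp
    have sym: "star s1 = s1"
    proof (rule entire_real_imp_star[OF s1(1)])
      fix x :: real assume x: "x \<noteq> y"
      have "s1 (of_real x) = s (of_real x) / of_real ((x - y) ^ n)"
        using x s1(3)[of "of_real x"] by simp
      moreover have "s (of_real x) \<in> \<real>" by (rule star_real[OF Suc.prems(3)])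
      ultimately show "s1 (of_real x) \<in> \<real>" by (metis Reals_divide Reals_of_real)
    qed
    obtain A c where A: "finite A" "\<bar>c\<bar> = 1"
      "\<And>x. x \<in> {-R..R} \<Longrightarrow> 0 \<le> c * Re (s1 (of_real x)) * (\<Prod>y\<in>A. x - y)"
      "\<And>y. y \<in> A \<Longrightarrow> \<exists>n q. odd n \<and> q holomorphic_on UNIV \<and> q (of_real y) \<noteq> 0 \<and>
        (\<forall>z. s1 z = (z - of_real y) ^ n * q z)"
      using Suc.hyps(1)[OF card s1(1,2) sym] by blast
    have yA: "y \<notin> A"
    proof
      assume "y \<in> A"
      from A(4)[OF this] obtain m q where "odd m" "\<And>z. s1 z = (z - of_real y) ^ m * q z" by blast
      then have "s1 (of_real y) = 0" by (cases m) auto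
      then show False using s1 by simp
    qed
    define A' where "A' = (if odd n then insert y A else A)"
    have re: "Re (s (of_real x)) = (x - y) ^ n * Re (s1 (of_real x))" for x
    proof -
      have "s (of_real x) = of_real ((x - y) ^ n) * s1 (of_real x)" by (simp add: s1)
      then show ?thesis by (simp only: Re_complex_of_real Im_complex_of_real times_complex.simps)
    qed
    have "0 \<le> c * Re (s (of_real x)) * (\<Prod>y\<in>A'. x - y)" if x: "x \<in> {-R..R}" for x
    proof (cases "odd n")
      case True
      then have "c * Re (s (of_real x)) * (\<Prod>y\<in>A'. x - y)
          = (x - y) ^ (Suc n) * (c * Re (s1 (of_real x)) * (\<Prod>y\<in>A. x - y))"
        using A(1) yA by (simp add: A'_def re)
      moreover have "0 \<le> (x - y) ^ (Suc n)" using True by (intro zero_le_even_power) auto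
      ultimately show ?thesis by (simp only: mult_nonneg_nonneg[OF _ A(3)[OF x]])
    next
      case False
      then have "c * Re (s (of_real x)) * (\<Prod>y\<in>A'. x - y)
          = (x - y) ^ n * (c * Re (s1 (of_real x)) * (\<Prod>y\<in>A. x - y))"
        by (simp add: A'_def re)
      moreover have "0 \<le> (x - y) ^ n" using False by (intro zero_le_even_power) auto
      ultimately show ?thesis by (simp only: mult_nonneg_nonneg[OF _ A(3)[OF x]])
    qed
    moreover have "\<exists>n q. odd n \<and> q holomorphic_on UNIV \<and> q (of_real y') \<noteq> 0 \<and>
        (\<forall>z. s z = (z - of_real y') ^ n * q z)" if y': "y' \<in> A'" for y'
    proof (cases "y' = y")
      case True
      then have "odd n" using y' yA by (auto simp: A'_def split: if_splits)
      then show ?thesis using s1 True by blast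
    next
      case False
      then have "y' \<in> A" using y' by (auto simp: A'_def split: if_splits)
      from A(4)[OF this] obtain m q where q: "odd m" "q holomorphic_on UNIV" "q (of_real y') \<noteq> 0"
        "\<And>z. s1 z = (z - of_real y') ^ m * q z" by blast
      have "(\<lambda>z. (z - of_real y) ^ n * q z) holomorphic_on UNIV" by (intro holomorphic_intros q)
      moreover have "(of_real y' - complex_of_real y) ^ n * q (of_real y') \<noteq> 0" using False q by simp
      moreover have "s z = (z - of_real y') ^ m * ((z - of_real y) ^ n * q z)" for z
        by (simp add: s1 q)
      ultimately show ?thesis using q(1) by blast
    qed
    ultimately show ?case using A(1,2) by (intro exI[of _ A'] exI[of _ c]) (auto simp: A'_def)
  qed
qed

lemma entire_divide_finite_zeros:
  assumes "finite D" "B holomorphic_on UNIV" "\<And>y. y \<in> D \<Longrightarrow> B y = 0"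
  shows "\<exists>E. E holomorphic_on UNIV \<and> (\<forall>z. B z = E z * (\<Prod>y\<in>D. z - y))"
  using assms
proof (induction D)
  case empty
  then show ?case by auto
next
  case (insert y D)
  then obtain E where E: "E holomorphic_on UNIV" "\<And>z. B z = E z * (\<Prod>y\<in>D. z - y)" by auto
  have "(\<Prod>u\<in>D. y - u) \<noteq> 0" using insert.hyps by auto
  then have "E y = 0" using E(2)[of y] insert.prems(2)[of y] by simp
  then obtain E' where E': "E' holomorphic_on UNIV" "\<And>z. E z = (z - y) * E' z"
    using entire_divide_zero[OF E(1)] by metis
  then show ?case using E insert.hyps by (intro exI[of _ E']) (auto simp: mult_ac)
qed

text \<open>If \<open>b * f\<close> changes sign at \<open>y\<close> while \<open>b\<close> does not, then \<open>f\<close> changes sign, and \<open>g\<close>, having the same signs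
  as \<open>f\<close>, must vanish by continuity.\<close>

lemma common_zero_at_sign_change:
  fixes b Q f g :: "real \<Rightarrow> real"
  assumes cont: "isCont b y" "isCont Q y" "isCont g y"
    and eq: "\<And>x. b x * f x = (x - y) ^ n * Q x" and odd: "odd n"
    and nz: "b y \<noteq> 0" "Q y \<noteq> 0" and fg: "\<And>x. 0 \<le> f x * g x"
  shows "f y = 0" "g y = 0"
proof -
  have "n \<noteq> 0" using odd by (rule odd_pos[THEN gr_implies_not0])
  then have "b y * f y = 0" using eq[of y] by (simp add: power_0_left)
  then show "f y = 0" using nz by simp
  define \<kappa> where "\<kappa> = Q y * b y"
  have \<kappa>: "\<kappa> \<noteq> 0" using nz by (simp add: \<kappa>_def)
  have near: "\<forall>\<^sub>F x in at y. 0 < b x * b y \<and> 0 < Q x * Q y"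
  proof -
    have "(\<lambda>x. b x * b y) \<midarrow>y\<rightarrow> b y * b y" "(\<lambda>x. Q x * Q y) \<midarrow>y\<rightarrow> Q y * Q y"
      using cont by (auto simp: isCont_def intro!: tendsto_intros)
    moreover have "0 < b y * b y" "0 < Q y * Q y" using nz by (auto simp: zero_less_mult_iff linorder_neq_iff)
    ultimately have "\<forall>\<^sub>F x in at y. 0 < b x * b y" "\<forall>\<^sub>F x in at y. 0 < Q x * Q y"
      by (auto intro: order_tendstoD)
    then show ?thesis by eventually_elim simp
  qed
  have sgn: "0 \<le> (x - y) ^ n * (g x * \<kappa>)" if "0 < b x * b y" "0 < Q x * Q y" for x
  proof -
    have bx: "b x \<noteq> 0" using that by auto
    have "(b x)\<^sup>2 * (f x * g x) * (b x * b y) * (Q x * Q y) \<ge> 0"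
      by (rule mult_nonneg_nonneg[OF mult_nonneg_nonneg[OF mult_nonneg_nonneg[OF
        zero_le_power2[of "b x"] fg[of x]] less_imp_le[OF that(1)]] less_imp_le[OF that(2)]])
    also have "(b x)\<^sup>2 * (f x * g x) * (b x * b y) * (Q x * Q y)
        = (b x)\<^sup>2 * ((b x * f x) * (g x * \<kappa>) * Q x)"
      by (simp add: \<kappa>_def power2_eq_square mult_ac)
    also have "\<dots> = (b x)\<^sup>2 * (Q x)\<^sup>2 * ((x - y) ^ n * (g x * \<kappa>))"
      unfolding eq by (simp add: power2_eq_square mult_ac)
    finally have nonneg: "0 \<le> (b x)\<^sup>2 * (Q x)\<^sup>2 * ((x - y) ^ n * (g x * \<kappa>))" .
    have "Q x \<noteq> 0" using that by auto
    then have pos: "0 < (b x)\<^sup>2 * (Q x)\<^sup>2" using bx by simp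
    show ?thesis
      using mult_pos_neg[OF pos, of "(x - y) ^ n * (g x * \<kappa>)"] nonneg by linarith
  qed
  have at_left_less: "\<forall>\<^sub>F x in at_left y. x < y" by (simp add: eventually_at_filter)
  have lim: "((\<lambda>x. g x * \<kappa>) \<longlongrightarrow> g y * \<kappa>) (at y)"
    using cont by (auto simp: isCont_def intro!: tendsto_intros)
  have "0 \<le> g y * \<kappa>"
  proof (rule tendsto_lowerbound[OF tendsto_mono[OF at_le lim]])
    have "\<forall>\<^sub>F x in at_right y. 0 < b x * b y \<and> 0 < Q x * Q y"
      by (rule filter_leD[OF at_le near]) simp
    then show "\<forall>\<^sub>F x in at_right y. 0 \<le> g x * \<kappa>"
      using eventually_at_right_less[of y]
    proof eventually_elim
      case (elim x)
      then have "0 \<le> (x - y) ^ n * (g x * \<kappa>)" "0 < (x - y) ^ n" using sgn[of x] by auto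
      then show ?case by (simp add: zero_le_mult_iff)
    qed
  qed auto
  moreover have "g y * \<kappa> \<le> 0"
  proof (rule tendsto_upperbound[OF tendsto_mono[OF at_le lim]])
    have "\<forall>\<^sub>F x in at_left y. 0 < b x * b y \<and> 0 < Q x * Q y"
      by (rule filter_leD[OF at_le near]) simp
    then show "\<forall>\<^sub>F x in at_left y. g x * \<kappa> \<le> 0"
      using at_left_less
    proof eventually_elim
      case (elim x)
      then have "0 \<le> (x - y) ^ n * (g x * \<kappa>)" "(x - y) ^ n < 0"
        using sgn[of x] odd by (auto simp: power_less_zero_eq)
      then show ?case by (simp add: zero_le_mult_iff)
    qed
  qed auto
  ultimately have "g y * \<kappa> = 0" by linarith
  then show "g y = 0" using \<kappa> by simp
qed

section \<open>Fast oscillation of functions with a spectral gap\<close>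

text \<open>The spectrum of \<open>X * k * p\<close> lies on the positive side, so that its integral vanishes. If the signs of \<open>X\<close> and of
  \<open>Re p\<close> match on \<open>[-R, R]\<close>, then the integral over the interval has no cancellation, and it is
  as small as the integral over the complement.\<close>

lemma matched_sign_mass:
  assumes p: "p holomorphic_on UNIV" and Cp: "Cp \<ge> 0"
    and bp: "\<And>z. 0 \<le> Im z \<Longrightarrow> cmod (p z) \<le> Cp * exp (- \<rho> * Im z)"
    and X: "X holomorphic_on UNIV" "star X = X" and K: "K \<ge> 0"
    and bX: "\<And>z. cmod (X z) \<le> K * exp (a * \<bar>Im z\<bar>) * (1 + cmod z)\<^sup>2"
    and e: "e > 0" "a + 4 * e \<le> \<rho>" and c: "\<bar>c\<bar> = 1"
    and sign: "AE x in lborel. x \<in> {-R..R} \<longrightarrow> 0 \<le> c * (Re (X (of_real x)) * Re (p (of_real x)))"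
  defines "k \<equiv> \<lambda>z. csinc (of_real e * z) ^ 4"
  defines "C4 \<equiv> 16 * K * Cp * (1 + 1 / e)\<^sup>2 * (1 + 1 / e\<^sup>2)"
  shows "(LINT x|lborel. indicator {-R..R} x * \<bar>Re (X (of_real x)) * Re (k (of_real x)) * Re (p (of_real x))\<bar>)
      \<le> (LINT x|lborel. indicator (- {-R..R}) x * (C4 / (1 + x\<^sup>2)))"
    and "integrable lborel (\<lambda>x. Re (X (of_real x)) * Re (k (of_real x)) * Re (p (of_real x)))"
proof -
  have kh: "k holomorphic_on UNIV" unfolding k_def by (rule holomorphic_csinc_power)
  have bd: "cmod (X z * k z * p z) \<le> C4 / (1 + (cmod z)\<^sup>2)" if z: "0 \<le> Im z" for z
  proof -
    define r where "r = cmod z"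
    have r: "r \<ge> 0" by (simp add: r_def)
    have er: "1 + e * r > 0" using e r by (simp add: add_pos_nonneg)
    have kb: "cmod (k z) \<le> 16 * exp (4 * e * Im z) / (1 + e * r) ^ 4"
      using cmod_csinc_power_le[OF e(1), of z 4] z by (simp add: k_def r_def)
    have "cmod (X z * k z * p z) \<le> (K * exp (a * Im z) * (1 + r)\<^sup>2) *
        (16 * exp (4 * e * Im z) / (1 + e * r) ^ 4) * (Cp * exp (- \<rho> * Im z))"
      unfolding norm_mult using bX[of z] kb bp[OF z] z K Cp er
      by (intro mult_mono) (auto simp: r_def intro!: mult_nonneg_nonneg divide_nonneg_nonneg)
    also have "\<dots> = 16 * K * Cp * exp ((a + 4 * e - \<rho>) * Im z) * ((1 + r)\<^sup>2 / (1 + e * r) ^ 4)"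
      by (simp add: exp_add exp_diff exp_minus algebra_simps divide_simps)
    also have "\<dots> \<le> 16 * K * Cp * 1 * ((1 + 1 / e)\<^sup>2 * ((1 + 1 / e\<^sup>2) / (1 + r\<^sup>2)))"
    proof (intro mult_mono)
      have "(a + 4 * e - \<rho>) * Im z \<le> 0" using e z by (intro mult_nonpos_nonneg) auto
      then show "exp ((a + 4 * e - \<rho>) * Im z) \<le> 1" by simp
      have "1 + r \<le> (1 + 1 / e) * (1 + e * r)" using e r by (simp add: field_simps)
      then have "(1 + r)\<^sup>2 \<le> ((1 + 1 / e) * (1 + e * r))\<^sup>2" using r by (intro power_mono) auto
      then have "(1 + r)\<^sup>2 / (1 + e * r) ^ 4 \<le> ((1 + 1 / e)\<^sup>2 * (1 + e * r)\<^sup>2) / (1 + e * r) ^ 4"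
        using er by (intro divide_right_mono) (auto simp: power_mult_distrib)
      also have "\<dots> = (1 + 1 / e)\<^sup>2 * (1 / (1 + e * r)\<^sup>2)"
        using er by (simp add: power4_eq_xxxx power2_eq_square)
      also have "\<dots> \<le> (1 + 1 / e)\<^sup>2 * ((1 + 1 / e\<^sup>2) / (1 + r\<^sup>2))"
        by (intro mult_left_mono one_plus_square_le e r) auto
      finally show "(1 + r)\<^sup>2 / (1 + e * r) ^ 4 \<le> (1 + 1 / e)\<^sup>2 * ((1 + 1 / e\<^sup>2) / (1 + r\<^sup>2))" .
    qed (use K Cp er in auto)
    also have "\<dots> = C4 / (1 + (cmod z)\<^sup>2)" by (simp add: C4_def r_def)
    finally show ?thesis .
  qed
  have hol: "(\<lambda>z. X z * k z * p z) holomorphic_on UNIV" by (intro holomorphic_intros X kh p)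
  note I = integral_upper_half_plane_zero[OF hol bd]
  define u where "u x = Re (X (of_real x)) * Re (k (of_real x)) * Re (p (of_real x))" for x :: real
  have kr: "k (of_real x) = of_real (Re (k (of_real x)))" "0 \<le> Re (k (of_real x))" for x
  proof -
    define t where "t = (if e * x = 0 then 1 else sin (e * x) / (e * x))"
    have "k (of_real x) = of_real (t ^ 4)"
      unfolding k_def of_real_mult[symmetric] csinc_of_real t_def by simp
    then show "k (of_real x) = of_real (Re (k (of_real x)))" "0 \<le> Re (k (of_real x))"
      by (simp_all only: Re_complex_of_real) (simp add: zero_le_even_power)
  qed
  have Xr: "X (of_real x) = of_real (Re (X (of_real x)))" for x
    using star_real[OF X(2), of x] by (simp add: of_real_Re)
  have u_eq: "u x = Re (X (of_real x) * k (of_real x) * p (of_real x))" for x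
    unfolding u_def by (subst (2) Xr, subst (2) kr) simp
  have int: "integrable lborel u" unfolding u_eq using I(1) by (rule integrable_Re)
  then show "integrable lborel (\<lambda>x. Re (X (of_real x)) * Re (k (of_real x)) * Re (p (of_real x)))"
    unfolding u_def .
  have zero: "(LINT x|lborel. u x) = 0"
    unfolding u_eq by (simp only: integral_Re[OF I(1)] I(2) zero_complex.sel)
  have [measurable]: "u \<in> borel_measurable borel" using int by auto
  have intI: "integrable lborel (\<lambda>x. indicator S x * f x)"
    if "integrable lborel f" "S \<in> sets borel" for S and f :: "real \<Rightarrow> real"
    using integrable_mult_indicator[OF _ that(1), of S] that(2) by simp
  have ub: "\<bar>u x\<bar> \<le> C4 / (1 + x\<^sup>2)" for x
    using bd[of "of_real x"] abs_Re_le_cmod[of "X (of_real x) * k (of_real x) * p (of_real x)"]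
    by (simp add: u_eq)
  have "(LINT x|lborel. indicator {-R..R} x * \<bar>u x\<bar>) = (LINT x|lborel. c * (indicator {-R..R} x * u x))"
  proof (rule integral_cong_AE)
    show "AE x in lborel. indicator {-R..R} x * \<bar>u x\<bar> = c * (indicator {-R..R} x * u x)"
      using sign
    proof eventually_elim
      case (elim x)
      show ?case
      proof (cases "x \<in> {-R..R}")
        case True
        have "0 \<le> Re (k (of_real x)) * (c * (Re (X (of_real x)) * Re (p (of_real x))))"
          by (rule mult_nonneg_nonneg[OF kr(2)]) (use elim True in auto)
        then have "0 \<le> c * u x" by (simp add: u_def mult_ac)
        then have "c * u x = \<bar>c * u x\<bar>" by simp
        also have "\<dots> = \<bar>u x\<bar>" using c by (simp add: abs_mult)
        finally show ?thesis using True by simp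
      qed simp
    qed
  qed (auto intro!: borel_measurable_times borel_measurable_abs)
  also have "\<dots> = c * (LINT x|lborel. indicator {-R..R} x * u x)" by simp
  also have "(LINT x|lborel. indicator {-R..R} x * u x) = (LINT x|lborel. u x - indicator (- {-R..R}) x * u x)"
    by (rule Bochner_Integration.integral_cong) (auto simp: indicator_def)
  also have "\<dots> = - (LINT x|lborel. indicator (- {-R..R}) x * u x)"
    using zero by (subst Bochner_Integration.integral_diff) (auto intro!: int intI)
  also have "c * - (LINT x|lborel. indicator (- {-R..R}) x * u x)
      \<le> \<bar>LINT x|lborel. indicator (- {-R..R}) x * u x\<bar>"
  proof -
    have "c * - J \<le> \<bar>J\<bar>" for J :: real
      using abs_ge_self[of "c * - J"] c by (simp add: abs_mult)
    then show ?thesis .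
  qed
  also have "\<dots> \<le> (LINT x|lborel. indicator (- {-R..R}) x * (C4 / (1 + x\<^sup>2)))"
  proof -
    have "norm (LINT x|lborel. indicator (- {-R..R}) x * u x)
      \<le> (LINT x|lborel. indicator (- {-R..R}) x * (C4 / (1 + x\<^sup>2)))"
    proof (rule Bochner_Integration.integral_norm_bound_integral)
      show "norm (indicator (- {-R..R}) x * u x) \<le> indicator (- {-R..R}) x * (C4 / (1 + x\<^sup>2))" for x
        using ub[of x] by (auto simp: indicator_def)
      show "integrable lborel (\<lambda>x. indicator (- {-R..R}) x * u x)" by (intro intI int) simp
      show "integrable lborel (\<lambda>x. indicator (- {-R..R}) x * (C4 / (1 + x\<^sup>2)))"
        by (intro intI integrable_inverse_quadratic) simp
    qed
    then show ?thesis by simp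
  qed
  finally show "(LINT x|lborel. indicator {-R..R} x * \<bar>Re (X (of_real x)) * Re (k (of_real x)) * Re (p (of_real x))\<bar>)
      \<le> (LINT x|lborel. indicator (- {-R..R}) x * (C4 / (1 + x\<^sup>2)))"
    unfolding u_def .
qed

lemma of_real_islimpt:
  assumes "a < c" "c < b"
  shows "complex_of_real c islimpt of_real ` {a..b}"
proof -
  have "c islimpt {a<..<b}" by (rule open_imp_islimpt) (use assms in auto)
  then have "complex_of_real c islimpt complex_of_real ` {a<..<b}"
    by (intro islimpt_isCont_image) (simp_all add: eventually_at_filter)
  then show ?thesis by (rule islimpt_subset) auto
qed

lemma entire_two_nonzero:
  assumes "p holomorphic_on UNIV" "q holomorphic_on UNIV" "p w \<noteq> 0" "q v \<noteq> 0"
  shows "\<exists>z. p z * q z \<noteq> 0"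
  using entire_mult_eq_0[OF assms(1,2) _ assms(3), of v] assms(4) by blast

lemma tail_integral_tendsto_0:
  "(\<lambda>n. LINT x|lborel. indicator (- {-real n..real n}) x * (C / (1 + x\<^sup>2))) \<longlonglongrightarrow> 0"
proof -
  have "(\<lambda>n. LINT x|lborel. indicator (- {-real n..real n}) x * (C / (1 + x\<^sup>2))) \<longlonglongrightarrow> (LINT x::real|lborel. 0)"
  proof (rule integral_dominated_convergence[where w = "\<lambda>x. \<bar>C\<bar> / (1 + x\<^sup>2)"])
    show "AE x in lborel. (\<lambda>n. indicator (- {-real n..real n}) x * (C / (1 + x\<^sup>2))) \<longlonglongrightarrow> 0"
    proof (rule AE_I2)
      fix x :: real
      obtain N :: nat where N: "\<bar>x\<bar> \<le> real N" using real_arch_simple by blast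
      have "eventually (\<lambda>n. indicator (- {-real n..real n}) x * (C / (1 + x\<^sup>2)) = 0) sequentially"
        using eventually_ge_at_top[of N] by eventually_elim (use N in \<open>auto simp: indicator_def\<close>)
      then show "(\<lambda>n. indicator (- {-real n..real n}) x * (C / (1 + x\<^sup>2))) \<longlonglongrightarrow> 0"
        by (rule tendsto_eventually)
    qed
    show "AE x in lborel. norm (indicator (- {-real n..real n}) x * (C / (1 + x\<^sup>2))) \<le> \<bar>C\<bar> / (1 + x\<^sup>2)" for n
      by (rule AE_I2) (auto simp: indicator_def abs_mult)
  qed (auto intro: integrable_inverse_quadratic)
  then show ?thesis by simp
qed

text \<open>Such a function is bounded in both half-planes, hence constant, and it decays along the imaginary axis.\<close>

lemma decaying_antisymmetric_eq_0:
  assumes p: "p holomorphic_on UNIV" "decays \<rho> p" and \<rho>: "0 < \<rho>"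
    and ps: "\<And>z. p z = - star p z"
  shows "p = (\<lambda>_. 0)"
proof -
  obtain C where C: "C \<ge> 0" "\<And>z. 0 \<le> Im z \<Longrightarrow> cmod (p z) \<le> C * exp (- \<rho> * Im z)"
    using p(2) by (elim decaysE) auto
  have bd: "cmod (p z) \<le> C * exp (- \<rho> * \<bar>Im z\<bar>)" for z
  proof (cases "0 \<le> Im z")
    case False
    have "cmod (p z) = cmod (p (cnj z))" using ps[of z] by (simp add: star_def)
    then show ?thesis using C(2)[of "cnj z"] False by simp
  qed (use C in auto)
  have "cmod (p z) \<le> C" for z
  proof -
    have "C * exp (- \<rho> * \<bar>Im z\<bar>) \<le> C * 1" using C(1) \<rho> by (intro mult_left_mono) auto
    with bd[of z] show ?thesis by simp
  qed
  then have "bounded (range p)" by (auto simp: bounded_iff)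
  then have "p constant_on UNIV" using p(1) Liouville_theorem by blast
  then obtain c where c: "\<And>z. p z = c" by (auto simp: constant_on_def)
  have "(\<lambda>n. C * exp (- \<rho> * real n)) \<longlonglongrightarrow> C * 0"
    using \<rho> by (intro tendsto_mult_left) real_asymp
  moreover have "cmod c \<le> C * exp (- \<rho> * real n)" for n
    using bd[of "\<i> * of_nat n"] c by simp
  ultimately have "cmod c \<le> C * 0" by (intro LIMSEQ_le_const) auto
  then show ?thesis using c by auto
qed

text \<open>Suppose that \<open>B = Im (q * cnj p)\<close> does not vanish identically. The sign changes of \<open>B * Re p\<close> in \<open>[-R, R]\<close> are
  zeros of \<open>B\<close>, so some of them may be divided out of \<open>B\<close> and others multiplied in. Doing this alternately
  gives two functions \<open>X\<close> and \<open>Y\<close> with \<open>X * Y = B\<^sup>2\<close>, whose growth is controlled independently of the number of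
  points because their ratios to \<open>B\<close> map the upper half-plane into itself or into the lower one. Now \<open>X * Re p\<close> and \<open>Y * Re p\<close> have a constant
  sign on \<open>[-R, R]\<close>, so both have little mass there, and so does their geometric mean \<open>\<bar>B * Re p\<bar>\<close>. Letting \<open>R\<close>
  tend to infinity yields \<open>B * Re p = 0\<close>.\<close>

lemma same_signs_imp_real_ratio:
  assumes p: "p holomorphic_on UNIV" "decays \<rho> p" "decays (- \<sigma>) (star p)"
    and q: "q holomorphic_on UNIV" "decays \<rho> q" "decays (- \<sigma>) (star q)"
    and gap: "\<rho> \<le> \<sigma>" "\<sigma> < 2 * \<rho>" "0 < \<rho>"
    and signs: "\<And>x::real. 0 \<le> Re (p (of_real x)) * Re (q (of_real x))"
  shows "q z * star p z = star q z * p z"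
proof -
  define B where "B z = (q z * star p z - star q z * p z) / (2 * \<i>)" for z
  define f where "f z = p z + star p z" for z
  \<comment> \<open>\<open>B\<close> has its spectrum in \<open>[-a, a]\<close>, and \<open>a < \<rho>\<close> by the gap condition.\<close>
  define a where "a = \<sigma> - \<rho>"
  have a: "0 \<le> a" "a < \<rho>" using gap by (auto simp: a_def)
  have Bh: "B holomorphic_on UNIV" unfolding B_def
    by (intro holomorphic_intros p q holomorphic_star) auto
  have fh: "f holomorphic_on UNIV" unfolding f_def by (intro holomorphic_intros p holomorphic_star)
  have Bs: "star B = B"
    by (rule ext) (simp add: B_def star_def minus_divide_left[symmetric] field_simps)
  have fs: "star f = f" by (rule ext) (simp add: f_def star_def add.commute)
  have Bx: "B (of_real x) = of_real (Im (q (of_real x) * cnj (p (of_real x))))" for x :: real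
  proof -
    define u where "u = q (of_real x) * cnj (p (of_real x))"
    have "B (of_real x) = (u - cnj u) / (2 * \<i>)" unfolding B_def star_of_real u_def by simp
    then show ?thesis unfolding complex_diff_cnj u_def[symmetric] by (simp add: complex_eq_iff)
  qed
  have fx: "f (of_real x) = of_real (2 * Re (p (of_real x)))" for x :: real
    unfolding f_def star_of_real by (simp add: complex_eq_iff)
  have "decays (- a) (\<lambda>z. q z * star p z)"
    using decays_mult[OF q(2) p(3)] by (simp add: a_def)
  moreover have "decays (- a) (\<lambda>z. star q z * p z)"
    using decays_mult[OF q(3) p(2)] by (simp add: a_def)
  ultimately have "decays (- a) (\<lambda>z. q z * star p z + (-1) * (star q z * p z))"
    by (intro decays_add decays_cmult)
  then have "decays (- a) (\<lambda>z. 1 / (2 * \<i>) * (q z * star p z + (-1) * (star q z * p z)))"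
    by (rule decays_cmult)
  then have "decays (- a) B" by (simp add: B_def [abs_def] diff_divide_distrib[symmetric])
  then obtain CB where CB: "CB \<ge> 0" "\<And>z. 0 \<le> Im z \<Longrightarrow> cmod (B z) \<le> CB * exp (a * Im z)"
    by (elim decaysE) auto
  have Bb: "cmod (B z) \<le> CB * exp (a * \<bar>Im z\<bar>)" for z
  proof (cases "0 \<le> Im z")
    case False
    have "cmod (B z) = cmod (B (cnj z))" by (metis Bs complex_mod_cnj star_def)
    then show ?thesis using CB(2)[of "cnj z"] False by simp
  qed (use CB in auto)
  have "B z = 0" for z
  proof (rule ccontr)
    assume Bz: "B z \<noteq> 0"
    obtain Cp where Cp: "Cp \<ge> 0" "\<And>z. 0 \<le> Im z \<Longrightarrow> cmod (p z) \<le> Cp * exp (- \<rho> * Im z)"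
      using p(2) by (elim decaysE) auto
    have "\<exists>w. f w \<noteq> 0"
    proof (rule ccontr)
      assume "\<not> ?thesis"
      then have ps: "p z = - star p z" for z by (simp add: f_def add_eq_0_iff2)
      have "p = (\<lambda>_. 0)" using decaying_antisymmetric_eq_0[OF p(1,2) gap(3)] ps by blast
      then show False using Bz by (simp add: B_def star_def)
    qed
    then obtain w where w: "B w * f w \<noteq> 0"
      using entire_two_nonzero[OF Bh fh Bz] by blast
    define s where "s = (\<lambda>z. B z * f z)"
    have sh: "s holomorphic_on UNIV" unfolding s_def by (intro holomorphic_intros Bh fh)
    have ss: "star s = s" unfolding s_def star_mult Bs fs ..
    \<comment> \<open>The convergence factor \<open>k\<close> widens the spectrum by \<open>4 * e\<close>, which still fits into the gap.\<close>
    define e where "e = (\<rho> - a) / 4"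
    have "4 * e = \<rho> - a" by (simp add: e_def)
    then have e: "e > 0" "a + 4 * e \<le> \<rho>" using a by linarith+
    define k where "k z = csinc (of_real e * z) ^ 4" for z
    have kh: "k holomorphic_on UNIV" unfolding k_def by (rule holomorphic_csinc_power)
    define K where "K = 8 * exp a * CB"
    have K: "K \<ge> 0" using CB by (simp add: K_def)
    define C4 where "C4 = 16 * K * Cp * (1 + 1 / e)\<^sup>2 * (1 + 1 / e\<^sup>2)"
    define \<tau> where "\<tau> R = (LINT x|lborel. indicator (- {-R..R}) x * (C4 / (1 + x\<^sup>2)))" for R
    define sk where "sk x = Re (s (of_real x)) * Re (k (of_real x))" for x :: real
    have skc: "continuous_on A sk" for A
      unfolding sk_def by (intro continuous_intros entire_real_continuous sh kh)
    have main: "(LINT x|lborel. indicator {0..1} x * \<bar>sk x\<bar>) \<le> 2 * \<tau> R" if R: "R \<ge> 1" for R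
    proof -
      obtain A c where A: "finite A" "\<bar>c\<bar> = 1"
        "\<And>x. x \<in> {-R..R} \<Longrightarrow> 0 \<le> c * Re (s (of_real x)) * (\<Prod>y\<in>A. x - y)"
        "\<And>y. y \<in> A \<Longrightarrow> \<exists>n Q. odd n \<and> Q holomorphic_on UNIV \<and> Q (of_real y) \<noteq> 0 \<and>
        (\<forall>z. s z = (z - of_real y) ^ n * Q z)"
        using real_entire_sign_changes[OF sh _ ss, of w R] w by (auto simp: s_def)
      \<comment> \<open>A zero of odd order of \<open>s\<close> at which \<open>B\<close> does not vanish is a sign change of \<open>Re p\<close>; then \<open>Re p\<close> and \<open>Re q\<close>
        both vanish there, and with them \<open>B\<close>.\<close>
      have BA: "B (of_real y) = 0" if y: "y \<in> A" for y
      proof (rule ccontr)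
        assume By: "B (of_real y) \<noteq> 0"
        obtain n Q where nQ: "odd n" "Q holomorphic_on UNIV" "Q (of_real y) \<noteq> 0"
          "\<And>z. s z = (z - of_real y) ^ n * Q z" using A(4)[OF y] by blast
        have Qs: "star Q = Q"
        proof (rule entire_real_imp_star[OF nQ(2)])
          fix x assume x: "x \<noteq> y"
          have "Q (of_real x) = s (of_real x) / of_real ((x - y) ^ n)"
            using x nQ(4)[of "of_real x"] by simp
          then show "Q (of_real x) \<in> \<real>" using star_real[OF ss] by (metis Reals_divide Reals_of_real)
        qed
        define b where "b x = Im (q (of_real x) * cnj (p (of_real x)))" for x :: real
        define Q' where "Q' x = Re (Q (of_real x))" for x :: real
        have Qr: "Q (of_real x) = of_real (Q' x)" for x
          using star_real[OF Qs, of x] by (simp add: of_real_Re Q'_def)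
        have cc: "isCont h y" if "continuous_on UNIV h" for h :: "real \<Rightarrow> real"
          using that by (simp add: continuous_on_eq_continuous_at)
        have c1: "isCont b y"
          unfolding b_def by (intro cc continuous_intros entire_real_continuous p q)
        have c2: "isCont Q' y" unfolding Q'_def by (intro cc continuous_intros entire_real_continuous nQ)
        have c3: "isCont (\<lambda>x. Re (q (complex_of_real x))) y"
          by (intro cc continuous_intros entire_real_continuous q)
        have eq: "b x * (2 * Re (p (complex_of_real x))) = (x - y) ^ n * Q' x" for x
        proof -
          have "complex_of_real (b x * (2 * Re (p (complex_of_real x)))) = s (of_real x)"
            by (simp add: s_def Bx fx b_def)
          also have "\<dots> = of_real ((x - y) ^ n * Q' x)" by (simp add: nQ(4) Qr)
          finally show ?thesis by (simp only: of_real_eq_iff)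
        qed
        have b0: "b y \<noteq> 0"
        proof
          assume "b y = 0"
          then have "B (of_real y) = 0" unfolding Bx b_def by (simp only: of_real_0)
          then show False using By by contradiction
        qed
        have Q0: "Q' y \<noteq> 0" using nQ(3) Qr by auto
        have fg: "0 \<le> 2 * Re (p (complex_of_real x)) * Re (q (complex_of_real x))" for x
          using signs[of x] by simp
        have "2 * Re (p (of_real y)) = 0" "Re (q (of_real y)) = 0"
          using common_zero_at_sign_change[OF c1 c2 c3 eq nQ(1) b0 Q0 fg] by auto
        then have "Im (q (of_real y) * cnj (p (of_real y))) = 0" by simp
        then have "B (of_real y) = 0" unfolding Bx by (simp only: of_real_0)
        then show False using By by contradiction
      qed
      obtain N D where ND: "N \<union> D = A" "N \<inter> D = {}"
        "(\<forall>z. Im z > 0 \<longrightarrow> 0 \<le> Im ((\<Prod>y\<in>N. z - of_real y) / (\<Prod>y\<in>D. z - of_real y))) \<or>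
         (\<forall>z. Im z > 0 \<longrightarrow> Im ((\<Prod>y\<in>N. z - of_real y) / (\<Prod>y\<in>D. z - of_real y)) \<le> 0)"
        using alternating_product[OF A(1)] by metis
      have fin: "finite N" "finite D" using ND(1) A(1) by (metis finite_Un)+
      define PN where "PN z = (\<Prod>y\<in>N. z - complex_of_real y)" for z
      define PD where "PD z = (\<Prod>y\<in>D. z - complex_of_real y)" for z
      have ph: "PN holomorphic_on U" "PD holomorphic_on U" for U
        unfolding PN_def PD_def by (intro holomorphic_intros)+
      have pnz: "PN z \<noteq> 0" "PD z \<noteq> 0" if "Im z \<noteq> 0" for z
        using that fin by (auto simp: PN_def PD_def)
      have pst: "star PN = PN" "star PD = PD"
        by (rule ext, simp add: star_def PN_def PD_def)+
      define m where "m z = PN z / PD z" for z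
      have mh: "m holomorphic_on {z. Im z > 0}" unfolding m_def
        by (intro holomorphic_intros ph) (use pnz in force)
      have msign: "(\<forall>z. Im z > 0 \<longrightarrow> 0 \<le> Im (m z)) \<or> (\<forall>z. Im z > 0 \<longrightarrow> Im (m z) \<le> 0)"
        using ND(3) unfolding m_def PN_def PD_def .
      \<comment> \<open>Normalizing \<open>m\<close> at \<open>\<i>\<close> makes the bounds on \<open>X\<close> and \<open>Y\<close> independent of \<open>R\<close>.\<close>
      define \<mu> where "\<mu> = cmod (m \<i>)"
      have \<mu>: "\<mu> > 0" using pnz[of \<i>] by (simp add: \<mu>_def m_def)
      have herg: "cmod (h z) \<le> cmod (h \<i>) * ((1 + cmod z)\<^sup>2 / Im z)"
        if h: "h holomorphic_on {z. Im z > 0}"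
          "(\<forall>z. Im z > 0 \<longrightarrow> 0 \<le> Im (h z)) \<or> (\<forall>z. Im z > 0 \<longrightarrow> Im (h z) \<le> 0)" and z: "Im z > 0" for h z
      proof -
        have "cmod (h z) \<le> cmod (h \<i>) * ((cmod (z - cnj \<i>))\<^sup>2 / (Im z * Im \<i>))"
          using h(2)
        proof
          assume "\<forall>z. Im z > 0 \<longrightarrow> 0 \<le> Im (h z)"
          then show ?thesis using h(1) z by (intro Herglotz_growth) auto
        next
          assume "\<forall>z. Im z > 0 \<longrightarrow> Im (h z) \<le> 0"
          then have "cmod (- h z) \<le> cmod (- h \<i>) * ((cmod (z - cnj \<i>))\<^sup>2 / (Im z * Im \<i>))"
            using h(1) z by (intro Herglotz_growth[of "\<lambda>z. - h z"] holomorphic_intros) auto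
          then show ?thesis by simp
        qed
        also have "\<dots> \<le> cmod (h \<i>) * ((1 + cmod z)\<^sup>2 / Im z)"
        proof -
          have "cmod (z - cnj \<i>) \<le> 1 + cmod z" using norm_triangle_ineq[of z \<i>] by simp
          then have "(cmod (z - cnj \<i>))\<^sup>2 \<le> (1 + cmod z)\<^sup>2" by (intro power_mono) auto
          then show ?thesis using z by (intro mult_left_mono) (auto intro: divide_right_mono)
        qed
        finally show ?thesis .
      qed
      have mb: "cmod (m z) \<le> \<mu> * ((1 + cmod z)\<^sup>2 / Im z)" if "Im z > 0" for z
        using herg[OF mh msign that] by (simp add: \<mu>_def)
      have mib: "cmod (inverse (m z)) \<le> inverse \<mu> * ((1 + cmod z)\<^sup>2 / Im z)" if z: "Im z > 0" for z
      proof -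
        have nz: "m z \<noteq> 0" if "Im z > 0" for z using pnz[of z] that by (simp add: m_def)
        have im: "Im (inverse u) = - Im u / (cmod u)\<^sup>2" for u :: complex
          by (simp add: cmod_power2)
        have ih: "(\<lambda>z. inverse (m z)) holomorphic_on {z. Im z > 0}"
          by (intro holomorphic_intros mh) (use nz in auto)
        have "(\<forall>z. Im z > 0 \<longrightarrow> 0 \<le> Im (inverse (m z))) \<or> (\<forall>z. Im z > 0 \<longrightarrow> Im (inverse (m z)) \<le> 0)"
          using msign unfolding im by (auto simp: divide_nonneg_nonneg divide_nonpos_nonneg)
        from herg[OF ih this z] show ?thesis by (simp add: \<mu>_def norm_inverse)
      qed
      \<comment> \<open>The argument is the same for \<open>X\<close> and for \<open>Y\<close>, with numerator and denominator exchanged.\<close>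
      have mass: "(LINT x|lborel. indicator {-R..R} x * \<bar>Re (X (of_real x)) * Re (k (of_real x)) * Re (p (of_real x))\<bar>) \<le> \<tau> R
          \<and> integrable lborel (\<lambda>x. Re (X (of_real x)) * Re (k (of_real x)) * Re (p (of_real x)))"
        if X: "X holomorphic_on UNIV" "\<And>z. X z * Den z = of_real \<nu> * B z * Num z"
          and ND': "\<And>z. Den z * Num z = (\<Prod>y\<in>A. z - of_real y)" "star Num = Num" "star Den = Den"
          and dz: "\<And>z. Im z \<noteq> 0 \<Longrightarrow> Den z \<noteq> 0" and \<nu>: "\<nu> > 0"
          and bd: "\<And>z. Im z > 0 \<Longrightarrow> \<nu> * cmod (Num z / Den z) \<le> (1 + cmod z)\<^sup>2 / Im z" for X Num Den \<nu>
      proof -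
        have Xz: "X z = of_real \<nu> * B z * (Num z / Den z)" if "Im z \<noteq> 0" for z
          using X(2)[of z] dz[OF that] by (simp add: field_simps)
        have NDst: "cmod (Num (cnj z) / Den (cnj z)) = cmod (Num z / Den z)" for z
          using arg_cong[OF ND'(2), of "\<lambda>f. cmod (f z)"] arg_cong[OF ND'(3), of "\<lambda>f. cmod (f z)"]
          by (simp add: star_def norm_divide)
        have bd2: "\<nu> * cmod (Num z / Den z) \<le> (1 + cmod z)\<^sup>2 / \<bar>Im z\<bar>" if "Im z \<noteq> 0" for z
          using bd[of z] bd[of "cnj z"] that NDst[of z] by (cases "Im z > 0") auto
        have Xb: "cmod (X z) \<le> CB * exp (a * \<bar>Im z\<bar>) * (1 + cmod z)\<^sup>2 / \<bar>Im z\<bar>" if "Im z \<noteq> 0" for z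
        proof -
          have "cmod (X z) = cmod (B z) * (\<nu> * cmod (Num z / Den z))"
            unfolding Xz[OF that] norm_mult using \<nu> by simp
          also have "\<dots> \<le> CB * exp (a * \<bar>Im z\<bar>) * ((1 + cmod z)\<^sup>2 / \<bar>Im z\<bar>)"
            using Bb[of z] bd2[OF that] CB(1) \<nu> by (intro mult_mono) auto
          finally show ?thesis by simp
        qed
        have Xb2: "cmod (X z) \<le> K * exp (a * \<bar>Im z\<bar>) * (1 + cmod z)\<^sup>2" for z
          unfolding K_def by (rule bound_near_real_axis[OF X(1) CB(1) a(1) Xb])
        have Ax: "(\<Prod>y\<in>A. complex_of_real x - of_real y) = of_real (\<Prod>y\<in>A. x - y)" for x by simp
        have Dx: "Den (of_real x) \<noteq> 0" if "x \<notin> A" for x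
        proof
          assume "Den (of_real x) = 0"
          then have "(\<Prod>y\<in>A. x - y) = 0" using ND'(1)[of "of_real x"] Ax[of x]
            by (metis mult_zero_left of_real_eq_0_iff)
          then show False using that A(1) by auto
        qed
        have re: "\<exists>n d. Num (of_real x) = complex_of_real n \<and> Den (of_real x) = complex_of_real d" for x
          using star_real[OF ND'(2), of x] star_real[OF ND'(3), of x] by (meson Reals_cases)
        have Xr: "X (of_real x) = of_real (Re (X (of_real x)))" if "x \<notin> A" for x
        proof -
          obtain n d where nd: "Num (of_real x) = complex_of_real n" "Den (of_real x) = complex_of_real d"
            using re by blast
          have "X (of_real x) = of_real \<nu> * B (of_real x) * of_real n / of_real d"
            using X(2)[of "of_real x"] Dx[OF that] nd by (simp add: field_simps)
          also have "\<dots> \<in> \<real>" unfolding Bx by (intro Reals_mult Reals_divide Reals_of_real)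
          finally show ?thesis by (simp add: of_real_Re)
        qed
        have Xs: "star X = X"
        proof -
          have "star X z * Den z = X z * Den z" for z
          proof -
            have "star X z * star Den z = star (\<lambda>z. X z * Den z) z" by (simp add: star_def)
            also have "(\<lambda>z. X z * Den z) = (\<lambda>z. of_real \<nu> * B z * Num z)" using X(2) by auto
            also have "star (\<lambda>z. of_real \<nu> * B z * Num z) z = of_real \<nu> * star B z * star Num z" by (simp add: star_def)
            finally show ?thesis using X(2) by (simp add: ND' Bs)
          qed
          then have off: "star X z = X z" if "Im z \<noteq> 0" for z
            using dz[OF that] mult_right_cancel by blast
          show ?thesis
          proof
            fix z
            have "star X z - X z = 0"
              by (rule analytic_continuation_open[of "{z. Im z > 0}" UNIV "\<lambda>z. star X z - X z" "\<lambda>_. 0"])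
                (use off convex_upper_half_plane(2) in \<open>auto intro!: holomorphic_intros holomorphic_star X exI[of _ \<i>]\<close>)
            then show "star X z = X z" by simp
          qed
        qed
        have "AE x in lborel. x \<notin> A"
          using A(1) by (intro AE_not_in finite_imp_null_set_lborel)
        then have "AE x in lborel. x \<in> {-R..R} \<longrightarrow> 0 \<le> c * (Re (X (of_real x)) * Re (p (of_real x)))"
        proof eventually_elim
          case (elim x)
          show ?case
          proof
            assume xR: "x \<in> {-R..R}"
            obtain n d where nd: "Num (of_real x) = complex_of_real n" "Den (of_real x) = complex_of_real d"
              using re by blast
            have d0: "d \<noteq> 0" using Dx[OF elim] nd by auto
            have prodA: "(\<Prod>y\<in>A. x - y) = d * n"
              using ND'(1)[of "of_real x"] nd Ax[of x] by (metis of_real_eq_iff of_real_mult)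
            define b where "b = Im (q (of_real x) * cnj (p (of_real x)))"
            have "complex_of_real (Re (X (of_real x)) * d) = complex_of_real (\<nu> * b * n)"
              using X(2)[of "of_real x"] nd Xr[OF elim] by (simp add: Bx b_def)
            then have Xd: "Re (X (of_real x)) * d = \<nu> * b * n" by (simp only: of_real_eq_iff)
            have sx: "Re (s (of_real x)) = b * (2 * Re (p (of_real x)))"
              by (simp add: s_def Bx fx b_def)
            have "0 \<le> \<nu> * (c * Re (s (of_real x)) * (\<Prod>y\<in>A. x - y))"
              by (rule mult_nonneg_nonneg[OF less_imp_le[OF \<nu>] A(3)[OF xR]])
            also have "\<dots> = 2 * d * c * Re (p (of_real x)) * (\<nu> * b * n)"
              unfolding sx prodA by (simp add: mult_ac)
            also have "\<dots> = (2 * d\<^sup>2) * (c * (Re (X (of_real x)) * Re (p (of_real x))))"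
              unfolding Xd[symmetric] by (simp add: power2_eq_square mult_ac)
            finally have nonneg: "0 \<le> (2 * d\<^sup>2) * (c * (Re (X (of_real x)) * Re (p (of_real x))))" .
            have pos: "0 < 2 * d\<^sup>2" using d0 by simp
            show "0 \<le> c * (Re (X (of_real x)) * Re (p (of_real x)))"
              using mult_pos_neg[OF pos, of "c * (Re (X (of_real x)) * Re (p (of_real x)))"] nonneg
              by linarith
          qed
        qed
        from matched_sign_mass[OF p(1) Cp X(1) Xs K Xb2 e A(2) this]
        show ?thesis unfolding k_def \<tau>_def C4_def by auto
      qed
      \<comment> \<open>The points in the denominator are zeros of \<open>B\<close>, so that \<open>X\<close> and \<open>Y\<close> are entire.\<close>
      obtain E1 where E1: "E1 holomorphic_on UNIV" "\<And>z. B z = E1 z * PD z"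
      proof -
        have "\<exists>E. E holomorphic_on UNIV \<and> (\<forall>z. B z = E z * (\<Prod>y\<in>of_real ` D. z - y))"
          using BA ND(1) fin by (intro entire_divide_finite_zeros Bh) auto
        then show ?thesis using that by (auto simp: PD_def prod.reindex inj_on_def o_def)
      qed
      obtain E2 where E2: "E2 holomorphic_on UNIV" "\<And>z. B z = E2 z * PN z"
      proof -
        have "\<exists>E. E holomorphic_on UNIV \<and> (\<forall>z. B z = E z * (\<Prod>y\<in>of_real ` N. z - y))"
          using BA ND(1) fin by (intro entire_divide_finite_zeros Bh) auto
        then show ?thesis using that by (auto simp: PN_def prod.reindex inj_on_def o_def)
      qed
      have PND: "PN z * PD z = (\<Prod>y\<in>A. z - of_real y)" for z
        unfolding PN_def PD_def ND(1)[symmetric] using fin ND(2) by (simp add: prod.union_disjoint)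
      define X where "X z = of_real (inverse \<mu>) * (E1 z * PN z)" for z
      define Y where "Y z = of_real \<mu> * (E2 z * PD z)" for z
      have Xh: "X holomorphic_on UNIV" "Y holomorphic_on UNIV"
        unfolding X_def Y_def by (intro holomorphic_intros E1 E2 ph)+
      have mX: "(LINT x|lborel. indicator {-R..R} x * \<bar>Re (X (of_real x)) * Re (k (of_real x)) * Re (p (of_real x))\<bar>) \<le> \<tau> R
          \<and> integrable lborel (\<lambda>x. Re (X (of_real x)) * Re (k (of_real x)) * Re (p (of_real x)))"
      proof (rule mass[where Num = PN and Den = PD and \<nu> = "inverse \<mu>", OF Xh(1)])
        show "X z * PD z = of_real (inverse \<mu>) * B z * PN z" for z by (simp add: X_def E1(2))
        show "inverse \<mu> * cmod (PN z / PD z) \<le> (1 + cmod z)\<^sup>2 / Im z" if "Im z > 0" for z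
          using mult_left_mono[OF mb[OF that], of "inverse \<mu>"] \<mu>
          by (simp add: m_def mult.assoc[symmetric] del: times_divide_eq_right times_divide_eq_left)
      qed (use PND pst pnz \<mu> in \<open>auto simp: mult.commute\<close>)
      have mY: "(LINT x|lborel. indicator {-R..R} x * \<bar>Re (Y (of_real x)) * Re (k (of_real x)) * Re (p (of_real x))\<bar>) \<le> \<tau> R
          \<and> integrable lborel (\<lambda>x. Re (Y (of_real x)) * Re (k (of_real x)) * Re (p (of_real x)))"
      proof (rule mass[where Num = PD and Den = PN and \<nu> = "\<mu>", OF Xh(2)])
        show "Y z * PN z = of_real \<mu> * B z * PD z" for z by (simp add: Y_def E2(2))
        show "\<mu> * cmod (PD z / PN z) \<le> (1 + cmod z)\<^sup>2 / Im z" if "Im z > 0" for z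
          using mult_left_mono[OF mib[OF that], of "\<mu>"] \<mu>
          by (simp add: m_def mult.assoc[symmetric] del: times_divide_eq_right times_divide_eq_left)
      qed (use PND pst pnz \<mu> in \<open>auto simp: mult.commute\<close>)
      define u where "u x = \<bar>Re (X (of_real x)) * Re (k (of_real x)) * Re (p (of_real x))\<bar>" for x :: real
      define v where "v x = \<bar>Re (Y (of_real x)) * Re (k (of_real x)) * Re (p (of_real x))\<bar>" for x :: real
      have intI: "integrable lborel (\<lambda>x. indicator S x * f x)"
        if "integrable lborel f" "S \<in> sets borel" for S and f :: "real \<Rightarrow> real"
        using integrable_mult_indicator[OF _ that(1), of S] that(2) by simp
      have iu: "integrable lborel u" "integrable lborel v" unfolding u_def v_def using mX mY by auto
      have "AE x in lborel. x \<notin> A"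
        using A(1) by (intro AE_not_in finite_imp_null_set_lborel)
      then have "AE x in lborel. indicator {0..1} x * \<bar>sk x\<bar> \<le> indicator {-R..R} x * u x + indicator {-R..R} x * v x"
      proof eventually_elim
        case (elim x)
        have XY: "X (of_real x) * Y (of_real x) = B (of_real x) * B (of_real x)"
        proof -
          have "X (of_real x) * Y (of_real x) = (E1 (of_real x) * PD (of_real x)) * (E2 (of_real x) * PN (of_real x))"
            using \<mu> by (simp add: X_def Y_def)
          then show ?thesis by (simp only: E1(2)[symmetric] E2(2)[symmetric])
        qed
        have rl: "PN (of_real x) \<in> \<real>" "PD (of_real x) \<in> \<real>" using star_real pst by blast+
        have nz: "PN (of_real x) \<noteq> 0" "PD (of_real x) \<noteq> 0" using PND[of "of_real x"] elim A(1) by auto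
        have "E1 (of_real x) = B (of_real x) / PD (of_real x)"
          unfolding E1(2)[of "of_real x"] using nz by simp
        moreover have "E2 (of_real x) = B (of_real x) / PN (of_real x)"
          unfolding E2(2)[of "of_real x"] using nz by simp
        ultimately have "E1 (of_real x) \<in> \<real>" "E2 (of_real x) \<in> \<real>"
          using rl by (auto simp: Bx intro!: Reals_divide)
        then have rX: "X (of_real x) \<in> \<real>" "Y (of_real x) \<in> \<real>"
          unfolding X_def Y_def using rl by (auto intro!: Reals_mult)
        define b where "b = Im (q (of_real x) * cnj (p (of_real x)))"
        have "of_real (Re (X (of_real x)) * Re (Y (of_real x))) = complex_of_real (b * b)"
          using XY rX by (simp add: of_real_Re Bx b_def)
        then have XYb: "Re (X (of_real x)) * Re (Y (of_real x)) = b * b" by (simp only: of_real_eq_iff)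
        define kp where "kp = Re (k (of_real x)) * Re (p (of_real x))"
        have "sk x = 2 * b * kp" by (simp add: sk_def s_def Bx fx b_def kp_def)
        then have sk2: "(sk x)\<^sup>2 = 4 * (u x * v x)"
        proof -
          have "u x * v x = \<bar>(Re (X (of_real x)) * Re (Y (of_real x))) * (kp * kp)\<bar>"
            by (simp add: u_def v_def kp_def abs_mult)
          also have "\<dots> = b * b * (kp * kp)" unfolding XYb by simp
          finally show ?thesis using \<open>sk x = 2 * b * kp\<close> by (simp add: power2_eq_square)
        qed
        have uv: "u x \<ge> 0" "v x \<ge> 0" by (auto simp: u_def v_def)
        have "4 * (u x * v x) \<le> (u x + v x)\<^sup>2"
          using zero_le_power2[of "u x - v x"] by (simp add: power2_eq_square algebra_simps)
        then have "\<bar>sk x\<bar> \<le> u x + v x"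
          using sk2 uv by (metis abs_le_square_iff abs_of_nonneg add_nonneg_nonneg)
        then show ?case using uv R by (auto simp: indicator_def)
      qed
      then have "(LINT x|lborel. indicator {0..1} x * \<bar>sk x\<bar>)
          \<le> (LINT x|lborel. indicator {-R..R} x * u x + indicator {-R..R} x * v x)"
      proof (rule integral_mono_AE[rotated 2])
        have "set_integrable lborel {0..1} (\<lambda>x. \<bar>sk x\<bar>)"
          by (intro borel_integrable_atLeastAtMost' continuous_intros skc)
        then show "integrable lborel (\<lambda>x. indicator {0..1} x * \<bar>sk x\<bar>)" by (simp add: set_integrable_def)
      qed (intro Bochner_Integration.integrable_add intI iu, auto)
      also have "\<dots> = (LINT x|lborel. indicator {-R..R} x * u x) + (LINT x|lborel. indicator {-R..R} x * v x)"
        by (intro Bochner_Integration.integral_add intI iu) auto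
      also have "\<dots> \<le> 2 * \<tau> R" using mX mY by (simp add: u_def v_def)
      finally show ?thesis .
    qed
    have "(\<lambda>n. 2 * \<tau> (real n)) \<longlonglongrightarrow> 2 * 0"
      unfolding \<tau>_def by (intro tendsto_mult_left tail_integral_tendsto_0)
    then have "(LINT x|lborel. indicator {0..1} x * \<bar>sk x\<bar>) \<le> 2 * 0"
      by (rule LIMSEQ_le_const) (use main in \<open>auto intro!: exI[of _ 1]\<close>)
    moreover have "(LINT x|lborel. indicator {0..1} x * \<bar>sk x\<bar>) = integral {0..1} (\<lambda>x. \<bar>sk x\<bar>)"
      using set_borel_integral_eq_integral(2)[of "{0..1}" "\<lambda>x. \<bar>sk x\<bar>"]
        borel_integrable_atLeastAtMost'[of 0 1 "\<lambda>x. \<bar>sk x\<bar>"]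
      by (simp add: set_lebesgue_integral_def skc continuous_on_rabs)
    moreover have "0 \<le> integral {0..1} (\<lambda>x. \<bar>sk x\<bar>)"
      by (intro Henstock_Kurzweil_Integration.integral_nonneg integrable_continuous_real continuous_intros skc) auto
    ultimately have "integral {0..1} (\<lambda>x. \<bar>sk x\<bar>) = 0" by linarith
    then have sk0: "sk x = 0" if "x \<in> {0..1}" for x
      using integral_eq_0_iff[of 0 1 "\<lambda>x. \<bar>sk x\<bar>"] that by (auto simp: skc continuous_on_rabs)
    have sk_eq: "s (of_real x) * k (of_real x) = of_real (sk x)" for x
    proof -
      have "s (of_real x) \<in> \<real>" using star_real[OF ss] .
      moreover have "k (of_real x) \<in> \<real>"
        unfolding k_def of_real_mult[symmetric] csinc_of_real by (intro Reals_power Reals_of_real)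
      ultimately show ?thesis by (simp add: sk_def of_real_Re)
    qed
    have lim: "complex_of_real (1/2) islimpt of_real ` {0..1}"
      by (rule of_real_islimpt) auto
    have sk00: "s (of_real x) * k (of_real x) = 0" if "x \<in> {0..1}" for x
      by (simp only: sk_eq sk0[OF that] of_real_0)
    have "s z * k z = 0" for z
    proof (rule analytic_continuation[of "\<lambda>z. s z * k z" UNIV "of_real ` {0..1}" "of_real (1/2)"])
      show "(\<lambda>z. s z * k z) holomorphic_on UNIV" by (intro holomorphic_intros sh kh)
      show "s u * k u = 0" if "u \<in> of_real ` {0..1}" for u using that sk00 by blast
    qed (use lim in auto)
    moreover have "s w \<noteq> 0" using w by (simp add: s_def)
    ultimately have "k 0 = 0" using entire_mult_eq_0[OF sh kh] by blast
    then show False by (simp add: k_def csinc_def)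
  qed
  then have "(q z * star p z - star q z * p z) / (2 * \<i>) = 0" unfolding B_def by blast
  then show ?thesis by simp
qed

section \<open>Functions of the same argument\<close>

lemma nonneg_product_imp_star:
  assumes F: "F holomorphic_on UNIV" and G: "G holomorphic_on UNIV"
    and pos: "\<And>x::real. G (of_real x) * cnj (F (of_real x)) \<in> \<real>\<^sub>\<ge>\<^sub>0"
  shows "G z * star F z = star G z * F z"
proof -
  have "(\<lambda>z. G z * star F z) = (\<lambda>z. star G z * F z)"
  proof (rule entire_eq_on_reals)
    fix x :: real
    have "G (of_real x) * cnj (F (of_real x)) \<in> \<real>"
      using pos[of x] nonneg_Reals_subset_Reals by blast
    then have "cnj (G (of_real x) * cnj (F (of_real x))) = G (of_real x) * cnj (F (of_real x))"
      by (simp only: Reals_cnj_iff)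
    then show "G (of_real x) * star F (of_real x) = star G (of_real x) * F (of_real x)"
      by (simp add: star_of_real)
  qed (intro holomorphic_intros F G holomorphic_star)+
  then show ?thesis by (rule fun_cong)
qed

text \<open>For a constant \<open>c\<close>, the real part of \<open>c * F\<close> on the line is that of a function \<open>p\<close> with positive spectrum,
  composed of both parts of \<open>F\<close>. As \<open>G / F\<close> is nonnegative, the signs of the real parts for \<open>F\<close> and \<open>G\<close> agree.
  The two values \<open>c = 1\<close> and \<open>c = \<i>\<close> suffice to recover the parts.\<close>

lemma same_argument_parts:
  assumes Fp: "Fp holomorphic_on UNIV" "decays \<rho> Fp" "decays (- \<sigma>) (star Fp)"
    and Fm: "Fm holomorphic_on UNIV" "decays \<rho> (star Fm)" "decays (- \<sigma>) Fm"
    and Gp: "Gp holomorphic_on UNIV" "decays \<rho> Gp" "decays (- \<sigma>) (star Gp)"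
    and Gm: "Gm holomorphic_on UNIV" "decays \<rho> (star Gm)" "decays (- \<sigma>) Gm"
    and F: "\<And>z. F z = Fp z + Fm z" and G: "\<And>z. G z = Gp z + Gm z"
    and gap: "\<rho> \<le> \<sigma>" "\<sigma> < 2 * \<rho>" "0 < \<rho>"
    and pos: "\<And>x::real. G (of_real x) * cnj (F (of_real x)) \<in> \<real>\<^sub>\<ge>\<^sub>0"
    and nz: "F w \<noteq> 0"
  shows "Gp z * F z = G z * Fp z" "Gm z * F z = G z * Fm z"
proof -
  have Fh: "F holomorphic_on UNIV" and Gh: "G holomorphic_on UNIV"
    unfolding F[abs_def] G[abs_def] by (intro holomorphic_intros Fp Fm Gp Gm)+
  have sym: "G z * star F z = star G z * F z" for z
    by (rule nonneg_product_imp_star[OF Fh Gh pos])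
  \<comment> \<open>The case distinction below is needed because the real part of \<open>c * F\<close> may vanish identically.\<close>
  have key: "(c * Gp z + cnj c * star Gm z) * F z = G z * (c * Fp z + cnj c * star Fm z)"
    if "c \<noteq> 0" for c z
  proof -
    define p where "p z = c * Fp z + cnj c * star Fm z" for z
    define q where "q z = c * Gp z + cnj c * star Gm z" for z
    have hol: "p holomorphic_on UNIV" "q holomorphic_on UNIV"
      unfolding p_def q_def by (intro holomorphic_intros Fp Fm Gp Gm holomorphic_star)+
    have ps: "star p = (\<lambda>z. cnj c * star Fp z + c * Fm z)" "star q = (\<lambda>z. cnj c * star Gp z + c * Gm z)"
      by (rule ext, simp add: p_def q_def star_def)+
    have dec: "decays \<rho> p" "decays \<rho> q" "decays (- \<sigma>) (star p)" "decays (- \<sigma>) (star q)"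
      unfolding ps unfolding p_def q_def by (intro decays_add decays_cmult Fp Fm Gp Gm)+
    define f where "f z = p z + star p z" for z
    define g where "g z = q z + star q z" for z
    have f: "f z = c * F z + cnj c * star F z" for z
      by (simp add: f_def ps) (simp add: p_def F star_def algebra_simps)
    have g: "g z = c * G z + cnj c * star G z" for z
      by (simp add: g_def ps) (simp add: q_def G star_def algebra_simps)
    have Rep: "Re (p (of_real x)) = Re (c * F (of_real x))"
      and Req: "Re (q (of_real x)) = Re (c * G (of_real x))" for x
      by (simp_all add: p_def q_def star_of_real F G algebra_simps)
    have "q z * star p z = star q z * p z" for z
    proof (rule same_signs_imp_real_ratio[OF hol(1) dec(1,3) hol(2) dec(2,4) gap])
      fix x :: real
      show "0 \<le> Re (p (of_real x)) * Re (q (of_real x))"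
      proof (cases "F (of_real x) = 0")
        case False
        obtain t where t: "t \<ge> 0" "G (of_real x) * cnj (F (of_real x)) = of_real t"
          using pos[of x] by (auto elim: nonneg_Reals_cases)
        define h where "h = t / (cmod (F (of_real x)))\<^sup>2"
        have "G (of_real x) * (cnj (F (of_real x)) * F (of_real x)) = of_real t * F (of_real x)"
          using t(2) by (simp add: mult.assoc[symmetric])
        then have "G (of_real x) = of_real h * F (of_real x)"
          using False unfolding h_def mult.commute[of "cnj _"] complex_norm_square[symmetric]
          by (simp add: field_simps)
        then have "c * G (of_real x) = of_real h * (c * F (of_real x))" by simp
        define u where "u = Re (c * F (of_real x))"
        have "Re (q (of_real x)) = h * u"
          unfolding Req \<open>c * G (of_real x) = of_real h * (c * F (of_real x))\<close> u_def
          by simp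
        moreover have "0 \<le> h * (u * u)" using t(1) by (simp add: h_def)
        ultimately show ?thesis unfolding Rep u_def[symmetric] by (simp add: mult.left_commute)
      qed (simp add: Rep)
    qed
    then have qf: "q z * f z = g z * p z" for z by (simp add: f_def g_def algebra_simps)
    have gF: "g z * F z = G z * f z" for z
      using sym[of z] by (simp add: f g algebra_simps)
    have fh: "f holomorphic_on UNIV" and gh: "g holomorphic_on UNIV"
      unfolding f_def g_def by (intro holomorphic_intros hol holomorphic_star)+
    have "q z * F z = G z * p z"
    proof (cases "\<exists>v. f v \<noteq> 0")
      case True
      then obtain v where v: "f v \<noteq> 0" by blast
      have "f z * (q z * F z - G z * p z) = 0" for z
        using qf[of z] gF[of z] by (simp add: algebra_simps)
      then have "q z * F z - G z * p z = 0"
        by (rule entire_mult_eq_0[where p = f and q = "\<lambda>z. q z * F z - G z * p z", OF fh _ _ v, rotated])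
          (intro holomorphic_intros hol Fh Gh)
      then show ?thesis by simp
    next
      case False
      then have f0: "f z = 0" for z by blast
      then have "F z * g z = 0" for z using gF[of z] by auto
      then have g0: "g z = 0" for z by (rule entire_mult_eq_0[OF Fh gh _ nz])
      have "p z = - star p z" "q z = - star q z" for z
        using f0[of z] g0[of z] by (simp_all add: f_def g_def add_eq_0_iff2)
      then have "p = (\<lambda>_. 0)" "q = (\<lambda>_. 0)"
        using decaying_antisymmetric_eq_0 hol dec(1,2) gap(3) by metis+
      then show ?thesis by simp
    qed
    then show ?thesis by (simp add: p_def q_def)
  qed
  have 1: "(Gp z + star Gm z) * F z = G z * (Fp z + star Fm z)" using key[of 1 z] by simp
  have "\<i> * ((Gp z - star Gm z) * F z) = \<i> * (G z * (Fp z - star Fm z))"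
    using key[of \<i> z] by (simp add: algebra_simps)
  then have 2: "(Gp z - star Gm z) * F z = G z * (Fp z - star Fm z)" by (simp only: mult_cancel_left) simp
  have "2 * (Gp z * F z) = (Gp z + star Gm z) * F z + (Gp z - star Gm z) * F z"
    by (simp add: algebra_simps)
  also have "\<dots> = 2 * (G z * Fp z)" unfolding 1 2 by (simp add: algebra_simps)
  finally have "2 * (Gp z * F z) = 2 * (G z * Fp z)" .
  then show "Gp z * F z = G z * Fp z" by simp
  then show "Gm z * F z = G z * Fm z" using F[of z] G[of z] by (simp add: algebra_simps)
qed

lemma entire_cancel_power:
  assumes "p holomorphic_on UNIV" "q holomorphic_on UNIV"
    and eq: "\<And>z. (z - y) ^ m * p z = (z - y) ^ m * q z"
  shows "p z = q z"
proof -
  have "p z - q z = 0"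
  proof (rule entire_mult_eq_0[where p = "\<lambda>z. (z - y) ^ m" and q = "\<lambda>z. p z - q z" and w = "y + 1"])
    show "(z - y) ^ m * (p z - q z) = 0" for z using eq[of z] by (simp add: algebra_simps)
  qed (use assms in \<open>auto intro!: holomorphic_intros\<close>)
  then show ?thesis by simp
qed

text \<open>If \<open>F\<close> has a zero of higher order than \<open>G\<close> at \<open>y\<close>, then every \<open>P\<close> for which \<open>G * P / F\<close> is entire
  must make up for the difference.\<close>

lemma order_defect:
  assumes F1: "F1 holomorphic_on UNIV" "\<And>z. F z = (z - y) ^ n * F1 z"
    and G1: "G1 holomorphic_on UNIV" "\<And>z. G z = (z - y) ^ m * G1 z" and mn: "m < n"
    and P: "P holomorphic_on UNIV" "Q holomorphic_on UNIV" and eq: "\<And>z. Q z * F z = G z * P z"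
  shows "G1 z * P z = (z - y) ^ (n - m) * (Q z * F1 z)"
proof (rule entire_cancel_power[where m = m and y = y and p = "\<lambda>z. G1 z * P z" and q = "\<lambda>z. (z - y) ^ (n - m) * (Q z * F1 z)"])
  show "(z - y) ^ m * (G1 z * P z) = (z - y) ^ m * ((z - y) ^ (n - m) * (Q z * F1 z))" for z
  proof -
    have n: "(z - y) ^ n = (z - y) ^ m * (z - y) ^ (n - m)" using mn by (simp add: power_add[symmetric])
    have "(z - y) ^ m * ((z - y) ^ (n - m) * (Q z * F1 z)) = Q z * F z"
      by (simp only: F1(2) n mult_ac)
    also have "\<dots> = (z - y) ^ m * (G1 z * P z)" unfolding eq G1(2) by (simp only: mult_ac)
    finally show ?thesis by (rule sym)
  qed
qed (intro holomorphic_intros assms)+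

text \<open>Stated by divisibility, so that the zero function has double zeros everywhere.\<close>

definition double_zero :: "(complex \<Rightarrow> complex) \<Rightarrow> complex \<Rightarrow> bool"
  where "double_zero p y \<longleftrightarrow> (\<exists>H. H holomorphic_on UNIV \<and> (\<forall>z. p z = (z - y)\<^sup>2 * H z))"

lemma order_defect_double_zero:
  assumes P: "P holomorphic_on UNIV" and G1: "G1 holomorphic_on UNIV" "G1 y \<noteq> 0"
    and K: "K holomorphic_on UNIV" and n: "2 \<le> n"
    and eq: "\<And>z. G1 z * P z = (z - y) ^ n * K z"
  shows "double_zero P y"
proof -
  have "P y = 0" using eq[of y] G1 n by (auto simp: power_0_left)
  then obtain P1 where P1: "P1 holomorphic_on UNIV" "\<And>z. P z = (z - y) * P1 z"
    using entire_divide_zero[OF P] by metis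
  have "G1 z * P1 z = (z - y) ^ (n - 1) * K z" for z
  proof (rule entire_cancel_power[where m = 1 and y = y and p = "\<lambda>z. G1 z * P1 z" and q = "\<lambda>z. (z - y) ^ (n - 1) * K z"])
    show "(z - y) ^ 1 * (G1 z * P1 z) = (z - y) ^ 1 * ((z - y) ^ (n - 1) * K z)" for z
      using eq[of z] P1(2)[of z] n by (cases n) (auto simp: mult_ac)
  qed (intro holomorphic_intros assms P1)+
  from this[of y] have "P1 y = 0" using G1 n by (auto simp: power_0_left)
  then obtain P2 where "P2 holomorphic_on UNIV" "\<And>z. P1 z = (z - y) * P2 z"
    using entire_divide_zero[OF P1(1)] by metis
  then show ?thesis using P1(2) unfolding double_zero_def power2_eq_square by (auto simp: mult.assoc)
qed

lemma entire_quotient_local: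
  assumes F: "F holomorphic_on UNIV" "F w \<noteq> 0"
    and loc: "\<And>y. \<exists>r>0. \<exists>g. g holomorphic_on ball y r \<and> (\<forall>z\<in>ball y r. G z = g z * F z)"
  obtains \<phi> where "\<phi> holomorphic_on UNIV" "\<And>z. G z = \<phi> z * F z"
proof -
  obtain r g where r: "\<And>y. r y > 0" and g: "\<And>y. g y holomorphic_on ball y (r y)"
    "\<And>y z. z \<in> ball y (r y) \<Longrightarrow> G z = g y z * F z"
    using loc by metis
  define \<phi> where "\<phi> y = g y y" for y
  have eq: "G z = \<phi> z * F z" for z using g(2)[of z z] r[of z] by (simp add: \<phi>_def)
  have "\<phi> field_differentiable (at y)" for y
  proof -
    obtain n q where q: "q holomorphic_on UNIV" "q y \<noteq> 0" "\<And>z. F z = (z - y) ^ n * q z"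
      using entire_factor_zero[OF F, of y] by metis
    have "isCont q y" using entire_continuous[OF q(1), of UNIV] by (simp add: continuous_on_eq_continuous_at)
    then have "\<forall>\<^sub>F z in nhds y. q z \<noteq> 0"
      using continuous_at_avoid[of y q 0] q(2)
      by (auto simp: eventually_nhds_metric dist_commute)
    moreover have "\<forall>\<^sub>F z in nhds y. z \<in> ball y (r y)"
      using r by (intro eventually_nhds_in_open) auto
    ultimately have "\<forall>\<^sub>F z in nhds y. \<phi> z = g y z"
    proof eventually_elim
      case (elim z)
      show ?case
      proof (cases "z = y")
        case False
        then have "F z \<noteq> 0" using elim q by simp
        then show ?thesis using g(2)[OF elim(2)] eq[of z] by simp
      qed (simp add: \<phi>_def)
    qed
    moreover have "g y field_differentiable (at y)"
      using g(1)[of y] r[of y] by (auto simp: holomorphic_on_def at_within_open[OF _ open_ball])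
    ultimately show ?thesis
      unfolding field_differentiable_def using DERIV_cong_ev[OF refl _ refl] by blast
  qed
  then have "\<phi> holomorphic_on UNIV" by (simp add: holomorphic_on_def field_differentiable_at_within)
  then show ?thesis using that eq by blast
qed

text \<open>A nonnegative function does not change sign.\<close>

lemma even_order_of_nonneg:
  fixes r :: "real \<Rightarrow> real"
  assumes "isCont r y" "r y \<noteq> 0" and nonneg: "\<And>x. 0 \<le> (x - y) ^ n * r x"
  shows "even n"
proof (rule ccontr)
  assume odd: "odd n"
  have "r y = 0"
    by (rule common_zero_at_sign_change(2)[where b = "\<lambda>_. 1" and y = y and Q = "\<lambda>_. 1" and g = r
        and f = "\<lambda>x. (x - y) ^ n" and n = n])
      (use assms odd in auto)
  then show False using assms by simp
qed

text \<open>At a pole of \<open>G / F\<close> both parts of \<open>F\<close> vanish, to at least the order of the pole. The symmetry of the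
  quotient yields the same at the conjugate point, and its sign makes the order of real poles even.\<close>

lemma same_argument_quotient:
  assumes Fp: "Fp holomorphic_on UNIV" "decays \<rho> Fp" "decays (- \<sigma>) (star Fp)"
    and Fm: "Fm holomorphic_on UNIV" "decays \<rho> (star Fm)" "decays (- \<sigma>) Fm"
    and Gp: "Gp holomorphic_on UNIV" "decays \<rho> Gp" "decays (- \<sigma>) (star Gp)"
    and Gm: "Gm holomorphic_on UNIV" "decays \<rho> (star Gm)" "decays (- \<sigma>) Gm"
    and F: "\<And>z. F z = Fp z + Fm z" and G: "\<And>z. G z = Gp z + Gm z"
    and gap: "\<rho> \<le> \<sigma>" "\<sigma> < 2 * \<rho>" "0 < \<rho>"
    and pos: "\<And>x::real. G (of_real x) * cnj (F (of_real x)) \<in> \<real>\<^sub>\<ge>\<^sub>0"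
    and nz: "F w \<noteq> 0"
    and nonreal: "\<And>y. y \<notin> \<real> \<Longrightarrow> \<not> (Fp y = 0 \<and> Fp (cnj y) = 0 \<and> Fm y = 0 \<and> Fm (cnj y) = 0)"
    and real: "(\<exists>M. \<forall>x::real. cmod (G (of_real x)) \<le> M * cmod (F (of_real x))) \<or>
      (\<forall>x::real. \<not> (double_zero Fp (of_real x) \<and> double_zero Fm (of_real x)))"
  obtains \<phi> where "\<phi> holomorphic_on UNIV" "star \<phi> = \<phi>"
    "\<And>z. G z = \<phi> z * F z" "\<And>z. Gp z = \<phi> z * Fp z" "\<And>z. Gm z = \<phi> z * Fm z"
    "\<And>x::real. \<phi> (of_real x) \<in> \<real>\<^sub>\<ge>\<^sub>0"
proof -
  have Fh: "F holomorphic_on UNIV" and Gh: "G holomorphic_on UNIV"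
    unfolding F[abs_def] G[abs_def] by (intro holomorphic_intros Fp Fm Gp Gm)+
  have sym: "G z * star F z = star G z * F z" for z
    by (rule nonneg_product_imp_star[OF Fh Gh pos])
  note parts = same_argument_parts[OF Fp Fm Gp Gm F G gap pos nz]
  have loc: "\<exists>r>0. \<exists>g. g holomorphic_on ball y r \<and> (\<forall>z\<in>ball y r. G z = g z * F z)" for y
  proof (cases "\<exists>v. G v \<noteq> 0")
    case False
    then show ?thesis by (intro exI[of _ 1] conjI exI[of _ "\<lambda>_. 0"]) auto
  next
    case True
    then obtain v where v: "G v \<noteq> 0" by blast
    obtain n F1 where F1: "F1 holomorphic_on UNIV" "F1 y \<noteq> 0" "\<And>z. F z = (z - y) ^ n * F1 z"
      using entire_factor_zero[OF Fh nz, of y] by metis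
    obtain m G1 where G1: "G1 holomorphic_on UNIV" "G1 y \<noteq> 0" "\<And>z. G z = (z - y) ^ m * G1 z"
      using entire_factor_zero[OF Gh v, of y] by metis
    have "n \<le> m"
    proof (rule ccontr)
      assume "\<not> n \<le> m"
      then have mn: "m < n" by simp
      note dp = order_defect[OF F1(1,3) G1(1,3) mn Fp(1) Gp(1) parts(1)]
      note dm = order_defect[OF F1(1,3) G1(1,3) mn Fm(1) Gm(1) parts(2)]
      have zy: "Fp y = 0" "Fm y = 0" using dp[of y] dm[of y] G1(2) mn by (auto simp: power_0_left)
      show False
      proof (cases "y \<in> \<real>")
        case False
        \<comment> \<open>The quotient equals its own \<open>star\<close>, so the defect of order occurs at the conjugate point as well.\<close>
        have Fs: "star F z = (z - cnj y) ^ n * star F1 z" and Gs: "star G z = (z - cnj y) ^ m * star G1 z" for z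
          by (simp_all add: star_def F1(3) G1(3))
        have mn': "star G1 (cnj y) \<noteq> 0" using G1(2) by (simp add: star_def)
        have cy: "P (cnj y) = 0" if P: "P holomorphic_on UNIV" "Q holomorphic_on UNIV" "\<And>z. Q z * F z = G z * P z" for P Q
        proof -
          have "Q z * star F z = star G z * P z" for z
          proof -
            have "F z * (Q z * star F z - star G z * P z) = 0" for z
            proof -
              have "F z * (Q z * star F z) = (Q z * F z) * star F z" by (simp only: mult_ac)
              also have "\<dots> = (G z * star F z) * P z" unfolding P(3) by (simp only: mult_ac)
              also have "\<dots> = F z * (star G z * P z)" unfolding sym by (simp only: mult_ac)
              finally show ?thesis by (simp add: right_diff_distrib)
            qed
            then have "Q z * star F z - star G z * P z = 0"
              by (rule entire_mult_eq_0[where p = F and q = "\<lambda>z. Q z * star F z - star G z * P z", OF Fh _ _ nz, rotated])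
                (intro holomorphic_intros P Fh Gh holomorphic_star)
            then show ?thesis by simp
          qed
          from order_defect[OF holomorphic_star[OF F1(1)] Fs holomorphic_star[OF G1(1)] Gs mn P(1,2) this, of "cnj y"]
          show ?thesis using mn' mn by (auto simp: power_0_left)
        qed
        show False using nonreal[OF False] zy cy[OF Fp(1) Gp(1) parts(1)] cy[OF Fm(1) Gm(1) parts(2)] by blast
      next
        case True
        then obtain x where x: "y = of_real x" by (elim Reals_cases)
        have cc: "isCont (\<lambda>t. h (complex_of_real t)) x" if "h holomorphic_on UNIV" for h
          using entire_real_continuous[OF that, of UNIV] by (simp add: continuous_on_eq_continuous_at)
        from real show False
        proof
          assume "\<exists>M. \<forall>x::real. cmod (G (of_real x)) \<le> M * cmod (F (of_real x))"
          then obtain M where M: "\<And>t::real. cmod (G (of_real t)) \<le> M * cmod (F (of_real t))" by blast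
          have le: "cmod (G1 (of_real t)) \<le> M * (\<bar>t - x\<bar> ^ (n - m) * cmod (F1 (of_real t)))" if "t \<noteq> x" for t
          proof -
            have ctx: "cmod (complex_of_real t - of_real x) = \<bar>t - x\<bar>" by (metis norm_of_real of_real_diff)
            have "\<bar>t - x\<bar> ^ m * cmod (G1 (of_real t)) \<le> M * (\<bar>t - x\<bar> ^ n * cmod (F1 (of_real t)))"
              using M[of t] unfolding F1(3) G1(3) x norm_mult norm_power ctx .
            also have "\<dots> = \<bar>t - x\<bar> ^ m * (M * (\<bar>t - x\<bar> ^ (n - m) * cmod (F1 (of_real t))))"
              using mn power_add[of "\<bar>t - x\<bar>" m "n - m"] by simp
            finally show ?thesis using that by simp
          qed
          have "((\<lambda>t. M * (\<bar>t - x\<bar> ^ (n - m) * cmod (F1 (of_real t)))) \<longlongrightarrow>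
              M * (\<bar>x - x\<bar> ^ (n - m) * cmod (F1 (of_real x)))) (at x)"
            using cc[OF F1(1)] unfolding isCont_def by (intro tendsto_intros)
          moreover have "((\<lambda>t. cmod (G1 (of_real t))) \<longlongrightarrow> cmod (G1 (of_real x))) (at x)"
            using cc[OF G1(1)] unfolding isCont_def by (intro tendsto_norm)
          moreover have "\<forall>\<^sub>F t in at x. cmod (G1 (of_real t)) \<le> M * (\<bar>t - x\<bar> ^ (n - m) * cmod (F1 (of_real t)))"
            using le by (auto simp: eventually_at_filter)
          ultimately have "cmod (G1 (of_real x)) \<le> M * (\<bar>x - x\<bar> ^ (n - m) * cmod (F1 (of_real x)))"
            by (intro tendsto_le[of "at x"]) auto
          then show False using G1(2) mn x by (auto simp: power_0_left)
        next
          assume dz: "\<forall>x::real. \<not> (double_zero Fp (of_real x) \<and> double_zero Fm (of_real x))"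
          \<comment> \<open>\<open>r\<close> is \<open>G * cnj F\<close> without its zero at \<open>x\<close>; nonnegativity makes the order \<open>m + n\<close> of that zero even,
            and with it the order \<open>n - m\<close> of the pole.\<close>
          define r where "r t = Re (G1 (of_real t) * cnj (F1 (of_real t)))" for t
          have GF: "G (of_real t) * cnj (F (of_real t)) = of_real ((t - x) ^ (m + n)) * (G1 (of_real t) * cnj (F1 (of_real t)))" for t
            by (simp add: F1(3) G1(3) x power_add mult_ac)
          have im0: "G1 (of_real t) * cnj (F1 (of_real t)) \<in> \<real>" for t
          proof -
            have "(\<lambda>z. G1 z * star F1 z) holomorphic_on UNIV" by (intro holomorphic_intros F1 G1 holomorphic_star)
            then have "star (\<lambda>z. G1 z * star F1 z) = (\<lambda>z. G1 z * star F1 z)"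
            proof (rule entire_real_imp_star)
              fix t :: real assume t: "t \<noteq> x"
              have "G1 (of_real t) * star F1 (of_real t) = (G (of_real t) * cnj (F (of_real t))) / of_real ((t - x) ^ (m + n))"
                using t unfolding GF by (simp add: star_of_real)
              then show "G1 (of_real t) * star F1 (of_real t) \<in> \<real>"
                using pos[of t] nonneg_Reals_subset_Reals by (metis Reals_divide Reals_of_real subsetD)
            qed
            from star_real[OF this, of t] show ?thesis by (simp add: star_of_real)
          qed
          have rr: "G1 (of_real t) * cnj (F1 (of_real t)) = of_real (r t)" for t
            unfolding r_def by (rule of_real_Re[OF im0, symmetric])
          have "even (m + n)"
          proof (rule even_order_of_nonneg)
            show "isCont r x"
              unfolding r_def using entire_real_continuous[OF F1(1), of UNIV] entire_real_continuous[OF G1(1), of UNIV]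
              by (intro continuous_on_interior[of UNIV] continuous_intros) auto
            show "r x \<noteq> 0" using rr[of x] F1(2) G1(2) x by auto
            show "0 \<le> (t - x) ^ (m + n) * r t" for t
            proof -
              have "complex_of_real ((t - x) ^ (m + n) * r t) \<in> \<real>\<^sub>\<ge>\<^sub>0" using pos[of t] unfolding GF rr by simp
              then show ?thesis by (simp only: nonneg_Reals_of_real_iff)
            qed
          qed
          then have 2: "2 \<le> n - m" using mn by presburger
          have "double_zero Fp y"
            by (rule order_defect_double_zero[OF Fp(1) G1(1,2) _ 2 dp]) (intro holomorphic_intros Gp F1)
          moreover have "double_zero Fm y"
            by (rule order_defect_double_zero[OF Fm(1) G1(1,2) _ 2 dm]) (intro holomorphic_intros Gm F1)
          ultimately show False using dz x by blast
        qed
      qed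
    qed
    have "isCont F1 y" using entire_continuous[OF F1(1), of UNIV] by (simp add: continuous_on_eq_continuous_at)
    then obtain r where r: "r > 0" "\<And>z. dist y z < r \<Longrightarrow> F1 z \<noteq> 0"
      using continuous_at_avoid[of y F1 0] F1(2) by blast
    show ?thesis
    proof (intro exI[of _ r] conjI exI[of _ "\<lambda>z. (z - y) ^ (m - n) * G1 z / F1 z"])
      show "(\<lambda>z. (z - y) ^ (m - n) * G1 z / F1 z) holomorphic_on ball y r"
        by (intro holomorphic_intros holomorphic_on_subset[OF F1(1)] holomorphic_on_subset[OF G1(1)]) (use r in auto)
      show "\<forall>z\<in>ball y r. G z = (z - y) ^ (m - n) * G1 z / F1 z * F z"
        using r(2) \<open>n \<le> m\<close> by (auto simp: F1(3) G1(3) power_add[symmetric])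
    qed (use r in auto)
  qed
  obtain \<phi> where \<phi>: "\<phi> holomorphic_on UNIV" "\<And>z. G z = \<phi> z * F z"
    using entire_quotient_local[OF Fh nz loc] by metis
  have mult: "Q z = \<phi> z * P z" if P: "P holomorphic_on UNIV" "Q holomorphic_on UNIV" "\<And>z. Q z * F z = G z * P z" for P Q z
  proof -
    have "F z * (Q z - \<phi> z * P z) = 0" for z using P(3)[of z] \<phi>(2)[of z] by (simp add: algebra_simps)
    then have "Q z - \<phi> z * P z = 0"
      by (rule entire_mult_eq_0[where p = F and q = "\<lambda>z. Q z - \<phi> z * P z", OF Fh _ _ nz, rotated])
        (intro holomorphic_intros P \<phi>)
    then show ?thesis by simp
  qed
  have star: "star \<phi> = \<phi>"
  proof
    fix z
    have "F z * star F z * (\<phi> z - star \<phi> z) = 0" for z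
    proof -
      have "star G z = star \<phi> z * star F z" by (simp add: star_def \<phi>(2))
      then show ?thesis using sym[of z] \<phi>(2)[of z] by (simp add: algebra_simps)
    qed
    moreover obtain v where "F v * star F v \<noteq> 0"
      using entire_two_nonzero[OF Fh holomorphic_star[OF Fh] nz, of "cnj w"] nz by (auto simp: star_def)
    ultimately have "\<phi> z - star \<phi> z = 0"
      by (intro entire_mult_eq_0[where p = "\<lambda>z. F z * star F z" and q = "\<lambda>z. \<phi> z - star \<phi> z" and w = v])
        (auto intro!: holomorphic_intros Fh \<phi> holomorphic_star)
    then show "star \<phi> z = \<phi> z" by simp
  qed
  have nonneg: "\<phi> (of_real x) \<in> \<real>\<^sub>\<ge>\<^sub>0" for x :: real
  proof -
    have r: "\<phi> (of_real t) = of_real (Re (\<phi> (of_real t)))" for t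
      using star_real[OF star, of t] by (simp add: of_real_Re)
    have "0 \<le> Re (\<phi> (of_real x))"
    proof (rule ccontr)
      assume neg: "\<not> ?thesis"
      \<comment> \<open>A negative value of \<open>\<phi>\<close> would persist on an interval, on which \<open>F\<close> would have to vanish.\<close>
      have off: "F (of_real t) = 0" if "Re (\<phi> (of_real t)) < 0" for t
      proof (rule ccontr)
        assume F0: "F (of_real t) \<noteq> 0"
        have "G (of_real t) * cnj (F (of_real t)) = of_real (Re (\<phi> (of_real t)) * (cmod (F (of_real t)))\<^sup>2)"
          using \<phi>(2)[of "of_real t"] r[of t] complex_norm_square[of "F (of_real t)"]
          by (simp add: mult.assoc)
        then have "complex_of_real (Re (\<phi> (of_real t)) * (cmod (F (of_real t)))\<^sup>2) \<in> \<real>\<^sub>\<ge>\<^sub>0"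
          using pos[of t] by simp
        then have "0 \<le> Re (\<phi> (of_real t)) * (cmod (F (of_real t)))\<^sup>2"
          by (simp only: nonneg_Reals_of_real_iff)
        then show False using that F0 by (simp add: zero_le_mult_iff)
      qed
      have "isCont (\<lambda>t. Re (\<phi> (of_real t))) x"
        using entire_real_continuous[OF \<phi>(1), of UNIV]
        by (intro continuous_on_interior[of UNIV] continuous_intros) auto
      moreover have "Re (\<phi> (of_real x)) < 0" using neg by simp
      ultimately have "\<forall>\<^sub>F t in at x. Re (\<phi> (of_real t)) < 0"
        unfolding isCont_def by (rule order_tendstoD)
      then obtain d where d: "d > 0" "\<And>t. t \<noteq> x \<Longrightarrow> dist t x < d \<Longrightarrow> Re (\<phi> (of_real t)) < 0"
        by (auto simp: eventually_at)
      have "F w = 0"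
      proof (rule analytic_continuation[OF Fh open_UNIV connected_UNIV _ UNIV_I])
        show "complex_of_real (x + d / 2) islimpt of_real ` {x + d/4..x + 3*d/4}"
          using d by (intro of_real_islimpt) auto
        show "F z = 0" if "z \<in> of_real ` {x + d/4..x + 3*d/4}" for z
          using that d off by (auto simp: dist_real_def)
      qed auto
      then show False using nz by simp
    qed
    then show ?thesis using r[of x] by (metis nonneg_Reals_of_real_iff)
  qed
  show ?thesis
    using that[of \<phi>] \<phi> star nonneg mult[OF Fp(1) Gp(1) parts(1)] mult[OF Fm(1) Gm(1) parts(2)] by blast
qed

section \<open>Fourier inversion\<close>

text \<open>Half-open intervals generate the Borel sets and are stable under intersection.\<close>

lemma AE_zero_of_interval_integrals:
  fixes d :: "real \<Rightarrow> complex"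
  assumes d: "integrable lborel d"
    and zero: "\<And>a b. a \<le> b \<Longrightarrow> (LINT x:{a<..b}|lborel. d x) = 0"
  shows "AE x in lborel. d x = 0"
proof -
  have [measurable]: "d \<in> borel_measurable borel" using d by auto
  have si: "set_integrable lborel A d" if "A \<in> sets borel" for A
    using d that by (auto simp: set_integrable_def intro: integrable_mult_indicator)
  let ?E = "range (\<lambda>(a, b). {a<..b::real})"
  have total: "(LINT x:UNIV|lborel. d x) = 0"
  proof -
    have "(\<lambda>n. LINT x:{- real n<..real n}|lborel. d x) \<longlonglongrightarrow> (LINT x:(\<Union>n. {- real n<..real n})|lborel. d x)"
    proof (rule set_integral_cont_up)
      show "incseq (\<lambda>n. {- real n<..real n})" by (auto simp: incseq_def)
    qed (auto intro!: si)
    moreover have "(\<Union>n. {- real n<..real n}) = UNIV"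
    proof -
      have "\<exists>n. - real n < x \<and> x \<le> real n" for x
      proof -
        obtain n where "\<bar>x\<bar> < real n" using reals_Archimedean2 by blast
        then show ?thesis by (intro exI[of _ n]) auto
      qed
      then show ?thesis by auto
    qed
    ultimately have "(\<lambda>n. LINT x:{- real n<..real n}|lborel. d x) \<longlonglongrightarrow> (LINT x:UNIV|lborel. d x)" by simp
    moreover have "(\<lambda>n. LINT x:{- real n<..real n}|lborel. d x) = (\<lambda>n. 0)" using zero by auto
    ultimately show ?thesis by (simp add: LIMSEQ_const_iff)
  qed
  have "(LINT x:A|lborel. d x) = 0" if "A \<in> sets borel" for A
  proof -
    have "Int_stable ?E"
    proof (rule Int_stableI_image)
      fix i j :: "real \<times> real"
      show "\<exists>k\<in>UNIV. (case i of (a, b) \<Rightarrow> {a<..b}) \<inter> (case j of (a, b) \<Rightarrow> {a<..b}) = (case k of (a, b) \<Rightarrow> {a<..b})"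
        by (intro bexI[of _ "(max (fst i) (fst j), min (snd i) (snd j))"]) (auto simp: split_beta)
    qed
    moreover have "?E \<subseteq> Pow UNIV" by auto
    moreover have "A \<in> sigma_sets UNIV ?E" using that by (simp add: borel_sigma_sets_Ioc)
    ultimately show ?thesis
    proof (induction rule: sigma_sets_induct_disjoint)
      case (basic A)
      then obtain a b where A: "A = {a<..b}" by auto
      show ?case
      proof (cases "a \<le> b")
        case False
        then have "A = {}" using A by auto
        then show ?thesis by (simp add: set_lebesgue_integral_def)
      qed (use A zero in auto)
    next
      case (compl A)
      then have A: "A \<in> sets borel" by (simp add: borel_sigma_sets_Ioc)
      have "(LINT x:A \<union> (UNIV - A)|lborel. d x) = (LINT x:A|lborel. d x) + (LINT x:UNIV - A|lborel. d x)"
        by (rule set_integral_Un) (use A in \<open>auto intro!: si\<close>)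
      then show ?case using compl total by (simp add: Un_Diff_cancel)
    next
      case (union A)
      then have A: "A i \<in> sets borel" for i by (auto simp: borel_sigma_sets_Ioc)
      have "(LINT x:(\<Union>i. A i)|lborel. d x) = (\<Sum>i. LINT x:A i|lborel. d x)"
        by (rule lebesgue_integral_countable_add)
          (use A union(1) in \<open>auto intro!: si simp: disjoint_family_on_def\<close>)
      then show ?case using union by simp
    qed (simp add: set_lebesgue_integral_def)
  qed
  then show ?thesis
    using sigma_finite_measure.density_zero[OF lborel.sigma_finite_measure_axioms d] by simp
qed

text \<open>The kernel of Levy's inversion formula: the transform of the indicator function of \<open>(a, b]\<close>. At \<open>t = 0\<close> the
  formula yields 0 instead of \<open>b - a\<close>.\<close>

definition kern :: "real \<Rightarrow> real \<Rightarrow> real \<Rightarrow> complex"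
  where "kern a b t = (iexp (-(t * a)) - iexp (-(t * b))) / (\<i> * t)"

text \<open>The Fourier transform in the normalization of characteristic functions.\<close>

definition char_transform :: "(real \<Rightarrow> complex) \<Rightarrow> real \<Rightarrow> complex"
  where "char_transform f t = (LINT x|lborel. iexp (t * x) * f x)"

lemma kern_bound: "a \<le> b \<Longrightarrow> cmod (kern a b t) \<le> b - a"
proof (cases "t = 0")
  case False
  assume "a \<le> b"
  then show ?thesis using Levy_Inversion_aux2[of "-b" "-a" t] False by (simp add: kern_def)
qed (simp add: kern_def)

lemma kern_measurable [measurable]: "kern a b \<in> borel_measurable borel"
  unfolding kern_def by measurable

lemma integrable_exp_mult:
  assumes "integrable lborel f"
  shows "integrable lborel (\<lambda>x. iexp (t * x) * f x)"
proof -
  have [measurable]: "f \<in> borel_measurable borel" using assms by auto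
  show ?thesis
    by (rule Bochner_Integration.integrable_bound[OF assms]) (auto simp: norm_mult)
qed

lemma char_transform_bound:
  assumes "integrable lborel f"
  shows "cmod (char_transform f t) \<le> (LINT x|lborel. cmod (f x))"
proof -
  have "cmod (char_transform f t) \<le> (LINT x|lborel. cmod (iexp (t * x) * f x))"
    unfolding char_transform_def by (rule integral_norm_bound)
  then show ?thesis by (simp add: norm_mult)
qed

lemma char_transform_isCont:
  assumes f: "integrable lborel f"
  shows "isCont (char_transform f) t"
proof -
  have [measurable]: "f \<in> borel_measurable borel" using f by auto
  show ?thesis
    unfolding continuous_at_sequentially
  proof (intro allI impI)
    fix s :: "nat \<Rightarrow> real" assume s: "s \<longlonglongrightarrow> t"
    have "(\<lambda>n. LINT x|lborel. iexp (s n * x) * f x) \<longlonglongrightarrow> (LINT x|lborel. iexp (t * x) * f x)"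
    proof (rule integral_dominated_convergence[where w = "\<lambda>x. cmod (f x)"])
      show "AE x in lborel. (\<lambda>n. iexp (s n * x) * f x) \<longlonglongrightarrow> iexp (t * x) * f x"
        by (intro AE_I2 tendsto_intros s)
    qed (use f in \<open>auto simp: norm_mult\<close>)
    then show "(char_transform f \<circ> s) \<longlonglongrightarrow> char_transform f t" by (simp add: char_transform_def o_def)
  qed
qed

lemma char_transform_continuous: "integrable lborel f \<Longrightarrow> continuous_on A (char_transform f)"
  by (meson char_transform_isCont continuous_at_imp_continuous_on)

lemma char_transform_measurable:
  "integrable lborel f \<Longrightarrow> char_transform f \<in> borel_measurable borel"
  by (intro borel_measurable_continuous_onI char_transform_continuous)

text \<open>The conclusion of Levy's inversion formula for a complex density \<open>f\<close>.\<close>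

definition Levy_invertible :: "(real \<Rightarrow> complex) \<Rightarrow> bool"
  where "Levy_invertible f \<longleftrightarrow> (\<forall>a b. a \<le> b \<longrightarrow>
    (\<lambda>n. 1 / (2 * pi) * (LINT t|lborel. indicator {- real n<..<real n} t *\<^sub>R (kern a b t * char_transform f t)))
      \<longlonglongrightarrow> (LINT x:{a<..b}|lborel. f x))"

text \<open>A nonnegative density is a multiple of a probability density, and it has no point masses.\<close>

lemma Levy_invertible_nonneg:
  fixes g :: "real \<Rightarrow> real"
  assumes g: "integrable lborel g" and nn: "\<And>x. 0 \<le> g x"
  shows "Levy_invertible (\<lambda>x. of_real (g x))"
proof -
  have [measurable]: "g \<in> borel_measurable borel" using g by auto
  define c where "c = (LINT x|lborel. g x)"
  have c0: "c \<ge> 0" unfolding c_def using nn by (intro integral_nonneg_AE) auto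
  show ?thesis
  proof (cases "c = 0")
    case True
    then have AE: "AE x in lborel. g x = 0"
      using integral_nonneg_eq_0_iff_AE[OF g] nn by (simp add: c_def)
    have "char_transform (\<lambda>x. of_real (g x)) t = (LINT x::real|lborel. 0)" for t
      unfolding char_transform_def by (rule integral_cong_AE) (use AE in auto)
    moreover have "(LINT x:{a<..b}|lborel. complex_of_real (g x)) = (LINT x::real|lborel. 0)" for a b
      unfolding set_lebesgue_integral_def by (rule integral_cong_AE) (use AE in auto)
    ultimately show ?thesis by (simp add: Levy_invertible_def)
  next
    case False
    with c0 have c: "c > 0" by simp
    define M where "M = density lborel (\<lambda>x. ennreal (g x / c))"
    have nnc: "0 \<le> g x / c" for x using nn c by simp
    have "emeasure M (space M) = (\<integral>\<^sup>+x. ennreal (g x / c) \<partial>lborel)"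
      by (simp add: M_def emeasure_density)
    also have "\<dots> = ennreal (LINT x|lborel. g x / c)"
      by (rule nn_integral_eq_integral) (use g nnc in auto)
    also have "(LINT x|lborel. g x / c) = 1" using c by (simp add: c_def[symmetric])
    finally have "prob_space M" by (intro prob_spaceI) simp
    then interpret M: real_distribution M
      by (intro real_distribution.intro) (auto simp: real_distribution_axioms_def M_def)
    have char: "char M t = char_transform (\<lambda>x. of_real (g x)) t / c" for t
    proof -
      have "char M t = (LINT x|lborel. (g x / c) *\<^sub>R iexp (t * x))"
        unfolding char_def M_def by (rule integral_density) (use nnc in auto)
      also have "\<dots> = (LINT x|lborel. (iexp (t * x) * of_real (g x)) / c)"
        by (rule Bochner_Integration.integral_cong) (auto simp: scaleR_conv_of_real)
      finally show ?thesis by (simp add: char_transform_def)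
    qed
    have meas: "measure M {a<..b} = (LINT x:{a<..b}|lborel. g x) / c" for a b
    proof -
      have "measure M {a<..b} = (LINT x|M. indicator {a<..b} x)" by simp
      also have "\<dots> = (LINT x|lborel. (g x / c) *\<^sub>R indicator {a<..b} x)"
        unfolding M_def by (rule integral_density) (use nnc in auto)
      also have "\<dots> = (LINT x|lborel. (indicator {a<..b} x * g x) / c)"
        by (rule Bochner_Integration.integral_cong) auto
      finally show ?thesis by (simp add: set_lebesgue_integral_def)
    qed
    have point: "measure M {a} = 0" for a
    proof -
      have "emeasure M {a} = 0" unfolding M_def
        by (subst emeasure_density) (auto simp: nn_integral_0_iff_AE AE_lborel_singleton intro: AE_mp[OF AE_lborel_singleton[of a]])
      then show ?thesis by (simp add: measure_def)
    qed
    show ?thesis unfolding Levy_invertible_def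
    proof (intro allI impI)
      fix a b :: real assume ab: "a \<le> b"
      have "(\<lambda>T. 1 / (2 * pi) * (CLBINT t=-T..T. (iexp (-(t * a)) - iexp (-(t * b))) / (\<i> * t) * char M t))
        \<longlonglongrightarrow> of_real (measure M {a<..b})"
        by (rule M.Levy_Inversion[OF ab point point])
      then have "(\<lambda>T. complex_of_real c * (1 / (2 * pi) * (CLBINT t=-T..T. (iexp (-(t * a)) - iexp (-(t * b))) / (\<i> * t) * char M t)))
        \<longlonglongrightarrow> complex_of_real c * of_real (measure M {a<..b})" by (rule tendsto_mult_left)
      moreover have "complex_of_real c * (1 / (2 * pi) * (CLBINT t=-T..T. (iexp (-(t * a)) - iexp (-(t * b))) / (\<i> * t) * char M t))
        = 1 / (2 * pi) * (LINT t|lborel. indicator {- real T<..<real T} t *\<^sub>R (kern a b t * char_transform (\<lambda>x. of_real (g x)) t))" for T :: nat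
      proof -
        have "einterval (ereal (real_of_int (- int T))) (ereal (real T)) = {- real T<..<real T}"
          by (auto simp: einterval_def)
        then have "(CLBINT t=-T..T. (iexp (-(t * a)) - iexp (-(t * b))) / (\<i> * t) * char M t)
          = (LINT t|lborel. (indicator {- real T<..<real T} t *\<^sub>R (kern a b t * char_transform (\<lambda>x. of_real (g x)) t)) / c)"
          unfolding interval_lebesgue_integral_def set_lebesgue_integral_def kern_def char
          by (auto intro!: Bochner_Integration.integral_cong simp: scaleR_conv_of_real simp del: integral_divide_zero)
        also have "\<dots> = (LINT t|lborel. indicator {- real T<..<real T} t *\<^sub>R (kern a b t * char_transform (\<lambda>x. of_real (g x)) t)) / c"
          by (rule integral_divide_zero)
        finally show ?thesis using c by simp
      qed
      moreover have "c * complex_of_real (measure M {a<..b}) = (LINT x:{a<..b}|lborel. complex_of_real (g x))"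
        using c unfolding meas by (simp add: set_lebesgue_integral_def flip: integral_complex_of_real of_real_mult)
          (simp add: scaleR_conv_of_real)
      ultimately show "(\<lambda>n. 1 / (2 * pi) * (LINT t|lborel. indicator {- real n<..<real n} t *\<^sub>R
          (kern a b t * char_transform (\<lambda>x. of_real (g x)) t))) \<longlonglongrightarrow> (LINT x:{a<..b}|lborel. of_real (g x))"
        by simp
    qed
  qed
qed

lemma Levy_invertible_kernel_integrable:
  assumes f: "integrable lborel f" and ab: "a \<le> b"
  shows "integrable lborel (\<lambda>t. indicator {- real n<..<real n} t *\<^sub>R (kern a b t * char_transform f t))"
proof -
  have [measurable]: "char_transform f \<in> borel_measurable borel" by (rule char_transform_measurable[OF f])
  define C where "C = (b - a) * (LINT x|lborel. cmod (f x))"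
  show ?thesis
  proof (rule Bochner_Integration.integrable_bound[where f = "\<lambda>t. indicator {- real n<..<real n} t *\<^sub>R C"])
    show "integrable lborel (\<lambda>t::real. indicator {- real n<..<real n} t *\<^sub>R C)"
      by (intro integrable_scaleR_left integrable_real_indicator) auto
    show "AE t in lborel. norm (indicator {- real n<..<real n} t *\<^sub>R (kern a b t * char_transform f t))
        \<le> norm (indicator {- real n<..<real n} t *\<^sub>R C)"
    proof (rule AE_I2)
      fix t :: real
      have "cmod (kern a b t * char_transform f t) \<le> C"
        unfolding norm_mult C_def using kern_bound[OF ab] char_transform_bound[OF f] ab by (intro mult_mono) auto
      then show "norm (indicator {- real n<..<real n} t *\<^sub>R (kern a b t * char_transform f t))
        \<le> norm (indicator {- real n<..<real n} t *\<^sub>R C)" by (auto simp: indicator_def)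
    qed
  qed auto
qed

lemma Levy_invertible_add:
  assumes f: "integrable lborel f" "Levy_invertible f" and g: "integrable lborel g" "Levy_invertible g"
  shows "Levy_invertible (\<lambda>x. f x + g x)"
  unfolding Levy_invertible_def
proof (intro allI impI)
  fix a b :: real assume ab: "a \<le> b"
  have phi: "char_transform (\<lambda>x. f x + g x) t = char_transform f t + char_transform g t" for t
    unfolding char_transform_def distrib_left
    by (intro Bochner_Integration.integral_add integrable_exp_mult f g)
  have si: "set_integrable lborel {a<..b} f" "set_integrable lborel {a<..b} g"
    using f g by (auto simp: set_integrable_def intro!: integrable_mult_indicator)
  let ?J = "\<lambda>f n. LINT t|lborel. indicator {- real n<..<real n} t *\<^sub>R (kern a b t * char_transform f t)"
  have "(\<lambda>n. 1 / (2 * pi) * ?J f n + 1 / (2 * pi) * ?J g n)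
      \<longlonglongrightarrow> (LINT x:{a<..b}|lborel. f x) + (LINT x:{a<..b}|lborel. g x)"
    using f(2) g(2) ab unfolding Levy_invertible_def by (intro tendsto_add) auto
  moreover have "1 / (2 * pi) * ?J f n + 1 / (2 * pi) * ?J g n = 1 / (2 * pi) * ?J (\<lambda>x. f x + g x) n" for n
  proof -
    have "?J (\<lambda>x. f x + g x) n = (LINT t|lborel. indicator {- real n<..<real n} t *\<^sub>R (kern a b t * char_transform f t)
        + indicator {- real n<..<real n} t *\<^sub>R (kern a b t * char_transform g t))"
      by (intro Bochner_Integration.integral_cong) (auto simp: phi distrib_left scaleR_add_right)
    also have "\<dots> = ?J f n + ?J g n"
      by (intro Bochner_Integration.integral_add Levy_invertible_kernel_integrable f g ab)
    finally show ?thesis by (simp only: distrib_left)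
  qed
  ultimately show "(\<lambda>n. 1 / (2 * pi) * ?J (\<lambda>x. f x + g x) n) \<longlonglongrightarrow> (LINT x:{a<..b}|lborel. f x + g x)"
    using set_integral_add(2)[OF si] by simp
qed

lemma Levy_invertible_cmult:
  assumes f: "Levy_invertible f"
  shows "Levy_invertible (\<lambda>x. c * f x)"
  unfolding Levy_invertible_def
proof (intro allI impI)
  fix a b :: real assume ab: "a \<le> b"
  have phi: "char_transform (\<lambda>x. c * f x) t = c * char_transform f t" for t
    unfolding char_transform_def by (simp add: mult.left_commute)
  let ?J = "\<lambda>f n. LINT t|lborel. indicator {- real n<..<real n} t *\<^sub>R (kern a b t * char_transform f t)"
  have "(\<lambda>n. c * (1 / (2 * pi) * ?J f n)) \<longlonglongrightarrow> c * (LINT x:{a<..b}|lborel. f x)"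
    using f ab unfolding Levy_invertible_def by (intro tendsto_mult_left) auto
  moreover have "?J (\<lambda>x. c * f x) n = c * ?J f n" for n
    unfolding phi by (subst integral_mult_right_zero[symmetric])
      (auto intro!: Bochner_Integration.integral_cong simp: mult_ac)
  ultimately show "(\<lambda>n. 1 / (2 * pi) * ?J (\<lambda>x. c * f x) n) \<longlonglongrightarrow> (LINT x:{a<..b}|lborel. c * f x)"
    by (simp add: set_lebesgue_integral_def mult.left_commute)
qed

text \<open>The formula is linear in the density, and integrable functions are combinations of four nonnegative ones.\<close>

lemma Levy_invertible_integrable:
  assumes f: "integrable lborel f"
  shows "Levy_invertible f"
proof -
  have real: "Levy_invertible (\<lambda>x. complex_of_real (g x))" if g: "integrable lborel g" for g :: "real \<Rightarrow> real"
  proof -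
    have p: "integrable lborel (\<lambda>x. max 0 (g x))" "integrable lborel (\<lambda>x. max 0 (- g x))"
      using g by (auto intro!: integrable_max)
    have "Levy_invertible (\<lambda>x. of_real (max 0 (g x)) + (-1) * of_real (max 0 (- g x)))"
      by (intro Levy_invertible_add Levy_invertible_cmult Levy_invertible_nonneg p) (auto intro!: integrable_of_real p)
    moreover have "(\<lambda>x. complex_of_real (max 0 (g x)) + (-1) * of_real (max 0 (- g x))) = (\<lambda>x. of_real (g x))"
      by (auto simp: fun_eq_iff max_def)
    ultimately show ?thesis by simp
  qed
  have i: "integrable lborel (\<lambda>x. Re (f x))" "integrable lborel (\<lambda>x. Im (f x))" using f by auto
  have "Levy_invertible (\<lambda>x. of_real (Re (f x)) + \<i> * of_real (Im (f x)))"
    by (intro Levy_invertible_add Levy_invertible_cmult real i) (auto intro!: integrable_of_real i)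
  then show ?thesis by (simp add: complex_eq[symmetric])
qed

lemma kern_eq_integral:
  assumes ab: "a \<le> b" and t: "t \<noteq> 0"
  shows "(LINT x:{a<..b}|lborel. iexp (-(t * x))) = kern a b t"
proof -
  have "((\<lambda>x. iexp (-(t * x))) has_integral
      (\<i> / t * iexp (-(t * b)) - \<i> / t * iexp (-(t * a)))) {a..b}"
  proof (rule fundamental_theorem_of_calculus[OF ab])
    fix x
    have "((\<lambda>z. \<i> / t * exp (\<i> * (- (complex_of_real t * z)))) has_field_derivative iexp (-(t * x))) (at (of_real x))"
      using t by (auto intro!: derivative_eq_intros simp: field_simps)
    from has_vector_derivative_real_field[OF this, of "{a..b}"]
    show "((\<lambda>x. \<i> / t * iexp (-(t * x))) has_vector_derivative iexp (-(t * x))) (at x within {a..b})"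
      by simp
  qed
  moreover have "(LINT x:{a<..b}|lborel. iexp (-(t * x))) = (LINT x:{a..b}|lborel. iexp (-(t * x)))"
    unfolding set_lebesgue_integral_def
  proof (rule integral_cong_AE)
    show "AE x in lborel. indicat_real {a<..b} x *\<^sub>R iexp (-(t * x)) = indicat_real {a..b} x *\<^sub>R iexp (-(t * x))"
      using AE_lborel_singleton[of a] by eventually_elim (auto simp: indicator_def)
  qed auto
  moreover have "(LINT x:{a..b}|lborel. iexp (-(t * x))) = integral {a..b} (\<lambda>x. iexp (-(t * x)))"
    by (intro set_borel_integral_eq_integral(2) borel_integrable_atLeastAtMost') (intro continuous_intros)
  moreover have "\<i> / t * iexp (-(t * b)) - \<i> / t * iexp (-(t * a)) = kern a b t"
    using t by (simp add: kern_def field_simps)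
  ultimately show ?thesis by (simp add: integral_unique)
qed

text \<open>When the transform is integrable, the limit in Levy's formula is a convergent integral, and Fubini's theorem exhibits it as
  the integral of the inverse transform over the interval. Functions with the same integrals over all intervals agree.\<close>

theorem char_transform_inversion:
  assumes f: "integrable lborel f" and h: "integrable lborel (char_transform f)"
  shows "AE x in lborel. f x = 1 / (2 * pi) * (LINT t|lborel. iexp (-(x * t)) * char_transform f t)"
proof -
  have [measurable]: "f \<in> borel_measurable borel" "char_transform f \<in> borel_measurable borel"
    using f h by auto
  define H where "H x = 1 / (2 * pi) * (LINT t|lborel. iexp (-(x * t)) * char_transform f t)" for x
  have Hphi: "H x = 1 / (2 * pi) * char_transform (char_transform f) (- x)" for x
    by (simp add: H_def char_transform_def)
  have "isCont (\<lambda>x. 1 / (2 * pi) * char_transform (char_transform f) (- x)) x" for x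
    using char_transform_isCont[OF h, of "- x"] by (intro continuous_intros isCont_o2[where f = uminus]) auto
  then have Hc: "continuous_on A H" for A unfolding Hphi[abs_def] by (simp add: continuous_at_imp_continuous_on)
  have [measurable]: "H \<in> borel_measurable borel" by (intro borel_measurable_continuous_onI Hc)
  have Hsi: "set_integrable lborel {a<..b} H" for a b
  proof -
    have "set_integrable lborel {a..b} H" by (intro borel_integrable_atLeastAtMost' Hc)
    then show ?thesis by (rule set_integrable_subset) auto
  qed
  have eq: "(LINT x:{a<..b}|lborel. f x) = (LINT x:{a<..b}|lborel. H x)" if ab: "a \<le> b" for a b
  proof -
    have "(\<lambda>n. LINT t|lborel. indicator {- real n<..<real n} t *\<^sub>R (kern a b t * char_transform f t))
        \<longlonglongrightarrow> (LINT t|lborel. kern a b t * char_transform f t)"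
    proof (rule integral_dominated_convergence[where w = "\<lambda>t. (b - a) * cmod (char_transform f t)"])
      show "AE t in lborel. (\<lambda>n. indicator {- real n<..<real n} t *\<^sub>R (kern a b t * char_transform f t))
          \<longlonglongrightarrow> kern a b t * char_transform f t"
      proof (rule AE_I2)
        fix t :: real
        obtain N :: nat where N: "\<bar>t\<bar> < real N" using reals_Archimedean2 by blast
        have "eventually (\<lambda>n. indicator {- real n<..<real n} t *\<^sub>R (kern a b t * char_transform f t)
            = kern a b t * char_transform f t) sequentially"
          using eventually_ge_at_top[of N] by eventually_elim (use N in \<open>auto simp: indicator_def\<close>)
        then show "(\<lambda>n. indicator {- real n<..<real n} t *\<^sub>R (kern a b t * char_transform f t))
          \<longlonglongrightarrow> kern a b t * char_transform f t" by (rule tendsto_eventually)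
      qed
      show "AE t in lborel. norm (indicator {- real n<..<real n} t *\<^sub>R (kern a b t * char_transform f t))
          \<le> (b - a) * cmod (char_transform f t)" for n
      proof (rule AE_I2)
        fix t :: real
        have "cmod (kern a b t * char_transform f t) \<le> (b - a) * cmod (char_transform f t)"
          unfolding norm_mult using kern_bound[OF ab] by (intro mult_right_mono) auto
        then show "norm (indicator {- real n<..<real n} t *\<^sub>R (kern a b t * char_transform f t))
          \<le> (b - a) * cmod (char_transform f t)" using ab by (auto simp: indicator_def)
      qed
    qed (use h in auto)
    then have "(\<lambda>n. 1 / (2 * pi) * (LINT t|lborel. indicator {- real n<..<real n} t *\<^sub>R (kern a b t * char_transform f t)))
        \<longlonglongrightarrow> 1 / (2 * pi) * (LINT t|lborel. kern a b t * char_transform f t)" by (rule tendsto_mult_left)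
    with Levy_invertible_integrable[OF f] ab
    have 1: "(LINT x:{a<..b}|lborel. f x) = 1 / (2 * pi) * (LINT t|lborel. kern a b t * char_transform f t)"
      unfolding Levy_invertible_def using LIMSEQ_unique by blast
    have "(LINT t|lborel. kern a b t * char_transform f t)
        = (LINT t|lborel. LINT x|lborel. indicator {a<..b} x *\<^sub>R (iexp (-(x * t)) * char_transform f t))"
    proof (rule integral_cong_AE)
      show "AE t in lborel. kern a b t * char_transform f t
          = (LINT x|lborel. indicator {a<..b} x *\<^sub>R (iexp (-(x * t)) * char_transform f t))"
        using AE_lborel_singleton[of 0]
      proof eventually_elim
        case (elim t)
        have "kern a b t * char_transform f t = (LINT x:{a<..b}|lborel. iexp (-(t * x))) * char_transform f t"
          using kern_eq_integral[OF ab elim] by simp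
        also have "\<dots> = (LINT x|lborel. (indicator {a<..b} x *\<^sub>R iexp (-(t * x))) * char_transform f t)"
          unfolding set_lebesgue_integral_def by (rule integral_mult_left_zero[symmetric])
        also have "\<dots> = (LINT x|lborel. indicator {a<..b} x *\<^sub>R (iexp (-(x * t)) * char_transform f t))"
          by (intro Bochner_Integration.integral_cong) (auto simp: mult.commute[of t])
        finally show ?case .
      qed
    qed measurable
    also have "\<dots> = (LINT x|lborel. LINT t|lborel. indicator {a<..b} x *\<^sub>R (iexp (-(x * t)) * char_transform f t))"
    proof (rule lborel_pair.Fubini_integral)
      show "integrable (lborel \<Otimes>\<^sub>M lborel) (\<lambda>(x, t). indicator {a<..b} x *\<^sub>R (iexp (-(x * t)) * char_transform f t))"
      proof (rule lborel_pair.Fubini_integrable)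
        show "(\<lambda>(x, t). indicator {a<..b} x *\<^sub>R (iexp (-(x * t)) * char_transform f t)) \<in> borel_measurable (lborel \<Otimes>\<^sub>M lborel)"
          by measurable
        have "integrable lborel (\<lambda>x. indicator {a<..b} x * (LINT t|lborel. cmod (char_transform f t)))"
          using ab by (intro integrable_mult_left integrable_real_indicator) auto
        then show "integrable lborel (\<lambda>x. LINT t|lborel. norm (case (x, t) of (x, t) \<Rightarrow>
            indicator {a<..b} x *\<^sub>R (iexp (-(x * t)) * char_transform f t)))"
          by (simp add: norm_mult)
        show "AE x in lborel. integrable lborel (\<lambda>t. case (x, t) of (x, t) \<Rightarrow>
            indicator {a<..b} x *\<^sub>R (iexp (-(x * t)) * char_transform f t))"
        proof (rule AE_I2)
          fix x :: real
          have "integrable lborel (\<lambda>t. iexp (- x * t) * char_transform f t)" by (rule integrable_exp_mult[OF h])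
          then show "integrable lborel (\<lambda>t. case (x, t) of (x, t) \<Rightarrow>
            indicator {a<..b} x *\<^sub>R (iexp (-(x * t)) * char_transform f t))" by simp
        qed
      qed
    qed
    finally have 2: "1 / (2 * pi) * (LINT t|lborel. kern a b t * char_transform f t) = (LINT x:{a<..b}|lborel. H x)"
      by (simp add: set_lebesgue_integral_def H_def)
    show ?thesis using 1 2 by simp
  qed
  have "AE x in lborel. \<forall>n::nat. indicator {- real n<..real n} x *\<^sub>R (f x - H x) = 0"
    unfolding AE_all_countable
  proof
    fix n :: nat
    have si: "set_integrable lborel A f" if "A \<in> sets borel" for A
      using f that by (auto simp: set_integrable_def intro: integrable_mult_indicator)
    have fH: "set_integrable lborel {- real n<..real n} (\<lambda>x. f x - H x)"
      by (intro set_integral_diff(1) si Hsi) auto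
    show "AE x in lborel. indicator {- real n<..real n} x *\<^sub>R (f x - H x) = 0"
    proof (rule AE_zero_of_interval_integrals)
      show "integrable lborel (\<lambda>x. indicator {- real n<..real n} x *\<^sub>R (f x - H x))"
        using fH by (simp add: set_integrable_def)
      fix a b :: real
      define a' b' where "a' = max a (- real n)" and "b' = max a' (min b (real n))"
      have "(LINT x:{a<..b}|lborel. indicator {- real n<..real n} x *\<^sub>R (f x - H x))
          = (LINT x:{a'<..b'}|lborel. f x - H x)"
        unfolding set_lebesgue_integral_def
        by (rule Bochner_Integration.integral_cong) (auto simp: indicator_def a'_def b'_def)
      also have "\<dots> = (LINT x:{a'<..b'}|lborel. f x) - (LINT x:{a'<..b'}|lborel. H x)"
        by (intro set_integral_diff(2) si Hsi) auto
      also have "\<dots> = 0" using eq[of a' b'] by (simp add: b'_def)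
      finally show "(LINT x:{a<..b}|lborel. indicator {- real n<..real n} x *\<^sub>R (f x - H x)) = 0" .
    qed
  qed
  then have "AE x in lborel. f x = H x"
  proof eventually_elim
    case (elim x)
    obtain n :: nat where "\<bar>x\<bar> < real n" using reals_Archimedean2 by blast
    then show ?case using elim[rule_format, of n] by (auto simp: indicator_def)
  qed
  then show ?thesis unfolding H_def .
qed

definition ft :: "(real \<Rightarrow> complex) \<Rightarrow> real \<Rightarrow> complex"
  where "ft f t = integral\<^sup>L lborel (\<lambda>x. exp (- 2 * pi * \<i> * of_real t * of_real x) * f x)"

lemma ft_exponent: "exp (- 2 * pi * \<i> * of_real t * of_real x) = iexp (- (2 * pi * t) * x)"
  by (simp add: mult_ac)

lemma ft_eq_char_transform: "ft f t = char_transform f (- (2 * pi * t))"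
  unfolding ft_def char_transform_def ft_exponent ..

lemma ft_bound: "integrable lborel f \<Longrightarrow> cmod (ft f t) \<le> (LINT x|lborel. cmod (f x))"
  unfolding ft_eq_char_transform by (rule char_transform_bound)

lemma ft_isCont: "integrable lborel f \<Longrightarrow> isCont (ft f) t"
  unfolding ft_eq_char_transform [abs_def]
  by (rule isCont_o2[where f = "\<lambda>t. - (2 * pi * t)"]) (auto intro!: continuous_intros char_transform_isCont)

lemma ft_continuous: "integrable lborel f \<Longrightarrow> continuous_on A (ft f)"
  by (meson ft_isCont continuous_at_imp_continuous_on)

lemma ft_cong_AE:
  assumes "AE x in lborel. f x = g x" "integrable lborel f" "integrable lborel g"
  shows "ft f t = ft g t"
proof -
  have [measurable]: "f \<in> borel_measurable borel" "g \<in> borel_measurable borel" using assms by auto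
  show ?thesis unfolding ft_def
    by (rule integral_cong_AE) (use assms(1) in \<open>auto elim: AE_mp\<close>)
qed

lemma ft_integrand: "integrable lborel f \<Longrightarrow>
    integrable lborel (\<lambda>x. exp (- 2 * pi * \<i> * of_real t * of_real x) * f x)"
  unfolding ft_exponent by (rule integrable_exp_mult)

lemma ft_add: "integrable lborel f \<Longrightarrow> integrable lborel g \<Longrightarrow> ft (\<lambda>x. f x + g x) t = ft f t + ft g t"
  unfolding ft_def distrib_left by (intro Bochner_Integration.integral_add ft_integrand)

lemma ft_diff: "integrable lborel f \<Longrightarrow> integrable lborel g \<Longrightarrow> ft (\<lambda>x. f x - g x) t = ft f t - ft g t"
  unfolding ft_def right_diff_distrib by (intro Bochner_Integration.integral_diff ft_integrand)

lemma ft_cmult: "ft (\<lambda>x. c * f x) t = c * ft f t"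
  unfolding ft_def by (simp add: mult.left_commute)

theorem Fourier_inversion:
  assumes f: "integrable lborel f" and h: "integrable lborel (ft f)"
  shows "AE x in lborel. f x = (LINT t|lborel. iexp (2 * pi * t * x) * ft f t)"
proof -
  have "integrable lborel (\<lambda>t. char_transform f (0 + (- (2 * pi)) * t))"
    using h by (simp add: ft_eq_char_transform [abs_def])
  then have h': "integrable lborel (char_transform f)"
    by (subst (asm) lborel_integrable_real_affine_iff) auto
  have eq: "(LINT t|lborel. iexp (-(x * t)) * char_transform f t)
      = 2 * pi * (LINT t|lborel. iexp (2 * pi * t * x) * ft f t)" for x
    by (subst lborel_integral_real_affine[of "- (2 * pi)" _ 0])
      (auto simp: ft_eq_char_transform scaleR_conv_of_real mult_ac)
  show ?thesis using char_transform_inversion[OF f h'] unfolding eq by simp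
qed

lemma ft_eq_0_imp_AE_0:
  assumes f: "integrable lborel f" and zero: "\<And>t. ft f t = 0"
  shows "AE x in lborel. f x = 0"
proof -
  have "ft f = (\<lambda>_. 0)" using zero by auto
  then show ?thesis using Fourier_inversion[OF f] by simp
qed

section \<open>Band-limited functions\<close>

text \<open>The function synthesized from the frequencies in \<open>[\<alpha>, \<beta>]\<close> with amplitudes \<open>p\<close>.\<close>

definition synth :: "real \<Rightarrow> real \<Rightarrow> (real \<Rightarrow> complex) \<Rightarrow> complex \<Rightarrow> complex"
  where "synth \<alpha> \<beta> p z = integral {\<alpha>..\<beta>} (\<lambda>t. p t * exp (2 * pi * \<i> * of_real t * z))"

lemma synth_integrable:
  "continuous_on {\<alpha>..\<beta>} p \<Longrightarrow> (\<lambda>t. p t * exp (2 * pi * \<i> * of_real t * z)) integrable_on {\<alpha>..\<beta>}"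
  by (intro integrable_continuous_real continuous_intros)

lemma synth_holomorphic:
  assumes p: "continuous_on {\<alpha>..\<beta>} p"
  shows "synth \<alpha> \<beta> p holomorphic_on UNIV"
proof -
  have "(\<lambda>z. integral (cbox \<alpha> \<beta>) (\<lambda>t. p t * exp (2 * pi * \<i> * of_real t * z))) holomorphic_on UNIV"
  proof (rule leibniz_rule_holomorphic)
    show "((\<lambda>z. p t * exp (2 * pi * \<i> * of_real t * z)) has_field_derivative
        p t * (2 * pi * \<i> * of_real t * exp (2 * pi * \<i> * of_real t * z))) (at z within UNIV)" for z t
      by (auto intro!: derivative_eq_intros)
    show "(\<lambda>t. p t * exp (2 * pi * \<i> * of_real t * z)) integrable_on cbox \<alpha> \<beta>" for z
      using synth_integrable[OF p] by simp
    have "continuous_on (UNIV \<times> cbox \<alpha> \<beta>) (\<lambda>x. p (snd x))"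
      by (rule continuous_on_compose2[OF p]) (auto intro!: continuous_intros)
    then show "continuous_on (UNIV \<times> cbox \<alpha> \<beta>) (\<lambda>(z, t). p t * (2 * pi * \<i> * of_real t * exp (2 * pi * \<i> * of_real t * z)))"
      unfolding split_beta by (intro continuous_intros)
  qed auto
  then show ?thesis by (simp add: synth_def [abs_def])
qed

lemma synth_bound:
  assumes p: "continuous_on {\<alpha>..\<beta>} p" and ab: "\<alpha> \<le> \<beta>" and M: "\<And>t. t \<in> {\<alpha>..\<beta>} \<Longrightarrow> cmod (p t) \<le> M"
    and E: "\<And>t. t \<in> {\<alpha>..\<beta>} \<Longrightarrow> - (2 * pi * t * Im z) \<le> E"
  shows "cmod (synth \<alpha> \<beta> p z) \<le> (\<beta> - \<alpha>) * M * exp E"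
proof -
  have "cmod (synth \<alpha> \<beta> p z) \<le> integral {\<alpha>..\<beta>} (\<lambda>t. M * exp E)"
    unfolding synth_def
  proof (rule integral_norm_bound_integral[OF synth_integrable[OF p]])
    fix t assume t: "t \<in> {\<alpha>..\<beta>}"
    have "cmod (p t * exp (2 * pi * \<i> * of_real t * z)) = cmod (p t) * exp (- (2 * pi * t * Im z))"
      by (simp add: norm_mult)
    also have "\<dots> \<le> M * exp E"
      using M[OF t] E[OF t] order_trans[OF norm_ge_zero M[OF t]] by (intro mult_mono) auto
    finally show "cmod (p t * exp (2 * pi * \<i> * of_real t * z)) \<le> M * exp E" .
  qed auto
  also have "\<dots> = (\<beta> - \<alpha>) * M * exp E" using ab by simp
  finally show ?thesis .
qed

lemma synth_decays:
  assumes p: "continuous_on {\<alpha>..\<beta>} p" and ab: "\<alpha> \<le> \<beta>"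
  shows "decays (2 * pi * \<alpha>) (synth \<alpha> \<beta> p)" "decays (- (2 * pi * \<beta>)) (star (synth \<alpha> \<beta> p))"
proof -
  have "bounded (p ` {\<alpha>..\<beta>})" by (intro compact_imp_bounded compact_continuous_image p) auto
  then obtain M where "\<forall>x\<in>p ` {\<alpha>..\<beta>}. cmod x \<le> M" unfolding bounded_iff by blast
  then have M: "cmod (p t) \<le> M" if "t \<in> {\<alpha>..\<beta>}" for t using that by blast
  show "decays (2 * pi * \<alpha>) (synth \<alpha> \<beta> p)"
  proof (rule decaysI)
    fix z assume z: "0 \<le> Im z"
    show "cmod (synth \<alpha> \<beta> p z) \<le> (\<beta> - \<alpha>) * M * exp (- (2 * pi * \<alpha>) * Im z)"
      by (rule synth_bound[OF p ab M]) (use z in \<open>auto intro: mult_right_mono\<close>)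
  qed
  show "decays (- (2 * pi * \<beta>)) (star (synth \<alpha> \<beta> p))"
  proof (rule decaysI)
    fix z assume z: "0 \<le> Im z"
    have "cmod (synth \<alpha> \<beta> p (cnj z)) \<le> (\<beta> - \<alpha>) * M * exp (- (- (2 * pi * \<beta>)) * Im z)"
      by (rule synth_bound[OF p ab M]) (use z in \<open>auto intro: mult_right_mono\<close>)
    then show "cmod (star (synth \<alpha> \<beta> p) z) \<le> (\<beta> - \<alpha>) * M * exp (- (- (2 * pi * \<beta>)) * Im z)"
      by (simp add: star_def)
  qed
qed

lemma band_limited_AE_synth:
  assumes f: "integrable lborel f" and supp: "\<And>t. t \<notin> {\<alpha>..\<beta>} \<Longrightarrow> ft f t = 0"
  shows "AE x in lborel. f x = synth \<alpha> \<beta> (ft f) (of_real x)"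
proof -
  have si: "set_integrable lborel {\<alpha>..\<beta>} (ft f)"
    by (intro borel_integrable_atLeastAtMost' ft_continuous f)
  have "(\<lambda>t. indicator {\<alpha>..\<beta>} t *\<^sub>R ft f t) = ft f"
    using supp by (auto simp: fun_eq_iff indicator_def)
  then have h: "integrable lborel (ft f)" using si by (simp add: set_integrable_def)
  have eq: "(LINT t|lborel. iexp (2 * pi * t * x) * ft f t) = synth \<alpha> \<beta> (ft f) (of_real x)" for x
  proof -
    have "(LINT t|lborel. iexp (2 * pi * t * x) * ft f t) = (LINT t:{\<alpha>..\<beta>}|lborel. ft f t * exp (2 * pi * \<i> * of_real t * of_real x))"
      unfolding set_lebesgue_integral_def
      by (rule Bochner_Integration.integral_cong) (use supp in \<open>auto simp: indicator_def mult_ac\<close>)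
    also have "\<dots> = synth \<alpha> \<beta> (ft f) (of_real x)" unfolding synth_def
      by (intro set_borel_integral_eq_integral(2) borel_integrable_atLeastAtMost' continuous_intros ft_continuous f)
    finally show ?thesis .
  qed
  show ?thesis using Fourier_inversion[OF f h] unfolding eq .
qed

lemma csinc_square_real: "csinc (of_real e * of_real x) ^ 2 = of_real ((if e * x = 0 then 1 else sin (e * x) / (e * x))\<^sup>2)"
  unfolding of_real_mult[symmetric] csinc_of_real by simp

lemma sinc_square_le_1: "(if e * x = 0 then 1 else sin (e * x) / (e * x))\<^sup>2 \<le> (1::real)"
proof (cases "e * x = 0")
  case False
  have "\<bar>sin (e * x) / (e * x)\<bar> \<le> 1" using abs_sin_x_le_abs_x[of "e * x"] False by simp
  then show ?thesis using False by (simp only: if_False abs_square_le_1)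
qed simp

lemma csinc_square_bound: "cmod (csinc (of_real e * of_real x) ^ 2) \<le> 1"
  unfolding csinc_square_real using sinc_square_le_1[of e x] by (simp only: norm_of_real) simp

lemma csinc_square_tendsto: "(\<lambda>n. csinc (of_real (1 / real (Suc n)) * of_real x) ^ 2) \<longlonglongrightarrow> 1"
proof -
  have "isCont csinc 0" using entire_continuous[OF holomorphic_csinc, of UNIV] by (simp add: continuous_on_eq_continuous_at)
  moreover have "(\<lambda>n. of_real (1 / real (Suc n)) * of_real x) \<longlonglongrightarrow> complex_of_real 0 * of_real x"
    by (intro tendsto_intros LIMSEQ_Suc[OF lim_const_over_n])
  ultimately have "(\<lambda>n. csinc (of_real (1 / real (Suc n)) * of_real x)) \<longlonglongrightarrow> csinc 0"
    by (intro isCont_tendsto_compose[of 0 csinc]) auto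
  then have "(\<lambda>n. csinc (of_real (1 / real (Suc n)) * of_real x) ^ 2) \<longlonglongrightarrow> csinc 0 ^ 2" by (intro tendsto_intros)
  then show ?thesis by (simp add: csinc_def)
qed

text \<open>After multiplication by a convergence factor, the integral defining the transform can be moved into the upper half-plane.\<close>

lemma smoothed_ft_eq_0:
  assumes F: "F holomorphic_on UNIV" "decays (2 * pi * \<alpha>) F" and e: "e > 0" "pi * t + e \<le> pi * \<alpha>"
  shows "integrable lborel (\<lambda>x. exp (- 2 * pi * \<i> * of_real t * of_real x) * (F (of_real x) * csinc (of_real e * of_real x) ^ 2))"
    "ft (\<lambda>x. F (of_real x) * csinc (of_real e * of_real x) ^ 2) t = 0"
proof -
  define P where "P z = exp (- 2 * pi * \<i> * of_real t * z) * (F z * csinc (of_real e * z) ^ 2)" for z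
  have P: "P holomorphic_on UNIV" unfolding P_def
    by (intro holomorphic_intros F holomorphic_csinc_power)
  obtain C where C: "C \<ge> 0" "\<And>z. 0 \<le> Im z \<Longrightarrow> cmod (F z) \<le> C * exp (- (2 * pi * \<alpha>) * Im z)"
    using F(2) by (elim decaysE) auto
  have bd: "cmod (P z) \<le> (4 * C * (1 + 1 / e\<^sup>2)) / (1 + (cmod z)\<^sup>2)" if z: "0 \<le> Im z" for z
  proof -
    have "cmod (csinc (of_real e * z) ^ 2) \<le> 2\<^sup>2 * exp (real 2 * e * \<bar>Im z\<bar>) / (1 + e * cmod z)\<^sup>2"
      by (rule cmod_csinc_power_le[OF e(1)])
    then have "cmod (P z) \<le> exp (2 * pi * t * Im z) * ((C * exp (- (2 * pi * \<alpha>) * Im z)) *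
        (4 * exp (2 * e * Im z) / (1 + e * cmod z)\<^sup>2))"
      unfolding P_def norm_mult using C z by (intro mult_mono) auto
    also have "\<dots> = 4 * C * exp (2 * (pi * t + e - pi * \<alpha>) * Im z) * (1 / (1 + e * cmod z)\<^sup>2)"
    proof -
      have E: "exp (2 * (pi * t + e - pi * \<alpha>) * Im z)
          = exp (2 * pi * t * Im z) * exp (- (2 * pi * \<alpha>) * Im z) * exp (2 * e * Im z)"
        by (simp only: exp_add[symmetric]) (simp add: algebra_simps)
      show ?thesis unfolding E by simp
    qed
    also have "\<dots> \<le> 4 * C * 1 * ((1 + 1 / e\<^sup>2) / (1 + (cmod z)\<^sup>2))"
    proof (intro mult_mono)
      have "2 * (pi * t + e - pi * \<alpha>) \<le> 0" using e by simp
      then have "2 * (pi * t + e - pi * \<alpha>) * Im z \<le> 0" using z by (rule mult_nonpos_nonneg)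
      then show "exp (2 * (pi * t + e - pi * \<alpha>) * Im z) \<le> 1" by simp
      show "1 / (1 + e * cmod z)\<^sup>2 \<le> (1 + 1 / e\<^sup>2) / (1 + (cmod z)\<^sup>2)" by (rule one_plus_square_le[OF e(1)]) simp
    qed (use C in auto)
    finally show ?thesis by simp
  qed
  from integral_upper_half_plane_zero[OF P bd]
  show "integrable lborel (\<lambda>x. exp (- 2 * pi * \<i> * of_real t * of_real x) * (F (of_real x) * csinc (of_real e * of_real x) ^ 2))"
    "ft (\<lambda>x. F (of_real x) * csinc (of_real e * of_real x) ^ 2) t = 0"
    by (simp_all add: P_def ft_def)
qed

lemma ft_smoothed_tendsto:
  assumes f: "integrable lborel f"
  shows "(\<lambda>n. ft (\<lambda>x. f x * csinc (of_real (1 / real (Suc n)) * of_real x) ^ 2) t) \<longlonglongrightarrow> ft f t"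
  unfolding ft_def
proof (rule integral_dominated_convergence[where w = "\<lambda>x. cmod (f x)"])
  have [measurable]: "f \<in> borel_measurable borel" using f by auto
  have m [measurable]: "(\<lambda>x. csinc (of_real (1 / real (Suc n)) * of_real x) ^ 2) \<in> borel_measurable borel" for n
    by (rule entire_real_measurable[OF holomorphic_csinc_power])
  show "(\<lambda>x. exp (- 2 * pi * \<i> * of_real t * of_real x) * f x) \<in> borel_measurable lborel" by measurable
  show "(\<lambda>x. exp (- 2 * pi * \<i> * of_real t * of_real x) * (f x * csinc (of_real (1 / real (Suc n)) * of_real x) ^ 2)) \<in> borel_measurable lborel" for n
    using m[of n] by measurable
  show "AE x in lborel. (\<lambda>n. exp (- 2 * pi * \<i> * of_real t * of_real x) * (f x * csinc (of_real (1 / real (Suc n)) * of_real x) ^ 2))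
      \<longlonglongrightarrow> exp (- 2 * pi * \<i> * of_real t * of_real x) * f x"
  proof (rule AE_I2)
    fix x
    have "(\<lambda>n. exp (- 2 * pi * \<i> * of_real t * of_real x) * (f x * csinc (of_real (1 / real (Suc n)) * of_real x) ^ 2))
      \<longlonglongrightarrow> exp (- 2 * pi * \<i> * of_real t * of_real x) * (f x * 1)"
      by (intro tendsto_mult_left csinc_square_tendsto)
    then show "(\<lambda>n. exp (- 2 * pi * \<i> * of_real t * of_real x) * (f x * csinc (of_real (1 / real (Suc n)) * of_real x) ^ 2))
      \<longlonglongrightarrow> exp (- 2 * pi * \<i> * of_real t * of_real x) * f x" by simp
  qed
  show "AE x in lborel. norm (exp (- 2 * pi * \<i> * of_real t * of_real x) * (f x * csinc (of_real (1 / real (Suc n)) * of_real x) ^ 2)) \<le> cmod (f x)" for n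
  proof (rule AE_I2)
    fix x
    have "cmod (f x) * cmod (csinc (of_real (1 / real (Suc n)) * of_real x) ^ 2) \<le> cmod (f x) * 1"
      by (intro mult_left_mono csinc_square_bound) auto
    moreover have "cmod (exp (- 2 * pi * \<i> * of_real t * of_real x)) = 1" by simp
    ultimately show "norm (exp (- 2 * pi * \<i> * of_real t * of_real x) * (f x * csinc (of_real (1 / real (Suc n)) * of_real x) ^ 2)) \<le> cmod (f x)"
      by (simp only: norm_mult mult_1_right mult_1_left)
  qed
qed (use f in auto)

text \<open>Decay in the upper half-plane pushes the spectrum to the right. Smoothing by convergence factors makes this
  work also for sums of two functions that decay in opposite half-planes and are not integrable separately.\<close>

lemma spectral_gap_of_decay:
  assumes f: "integrable lborel f" and eq: "\<And>x. f x = F (of_real x) + G (of_real x)"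
    and F: "F holomorphic_on UNIV" "decays (2 * pi * \<alpha>) F"
    and G: "G holomorphic_on UNIV" "decays (- (2 * pi * \<beta>)) (star G)" and t: "\<beta> < t" "t < \<alpha>"
  shows "ft f t = 0"
proof -
  define k where "k n x = csinc (of_real (1 / real (Suc n)) * of_real x) ^ 2" for n and x :: real
  have G0: "integrable lborel (\<lambda>x. exp (- 2 * pi * \<i> * of_real t * of_real x) * (G (of_real x) * k n x))
      \<and> ft (\<lambda>x. G (of_real x) * k n x) t = 0" if n: "1 / real (Suc n) \<le> pi * (t - \<beta>)" for n
  proof -
    have "pi * - t + 1 / real (Suc n) \<le> pi * - \<beta>" using n by (simp add: algebra_simps)
    note S = smoothed_ft_eq_0[OF holomorphic_star[OF G(1)], of "- \<beta>" "1 / real (Suc n)" "- t", OF _ _ this]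
    have d: "decays (2 * pi * - \<beta>) (star G)" using G(2) by simp
    have cj: "cnj (exp (- 2 * pi * \<i> * of_real (- t) * of_real x) * (star G (of_real x) * k n x))
        = exp (- 2 * pi * \<i> * of_real t * of_real x) * (G (of_real x) * k n x)" for x
    proof -
      have "cnj (k n x) = k n x" unfolding k_def csinc_square_real by simp
      then show ?thesis by (simp add: star_def exp_cnj)
    qed
    have "integrable lborel (\<lambda>x. exp (- 2 * pi * \<i> * of_real (- t) * of_real x) * (star G (of_real x) * k n x))"
      using S(1)[OF d] by (simp add: k_def)
    then have "integrable lborel (\<lambda>x. cnj (exp (- 2 * pi * \<i> * of_real (- t) * of_real x) * (star G (of_real x) * k n x)))"
      by (simp only: complex_integrable_cnj)
    moreover have "ft (\<lambda>x. G (of_real x) * k n x) t = cnj (ft (\<lambda>x. star G (of_real x) * k n x) (- t))"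
      unfolding ft_def cj[symmetric] by (rule Bochner_Integration.integral_cnj)
    ultimately show ?thesis using S(2)[OF d] unfolding cj by (simp add: k_def)
  qed
  have F0: "integrable lborel (\<lambda>x. exp (- 2 * pi * \<i> * of_real t * of_real x) * (F (of_real x) * k n x))
      \<and> ft (\<lambda>x. F (of_real x) * k n x) t = 0" if n: "1 / real (Suc n) \<le> pi * (\<alpha> - t)" for n
    using smoothed_ft_eq_0[OF F, of "1 / real (Suc n)" t] n by (simp add: k_def algebra_simps)
  have "(\<lambda>n. ft (\<lambda>x. f x * k n x) t) \<longlonglongrightarrow> ft f t" unfolding k_def by (rule ft_smoothed_tendsto[OF f])
  moreover have "eventually (\<lambda>n. ft (\<lambda>x. f x * k n x) t = 0) sequentially"
  proof -
    have l: "(\<lambda>n. 1 / real (Suc n)) \<longlonglongrightarrow> 0" by (rule LIMSEQ_Suc[OF lim_const_over_n])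
    have "0 < pi * (t - \<beta>)" "0 < pi * (\<alpha> - t)" using t by auto
    then have "eventually (\<lambda>n. 1 / real (Suc n) < pi * (t - \<beta>)) sequentially"
      "eventually (\<lambda>n. 1 / real (Suc n) < pi * (\<alpha> - t)) sequentially"
      using order_tendstoD(2)[OF l] by auto
    then show ?thesis
    proof eventually_elim
      case (elim n)
      have "ft (\<lambda>x. f x * k n x) t = ft (\<lambda>x. F (of_real x) * k n x) t + ft (\<lambda>x. G (of_real x) * k n x) t"
        unfolding ft_def eq distrib_right distrib_left
        by (rule Bochner_Integration.integral_add) (use F0 G0 elim in auto)
      then show ?case using F0[of n] G0[of n] elim by simp
    qed
  qed
  ultimately have "(\<lambda>n. 0) \<longlonglongrightarrow> ft f t" by (rule Lim_transform_eventually)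
  then show ?thesis by (simp add: LIMSEQ_const_iff)
qed

lemma decays_zero: "decays a (\<lambda>_. 0)"
  by (rule decaysI[of _ 0]) simp

lemma star_zero [simp]: "star (\<lambda>_. 0) = (\<lambda>_. 0)" by (simp add: star_def fun_eq_iff)

lemma ft_left_of_band:
  assumes "integrable lborel (\<lambda>x. F (of_real x))" "F holomorphic_on UNIV" "decays (2 * pi * \<alpha>) F" "t < \<alpha>"
  shows "ft (\<lambda>x. F (of_real x)) t = 0"
  by (rule spectral_gap_of_decay[OF assms(1) _ assms(2,3), of "\<lambda>_. 0" "t - 1"]) (use assms(4) decays_zero in auto)

lemma ft_right_of_band:
  assumes "integrable lborel (\<lambda>x. G (of_real x))" "G holomorphic_on UNIV" "decays (- (2 * pi * \<beta>)) (star G)" "\<beta> < t"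
  shows "ft (\<lambda>x. G (of_real x)) t = 0"
  by (rule spectral_gap_of_decay[OF assms(1) _ _ _ assms(2,3), of "\<lambda>_. 0" "t + 1"]) (use assms(4) decays_zero in auto)

section \<open>Convolution and the separation of spectral intervals\<close>

definition conv :: "(real \<Rightarrow> complex) \<Rightarrow> (real \<Rightarrow> complex) \<Rightarrow> real \<Rightarrow> complex"
  where "conv f g x = (LINT y|lborel. f y * g (x - y))"

lemma conv_ft:
  assumes f: "integrable lborel f" and g: "integrable lborel g"
  shows "integrable lborel (conv f g)" "ft (conv f g) t = ft f t * ft g t"
proof -
  have [measurable]: "f \<in> borel_measurable borel" "g \<in> borel_measurable borel" using f g by auto
  have gs: "integrable lborel (\<lambda>x. g (x - y))" for y
    using lborel_integrable_real_affine[OF g, of 1 "- y"] by simp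
  have int: "integrable (lborel \<Otimes>\<^sub>M lborel) (\<lambda>(y, x). f y * g (x - y))"
  proof (rule lborel_pair.Fubini_integrable)
    show "(\<lambda>(y, x). f y * g (x - y)) \<in> borel_measurable (lborel \<Otimes>\<^sub>M lborel)" by measurable
    have "(LINT x|lborel. cmod (g (x - y))) = (LINT x|lborel. cmod (g x))" for y
      using lborel_integral_real_affine[of 1 "\<lambda>x. cmod (g x)" "- y"] by simp
    then show "integrable lborel (\<lambda>y. LINT x|lborel. norm (case (y, x) of (y, x) \<Rightarrow> f y * g (x - y)))"
      using f by (simp add: norm_mult)
    show "AE y in lborel. integrable lborel (\<lambda>x. case (y, x) of (y, x) \<Rightarrow> f y * g (x - y))"
      using gs by simp
  qed
  then show ci: "integrable lborel (conv f g)"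
    using lborel_pair.integrable_snd[of "\<lambda>y x. f y * g (x - y)"] by (simp add: conv_def [abs_def])
  let ?E = "\<lambda>x. iexp (- (2 * pi * t) * x)"
  have "ft (conv f g) t = (LINT x|lborel. LINT y|lborel. ?E x * (f y * g (x - y)))"
    unfolding ft_def ft_exponent conv_def by simp
  also have "\<dots> = (LINT y|lborel. LINT x|lborel. ?E x * (f y * g (x - y)))"
  proof (rule lborel_pair.Fubini_integral)
    show "integrable (lborel \<Otimes>\<^sub>M lborel) (\<lambda>(y, x). ?E x * (f y * g (x - y)))"
      by (rule Bochner_Integration.integrable_bound[OF int]) (auto simp: norm_mult)
  qed
  also have "\<dots> = (LINT y|lborel. ?E y * f y * ft g t)"
  proof (rule Bochner_Integration.integral_cong)
    fix y :: real
    have "(LINT x|lborel. ?E x * (f y * g (x - y))) = (LINT x|lborel. ?E (y + 1 * x) * (f y * g (y + 1 * x - y)))"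
      by (subst lborel_integral_real_affine[of 1 _ y]) auto
    also have "\<dots> = (LINT x|lborel. (?E y * f y) * (?E x * g x))"
      by (rule Bochner_Integration.integral_cong) (auto simp: algebra_simps exp_add[symmetric] mult_exp_exp)
    also have "\<dots> = ?E y * f y * ft g t" unfolding ft_def ft_exponent by simp
    finally show "(LINT x|lborel. ?E x * (f y * g (x - y))) = ?E y * f y * ft g t" .
  qed simp
  also have "\<dots> = ft f t * ft g t" unfolding ft_def[of f] ft_exponent by simp
  finally show "ft (conv f g) t = ft f t * ft g t" .
qed

lemma AE_eq_imp_eq_on_open:
  fixes f g :: "real \<Rightarrow> complex"
  assumes ae: "AE x in lborel. x \<in> U \<longrightarrow> f x = g x" and U: "open U" "y \<in> U"
    and f: "continuous_on UNIV f" and g: "continuous_on UNIV g"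
  shows "f y = g y"
proof -
  have "y \<in> {x. f x = g x}"
  proof (rule mem_closed_if_AE_lebesgue_open[OF U(1) _ _ U(2)])
    show "closed {x. f x = g x}" by (rule closed_Collect_eq[OF f g])
    show "AE x\<in>U in lebesgue. x \<in> {x. f x = g x}" using AE_completion[OF ae] by simp
  qed
  then show ?thesis by simp
qed

lemma entire_unique_AE:
  assumes F: "F holomorphic_on UNIV" and G: "G holomorphic_on UNIV"
    and ae: "AE x in lborel. F (of_real x) = G (complex_of_real x)"
  shows "F = G"
proof (rule entire_eq_on_reals[OF F G])
  show "F (of_real x) = G (of_real x)" for x
    by (rule AE_eq_imp_eq_on_open[of UNIV "\<lambda>x. F (of_real x)" "\<lambda>x. G (of_real x)"])
      (use ae in \<open>auto intro!: entire_real_continuous F G\<close>)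
qed

lemma integrable_indicator_Ioc: "integrable lborel (indicator {a<..b::real} :: real \<Rightarrow> complex)"
proof -
  have "integrable lborel (\<lambda>x. complex_of_real (indicator {a<..b} x))"
    by (intro integrable_of_real integrable_real_indicator; cases "a \<le> b"; simp)
  moreover have "(\<lambda>x. complex_of_real (indicator {a<..b} x)) = indicator {a<..b}"
    by (auto simp: indicator_def)
  ultimately show ?thesis by simp
qed

lemma ft_indicator_bound:
  assumes ab: "a \<le> b"
  shows "cmod (ft (indicator {a<..b}) t) \<le> (b - a + 1) / (1 + \<bar>t\<bar>)"
proof (cases "t = 0")
  case True
  have "cmod (ft (indicator {a<..b}) 0) \<le> (LINT x|lborel. cmod (indicator {a<..b} x))"
    by (rule ft_bound[OF integrable_indicator_Ioc])
  also have "\<dots> = b - a"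
  proof -
    have "(LINT x|lborel. cmod (indicator {a<..b} x)) = (LINT x|lborel. indicator {a<..b} x)"
      by (rule Bochner_Integration.integral_cong) (auto simp: indicator_def)
    then show ?thesis using ab by simp
  qed
  finally show ?thesis using True by simp
next
  case False
  have "ft (indicator {a<..b}) t = (LINT x:{a<..b}|lborel. iexp (-((2 * pi * t) * x)))"
    unfolding ft_def ft_exponent set_lebesgue_integral_def
    by (rule Bochner_Integration.integral_cong) (auto simp: indicator_def)
  also have "\<dots> = kern a b (2 * pi * t)" using False by (intro kern_eq_integral ab) auto
  finally have eq: "ft (indicator {a<..b}) t = kern a b (2 * pi * t)" .
  have 1: "cmod (kern a b (2 * pi * t)) \<le> b - a" by (rule kern_bound[OF ab])
  have "cmod (iexp (-((2 * pi * t) * a)) - iexp (-((2 * pi * t) * b))) \<le> 1 + 1"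
    by (rule norm_triangle_le_diff) (intro add_mono, simp_all)
  moreover have "cmod (kern a b T) * \<bar>T\<bar> = cmod (iexp (-(T * a)) - iexp (-(T * b)))" if "T \<noteq> 0" for T
    using that by (simp add: kern_def norm_divide norm_mult)
  ultimately have "cmod (kern a b (2 * pi * t)) * \<bar>2 * pi * t\<bar> \<le> 2"
    using False by simp
  moreover have "2 * \<bar>t\<bar> \<le> \<bar>2 * pi * t\<bar>" using pi_ge_two by (simp add: abs_mult mult_right_mono)
  ultimately have "cmod (kern a b (2 * pi * t)) * (2 * \<bar>t\<bar>) \<le> 2"
    by (meson mult_left_mono norm_ge_zero order_trans)
  then have "cmod (kern a b (2 * pi * t)) * (1 + \<bar>t\<bar>) \<le> b - a + 1" using 1 by (simp add: algebra_simps)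
  then show ?thesis unfolding eq by (simp add: pos_le_divide_eq add_pos_nonneg)
qed

text \<open>The convolution of two indicator functions is a trapezoid that is constant on \<open>[\<rho>, \<sigma>]\<close> and vanishes on the
  negative axis. Its transform is a product of two functions of first-order decay, hence integrable, so that
  by inversion its reflection is a kernel whose transform is the trapezoid.\<close>

lemma splitting_kernel:
  fixes \<rho> \<sigma> :: real
  assumes \<rho>: "0 < \<rho>" "\<rho> \<le> \<sigma>"
  obtains V where "integrable lborel V" "\<And>t. \<rho> \<le> t \<Longrightarrow> t \<le> \<sigma> \<Longrightarrow> ft V t = 1"
    "\<And>t. t \<le> - \<rho> \<Longrightarrow> ft V t = 0"
proof -
  \<comment> \<open>The lengths \<open>\<sigma>\<close> and \<open>\<rho>/2\<close> are chosen so that the height of the trapezoid is \<open>\<rho>/2\<close>, attained between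
    \<open>3 * \<rho> / 4\<close> and \<open>\<sigma> + \<rho> / 4\<close>; the support starts at \<open>\<rho> / 4\<close>.\<close>
  define A where "A = {\<rho>/2<..\<sigma> + \<rho>/2}"
  define B where "B = {- (\<rho>/4)<..\<rho>/4}"
  let ?A = "indicator A :: real \<Rightarrow> complex" and ?B = "indicator B :: real \<Rightarrow> complex"
  have int: "integrable lborel ?A" "integrable lborel ?B" unfolding A_def B_def by (rule integrable_indicator_Ioc)+
  define \<tau> where "\<tau> = conv ?A ?B"
  have \<tau>: "integrable lborel \<tau>" "\<And>t. ft \<tau> t = ft ?A t * ft ?B t"
    unfolding \<tau>_def using conv_ft[OF int] by auto
  define c where "c = (\<sigma> + 1) * (\<rho>/2 + 1)"
  have bd: "cmod (ft \<tau> t) \<le> c / (1 + t\<^sup>2)" for t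
  proof -
    have "cmod (ft ?A t) \<le> (\<sigma> + 1) / (1 + \<bar>t\<bar>)"
      using ft_indicator_bound[of "\<rho>/2" "\<sigma> + \<rho>/2" t] \<rho> by (simp add: A_def)
    moreover have "cmod (ft ?B t) \<le> (\<rho>/2 + 1) / (1 + \<bar>t\<bar>)"
      using ft_indicator_bound[of "- (\<rho>/4)" "\<rho>/4" t] \<rho> by (simp add: B_def)
    ultimately have "cmod (ft \<tau> t) \<le> ((\<sigma> + 1) / (1 + \<bar>t\<bar>)) * ((\<rho>/2 + 1) / (1 + \<bar>t\<bar>))"
      unfolding \<tau>(2) norm_mult using \<rho> by (intro mult_mono) auto
    also have "\<dots> = c / (1 + \<bar>t\<bar>)\<^sup>2" by (simp add: c_def power2_eq_square)
    also have "\<dots> \<le> c / (1 + t\<^sup>2)"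
    proof (intro divide_left_mono mult_pos_pos)
      show "1 + t\<^sup>2 \<le> (1 + \<bar>t\<bar>)\<^sup>2" by (simp add: power2_eq_square algebra_simps)
    qed (use \<rho> in \<open>auto simp: c_def add_pos_nonneg\<close>)
    finally show ?thesis .
  qed
  have h: "integrable lborel (ft \<tau>)"
  proof (rule Bochner_Integration.integrable_bound[OF integrable_inverse_quadratic[of c]])
    show "ft \<tau> \<in> borel_measurable lborel"
      using borel_measurable_continuous_onI[OF ft_continuous[OF \<tau>(1)]] by simp
    show "AE t in lborel. norm (ft \<tau> t) \<le> norm (c / (1 + t\<^sup>2))"
      using bd by (intro AE_I2) (metis abs_ge_self order_trans real_norm_def)
  qed
  define V where "V x = complex_of_real (2 / \<rho>) * ft \<tau> (- x)" for x
  have hm: "integrable lborel (\<lambda>x. ft \<tau> (- x))"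
    using lborel_integrable_real_affine[OF h, of "-1" 0] by simp
  have Vi: "integrable lborel V" unfolding V_def using hm by simp
  have ftV: "ft V s = complex_of_real (2 / \<rho>) * (LINT t|lborel. iexp (2 * pi * t * s) * ft \<tau> t)" for s
  proof -
    have "ft V s = complex_of_real (2 / \<rho>) * (LINT x|lborel. iexp (- (2 * pi * s) * x) * ft \<tau> (- x))"
      unfolding V_def ft_cmult by (simp only: ft_def[of "\<lambda>x. ft \<tau> (- x)"] ft_exponent)
    also have "(LINT x|lborel. iexp (- (2 * pi * s) * x) * ft \<tau> (- x))
        = (LINT t|lborel. iexp (2 * pi * t * s) * ft \<tau> t)"
      by (subst lborel_integral_real_affine[of "-1" _ 0]) (auto simp: mult_ac)
    finally show ?thesis .
  qed
  have ae: "AE s in lborel. ft V s = complex_of_real (2 / \<rho>) * \<tau> s"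
    using Fourier_inversion[OF \<tau>(1) h] by eventually_elim (simp add: ftV)
  have tau1: "\<tau> s = of_real (\<rho>/2)" if "3*\<rho>/4 < s" "s < \<sigma> + \<rho>/4" for s
  proof -
    have "\<tau> s = (LINT y|lborel. indicator {s - \<rho>/4..<s + \<rho>/4} y)"
      unfolding \<tau>_def conv_def
      by (rule Bochner_Integration.integral_cong) (use that in \<open>auto simp: A_def B_def indicator_def\<close>)
    also have "\<dots> = of_real (LINT y|lborel. indicator {s - \<rho>/4..<s + \<rho>/4} y)"
      unfolding integral_complex_of_real[symmetric]
      by (rule Bochner_Integration.integral_cong) (auto simp: indicator_def)
    also have "(LINT y|lborel. indicator {s - \<rho>/4..<s + \<rho>/4} y) = \<rho>/2" using \<rho> by simp
    finally show ?thesis .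
  qed
  have tau0: "\<tau> s = 0" if "s < 0" for s
  proof -
    have "\<tau> s = (LINT y::real|lborel. 0)"
      unfolding \<tau>_def conv_def
      by (rule Bochner_Integration.integral_cong) (use that \<rho> in \<open>auto simp: A_def B_def indicator_def\<close>)
    then show ?thesis by simp
  qed
  have cV: "continuous_on UNIV (ft V)" by (rule ft_continuous[OF Vi])
  have "ft V t = 1" if "\<rho> \<le> t" "t \<le> \<sigma>" for t
  proof (rule AE_eq_imp_eq_on_open[of "{3*\<rho>/4<..<\<sigma> + \<rho>/4}" "ft V" "\<lambda>_. 1", OF _ _ _ cV])
    show "AE s in lborel. s \<in> {3*\<rho>/4<..<\<sigma> + \<rho>/4} \<longrightarrow> ft V s = 1"
      using ae
    proof eventually_elim
      case (elim s)
      have "complex_of_real (2 / \<rho>) * of_real (\<rho>/2) = 1"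
        using \<rho> by (simp only: of_real_mult[symmetric]) simp
      then show ?case using elim tau1[of s] by (metis greaterThanLessThan_iff)
    qed
  qed (use that \<rho> in auto)
  moreover have "ft V t = 0" if "t \<le> - \<rho>" for t
    by (rule AE_eq_imp_eq_on_open[of "{..<0}" "ft V" "\<lambda>_. 0", OF _ _ _ cV])
      (use ae tau0 that \<rho> in \<open>auto elim!: AE_mp\<close>)
  ultimately show ?thesis using that[of V] Vi by blast
qed

section \<open>Spectral parts of elements of $L^1$\<close>

lemma integrable_rep: "integrable lborel (rep_L1 g)"
  using Quotient_rep_reflp[OF Quotient_L1, of g] by simp

lemma measurable_rep [measurable]: "rep_L1 g \<in> borel_measurable borel"
  using integrable_rep[of g] by auto

lemma rep_abs_AE: "integrable lborel f \<Longrightarrow> AE x in lborel. rep_L1 (abs_L1 f) x = f x"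
  using Quotient_rep_abs[OF Quotient_L1, of f] by simp

lemma abs_rep [simp]: "abs_L1 (rep_L1 g) = g"
  by (rule Quotient_abs_rep[OF Quotient_L1])

lemma abs_L1_cong: "integrable lborel f \<Longrightarrow> integrable lborel g \<Longrightarrow> AE x in lborel. f x = g x \<Longrightarrow> abs_L1 f = abs_L1 g"
  using Quotient_rel_abs[OF Quotient_L1, of f g] by simp

lemma L1_eqI: "AE x in lborel. rep_L1 f x = rep_L1 g x \<Longrightarrow> f = g"
  using abs_L1_cong[OF integrable_rep integrable_rep, of f g] by simp

lemma fourier_eq_ft: "fourier g = ft (rep_L1 g)"
  unfolding fourier.rep_eq ft_def by simp

lemma fourier_abs: "integrable lborel f \<Longrightarrow> fourier (abs_L1 f) = ft f"
  unfolding ft_def by (subst fourier.abs_eq) auto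

lemma norm_abs: "integrable lborel f \<Longrightarrow> norm (abs_L1 f) = (LINT x|lborel. cmod (f x))"
  by (subst norm_L1.abs_eq) auto

lemma rep_add: "AE x in lborel. rep_L1 (f + g) x = rep_L1 f x + rep_L1 g x"
proof -
  have "f + g = abs_L1 (\<lambda>x. rep_L1 f x + rep_L1 g x)"
    using plus_L1.abs_eq[of "rep_L1 f" "rep_L1 g"] integrable_rep[of f] integrable_rep[of g] by simp
  then show ?thesis using rep_abs_AE[of "\<lambda>x. rep_L1 f x + rep_L1 g x"] integrable_rep[of f] integrable_rep[of g] by simp
qed

lemma rep_scaleC: "AE x in lborel. rep_L1 (scaleC_L1 c f) x = c * rep_L1 f x"
proof -
  have "scaleC_L1 c f = abs_L1 (\<lambda>x. c * rep_L1 f x)"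
    using scaleC_L1.abs_eq[of "rep_L1 f" c] integrable_rep[of f] by simp
  then show ?thesis using rep_abs_AE[of "\<lambda>x. c * rep_L1 f x"] integrable_rep[of f] by simp
qed

lemma scaleR_eq_scaleC: "r *\<^sub>R f = scaleC_L1 (of_real r) f"
  using scaleR_L1.abs_eq[of "rep_L1 f" r] scaleC_L1.abs_eq[of "rep_L1 f" "of_real r"] integrable_rep[of f]
  by (simp add: scaleR_conv_of_real)

lemma fourier_add: "fourier (f + g) t = fourier f t + fourier g t"
  unfolding fourier_eq_ft
  by (subst ft_cong_AE[OF rep_add integrable_rep Bochner_Integration.integrable_add[OF integrable_rep integrable_rep]])
    (rule ft_add[OF integrable_rep integrable_rep])

lemma fourier_scaleC: "fourier (scaleC_L1 c f) t = c * fourier f t"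
  unfolding fourier_eq_ft
  by (subst ft_cong_AE[OF rep_scaleC integrable_rep integrable_mult_right[OF integrable_rep]])
    (rule ft_cmult)

lemma fourier_inj:
  assumes "\<And>t. fourier f t = fourier g t"
  shows "f = g"
proof (rule L1_eqI)
  have "AE x in lborel. rep_L1 f x - rep_L1 g x = 0"
  proof (rule ft_eq_0_imp_AE_0)
    show "integrable lborel (\<lambda>x. rep_L1 f x - rep_L1 g x)" by (intro Bochner_Integration.integrable_diff integrable_rep)
    show "ft (\<lambda>x. rep_L1 f x - rep_L1 g x) t = 0" for t
      using assms[of t] ft_diff[OF integrable_rep integrable_rep, of f g t] by (simp add: fourier_eq_ft)
  qed
  then show "AE x in lborel. rep_L1 f x = rep_L1 g x" by simp
qed

lemma PW1_iff:
  assumes "closed S"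
  shows "f \<in> PW1 S \<longleftrightarrow> (\<forall>t. t \<notin> S \<longrightarrow> fourier f t = 0)"
proof
  assume "f \<in> PW1 S"
  then have "closure {t. fourier f t \<noteq> 0} \<subseteq> S" by (simp add: PW1_def Sp_def)
  then have "{t. fourier f t \<noteq> 0} \<subseteq> S" by (rule subset_trans[OF closure_subset])
  then show "\<forall>t. t \<notin> S \<longrightarrow> fourier f t = 0" by blast
next
  assume "\<forall>t. t \<notin> S \<longrightarrow> fourier f t = 0"
  then have "{t. fourier f t \<noteq> 0} \<subseteq> S" by auto
  then show "f \<in> PW1 S" using assms by (simp add: PW1_def Sp_def closure_minimal)
qed

lemma closed_band: "closed ({-\<sigma>..-\<rho>} \<union> {\<rho>..\<sigma>::real})"
  by (intro closed_Un) auto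

lemma entire_ext_eqI:
  assumes "F holomorphic_on UNIV" "AE x in lborel. rep_L1 f x = F (of_real x)"
  shows "entire_ext f = F"
  unfolding entire_ext_def
proof (rule the_equality)
  show "F holomorphic_on UNIV \<and> (AE x in lborel. rep_L1 f x = F (of_real x))" using assms by simp
  fix G assume G: "G holomorphic_on UNIV \<and> (AE x in lborel. rep_L1 f x = G (of_real x))"
  have "AE x in lborel. G (of_real x) = F (of_real x)"
    using assms(2) conjunct2[OF G] by eventually_elim simp
  then show "G = F" using entire_unique_AE assms(1) G by blast
qed

lemma entire_ext_band:
  assumes f: "f \<in> PW1 {\<alpha>..\<beta>}" and ab: "\<alpha> \<le> \<beta>"
  shows "entire_ext f holomorphic_on UNIV" "AE x in lborel. rep_L1 f x = entire_ext f (of_real x)"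
    "decays (2 * pi * \<alpha>) (entire_ext f)" "decays (- (2 * pi * \<beta>)) (star (entire_ext f))"
    "integrable lborel (\<lambda>x. entire_ext f (of_real x))" "ft (\<lambda>x. entire_ext f (of_real x)) = fourier f"
proof -
  have c: "continuous_on {\<alpha>..\<beta>} (ft (rep_L1 f))" by (intro ft_continuous integrable_rep)
  have z: "ft (rep_L1 f) t = 0" if "t \<notin> {\<alpha>..\<beta>}" for t
    using f that by (auto simp: PW1_iff fourier_eq_ft)
  have ae: "AE x in lborel. rep_L1 f x = synth \<alpha> \<beta> (ft (rep_L1 f)) (of_real x)"
    by (rule band_limited_AE_synth[OF integrable_rep z])
  have h: "synth \<alpha> \<beta> (ft (rep_L1 f)) holomorphic_on UNIV" by (rule synth_holomorphic[OF c])
  have eq: "entire_ext f = synth \<alpha> \<beta> (ft (rep_L1 f))" by (rule entire_ext_eqI[OF h ae])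
  show ho: "entire_ext f holomorphic_on UNIV" and ae': "AE x in lborel. rep_L1 f x = entire_ext f (of_real x)"
    and "decays (2 * pi * \<alpha>) (entire_ext f)" "decays (- (2 * pi * \<beta>)) (star (entire_ext f))"
    unfolding eq using h ae synth_decays[OF c ab] by auto
  show i: "integrable lborel (\<lambda>x. entire_ext f (of_real x))"
    by (rule integrable_cong_AE_imp[OF integrable_rep[of f]])
      (use ae' entire_real_measurable[OF ho] in \<open>auto elim: AE_mp\<close>)
  show "ft (\<lambda>x. entire_ext f (of_real x)) = fourier f"
    unfolding fourier_eq_ft using ft_cong_AE[OF ae' integrable_rep i] by auto
qed

text \<open>The positive part is the convolution with a kernel whose transform is 1 on \<open>[\<rho>, \<sigma>]\<close> and 0 on \<open>[-\<sigma>, -\<rho>]\<close>.\<close>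

lemma spectral_parts_ex1:
  assumes f: "f \<in> PW1 ({-\<sigma>..-\<rho>} \<union> {\<rho>..\<sigma>})" and \<rho>: "0 < \<rho>" "\<rho> \<le> \<sigma>"
  shows "\<exists>!p. fst p \<in> PW1 {-\<sigma>..-\<rho>} \<and> snd p \<in> PW1 {\<rho>..\<sigma>} \<and> f = fst p + snd p"
proof -
  obtain V where V: "integrable lborel V" "\<And>t. \<rho> \<le> t \<Longrightarrow> t \<le> \<sigma> \<Longrightarrow> ft V t = 1"
    "\<And>t. t \<le> - \<rho> \<Longrightarrow> ft V t = 0"
    using splitting_kernel[OF \<rho>] by blast
  define p where "p = abs_L1 (conv V (rep_L1 f))"
  define m where "m = f + scaleC_L1 (-1) p"
  have fp: "fourier p t = ft V t * fourier f t" for t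
    unfolding p_def fourier_eq_ft[of f] using conv_ft[OF V(1) integrable_rep] by (simp add: fourier_abs)
  have fm: "fourier m t = fourier f t - fourier p t" for t
    by (simp add: m_def fourier_add fourier_scaleC)
  have f0: "fourier f t = 0" if "t \<notin> {-\<sigma>..-\<rho>} \<union> {\<rho>..\<sigma>}" for t
    using f that by (simp add: PW1_iff[OF closed_band])
  have "p \<in> PW1 {\<rho>..\<sigma>}" unfolding PW1_iff[OF closed_atLeastAtMost]
  proof (intro allI impI)
    fix t assume t: "t \<notin> {\<rho>..\<sigma>}"
    then show "fourier p t = 0" using f0[of t] V(3)[of t] unfolding fp by auto
  qed
  moreover have "m \<in> PW1 {-\<sigma>..-\<rho>}" unfolding PW1_iff[OF closed_atLeastAtMost]
  proof (intro allI impI)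
    fix t assume t: "t \<notin> {-\<sigma>..-\<rho>}"
    then show "fourier m t = 0" using f0[of t] V(2)[of t] unfolding fm fp by auto
  qed
  moreover have "f = m + p"
    by (rule fourier_inj) (simp add: fourier_add fm)
  ultimately have ex: "fst (m, p) \<in> PW1 {-\<sigma>..-\<rho>} \<and> snd (m, p) \<in> PW1 {\<rho>..\<sigma>} \<and> f = fst (m, p) + snd (m, p)" by simp
  show ?thesis
  proof (rule ex1I[where a = "(m, p)"])
    show "fst (m, p) \<in> PW1 {-\<sigma>..-\<rho>} \<and> snd (m, p) \<in> PW1 {\<rho>..\<sigma>} \<and> f = fst (m, p) + snd (m, p)" by (rule ex)
    fix q assume q: "fst q \<in> PW1 {-\<sigma>..-\<rho>} \<and> snd q \<in> PW1 {\<rho>..\<sigma>} \<and> f = fst q + snd q"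
    have z: "fourier (fst q) t = 0" if "t \<notin> {-\<sigma>..-\<rho>}" for t using q that by (simp add: PW1_iff)
    have z': "fourier (snd q) t = 0" if "t \<notin> {\<rho>..\<sigma>}" for t using q that by (simp add: PW1_iff)
    have y: "fourier m t = 0" if "t \<notin> {-\<sigma>..-\<rho>}" for t using ex that by (simp add: PW1_iff)
    have y': "fourier p t = 0" if "t \<notin> {\<rho>..\<sigma>}" for t using ex that by (simp add: PW1_iff)
    have s: "fourier (fst q) t + fourier (snd q) t = fourier m t + fourier p t" for t
      using q ex by (metis fourier_add fst_conv snd_conv)
    have "snd q = p"
    proof (rule fourier_inj)
      fix t
      show "fourier (snd q) t = fourier p t"
        using s[of t] z[of t] y[of t] z'[of t] y'[of t] \<rho> by (cases "t \<in> {\<rho>..\<sigma>}") auto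
    qed
    moreover have "fst q = m"
    proof (rule fourier_inj)
      fix t
      show "fourier (fst q) t = fourier m t"
        using s[of t] z[of t] y[of t] z'[of t] y'[of t] \<rho> by (cases "t \<in> {\<rho>..\<sigma>}") auto
    qed
    ultimately show "q = (m, p)" by (simp add: prod_eq_iff)
  qed
qed

text \<open>The two parts decay in opposite half-planes, and their transforms are the restrictions of the transform
  of \<open>f\<close> to the two half-lines.\<close>

lemma spectral_parts_entire:
  assumes f: "f \<in> PW1 ({-\<sigma>..-\<rho>} \<union> {\<rho>..\<sigma>})" and \<rho>: "0 < \<rho>" "\<rho> \<le> \<sigma>"
  defines "P \<equiv> pos_part \<rho> \<sigma> f" and "N \<equiv> neg_part \<rho> \<sigma> f"
  shows "P holomorphic_on UNIV" "decays (2 * pi * \<rho>) P" "decays (- (2 * pi * \<sigma>)) (star P)"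
    "N holomorphic_on UNIV" "decays (2 * pi * \<rho>) (star N)" "decays (- (2 * pi * \<sigma>)) N"
    "AE x in lborel. rep_L1 f x = P (of_real x) + N (of_real x)"
    "integrable lborel (\<lambda>x. P (of_real x))" "integrable lborel (\<lambda>x. N (of_real x))"
    "\<And>t. 0 < t \<Longrightarrow> ft (\<lambda>x. P (of_real x)) t = fourier f t"
    "\<And>t. t < 0 \<Longrightarrow> ft (\<lambda>x. N (of_real x)) t = fourier f t"
proof -
  let ?p = "spectral_parts \<rho> \<sigma> f"
  have sp: "fst ?p \<in> PW1 {-\<sigma>..-\<rho>} \<and> snd ?p \<in> PW1 {\<rho>..\<sigma>} \<and> f = fst ?p + snd ?p"
    unfolding spectral_parts_def by (rule theI'[OF spectral_parts_ex1[OF f \<rho>]])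
  note fs = conjunct1[OF sp] conjunct1[OF conjunct2[OF sp]]
  have eq: "f = fst ?p + snd ?p" using sp by blast
  have ab: "-\<sigma> \<le> -\<rho>" using \<rho> by simp
  note NN = entire_ext_band[OF fs(1) ab, folded neg_part_def, folded N_def]
  note PP = entire_ext_band[OF fs(2) \<rho>(2), folded pos_part_def, folded P_def]
  show "P holomorphic_on UNIV" "decays (2 * pi * \<rho>) P" "decays (- (2 * pi * \<sigma>)) (star P)"
    "N holomorphic_on UNIV" "decays (2 * pi * \<rho>) (star N)" "decays (- (2 * pi * \<sigma>)) N"
    "integrable lborel (\<lambda>x. P (of_real x))" "integrable lborel (\<lambda>x. N (of_real x))"
    using NN PP by auto
  show "AE x in lborel. rep_L1 f x = P (of_real x) + N (of_real x)"
    using NN(2) PP(2) rep_add[of "fst ?p" "snd ?p"] by eventually_elim (simp add: eq[symmetric] add.commute)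
  have fe: "fourier f t = fourier (fst ?p) t + fourier (snd ?p) t" for t
    using arg_cong[OF eq, of "\<lambda>f. fourier f t"] by (simp add: fourier_add)
  show "ft (\<lambda>x. P (of_real x)) t = fourier f t" if "0 < t" for t
  proof -
    have "fourier (fst ?p) t = 0" using fs(1) that \<rho> by (simp add: PW1_iff)
    then show ?thesis using fe[of t] PP(6) by simp
  qed
  show "ft (\<lambda>x. N (of_real x)) t = fourier f t" if "t < 0" for t
  proof -
    have "fourier (snd ?p) t = 0" using fs(2) that \<rho> by (simp add: PW1_iff)
    then show ?thesis using fe[of t] NN(6) by simp
  qed
qed

text \<open>A converse, in which only the sum is required to be integrable.\<close>

lemma abs_L1_in_PW1:
  assumes i: "integrable lborel (\<lambda>x. P (of_real x) + N (of_real x))"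
    and P: "P holomorphic_on UNIV" "decays (2 * pi * \<rho>) P" "decays (- (2 * pi * \<sigma>)) (star P)"
    and N: "N holomorphic_on UNIV" "decays (2 * pi * \<rho>) (star N)" "decays (- (2 * pi * \<sigma>)) N"
    and \<rho>: "0 < \<rho>" "\<rho> \<le> \<sigma>"
  shows "abs_L1 (\<lambda>x. P (of_real x) + N (of_real x)) \<in> PW1 ({-\<sigma>..-\<rho>} \<union> {\<rho>..\<sigma>})"
proof -
  let ?F = "\<lambda>z. P z + N z"
  have F: "?F holomorphic_on UNIV" by (intro holomorphic_intros P N)
  have le: "- (2 * pi * \<sigma>) \<le> 2 * pi * \<rho>"
  proof -
    have "0 \<le> 2 * pi * \<sigma>" "0 \<le> 2 * pi * \<rho>" using \<rho> by simp_all
    then show ?thesis by linarith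
  qed
  have 1: "decays (2 * pi * (- \<sigma>)) ?F"
    using decays_add[OF decays_mono[OF P(2) le] N(3)] by simp
  have 2: "decays (- (2 * pi * \<sigma>)) (star ?F)"
    using decays_add[OF P(3) decays_mono[OF N(2) le]] by (simp add: star_add)
  have "ft (\<lambda>x. ?F (of_real x)) t = 0" if t: "t \<notin> {-\<sigma>..-\<rho>} \<union> {\<rho>..\<sigma>}" for t
  proof -
    consider "t < - \<sigma>" | "\<sigma> < t" | "- \<rho> < t" "t < \<rho>" using t by (auto simp: not_le)
    then show ?thesis
    proof cases
      case 1
      then show ?thesis by (intro ft_left_of_band[OF i F \<open>decays (2 * pi * (- \<sigma>)) ?F\<close>])
    next
      case 2
      then show ?thesis by (intro ft_right_of_band[OF i F \<open>decays (- (2 * pi * \<sigma>)) (star ?F)\<close>])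
    next
      case 3
      have "decays (- (2 * pi * (- \<rho>))) (star N)" using N(2) by simp
      then show ?thesis using spectral_gap_of_decay[OF i refl P(1,2) N(1)] 3 by blast
    qed
  qed
  then show ?thesis unfolding PW1_iff[OF closed_band] fourier_abs[OF i] by blast
qed

lemma in_Sp_nearby:
  assumes "s \<in> Sp f" "d > 0"
  obtains t where "\<bar>t - s\<bar> < d" "fourier f t \<noteq> 0"
proof -
  have "\<exists>t\<in>{t. fourier f t \<noteq> 0}. dist t s < d"
    using assms unfolding Sp_def closure_approachable by blast
  then show ?thesis using that by (auto simp: dist_real_def)
qed

text \<open>An endpoint in the spectrum means that the part to which it belongs does not decay, or does not grow, at a rate
  better than the guaranteed one: a better rate would push the spectrum away from the endpoint.
  Each of the four endpoints corresponds to one part and one half-plane.\<close>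

lemma quotient_type0_of_spectrum:
  assumes f: "f \<in> PW1 ({-\<sigma>..-\<rho>} \<union> {\<rho>..\<sigma>})" and \<rho>: "0 < \<rho>" "\<rho> < \<sigma>"
    and ends: "\<sigma> \<in> Sp f \<or> - \<sigma> \<in> Sp f \<or> \<rho> \<in> Sp f \<or> - \<rho> \<in> Sp f"
    and ph: "\<phi> holomorphic_on UNIV" "star \<phi> = \<phi>"
    and Gp: "decays (2 * pi * \<rho>) Gp" "decays (- (2 * pi * \<sigma>)) (star Gp)" "\<And>z. Gp z = \<phi> z * pos_part \<rho> \<sigma> f z"
    and Gm: "decays (2 * pi * \<rho>) (star Gm)" "decays (- (2 * pi * \<sigma>)) Gm" "\<And>z. Gm z = \<phi> z * neg_part \<rho> \<sigma> f z"
  shows "type0 \<phi>"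
proof -
  define P where "P = pos_part \<rho> \<sigma> f"
  define N where "N = neg_part \<rho> \<sigma> f"
  note PN = spectral_parts_entire[OF f \<rho>(1) less_imp_le[OF \<rho>(2)], folded P_def N_def]
  have f0: "fourier f t = 0" if "t \<notin> {-\<sigma>..-\<rho>} \<union> {\<rho>..\<sigma>}" for t
    using f that by (simp add: PW1_iff[OF closed_band])
  have two_pi: "2 * pi * (a + d / (2 * pi)) = 2 * pi * a + d" for a d :: real by (simp add: field_simps)
  have Gps: "star Gp z = \<phi> z * star P z" and Gms: "star Gm z = \<phi> z * star N z" for z
    using Gp(3)[of "cnj z"] Gm(3)[of "cnj z"] ph(2) by (simp_all add: star_def P_def N_def fun_eq_iff)
  from ends show ?thesis
  proof (elim disjE)
    assume "\<sigma> \<in> Sp f"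
    then have sharp: "\<not> decays (- (2 * pi * \<sigma>) + d) (star P)" if d: "d > 0" for d
    proof (rule_tac notI)
      assume dec: "decays (- (2 * pi * \<sigma>) + d) (star P)"
      define e where "e = min (d / (2 * pi)) \<rho>"
      have e: "e > 0" "e \<le> d / (2 * pi)" using d \<rho> by (auto simp: e_def)
      obtain t where t: "\<bar>t - \<sigma>\<bar> < e" "fourier f t \<noteq> 0" using in_Sp_nearby[OF \<open>\<sigma> \<in> Sp f\<close> e(1)] .
      have "decays (- (2 * pi * (\<sigma> - d / (2 * pi)))) (star P)"
        using dec two_pi[of "- \<sigma>" d] by (simp add: algebra_simps)
      then have "ft (\<lambda>x. P (of_real x)) t = 0"
        by (rule ft_right_of_band[OF PN(8,1)]) (use t e in linarith)
      moreover have "0 < t" using t e \<rho> by (auto simp: e_def)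
      ultimately show False using t PN(10)[of t] by simp
    qed
    show ?thesis
    proof (rule quotient_type0[OF ph, where F = "star P" and G = "star Gp" and a = "- (2 * pi * \<sigma>)" and b = "- (2 * pi * \<rho>)"])
    qed (use PN Gp Gps sharp in \<open>auto intro: holomorphic_star\<close>)
  next
    assume "- \<sigma> \<in> Sp f"
    then have sharp: "\<not> decays (- (2 * pi * \<sigma>) + d) N" if d: "d > 0" for d
    proof (rule_tac notI)
      assume dec: "decays (- (2 * pi * \<sigma>) + d) N"
      define e where "e = min (d / (2 * pi)) \<rho>"
      have e: "e > 0" "e \<le> d / (2 * pi)" using d \<rho> by (auto simp: e_def)
      obtain t where t: "\<bar>t - (- \<sigma>)\<bar> < e" "fourier f t \<noteq> 0" using in_Sp_nearby[OF \<open>- \<sigma> \<in> Sp f\<close> e(1)] .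
      have "decays (2 * pi * (- \<sigma> + d / (2 * pi))) N"
        using dec two_pi[of "- \<sigma>" d] by simp
      then have "ft (\<lambda>x. N (of_real x)) t = 0"
        by (rule ft_left_of_band[OF PN(9,4)]) (use t e in linarith)
      moreover have "t < 0" using t e \<rho> by (auto simp: e_def)
      ultimately show False using t PN(11)[of t] by simp
    qed
    show ?thesis
    proof (rule quotient_type0[OF ph, where F = N and G = Gm and a = "- (2 * pi * \<sigma>)" and b = "- (2 * pi * \<rho>)"])
    qed (use PN Gm sharp in \<open>auto simp: N_def\<close>)
  next
    assume "\<rho> \<in> Sp f"
    then have sharp: "\<not> decays (2 * pi * \<rho> + d) P" if d: "d > 0" for d
    proof (rule_tac notI)
      assume dec: "decays (2 * pi * \<rho> + d) P"
      define e where "e = min (d / (2 * pi)) \<rho>"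
      have e: "e > 0" "e \<le> d / (2 * pi)" using d \<rho> by (auto simp: e_def)
      obtain t where t: "\<bar>t - \<rho>\<bar> < e" "fourier f t \<noteq> 0" using in_Sp_nearby[OF \<open>\<rho> \<in> Sp f\<close> e(1)] .
      have "decays (2 * pi * (\<rho> + d / (2 * pi))) P"
        using dec two_pi[of "\<rho>" d] by simp
      then have "ft (\<lambda>x. P (of_real x)) t = 0"
        by (rule ft_left_of_band[OF PN(8,1)]) (use t e in linarith)
      moreover have "0 < t" using t e \<rho> by (auto simp: e_def)
      ultimately show False using t PN(10)[of t] by simp
    qed
    show ?thesis
    proof (rule quotient_type0[OF ph, where F = P and G = Gp and a = "2 * pi * \<rho>" and b = "2 * pi * \<sigma>"])
    qed (use PN Gp sharp in \<open>auto simp: P_def\<close>)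
  next
    assume "- \<rho> \<in> Sp f"
    then have sharp: "\<not> decays (2 * pi * \<rho> + d) (star N)" if d: "d > 0" for d
    proof (rule_tac notI)
      assume dec: "decays (2 * pi * \<rho> + d) (star N)"
      define e where "e = min (d / (2 * pi)) \<rho>"
      have e: "e > 0" "e \<le> d / (2 * pi)" using d \<rho> by (auto simp: e_def)
      obtain t where t: "\<bar>t - (- \<rho>)\<bar> < e" "fourier f t \<noteq> 0" using in_Sp_nearby[OF \<open>- \<rho> \<in> Sp f\<close> e(1)] .
      have "decays (- (2 * pi * (- \<rho> - d / (2 * pi)))) (star N)"
        using dec two_pi[of "\<rho>" d] by (simp add: algebra_simps)
      then have "ft (\<lambda>x. N (of_real x)) t = 0"
        by (rule ft_right_of_band[OF PN(9,4)]) (use t e in linarith)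
      moreover have "t < 0" using t e \<rho> by (auto simp: e_def)
      ultimately show False using t PN(11)[of t] by simp
    qed
    show ?thesis
    proof (rule quotient_type0[OF ph, where F = "star N" and G = "star Gm" and a = "2 * pi * \<rho>" and b = "2 * pi * \<sigma>"])
    qed (use PN Gm Gms sharp in \<open>auto intro: holomorphic_star\<close>)
  qed
qed

section \<open>Multipliers of exponential type zero\<close>

lemma type0_star: "type0 w \<Longrightarrow> type0 (star w)"
  unfolding type0_def star_def complex_mod_cnj by (metis complex_mod_cnj)

lemma type0_upper_mult_decays:
  assumes w: "type0 w" and P: "decays a P"
  shows "type0_upper (\<lambda>z. w z * P z * exp (\<i> * of_real (- a) * z))"
  unfolding type0_upper_def
proof (intro allI impI)
  fix e :: real assume "e > 0"
  then obtain C where C: "\<And>z. cmod (w z) \<le> C * exp (e * cmod z)" using w by (auto simp: type0_def)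
  obtain D where D: "D \<ge> 0" "\<And>z. 0 \<le> Im z \<Longrightarrow> cmod (P z) \<le> D * exp (- a * Im z)"
    using P by (elim decaysE) auto
  have "cmod (w z * P z * exp (\<i> * of_real (- a) * z)) \<le> (C * D) * exp (e * cmod z)" if z: "0 \<le> Im z" for z
  proof -
    have "cmod (w z * P z * exp (\<i> * of_real (- a) * z)) = cmod (w z) * (cmod (P z) * exp (a * Im z))"
      by (simp add: norm_mult)
    also have "\<dots> \<le> (C * exp (e * cmod z)) * (D * exp (- a * Im z) * exp (a * Im z))"
      using order_trans[OF norm_ge_zero C[of z]] by (intro mult_mono mult_right_mono C D z) auto
    also have "D * exp (- a * Im z) * exp (a * Im z) = D" by (simp add: exp_minus)
    finally show ?thesis by (simp add: mult_ac)
  qed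
  then show "\<exists>C. \<forall>z. 0 \<le> Im z \<longrightarrow> cmod (w z * P z * exp (\<i> * of_real (- a) * z)) \<le> C * exp (e * cmod z)"
    by blast
qed

text \<open>A subexponential loss in the decay can be recovered from boundedness on the line.\<close>

lemma decays_of_type0_upper:
  assumes A: "A holomorphic_on UNIV" and t: "type0_upper (\<lambda>z. A z * exp (\<i> * of_real (- a) * z))"
    and bd: "\<And>x::real. cmod (A (of_real x)) \<le> M"
  shows "decays a A"
proof (rule decaysI[of _ M])
  fix z assume z: "0 \<le> Im z"
  have "cmod (A z * exp (\<i> * of_real (- a) * z)) \<le> M"
    by (rule type0_upper_bounded[where p = "\<lambda>z. A z * exp (\<i> * of_real (- a) * z)"])
      (use t z bd A in \<open>auto intro!: holomorphic_intros simp: norm_mult\<close>)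
  then have "cmod (A z) * exp (a * Im z) \<le> M" by (simp add: norm_mult)
  then have "cmod (A z) * exp (a * Im z) * exp (- a * Im z) \<le> M * exp (- a * Im z)" by (rule mult_right_mono) simp
  then show "cmod (A z) \<le> M * exp (- a * Im z)" by (simp add: exp_minus mult.assoc)
qed

lemma decays_type0_mult:
  assumes "w holomorphic_on UNIV" "P holomorphic_on UNIV" "type0 w" "decays a P"
    and "\<And>x::real. cmod (w (of_real x) * P (of_real x)) \<le> M"
  shows "decays a (\<lambda>z. w z * P z)"
  by (rule decays_of_type0_upper[OF _ type0_upper_mult_decays[OF assms(3,4)] assms(5)])
    (intro holomorphic_intros assms)

text \<open>For the primitive \<open>H\<close> of \<open>G\<close>, this difference is the integral of \<open>G\<close> over a segment of length \<open>h\<close>.\<close>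

lemma type0_upper_shift_diff:
  assumes G: "G holomorphic_on UNIV" "type0_upper (\<lambda>z. G z * exp (\<i> * of_real (- a) * z))" and h: "h > 0"
    and H: "\<And>z. (H has_field_derivative G z) (at z)"
  shows "type0_upper (\<lambda>z. (H (z + of_real h) - H z) * exp (\<i> * of_real (- a) * z))"
  unfolding type0_upper_def
proof (intro allI impI)
  fix e :: real assume e: "e > 0"
  obtain C where C: "\<And>z. 0 \<le> Im z \<Longrightarrow> cmod (G z * exp (\<i> * of_real (- a) * z)) \<le> C * exp (e * cmod z)"
    using G(2) e by (auto simp: type0_upper_def)
  have C0: "C \<ge> 0" using order_trans[OF norm_ge_zero C[of 0]] by simp
  have Gb: "cmod (G z) \<le> C * exp (e * cmod z) * exp (- a * Im z)" if "0 \<le> Im z" for z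
  proof -
    have "cmod (G z) * exp (a * Im z) \<le> C * exp (e * cmod z)" using C[OF that] by (simp add: norm_mult)
    then have "cmod (G z) * exp (a * Im z) * exp (- a * Im z) \<le> C * exp (e * cmod z) * exp (- a * Im z)"
      by (rule mult_right_mono) simp
    then show ?thesis by (simp add: exp_minus mult.assoc)
  qed
  have "cmod ((H (z + of_real h) - H z) * exp (\<i> * of_real (- a) * z)) \<le> (h * C * exp (e * h)) * exp (e * cmod z)"
    if z: "0 \<le> Im z" for z
  proof -
    have "cmod (H (z + of_real h) - H z) \<le> (C * exp (e * (cmod z + h)) * exp (- a * Im z)) * cmod (z + of_real h - z)"
    proof (rule field_differentiable_bound[of "closed_segment z (z + of_real h)" H G])
      fix u assume "u \<in> closed_segment z (z + of_real h)"
      then obtain s where s: "0 \<le> s" "s \<le> 1" "u = z + of_real (s * h)"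
        by (auto simp: closed_segment_def scaleR_conv_of_real algebra_simps)
      have iu: "Im u = Im z" using s by simp
      have sh: "s * h \<le> 1 * h" using s h by (intro mult_right_mono) auto
      have "cmod u \<le> cmod z + \<bar>s * h\<bar>" unfolding s(3) by (rule order_trans[OF norm_triangle_ineq]) (simp only: norm_of_real order_refl)
      then have "cmod u \<le> cmod z + s * h" using s h by simp
      then have "cmod u \<le> cmod z + h" using sh by linarith
      then have "C * exp (e * cmod u) * exp (- a * Im z) \<le> C * exp (e * (cmod z + h)) * exp (- a * Im z)"
        using C0 e by (intro mult_right_mono mult_left_mono) auto
      with Gb[of u] iu z show "cmod (G u) \<le> C * exp (e * (cmod z + h)) * exp (- a * Im z)" by auto
    qed (auto intro: has_field_derivative_at_within H)
    also have "cmod (z + of_real h - z) = h" using h by simp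
    finally have "cmod (H (z + of_real h) - H z) * exp (a * Im z)
        \<le> C * exp (e * (cmod z + h)) * exp (- a * Im z) * h * exp (a * Im z)" by (rule mult_right_mono) simp
    also have "\<dots> = (h * C * exp (e * h)) * exp (e * cmod z)"
      by (simp add: exp_minus exp_add distrib_left)
    finally show ?thesis by (simp add: norm_mult)
  qed
  then show "\<exists>C. \<forall>z. 0 \<le> Im z \<longrightarrow> cmod ((H (z + of_real h) - H z) * exp (\<i> * of_real (- a) * z)) \<le> C * exp (e * cmod z)"
    by blast
qed

text \<open>The integrals of \<open>G\<close> over intervals of length \<open>h\<close> are bounded by the norm of \<open>G\<close>, so that their growth
  off the line is purely exponential and locates their spectrum. Passing to these integrals multiplies the transform by that of an indicator function.\<close>

lemma ft_right_of_growth: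
  assumes G: "G holomorphic_on UNIV" and i: "integrable lborel (\<lambda>x. G (of_real x))"
    and t0: "type0_upper (\<lambda>z. star G z * exp (\<i> * of_real (- (- (2 * pi * \<beta>))) * z))"
    and t: "\<beta> < t" "0 < t"
  shows "ft (\<lambda>x. G (of_real x)) t = 0"
proof -
  \<comment> \<open>Half a period at frequency \<open>t\<close>, so that the transform of the indicator function does not vanish there.\<close>
  define h where "h = 1 / (2 * t)"
  have h: "h > 0" using t by (simp add: h_def)
  obtain H where H: "\<And>z. (H has_field_derivative G z) (at z)"
    using holomorphic_convex_primitive'[OF convex_UNIV open_UNIV G] by auto
  define D where "D z = H (z + of_real h) - H z" for z
  have Hh: "H holomorphic_on UNIV" using H by (auto simp: holomorphic_on_def field_differentiable_def)
  have Dh: "D holomorphic_on UNIV"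
  proof -
    have "(\<lambda>z. z + complex_of_real h) holomorphic_on UNIV" by (intro holomorphic_intros)
    moreover have "H holomorphic_on (\<lambda>z. z + complex_of_real h) ` UNIV" by (rule holomorphic_on_subset[OF Hh]) simp
    ultimately have "(H \<circ> (\<lambda>z. z + complex_of_real h)) holomorphic_on UNIV" by (rule holomorphic_on_compose)
    then show ?thesis unfolding D_def by (intro holomorphic_intros Hh) (simp add: o_def)
  qed
  have Dreal: "D (of_real x) = conv (indicator {-h<..0}) (\<lambda>x. G (of_real x)) x" for x
  proof -
    have "((\<lambda>s. G (of_real s)) has_integral (H (of_real (x + h)) - H (of_real x))) {x..x + h}"
    proof (rule fundamental_theorem_of_calculus)
      show "((\<lambda>s. H (of_real s)) has_vector_derivative G (of_real s)) (at s within {x..x + h})" for s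
        using has_vector_derivative_real_field[OF H] .
    qed (use h in simp)
    then have "D (of_real x) = integral {x..x + h} (\<lambda>s. G (of_real s))" by (simp add: D_def integral_unique)
    also have "\<dots> = (LINT s:{x..x + h}|lborel. G (of_real s))"
      by (intro set_borel_integral_eq_integral(2)[symmetric] borel_integrable_atLeastAtMost' entire_real_continuous G)
    also have "\<dots> = (LINT y|lborel. indicator {x..x + h} (x + (-1) * y) *\<^sub>R G (of_real (x + (-1) * y)))"
      unfolding set_lebesgue_integral_def by (subst lborel_integral_real_affine[of "-1" _ x]) auto
    also have "\<dots> = (LINT y|lborel. indicator {-h<..0} y * G (of_real (x - y)))"
    proof (rule integral_cong_AE)
      have [measurable]: "(\<lambda>x::real. G (of_real x)) \<in> borel_measurable borel" by (rule entire_real_measurable[OF G])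
      have [measurable]: "(\<lambda>y::real. G (of_real (x - y))) \<in> borel_measurable borel"
        using measurable_compose[of "\<lambda>y. x - y" borel borel "\<lambda>x. G (of_real x)"] by simp
      show "(\<lambda>y. indicat_real {x..x + h} (x + (-1) * y) *\<^sub>R G (of_real (x + (-1) * y))) \<in> borel_measurable lborel"
        using \<open>(\<lambda>y. G (of_real (x - y))) \<in> borel_measurable borel\<close> by (simp del: of_real_diff)
      show "(\<lambda>y. indicator {-h<..0} y * G (of_real (x - y))) \<in> borel_measurable lborel" by measurable
      show "AE y in lborel. indicat_real {x..x + h} (x + (-1) * y) *\<^sub>R G (of_real (x + (-1) * y))
          = indicator {-h<..0} y * G (of_real (x - y))"
        using AE_lborel_singleton[of "- h"] by eventually_elim (auto simp: indicator_def)
    qed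
    finally show ?thesis by (simp add: conv_def)
  qed
  note cv = conv_ft[OF integrable_indicator_Ioc[of "-h" 0] i]
  have Di: "integrable lborel (\<lambda>x. D (of_real x))" unfolding Dreal using cv(1) by simp
  have Db: "cmod (D (of_real x)) \<le> (LINT x|lborel. cmod (G (of_real x)))" for x
  proof -
    have m: "(\<lambda>x::real. G (of_real x)) \<in> borel_measurable borel" by (rule entire_real_measurable[OF G])
    have gi: "integrable lborel (\<lambda>y. cmod (G (of_real (x + (-1) * y))))"
      using lborel_integrable_real_affine[OF integrable_norm[OF i], of "-1" x] by simp
    have "cmod (D (of_real x)) \<le> (LINT y|lborel. cmod (indicator {-h<..0} y * G (of_real (x - y))))"
      unfolding Dreal conv_def by (rule integral_norm_bound)
    also have "\<dots> \<le> (LINT y|lborel. cmod (G (of_real (x + (-1) * y))))"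
      by (rule integral_mono'[OF gi]) (auto simp: indicator_def)
    also have "\<dots> = (LINT x|lborel. cmod (G (of_real x)))"
      by (subst (2) lborel_integral_real_affine[of "-1" _ x]) auto
    finally show ?thesis .
  qed
  have sD: "star D = (\<lambda>z. star H (z + of_real h) - star H z)" by (rule ext) (simp add: star_def D_def)
  have sH: "(star H has_field_derivative star G z) (at z)" for z
    using has_field_derivative_cnj_cnj[OF H[of "cnj z"]] by (simp add: star_def [abs_def] o_def)
  have "type0_upper (\<lambda>z. star D z * exp (\<i> * of_real (- (- (2 * pi * \<beta>))) * z))"
    unfolding sD by (rule type0_upper_shift_diff[OF holomorphic_star[OF G] t0 h sH])
  then have "decays (- (2 * pi * \<beta>)) (star D)"
    by (rule decays_of_type0_upper[OF holomorphic_star[OF Dh]]) (use Db in \<open>simp add: star_def\<close>)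
  then have "ft (\<lambda>x. D (of_real x)) t = 0" by (rule ft_right_of_band[OF Di Dh _ t(1)])
  then have z: "ft (indicator {-h<..0}) t * ft (\<lambda>x. G (of_real x)) t = 0"
    unfolding Dreal using cv(2) by simp
  have "ft (indicator {-h<..0}) t = (LINT x:{-h<..0}|lborel. iexp (-((2 * pi * t) * x)))"
    unfolding ft_def ft_exponent set_lebesgue_integral_def
    by (rule Bochner_Integration.integral_cong) (auto simp: indicator_def)
  also have "\<dots> = kern (-h) 0 (2 * pi * t)" using t h by (intro kern_eq_integral) auto
  also have "\<dots> = (exp (\<i> * pi) - 1) / (\<i> * (2 * pi * t))"
    using t by (simp add: kern_def h_def mult_ac)
  also have "\<dots> \<noteq> 0" using t by simp
  finally show ?thesis using z by simp
qed

lemma ft_star: "ft (\<lambda>x. star G (of_real x)) t = cnj (ft (\<lambda>x. G (of_real x)) (- t))"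
  unfolding ft_def Bochner_Integration.integral_cnj[symmetric]
  by (rule Bochner_Integration.integral_cong) (auto simp: star_def exp_cnj)

lemma synth_combine:
  assumes "continuous_on {a..c} p" "a \<le> b" "b \<le> c"
  shows "synth a c p z = synth a b p z + synth b c p z"
  unfolding synth_def
  by (rule Henstock_Kurzweil_Integration.integral_combine[symmetric])
    (use assms synth_integrable[OF assms(1)] in auto)

lemma type0_of_upper_halves:
  assumes "type0_upper p" "type0_upper (star p)"
  shows "type0 p"
  unfolding type0_def
proof (intro allI impI)
  fix e :: real assume e: "e > 0"
  obtain C where C: "\<And>z. 0 \<le> Im z \<Longrightarrow> cmod (p z) \<le> C * exp (e * cmod z)"
    using assms(1) e by (auto simp: type0_upper_def)
  obtain D where D: "\<And>z. 0 \<le> Im z \<Longrightarrow> cmod (star p z) \<le> D * exp (e * cmod z)"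
    using assms(2) e by (auto simp: type0_upper_def)
  have "cmod (p z) \<le> max C D * exp (e * cmod z)" for z
  proof (cases "0 \<le> Im z")
    case True
    have "C * exp (e * cmod z) \<le> max C D * exp (e * cmod z)" by (intro mult_right_mono) auto
    with C[OF True] show ?thesis by linarith
  next
    case False
    have "cmod (p z) \<le> D * exp (e * cmod z)" using D[of "cnj z"] False by (simp add: star_def)
    moreover have "D * exp (e * cmod z) \<le> max C D * exp (e * cmod z)" by (intro mult_right_mono) auto
    ultimately show ?thesis by linarith
  qed
  then show "\<exists>C. \<forall>z. cmod (p z) \<le> C * exp (e * cmod z)" by blast
qed

lemma type0_upper_diff:
  assumes "type0_upper p" "type0_upper q"
  shows "type0_upper (\<lambda>z. p z - q z)"
  unfolding type0_upper_def
proof (intro allI impI)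
  fix e :: real assume e: "e > 0"
  obtain C where C: "\<And>z. 0 \<le> Im z \<Longrightarrow> cmod (p z) \<le> C * exp (e * cmod z)"
    using assms(1) e by (auto simp: type0_upper_def)
  obtain D where D: "\<And>z. 0 \<le> Im z \<Longrightarrow> cmod (q z) \<le> D * exp (e * cmod z)"
    using assms(2) e by (auto simp: type0_upper_def)
  have "cmod (p z - q z) \<le> (C + D) * exp (e * cmod z)" if "0 \<le> Im z" for z
    using norm_triangle_ineq4[of "p z" "q z"] C[OF that] D[OF that] by (simp add: distrib_right)
  then show "\<exists>C. \<forall>z. 0 \<le> Im z \<longrightarrow> cmod (p z - q z) \<le> C * exp (e * cmod z)" by blast
qed

lemma decays_imp_type0_upper:
  assumes "decays 0 p" shows "type0_upper p"
proof -
  obtain C where C: "C \<ge> 0" "\<And>z. 0 \<le> Im z \<Longrightarrow> cmod (p z) \<le> C" using assms by (elim decaysE) auto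
  show ?thesis unfolding type0_upper_def
  proof (intro allI impI exI[of _ C])
    fix e :: real and z assume "e > 0" "0 \<le> Im z"
    moreover from this have "C * 1 \<le> C * exp (e * cmod z)" using C by (intro mult_left_mono) auto
    ultimately show "cmod (p z) \<le> C * exp (e * cmod z)" using C(2)[of z] by linarith
  qed
qed

lemma type0_upper_of_mult_decays:
  assumes w: "type0 w" and P: "decays a P" and a: "a \<ge> 0"
  shows "type0_upper (\<lambda>z. w z * P z)"
proof -
  have "decays 0 P" using decays_mono[OF P a] .
  from type0_upper_mult_decays[OF w this] show ?thesis by simp
qed

lemma type0_mult_on_imaginary_axis:
  assumes w: "type0 w" and P: "decays a P" and a: "a > 0"
  shows "\<exists>M. \<forall>y\<ge>0. cmod (w (\<i> * of_real y) * P (\<i> * of_real y)) \<le> M"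
proof -
  obtain C where C: "\<And>z. cmod (w z) \<le> C * exp (a * cmod z)" using w a by (auto simp: type0_def)
  obtain D where D: "D \<ge> 0" "\<And>z. 0 \<le> Im z \<Longrightarrow> cmod (P z) \<le> D * exp (- a * Im z)"
    using P by (elim decaysE) auto
  have "cmod (w (\<i> * of_real y) * P (\<i> * of_real y)) \<le> C * D" if y: "y \<ge> 0" for y
  proof -
    have "cmod (w (\<i> * of_real y)) \<le> C * exp (a * y)" using C[of "\<i> * of_real y"] y by (simp add: norm_mult)
    moreover have "cmod (P (\<i> * of_real y)) \<le> D * exp (- a * y)" using D(2)[of "\<i> * of_real y"] y by simp
    ultimately have "cmod (w (\<i> * of_real y) * P (\<i> * of_real y)) \<le> (C * exp (a * y)) * (D * exp (- a * y))"
      unfolding norm_mult using order_trans[OF norm_ge_zero \<open>cmod (w (\<i> * of_real y)) \<le> C * exp (a * y)\<close>]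
      by (intro mult_mono) auto
    also have "\<dots> = C * D" by (simp add: exp_minus)
    finally show ?thesis .
  qed
  then show ?thesis by blast
qed

text \<open>A multiplier of type zero should not enlarge the spectrum, but after multiplication the two parts \<open>A\<close> and \<open>B\<close>
  are not known to be integrable, or even bounded, separately. The product \<open>G = A + B\<close> is band-limited, so it splits at frequency 0
  into functions \<open>Kp\<close> and \<open>Km\<close> that are bounded in the upper and in the lower half-plane. The two
  decompositions differ by an entire function of type zero, bounded on the imaginary axis, hence a constant.
  This bounds the parts on the line, and they inherit the decay of the parts of \<open>f\<close>.\<close>

lemma type0_multiplier_in_PW1:
  assumes P: "P holomorphic_on UNIV" "decays (2 * pi * \<rho>) P" "decays (- (2 * pi * \<sigma>)) (star P)"
    and N: "N holomorphic_on UNIV" "decays (2 * pi * \<rho>) (star N)" "decays (- (2 * pi * \<sigma>)) N"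
    and \<rho>: "0 < \<rho>" "\<rho> \<le> \<sigma>"
    and w: "w holomorphic_on UNIV" "type0 w"
    and i: "integrable lborel (\<lambda>x. w (of_real x) * P (of_real x) + w (of_real x) * N (of_real x))"
  shows "abs_L1 (\<lambda>x. w (of_real x) * P (of_real x) + w (of_real x) * N (of_real x)) \<in> PW1 ({-\<sigma>..-\<rho>} \<union> {\<rho>..\<sigma>})"
proof -
  define A where "A z = w z * P z" for z
  define B where "B z = w z * N z" for z
  define G where "G z = A z + B z" for z
  have Ah: "A holomorphic_on UNIV" and Bh: "B holomorphic_on UNIV" unfolding A_def B_def by (intro holomorphic_intros w P N)+
  have Gh: "G holomorphic_on UNIV" unfolding G_def by (intro holomorphic_intros Ah Bh)
  have Gi: "integrable lborel (\<lambda>x. G (of_real x))" using i by (simp add: G_def A_def B_def)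
  have sA: "star A = (\<lambda>z. star w z * star P z)" and sB: "star B = (\<lambda>z. star w z * star N z)"
    by (rule ext, simp add: star_def A_def B_def)+
  have \<sigma>: "0 < \<sigma>" using \<rho> by simp
  have le: "- (2 * pi * \<sigma>) \<le> 2 * pi * \<rho>"
  proof -
    have "0 \<le> 2 * pi * \<sigma>" "0 \<le> 2 * pi * \<rho>" using \<rho> by simp_all
    then show ?thesis by linarith
  qed
  have PN: "decays (- (2 * pi * \<sigma>)) (\<lambda>z. P z + N z)" by (intro decays_add N decays_mono[OF P(2) le])
  have PNs: "decays (- (2 * pi * \<sigma>)) (\<lambda>z. star P z + star N z)" by (intro decays_add P decays_mono[OF N(2) le])
  have up: "type0_upper (\<lambda>z. star (star G) z * exp (\<i> * of_real (- (- (2 * pi * \<sigma>))) * z))"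
    using type0_upper_mult_decays[OF w(2) PN] by (simp add: G_def A_def B_def distrib_left)
  have low: "type0_upper (\<lambda>z. star G z * exp (\<i> * of_real (- (- (2 * pi * \<sigma>))) * z))"
    using type0_upper_mult_decays[OF type0_star[OF w(2)] PNs] by (simp add: star_def G_def A_def B_def distrib_left)
  have sGi: "integrable lborel (\<lambda>x. star G (of_real x))" using Gi by (simp add: star_def)
  have right: "ft (\<lambda>x. G (of_real x)) t = 0" if "\<sigma> < t" for t
    using ft_right_of_growth[OF Gh Gi low that] that \<sigma> by simp
  have left: "ft (\<lambda>x. G (of_real x)) t = 0" if "t < - \<sigma>" for t
  proof -
    have "ft (\<lambda>x. star G (of_real x)) (- t) = 0"
      using ft_right_of_growth[OF holomorphic_star[OF Gh] sGi up, of "- t"] that \<sigma> by simp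
    then show ?thesis by (simp add: ft_star)
  qed
  define p where "p = ft (\<lambda>x. G (of_real x))"
  have pc: "continuous_on X p" for X unfolding p_def by (rule ft_continuous[OF Gi])
  have "AE x in lborel. G (of_real x) = synth (-\<sigma>) \<sigma> p (of_real x)"
    unfolding p_def by (rule band_limited_AE_synth[OF Gi]) (use left right in \<open>auto simp: not_le\<close>)
  then have Gs: "G = synth (-\<sigma>) \<sigma> p"
    by (intro entire_unique_AE Gh synth_holomorphic pc)
  define Kp where "Kp = synth 0 \<sigma> p"
  define Km where "Km = synth (-\<sigma>) 0 p"
  have Kh: "Kp holomorphic_on UNIV" "Km holomorphic_on UNIV" unfolding Kp_def Km_def by (intro synth_holomorphic pc)+
  have GK: "G z = Km z + Kp z" for z
    unfolding Gs Kp_def Km_def by (rule synth_combine[OF pc]) (use \<sigma> in auto)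
  have Kd: "decays 0 Kp" "decays 0 (star Km)"
    using synth_decays(1)[OF pc, of 0 \<sigma>] synth_decays(2)[OF pc, of "-\<sigma>" 0] \<sigma> by (auto simp: Kp_def Km_def)
  have Kb: "\<exists>M. \<forall>z. 0 \<le> Im z \<longrightarrow> cmod (K z) \<le> M" if "decays 0 K" for K
    using that by (auto simp: decays_def)
  \<comment> \<open>The two expressions for \<open>E\<close> give its growth in the upper and in the lower half-plane.\<close>
  define E where "E z = A z - Kp z" for z
  have E2: "E z = Km z - B z" for z using GK[of z] by (simp add: E_def G_def algebra_simps)
  have Eh: "E holomorphic_on UNIV" unfolding E_def by (intro holomorphic_intros Ah Kh)
  have sE: "star E = (\<lambda>z. star Km z - star B z)" by (rule ext) (simp add: star_def E2)
  have rpos: "2 * pi * \<rho> > 0" using \<rho> by simp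
  have Et: "type0 E"
  proof (rule type0_of_upper_halves)
    show "type0_upper E" unfolding E_def A_def
      by (intro type0_upper_diff type0_upper_of_mult_decays[OF w(2) P(2)] decays_imp_type0_upper Kd) (use rpos in simp)
    show "type0_upper (star E)" unfolding sE sB
      by (intro type0_upper_diff type0_upper_of_mult_decays[OF type0_star[OF w(2)] N(2)] decays_imp_type0_upper Kd)
        (use rpos in simp)
  qed
  obtain c where c: "\<And>z. E z = c"
  proof -
    obtain M1 where M1: "\<And>y. y \<ge> 0 \<Longrightarrow> cmod (A (\<i> * of_real y)) \<le> M1"
      using type0_mult_on_imaginary_axis[OF w(2) P(2) rpos] by (auto simp: A_def)
    obtain M2 where M2: "\<And>y. y \<ge> 0 \<Longrightarrow> cmod (star B (\<i> * of_real y)) \<le> M2"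
      using type0_mult_on_imaginary_axis[OF type0_star[OF w(2)] N(2) rpos] by (auto simp: sB)
    obtain M3 where M3: "\<And>z. 0 \<le> Im z \<Longrightarrow> cmod (Kp z) \<le> M3" using Kb[OF Kd(1)] by blast
    obtain M4 where M4: "\<And>z. 0 \<le> Im z \<Longrightarrow> cmod (star Km z) \<le> M4" using Kb[OF Kd(2)] by blast
    define E' where "E' z = E (\<i> * z)" for z
    have E'h: "E' holomorphic_on UNIV"
    proof -
      have "(\<lambda>z. \<i> * z) holomorphic_on UNIV" by (intro holomorphic_intros)
      moreover have "E holomorphic_on (\<lambda>z. \<i> * z) ` UNIV" by (rule holomorphic_on_subset[OF Eh]) simp
      ultimately have "(E \<circ> (\<lambda>z. \<i> * z)) holomorphic_on UNIV" by (rule holomorphic_on_compose)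
      then show ?thesis by (simp add: o_def E'_def [abs_def])
    qed
    have E't: "type0 E'"
      unfolding type0_def
    proof (intro allI impI)
      fix e :: real assume "e > 0"
      then obtain C where C: "\<And>z. cmod (E z) \<le> C * exp (e * cmod z)" using Et by (auto simp: type0_def)
      have "cmod (E' z) \<le> C * exp (e * cmod z)" for z using C[of "\<i> * z"] by (simp add: E'_def norm_mult)
      then show "\<exists>C. \<forall>z. cmod (E' z) \<le> C * exp (e * cmod z)" by blast
    qed
    have "cmod (E' (of_real y)) \<le> max (M1 + M3) (M2 + M4)" for y :: real
    proof (cases "y \<ge> 0")
      case True
      have "cmod (E (\<i> * of_real y)) \<le> M1 + M3"
        unfolding E_def by (rule norm_triangle_le_diff) (use M1[OF True] M3[of "\<i> * of_real y"] True in \<open>intro add_mono; simp\<close>)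
      then show ?thesis by (simp add: E'_def)
    next
      case False
      have "cmod (star E (\<i> * of_real (- y))) \<le> M4 + M2"
        unfolding sE by (rule norm_triangle_le_diff) (use M2[of "- y"] M4[of "\<i> * of_real (- y)"] False in \<open>intro add_mono; simp\<close>)
      then show ?thesis by (simp add: E'_def star_def)
    qed
    then obtain c where c: "\<And>z. E' z = c" using type0_bounded_constant[OF E'h E't] by blast
    have "E z = c" for z using c[of "- \<i> * z"] by (simp add: E'_def)
    then show ?thesis using that by blast
  qed
  obtain M3 where M3: "\<And>z. 0 \<le> Im z \<Longrightarrow> cmod (Kp z) \<le> M3" using Kb[OF Kd(1)] by blast
  obtain M4 where M4: "\<And>z. 0 \<le> Im z \<Longrightarrow> cmod (star Km z) \<le> M4" using Kb[OF Kd(2)] by blast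
  have Ab: "cmod (A (of_real x)) \<le> M3 + cmod c" for x :: real
  proof -
    have "A (of_real x) = Kp (of_real x) + c" using c[of "of_real x"] by (simp add: E_def algebra_simps)
    then show ?thesis using M3[of "of_real x"] norm_triangle_ineq[of "Kp (of_real x)" c] by simp
  qed
  have Bb: "cmod (B (of_real x)) \<le> M4 + cmod c" for x :: real
  proof -
    have "B (of_real x) = Km (of_real x) - c" using c[of "of_real x"] by (simp add: E2 algebra_simps)
    moreover have "cmod (Km (of_real x)) \<le> M4" using M4[of "of_real x"] by (simp add: star_def)
    ultimately show ?thesis using norm_triangle_ineq4[of "Km (of_real x)" c] by simp
  qed
  have "decays (2 * pi * \<rho>) A" unfolding A_def
    by (rule decays_type0_mult[OF w(1) P(1) w(2) P(2)]) (use Ab in \<open>simp add: A_def\<close>)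
  moreover have "decays (- (2 * pi * \<sigma>)) (star A)" unfolding sA
    by (rule decays_type0_mult[OF holomorphic_star[OF w(1)] holomorphic_star[OF P(1)] type0_star[OF w(2)] P(3)])
      (use Ab in \<open>simp add: A_def star_def norm_mult\<close>)
  moreover have "decays (2 * pi * \<rho>) (star B)" unfolding sB
    by (rule decays_type0_mult[OF holomorphic_star[OF w(1)] holomorphic_star[OF N(1)] type0_star[OF w(2)] N(2)])
      (use Bb in \<open>simp add: B_def star_def norm_mult\<close>)
  moreover have "decays (- (2 * pi * \<sigma>)) B" unfolding B_def
    by (rule decays_type0_mult[OF w(1) N(1) w(2) N(3)]) (use Bb in \<open>simp add: B_def\<close>)
  moreover have "integrable lborel (\<lambda>x. A (of_real x) + B (of_real x))" using Gi by (simp add: G_def)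
  ultimately have "abs_L1 (\<lambda>x. A (of_real x) + B (of_real x)) \<in> PW1 ({-\<sigma>..-\<rho>} \<union> {\<rho>..\<sigma>})"
    using Ah Bh \<rho> by (intro abs_L1_in_PW1)
  then show ?thesis by (simp add: A_def B_def)
qed

section \<open>Extreme and exposed points of unit balls in $L^1$\<close>

definition complex_subspace :: "L1 set \<Rightarrow> bool"
  where "complex_subspace X \<longleftrightarrow> (\<forall>f\<in>X. \<forall>g\<in>X. f + g \<in> X) \<and> (\<forall>c. \<forall>f\<in>X. scaleC_L1 c f \<in> X)"

lemma complex_subspaceD:
  assumes "complex_subspace X"
  shows "f \<in> X \<Longrightarrow> g \<in> X \<Longrightarrow> f + g \<in> X" "f \<in> X \<Longrightarrow> scaleC_L1 c f \<in> X" "f \<in> X \<Longrightarrow> r *\<^sub>R f \<in> X"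
    "f \<in> X \<Longrightarrow> - f \<in> X" "f \<in> X \<Longrightarrow> g \<in> X \<Longrightarrow> f - g \<in> X"
proof -
  show 1: "f \<in> X \<Longrightarrow> g \<in> X \<Longrightarrow> f + g \<in> X" "f \<in> X \<Longrightarrow> scaleC_L1 c f \<in> X" for f g c
    using assms by (auto simp: complex_subspace_def)
  show 2: "f \<in> X \<Longrightarrow> r *\<^sub>R f \<in> X" for r f using 1(2) by (simp add: scaleR_eq_scaleC)
  show 3: "f \<in> X \<Longrightarrow> - f \<in> X" for f using 2[of f "-1"] by simp
  show "f \<in> X \<Longrightarrow> g \<in> X \<Longrightarrow> f - g \<in> X" using 1(1)[of f "- g"] 3[of g] by simp
qed

lemma complex_subspace_PW1: "closed S \<Longrightarrow> complex_subspace (PW1 S)"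
  by (simp add: complex_subspace_def PW1_iff fourier_add fourier_scaleC)

lemma rep_scaleR: "AE x in lborel. rep_L1 (r *\<^sub>R f) x = r *\<^sub>R rep_L1 f x"
  using rep_scaleC[of "of_real r" f] by (simp add: scaleR_eq_scaleC scaleR_conv_of_real)

lemma rep_diff: "AE x in lborel. rep_L1 (f - g) x = rep_L1 f x - rep_L1 g x"
  using rep_add[of f "(-1) *\<^sub>R g"] rep_scaleR[of "-1" g] by eventually_elim simp

lemma norm_rep: "norm f = (LINT x|lborel. cmod (rep_L1 f x))"
  using norm_abs[OF integrable_rep[of f]] by simp

lemma integrable_cmod_rep: "integrable lborel (\<lambda>x. cmod (rep_L1 f x))"
  using integrable_rep by (rule integrable_norm)

lemma complex_norm_add_eq:
  fixes p q :: complex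
  assumes "cmod (p + q) = cmod p + cmod q"
  shows "p * cnj (p + q) \<in> \<real>\<^sub>\<ge>\<^sub>0"
proof -
  have "(cmod (p + q))\<^sup>2 = (cmod p)\<^sup>2 + 2 * Re (p * cnj q) + (cmod q)\<^sup>2"
    unfolding cmod_power2 by (simp add: power2_eq_square algebra_simps)
  with assms have "Re (p * cnj q) = cmod p * cmod q" unfolding assms by (simp add: power2_sum)
  then have re: "Re (p * cnj q) = cmod (p * cnj q)" by (simp add: norm_mult)
  then have im: "Im (p * cnj q) = 0" using cmod_eq_Re[of "p * cnj q"] by (metis abs_norm_cancel cmod_power2 add_cancel_right_right power2_eq_iff zero_eq_power2)
  have "p * cnj (p + q) = of_real ((cmod p)\<^sup>2) + p * cnj q" by (simp only: distrib_left complex_cnj_add complex_norm_square)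
  moreover have "p * cnj q \<in> \<real>\<^sub>\<ge>\<^sub>0" using re im by (simp add: complex_nonneg_Reals_iff)
  moreover have "complex_of_real ((cmod p)\<^sup>2) \<in> \<real>\<^sub>\<ge>\<^sub>0" by (subst nonneg_Reals_of_real_iff) simp
  ultimately show ?thesis by (metis nonneg_Reals_add_I)
qed

lemma Re_eq_cmod_imp_nonneg: "cmod z \<le> Re z \<Longrightarrow> z \<in> \<real>\<^sub>\<ge>\<^sub>0"
proof -
  assume a: "cmod z \<le> Re z"
  have r: "Re z \<ge> 0" using order_trans[OF norm_ge_zero a] .
  have "(cmod z)\<^sup>2 \<le> (Re z)\<^sup>2" using a by (intro power_mono) auto
  then have "Im z = 0" by (simp add: cmod_power2)
  then show ?thesis using r by (simp add: complex_nonneg_Reals_iff)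
qed

lemma mem_open_segment_around:
  fixes f d :: "'a :: real_vector"
  assumes "d \<noteq> 0"
  shows "f \<in> open_segment (f + d) (f - d)"
  unfolding in_segment
proof (intro conjI exI[of _ "1/2"])
  show "f + d \<noteq> f - d"
  proof
    assume "f + d = f - d"
    then have "2 *\<^sub>R d = 0" by (simp add: scaleR_2 eq_neg_iff_add_eq_0)
    then show False using assms by simp
  qed
  have "(1 / 2) *\<^sub>R (f + d) + (1 / 2) *\<^sub>R (f - d) = (1 / 2) *\<^sub>R (2 *\<^sub>R f)"
    unfolding scaleR_right_distrib[symmetric] by (simp add: scaleR_2)
  then show "f = (1 - 1 / 2) *\<^sub>R (f + d) + (1 / 2) *\<^sub>R (f - d)" by simp
qed auto

text \<open>Subtracting its mean with respect to \<open>\<bar>f\<bar>\<close>, the multiplier \<open>h\<close> may be assumed to have mean zero. Then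
  \<open>(1 + s h) f\<close> has the norm of \<open>f\<close> for all small real \<open>s\<close> of either sign.\<close>

lemma real_multiplier_not_extreme:
  fixes h :: "real \<Rightarrow> real"
  assumes X: "complex_subspace X" and f: "f \<in> X" and g: "g \<in> X"
    and h: "AE x in lborel. rep_L1 g x = h x *\<^sub>R rep_L1 f x" "\<And>x. \<bar>h x\<bar> \<le> M" "h \<in> borel_measurable borel"
    and nc: "\<And>c. g \<noteq> c *\<^sub>R f"
  shows "f \<notin> Ext X"
proof
  assume "f \<in> Ext X"
  then have fb: "f \<in> unit_ball X"
    and ext: "\<And>a b. a \<in> unit_ball X \<Longrightarrow> b \<in> unit_ball X \<Longrightarrow> f \<notin> open_segment a b"
    by (auto simp: Ext_def extreme_point_of_def)
  have f1: "norm f \<le> 1" using fb by (simp add: unit_ball_def)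
  have f0: "norm f \<noteq> 0"
  proof
    assume "norm f = 0"
    then have "f = 0" by simp
    then have "AE x in lborel. rep_L1 f x = 0" using rep_scaleR[of 0 0] by simp
    with h(1) have "AE x in lborel. rep_L1 g x = rep_L1 f x" by eventually_elim simp
    then have "g = f" by (rule L1_eqI)
    then show False using nc[of 1] by simp
  qed
  define I where "I = (LINT x|lborel. h x * cmod (rep_L1 f x))"
  define c where "c = I / norm f"
  define K where "K = \<bar>M\<bar> + \<bar>c\<bar> + 1"
  have K: "K > 0" by (simp add: K_def)
  have hK: "\<bar>h x - c\<bar> \<le> K" for x using h(2)[of x] by (simp add: K_def)
  have hi: "integrable lborel (\<lambda>x. h x * cmod (rep_L1 f x))"
  proof (rule Bochner_Integration.integrable_bound[of lborel "\<lambda>x. M * cmod (rep_L1 f x)"])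
    show "integrable lborel (\<lambda>x. M * cmod (rep_L1 f x))" using integrable_cmod_rep by simp
    show "AE x in lborel. norm (h x * cmod (rep_L1 f x)) \<le> norm (M * cmod (rep_L1 f x))"
      using order_trans[OF h(2) abs_ge_self] by (auto simp: abs_mult intro!: mult_right_mono)
  qed (use h(3) in measurable)
  have n: "norm (f + s *\<^sub>R (g - c *\<^sub>R f)) = norm f" if s: "\<bar>s\<bar> * K \<le> 1" for s
  proof -
    have "AE x in lborel. cmod (rep_L1 (f + s *\<^sub>R (g - c *\<^sub>R f)) x) = cmod (rep_L1 f x) + s * (h x * cmod (rep_L1 f x) - c * cmod (rep_L1 f x))"
      using h(1) rep_add[of f "s *\<^sub>R (g - c *\<^sub>R f)"] rep_scaleR[of s "g - c *\<^sub>R f"] rep_diff[of g "c *\<^sub>R f"] rep_scaleR[of c f]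
    proof eventually_elim
      case (elim x)
      have "\<bar>s * (h x - c)\<bar> \<le> \<bar>s\<bar> * K" unfolding abs_mult using hK by (intro mult_left_mono) auto
      then have "0 \<le> 1 + s * (h x - c)" using s by linarith
      moreover have "rep_L1 (f + s *\<^sub>R (g - c *\<^sub>R f)) x = (1 + s * (h x - c)) *\<^sub>R rep_L1 f x"
        using elim by (simp add: scaleR_conv_of_real algebra_simps)
      ultimately have eq: "cmod (rep_L1 (f + s *\<^sub>R (g - c *\<^sub>R f)) x) = (1 + s * (h x - c)) * cmod (rep_L1 f x)"
        by (simp only: norm_scaleR abs_of_nonneg)
      show ?case unfolding eq by (simp add: algebra_simps)
    qed
    then have "norm (f + s *\<^sub>R (g - c *\<^sub>R f)) = (LINT x|lborel. cmod (rep_L1 f x) + s * (h x * cmod (rep_L1 f x) - c * cmod (rep_L1 f x)))"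
      unfolding norm_rep by (intro integral_cong_AE) (use h(3) in measurable)
    also have "\<dots> = norm f + s * (I - c * norm f)"
      using hi integrable_cmod_rep[of f] by (simp add: I_def norm_rep)
    finally show ?thesis using f0 by (simp add: c_def)
  qed
  have mem: "f + s *\<^sub>R (g - c *\<^sub>R f) \<in> unit_ball X" if "\<bar>s\<bar> * K \<le> 1" for s
    using n[OF that] f1 complex_subspaceD[OF X] f g by (auto simp: unit_ball_def)
  define s where "s = 1 / K"
  have s: "s > 0" "\<bar>s\<bar> * K \<le> 1" "\<bar>- s\<bar> * K \<le> 1" using K by (auto simp: s_def)
  have "f \<in> open_segment (f + s *\<^sub>R (g - c *\<^sub>R f)) (f - s *\<^sub>R (g - c *\<^sub>R f))"
    by (rule mem_open_segment_around) (use s nc[of c] in simp)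
  then have "f \<in> open_segment (f + s *\<^sub>R (g - c *\<^sub>R f)) (f + (- s) *\<^sub>R (g - c *\<^sub>R f))" by simp
  then show False using ext[OF mem[OF s(2)] mem[OF s(3)]] by blast
qed

text \<open>A function of norm less than 1 can be moved in the direction of \<open>v\<close> both ways.\<close>

lemma extreme_imp_norm_1:
  assumes X: "complex_subspace X" and v: "v \<in> X" "v \<noteq> 0" and f: "f \<in> Ext X"
  shows "norm f = 1"
proof (rule ccontr)
  assume "norm f \<noteq> 1"
  from f have fb: "f \<in> unit_ball X"
    and ext: "\<And>a b. a \<in> unit_ball X \<Longrightarrow> b \<in> unit_ball X \<Longrightarrow> f \<notin> open_segment a b"
    by (auto simp: Ext_def extreme_point_of_def)
  have f1: "norm f < 1" "f \<in> X" using fb \<open>norm f \<noteq> 1\<close> by (auto simp: unit_ball_def)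
  define s where "s = (1 - norm f) / norm v"
  have s: "s > 0" "s * norm v = 1 - norm f" using f1 v by (auto simp: s_def)
  have m: "f + s *\<^sub>R v \<in> unit_ball X" "f - s *\<^sub>R v \<in> unit_ball X"
    using norm_triangle_ineq[of f "s *\<^sub>R v"] norm_triangle_ineq4[of f "s *\<^sub>R v"] s
      complex_subspaceD[OF X] f1 v by (auto simp: unit_ball_def)
  have "f \<in> open_segment (f + s *\<^sub>R v) (f - s *\<^sub>R v)"
    by (rule mem_open_segment_around) (use s v in simp)
  then show False using ext[OF m] by blast
qed

text \<open>If \<open>f\<close> lies in an open segment, equality holds almost everywhere in the triangle inequality, so that the endpoints have the
  argument of \<open>f\<close> and are dominated by multiples of \<open>f\<close>.\<close>

lemma extreme_if_rigid:
  assumes X: "complex_subspace X" and f: "f \<in> X" "norm f = 1"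
    and rigid: "\<And>g M. g \<in> X \<Longrightarrow> norm g = 1 \<Longrightarrow>
      AE x in lborel. rep_L1 g x * cnj (rep_L1 f x) \<in> \<real>\<^sub>\<ge>\<^sub>0 \<Longrightarrow>
      AE x in lborel. cmod (rep_L1 g x) \<le> M * cmod (rep_L1 f x) \<Longrightarrow> g = f"
  shows "f \<in> Ext X"
proof -
  have "f \<notin> open_segment a b" if a: "a \<in> unit_ball X" and b: "b \<in> unit_ball X" for a b
  proof
    assume "f \<in> open_segment a b"
    then obtain u where u: "0 < u" "u < 1" "f = (1 - u) *\<^sub>R a + u *\<^sub>R b" and ab: "a \<noteq> b" by (auto simp: in_segment)
    have nab: "norm a \<le> 1" "norm b \<le> 1" "a \<in> X" "b \<in> X" using a b by (auto simp: unit_ball_def)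
    have "1 \<le> norm ((1 - u) *\<^sub>R a) + norm (u *\<^sub>R b)" using norm_triangle_ineq[of "(1 - u) *\<^sub>R a" "u *\<^sub>R b"] u f by simp
    then have le: "1 \<le> (1 - u) * norm a + u * norm b" using u by simp
    have a1: "norm a = 1"
    proof (rule ccontr)
      assume "norm a \<noteq> 1"
      then have "(1 - u) * norm a < (1 - u) * 1" using nab u by (intro mult_strict_left_mono) auto
      moreover have "u * norm b \<le> u * 1" using nab u by (intro mult_left_mono) auto
      ultimately have "(1 - u) * norm a + u * norm b < 1" using add_less_le_mono by fastforce
      with leD[OF le] show False by (rule notE)
    qed
    have b1: "norm b = 1"
    proof (rule ccontr)
      assume "norm b \<noteq> 1"
      then have "u * norm b < u * 1" using nab u by (intro mult_strict_left_mono) auto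
      then show False using le a1 by simp
    qed
    let ?d = "\<lambda>x. (1 - u) * cmod (rep_L1 a x) + u * cmod (rep_L1 b x) - cmod (rep_L1 f x)"
    have fx: "AE x in lborel. rep_L1 f x = (1 - u) *\<^sub>R rep_L1 a x + u *\<^sub>R rep_L1 b x"
      using rep_add[of "(1 - u) *\<^sub>R a" "u *\<^sub>R b"] rep_scaleR[of "1 - u" a] rep_scaleR[of u b]
      by eventually_elim (simp add: u(3)[symmetric])
    have nn: "AE x in lborel. 0 \<le> ?d x"
      using fx
    proof eventually_elim
      case (elim x)
      show ?case using norm_triangle_ineq[of "(1 - u) *\<^sub>R rep_L1 a x" "u *\<^sub>R rep_L1 b x"] u(1,2) by (simp add: elim)
    qed
    have di: "integrable lborel ?d" using integrable_cmod_rep by simp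
    have "(LINT x|lborel. ?d x) = (1 - u) * norm a + u * norm b - norm f"
      using integrable_cmod_rep by (simp add: norm_rep)
    also have "\<dots> = 0" using a1 b1 f by simp
    finally have d0: "AE x in lborel. ?d x = 0" using integral_nonneg_eq_0_iff_AE[OF di nn] by simp
    have pos: "AE x in lborel. rep_L1 a x * cnj (rep_L1 f x) \<in> \<real>\<^sub>\<ge>\<^sub>0"
      using fx d0
    proof eventually_elim
      case (elim x)
      let ?p = "(1 - u) *\<^sub>R rep_L1 a x" and ?q = "u *\<^sub>R rep_L1 b x"
      have "cmod (?p + ?q) = cmod ?p + cmod ?q" using elim u by simp
      then have "?p * cnj (?p + ?q) \<in> \<real>\<^sub>\<ge>\<^sub>0" by (rule complex_norm_add_eq)
      then have "?p * cnj (rep_L1 f x) \<in> \<real>\<^sub>\<ge>\<^sub>0" by (simp only: elim(1))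
      moreover have "complex_of_real (1 / (1 - u)) \<in> \<real>\<^sub>\<ge>\<^sub>0" using u by (subst nonneg_Reals_of_real_iff) simp
      ultimately have "complex_of_real (1 / (1 - u)) * (?p * cnj (rep_L1 f x)) \<in> \<real>\<^sub>\<ge>\<^sub>0" by (rule nonneg_Reals_mult_I[rotated])
      moreover have "complex_of_real (1 / (1 - u)) * (?p * cnj (rep_L1 f x)) = of_real (1 / (1 - u) * (1 - u)) * (rep_L1 a x * cnj (rep_L1 f x))"
        unfolding scaleR_conv_of_real of_real_mult by (simp only: mult_ac)
      ultimately show ?case using u by simp
    qed
    have bd: "AE x in lborel. cmod (rep_L1 a x) \<le> 1 / (1 - u) * cmod (rep_L1 f x)"
      using d0
    proof eventually_elim
      case (elim x)
      have "0 \<le> u * cmod (rep_L1 b x)" using u by simp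
      then have "(1 - u) * cmod (rep_L1 a x) \<le> cmod (rep_L1 f x)" using elim by linarith
      then show ?case using u(1,2) by (simp add: field_simps)
    qed
    have "a = f" by (rule rigid[OF nab(3) a1 pos bd])
    then have "u *\<^sub>R a = u *\<^sub>R b" using u(3) by (auto simp: scaleR_left_diff_distrib)
    then show False using u ab by simp
  qed
  then show ?thesis using f by (auto simp: Ext_def extreme_point_of_def unit_ball_def)
qed

lemma dual_le_norm:
  assumes X: "complex_subspace X" and p: "\<phi> \<in> dual X" "dual_norm X \<phi> = 1" and g: "g \<in> X"
  shows "cmod (\<phi> g) \<le> norm g"
proof -
  obtain B where B: "\<And>f. f \<in> X \<Longrightarrow> cmod (\<phi> f) \<le> B * norm f" using p(1) unfolding dual_def by blast
  have sc: "\<phi> (scaleC_L1 c f) = c * \<phi> f" if "f \<in> X" for c f using p(1) that by (auto simp: dual_def)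
  have bdd: "bdd_above ((\<lambda>f. cmod (\<phi> f)) ` unit_ball X)"
  proof (rule bdd_aboveI2[of _ _ "\<bar>B\<bar>"])
    fix f assume "f \<in> unit_ball X"
    then have f: "f \<in> X" "norm f \<le> 1" by (auto simp: unit_ball_def)
    have "B * norm f \<le> \<bar>B\<bar> * 1" using f by (intro mult_mono) auto
    then show "cmod (\<phi> f) \<le> \<bar>B\<bar>" using B[OF f(1)] by simp
  qed
  show ?thesis
  proof (cases "g = 0")
    case True
    then show ?thesis using B[OF g] by simp
  next
    case False
    define r where "r = 1 / norm g"
    have r: "r > 0" "r * norm g = 1" using False by (auto simp: r_def)
    have "r *\<^sub>R g \<in> unit_ball X" using r g complex_subspaceD[OF X] by (simp add: unit_ball_def)
    then have "cmod (\<phi> (r *\<^sub>R g)) \<le> 1" using cSUP_upper[OF _ bdd] p(2) by (simp add: dual_norm_def)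
    then have "r * cmod (\<phi> g) \<le> r * norm g" using r by (simp add: scaleR_eq_scaleC sc[OF g] norm_mult)
    then show ?thesis by (rule mult_left_le_imp_le[OF _ r(1)])
  qed
qed

text \<open>A functional that norms \<open>f\<close> cannot distinguish \<open>f\<close> from other normalized functions of the same
  argument, because the norm is differentiable at \<open>f\<close> in their direction, with derivative 1. Explicitly, \<open>n f - g\<close> has norm \<open>n - 1\<close>
  up to an error that vanishes as \<open>n\<close> grows, and the value of the functional there is \<open>n - \<phi> g\<close>.\<close>

lemma exposed_imp_rigid:
  assumes X: "complex_subspace X" and f: "f \<in> Exp X" and g: "g \<in> X" "norm g = 1"
    and pos: "AE x in lborel. rep_L1 g x * cnj (rep_L1 f x) \<in> \<real>\<^sub>\<ge>\<^sub>0"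
    and zero: "AE x in lborel. rep_L1 f x = 0 \<longrightarrow> rep_L1 g x = 0"
  shows "g = f"
proof -
  obtain \<phi> where p: "\<phi> \<in> dual X" "dual_norm X \<phi> = 1" and only: "{g \<in> unit_ball X. \<phi> g = 1} = {f}"
    and fb: "f \<in> unit_ball X" using f by (auto simp: Exp_def)
  have pf: "\<phi> f = 1" using only by blast
  have fX: "f \<in> X" "norm f \<le> 1" using fb by (auto simp: unit_ball_def)
  have nf: "norm f = 1" using dual_le_norm[OF X p fX(1)] pf fX(2) by simp
  have lin: "\<phi> (a + b) = \<phi> a + \<phi> b" "\<phi> (scaleC_L1 c a) = c * \<phi> a" if "a \<in> X" "b \<in> X" for a b c
    using p(1) that by (auto simp: dual_def)
  \<comment> \<open>Where \<open>g\<close> exceeds \<open>n f\<close>, the norm of \<open>n f - g\<close> picks up twice the excess.\<close>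
  let ?J = "\<lambda>n x. max 0 (cmod (rep_L1 g x) - real n * cmod (rep_L1 f x))"
  have Jm: "?J n \<in> borel_measurable lborel" for n by measurable
  have Jle: "norm (?J n x) \<le> cmod (rep_L1 g x)" for n x by simp
  have lim: "(\<lambda>n. LINT x|lborel. ?J n x) \<longlonglongrightarrow> (LINT x::real|lborel. 0)"
  proof (rule integral_dominated_convergence[where w = "\<lambda>x. cmod (rep_L1 g x)"])
    show "AE x in lborel. (\<lambda>n. ?J n x) \<longlonglongrightarrow> 0"
      using zero
    proof eventually_elim
      case (elim x)
      show ?case
      proof (cases "rep_L1 f x = 0")
        case True
        then show ?thesis using elim by simp
      next
        case False
        obtain m :: nat where m: "cmod (rep_L1 g x) / cmod (rep_L1 f x) \<le> real m" using real_arch_simple by blast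
        have "?J n x = 0" if "n \<ge> m" for n
        proof -
          have "cmod (rep_L1 g x) \<le> real m * cmod (rep_L1 f x)" using m False by (simp add: field_simps)
          also have "\<dots> \<le> real n * cmod (rep_L1 f x)" using that by (intro mult_right_mono) auto
          finally show ?thesis by simp
        qed
        then show ?thesis by (intro tendsto_eventually) (auto simp: eventually_sequentially)
      qed
    qed
  qed (use Jm integrable_cmod_rep Jle in auto)
  have Ji: "integrable lborel (?J n)" for n
    by (rule Bochner_Integration.integrable_bound[OF integrable_cmod_rep[of g]]) (use Jm Jle in auto)
  have low: "1 - 2 * (LINT x|lborel. ?J (Suc n) x) \<le> Re (\<phi> g)" for n
  proof -
    let ?m = "real (Suc n)"
    have "AE x in lborel. cmod (rep_L1 (?m *\<^sub>R f - g) x) = ?m * cmod (rep_L1 f x) - cmod (rep_L1 g x) + 2 * ?J (Suc n) x"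
      using rep_diff[of "?m *\<^sub>R f" g] rep_scaleR[of ?m f] pos zero
    proof eventually_elim
      case (elim x)
      have "cmod (?m *\<^sub>R rep_L1 f x - rep_L1 g x) = \<bar>?m * cmod (rep_L1 f x) - cmod (rep_L1 g x)\<bar>"
      proof (cases "rep_L1 f x = 0")
        case True
        then show ?thesis using elim by simp
      next
        case False
        let ?a = "rep_L1 f x" and ?b = "rep_L1 g x"
        have bc: "?b * cnj ?a = of_real (cmod ?b * cmod ?a)"
        proof -
          obtain r where r: "?b * cnj ?a = of_real r" "r \<ge> 0" using elim(3) by (auto elim: nonneg_Reals_cases)
          have "r = cmod ?b * cmod ?a" using arg_cong[OF r(1), of cmod] r(2) by (simp add: norm_mult)
          then show ?thesis using r(1) by (simp only:)
        qed
        have "(?m *\<^sub>R ?a - ?b) * cnj ?a = ?m *\<^sub>R (?a * cnj ?a) - ?b * cnj ?a" by (simp add: left_diff_distrib)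
        also have "\<dots> = of_real ((?m * cmod ?a - cmod ?b) * cmod ?a)"
          unfolding bc complex_norm_square[symmetric] by (simp add: scaleR_conv_of_real power2_eq_square algebra_simps)
        finally have "cmod ((?m *\<^sub>R ?a - ?b) * cnj ?a) = \<bar>(?m * cmod ?a - cmod ?b) * cmod ?a\<bar>" by (simp only: norm_of_real)
        then show ?thesis using False by (simp add: norm_mult abs_mult)
      qed
      then show ?case using elim by (simp add: abs_if max_def)
    qed
    then have "norm (?m *\<^sub>R f - g) = (LINT x|lborel. ?m * cmod (rep_L1 f x) - cmod (rep_L1 g x) + 2 * ?J (Suc n) x)"
      unfolding norm_rep by (intro integral_cong_AE) measurable
    also have "\<dots> = ?m * norm f - norm g + 2 * (LINT x|lborel. ?J (Suc n) x)"
    proof -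
      have i: "integrable lborel (\<lambda>x. ?m * cmod (rep_L1 f x))" "integrable lborel (\<lambda>x. 2 * ?J (Suc n) x)"
        by (rule integrable_mult_right, rule integrable_cmod_rep, rule integrable_mult_right, rule Ji)
      show ?thesis
        by (simp only: Bochner_Integration.integral_add[OF Bochner_Integration.integrable_diff[OF i(1) integrable_cmod_rep] i(2)]
          Bochner_Integration.integral_diff[OF i(1) integrable_cmod_rep] integral_mult_right_zero norm_rep)
    qed
    finally have n: "norm (?m *\<^sub>R f - g) = ?m - 1 + 2 * (LINT x|lborel. ?J (Suc n) x)" by (simp only: nf g(2) mult_1_right)
    have X1: "?m *\<^sub>R f \<in> X" "(-1) *\<^sub>R g \<in> X" "?m *\<^sub>R f - g \<in> X"
      by (intro complex_subspaceD[OF X] fX(1) g(1))+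
    have "\<phi> (?m *\<^sub>R f + (-1) *\<^sub>R g) = ?m - \<phi> g"
      unfolding lin(1)[OF X1(1,2)] by (simp only: scaleR_eq_scaleC lin(2)[OF fX(1) g(1)] lin(2)[OF g(1) g(1)] pf) simp
    then have "\<phi> (?m *\<^sub>R f - g) = ?m - \<phi> g" by simp
    then have "Re (?m - \<phi> g) \<le> norm (?m *\<^sub>R f - g)"
      using order_trans[OF complex_Re_le_cmod dual_le_norm[OF X p X1(3)]] by (simp only:)
    moreover have "Re (?m - \<phi> g) = ?m - Re (\<phi> g)" by (simp only: minus_complex.sel Re_complex_of_real)
    ultimately show ?thesis using n by linarith
  qed
  have "(\<lambda>n. 1 - 2 * (LINT x|lborel. ?J (Suc n) x)) \<longlonglongrightarrow> 1 - 2 * 0"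
    using LIMSEQ_Suc[OF lim] by (intro tendsto_intros) simp
  then have "1 - 2 * 0 \<le> Re (\<phi> g)" by (rule LIMSEQ_le_const2) (use low in blast)
  then have "1 \<le> Re (\<phi> g)" by simp
  moreover have c1: "cmod (\<phi> g) \<le> 1" using dual_le_norm[OF X p g(1)] g by simp
  ultimately have "\<phi> g = 1"
  proof -
    assume 1: "1 \<le> Re (\<phi> g)"
    have "cmod (\<phi> g) \<le> Re (\<phi> g)" using 1 c1 by linarith
    then have "Im (\<phi> g) = 0" using Re_eq_cmod_imp_nonneg[of "\<phi> g"] by (simp add: complex_nonneg_Reals_iff)
    moreover have "Re (\<phi> g) = 1" using 1 c1 complex_Re_le_cmod[of "\<phi> g"] by linarith
    ultimately show ?thesis by (simp add: complex_eq_iff)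
  qed
  moreover have "g \<in> unit_ball X" using g by (simp add: unit_ball_def)
  ultimately have "g \<in> {g \<in> unit_ball X. \<phi> g = 1}" by blast
  then show ?thesis unfolding only by simp
qed

text \<open>The set on which a norming functional equals 1 is a face of the ball.\<close>

lemma exposed_imp_extreme:
  assumes X: "complex_subspace X" and f: "f \<in> Exp X"
  shows "f \<in> Ext X"
proof -
  obtain \<phi> where p: "\<phi> \<in> dual X" "dual_norm X \<phi> = 1" and only: "{g \<in> unit_ball X. \<phi> g = 1} = {f}"
    and fb: "f \<in> unit_ball X" using f by (auto simp: Exp_def)
  have pf: "\<phi> f = 1" using only by blast
  have one: "a = f" if a: "a \<in> unit_ball X" and r: "Re (\<phi> a) = 1" for a
  proof -
    have "cmod (\<phi> a) \<le> 1" using dual_le_norm[OF X p, of a] a by (simp add: unit_ball_def)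
    then have "Im (\<phi> a) = 0" using Re_eq_cmod_imp_nonneg[of "\<phi> a"] r by (simp add: complex_nonneg_Reals_iff)
    then have "\<phi> a = 1" using r by (simp add: complex_eq_iff)
    then have "a \<in> {g \<in> unit_ball X. \<phi> g = 1}" using a by blast
    then show ?thesis unfolding only by simp
  qed
  have re: "Re (\<phi> a) \<le> 1" if "a \<in> unit_ball X" for a
    using dual_le_norm[OF X p, of a] complex_Re_le_cmod[of "\<phi> a"] that by (simp add: unit_ball_def)
  have "f \<notin> open_segment a b" if a: "a \<in> unit_ball X" and b: "b \<in> unit_ball X" for a b
  proof
    assume "f \<in> open_segment a b"
    then obtain u where u: "0 < u" "u < 1" "f = (1 - u) *\<^sub>R a + u *\<^sub>R b" and ab: "a \<noteq> b" by (auto simp: in_segment)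
    have m: "a \<in> X" "b \<in> X" "(1 - u) *\<^sub>R a \<in> X" "u *\<^sub>R b \<in> X"
      using a b complex_subspaceD[OF X] by (auto simp: unit_ball_def)
    have lin: "\<phi> (a + b) = \<phi> a + \<phi> b" "\<phi> (scaleC_L1 c a) = c * \<phi> a" if "a \<in> X" "b \<in> X" for a b c
      using p(1) that by (auto simp: dual_def)
    have "\<phi> f = of_real (1 - u) * \<phi> a + of_real u * \<phi> b"
      unfolding u(3) lin(1)[OF m(3,4)] by (simp only: scaleR_eq_scaleC lin(2)[OF m(1,2)] lin(2)[OF m(2,2)])
    from arg_cong[OF this, of Re] have eq: "(1 - u) * Re (\<phi> a) + u * Re (\<phi> b) = 1" by (simp add: pf)
    have ra: "Re (\<phi> a) = 1"
    proof (rule ccontr)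
      assume "Re (\<phi> a) \<noteq> 1"
      then have "(1 - u) * Re (\<phi> a) < (1 - u) * 1" using re[OF a] u by (intro mult_strict_left_mono) auto
      moreover have "u * Re (\<phi> b) \<le> u * 1" using re[OF b] u by (intro mult_left_mono) auto
      ultimately have "(1 - u) * Re (\<phi> a) + u * Re (\<phi> b) < 1" using add_less_le_mono by fastforce
      then show False using eq by simp
    qed
    then have "Re (\<phi> b) = 1" using eq u by simp
    then show False using one[OF a ra] one[OF b] ab by simp
  qed
  then show ?thesis using fb by (auto simp: Ext_def extreme_point_of_def)
qed

text \<open>Integration against \<open>cnj (sgn f)\<close> attains its norm exactly at the normalized functions of the same argument.\<close>

lemma exposed_if_rigid:
  assumes X: "complex_subspace X" and f: "f \<in> X" "norm f = 1"
    and rigid: "\<And>g. g \<in> X \<Longrightarrow> norm g = 1 \<Longrightarrow>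
      AE x in lborel. rep_L1 g x * cnj (rep_L1 f x) \<in> \<real>\<^sub>\<ge>\<^sub>0 \<Longrightarrow> g = f"
  shows "f \<in> Exp X"
proof -
  define u where "u x = cnj (sgn (rep_L1 f x))" for x
  have [measurable]: "cnj \<in> borel_measurable borel" by (intro borel_measurable_continuous_onI continuous_intros)
  have um [measurable]: "u \<in> borel_measurable borel" unfolding u_def [abs_def] sgn_div_norm by measurable
  have u1: "cmod (u x) \<le> 1" for x by (simp add: u_def norm_sgn)
  define \<phi> where "\<phi> g = (LINT x|lborel. rep_L1 g x * u x)" for g
  have le: "cmod (rep_L1 g x * u x) \<le> cmod (rep_L1 g x)" for g x
    using mult_left_mono[OF u1, of "cmod (rep_L1 g x)" x] by (simp add: norm_mult)
  have ui: "integrable lborel (\<lambda>x. rep_L1 g x * u x)" for g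
    by (rule Bochner_Integration.integrable_bound[OF integrable_rep[of g]]) (use le in auto)
  have bd: "cmod (\<phi> g) \<le> norm g" for g
    unfolding \<phi>_def norm_rep by (rule order_trans[OF integral_norm_bound]) (intro integral_mono integrable_norm ui integrable_cmod_rep le)
  have add: "\<phi> (a + b) = \<phi> a + \<phi> b" for a b
  proof -
    have "\<phi> (a + b) = (LINT x|lborel. rep_L1 a x * u x + rep_L1 b x * u x)"
      unfolding \<phi>_def by (rule integral_cong_AE) (use rep_add[of a b] in \<open>auto simp: distrib_right elim: eventually_mono\<close>)
    then show ?thesis using ui by (simp add: \<phi>_def)
  qed
  have sc: "\<phi> (scaleC_L1 c a) = c * \<phi> a" for c a
  proof -
    have "\<phi> (scaleC_L1 c a) = (LINT x|lborel. c * (rep_L1 a x * u x))"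
      unfolding \<phi>_def by (rule integral_cong_AE) (use rep_scaleC[of c a] in \<open>auto simp: mult.assoc elim: eventually_mono\<close>)
    then show ?thesis using ui by (simp add: \<phi>_def)
  qed
  have pf: "\<phi> f = 1"
  proof -
    have "\<phi> f = (LINT x|lborel. complex_of_real (cmod (rep_L1 f x)))"
      unfolding \<phi>_def
    proof (rule Bochner_Integration.integral_cong)
      fix x
      have "rep_L1 f x * cnj (rep_L1 f x) = of_real (cmod (rep_L1 f x)) * of_real (cmod (rep_L1 f x))"
        by (simp only: complex_norm_square[symmetric] power2_eq_square of_real_mult)
      then show "rep_L1 f x * u x = of_real (cmod (rep_L1 f x))"
        by (cases "rep_L1 f x = 0") (simp_all add: u_def sgn_eq)
    qed simp
    then show ?thesis using f(2) by (simp add: norm_rep)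
  qed
  have fb: "f \<in> unit_ball X" using f by (simp add: unit_ball_def)
  have "\<exists>B. \<forall>f\<in>X. cmod (\<phi> f) \<le> B * norm f" using bd by (intro exI[of _ 1]) simp
  then have "\<phi> \<in> dual X" unfolding dual_def using add sc by blast
  moreover have "dual_norm X \<phi> = 1"
    unfolding dual_norm_def
  proof (rule antisym)
    have b: "cmod (\<phi> g) \<le> 1" if "g \<in> unit_ball X" for g using bd[of g] that by (simp add: unit_ball_def)
    show "(SUP f\<in>unit_ball X. cmod (\<phi> f)) \<le> 1" using fb b by (intro cSUP_least) auto
    have "bdd_above ((\<lambda>f. cmod (\<phi> f)) ` unit_ball X)" by (rule bdd_aboveI2[OF b])
    then show "1 \<le> (SUP f\<in>unit_ball X. cmod (\<phi> f))"
      using cSUP_upper[OF fb, of "\<lambda>f. cmod (\<phi> f)"] pf by simp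
  qed
  moreover have "{g \<in> unit_ball X. \<phi> g = 1} = {f}"
  proof (intro equalityI subsetI)
    fix g assume "g \<in> {g \<in> unit_ball X. \<phi> g = 1}"
    then have g: "g \<in> X" "norm g \<le> 1" "\<phi> g = 1" by (auto simp: unit_ball_def)
    have g1: "norm g = 1" using bd[of g] g by simp
    let ?d = "\<lambda>x. cmod (rep_L1 g x) - Re (rep_L1 g x * u x)"
    have nn: "AE x in lborel. 0 \<le> ?d x" using order_trans[OF complex_Re_le_cmod le] by (intro AE_I2) (simp only: diff_ge_0_iff_ge)
    have ri: "integrable lborel (\<lambda>x. Re (rep_L1 g x * u x))" by (rule integrable_Re[OF ui])
    have "(LINT x|lborel. ?d x) = norm g - Re (\<phi> g)"
      unfolding \<phi>_def using integrable_cmod_rep[of g] ri integral_Re[OF ui[of g]] by (simp only: norm_rep Bochner_Integration.integral_diff)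
    then have "(LINT x|lborel. ?d x) = 0" using g g1 by simp
    moreover have "integrable lborel ?d" by (intro Bochner_Integration.integrable_diff integrable_cmod_rep ri)
    ultimately have "AE x in lborel. ?d x = 0" using integral_nonneg_eq_0_iff_AE[OF _ nn] by blast
    then have "AE x in lborel. rep_L1 g x * cnj (rep_L1 f x) \<in> \<real>\<^sub>\<ge>\<^sub>0"
    proof eventually_elim
      case (elim x)
      have "rep_L1 g x * u x \<in> \<real>\<^sub>\<ge>\<^sub>0" using elim le[of g x] by (intro Re_eq_cmod_imp_nonneg) simp
      moreover have "complex_of_real (cmod (rep_L1 f x)) \<in> \<real>\<^sub>\<ge>\<^sub>0" by simp
      ultimately have "rep_L1 g x * u x * of_real (cmod (rep_L1 f x)) \<in> \<real>\<^sub>\<ge>\<^sub>0" by (rule nonneg_Reals_mult_I)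
      moreover have "u x * of_real (cmod (rep_L1 f x)) = cnj (rep_L1 f x)" by (simp add: u_def sgn_eq)
      ultimately show ?case by (simp only: mult.assoc)
    qed
    then show "g \<in> {f}" using rigid[OF g(1) g1] by simp
  qed (use fb pf in auto)
  ultimately show ?thesis using fb by (auto simp: Exp_def)
qed

section \<open>Perturbations inside the Paley-Wiener space\<close>

lemma rep_zero: "AE x in lborel. rep_L1 0 x = 0"
  using rep_scaleR[of 0 0] by simp

lemma type0_of_has_exp_type: "has_exp_type w 0 \<Longrightarrow> type0 w"
  by (simp add: has_exp_type_def type0_def)

text \<open>The lower bound in the definition of the type is automatic for type zero, by Liouville's theorem.\<close>

lemma has_exp_type_0_of_type0:
  assumes p: "p holomorphic_on UNIV" "type0 p" and nc: "\<not> p constant_on UNIV"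
  shows "has_exp_type p 0"
proof -
  have "\<exists>z. n \<le> cmod z \<and> exp (- e * cmod z) < cmod (p z)" if e: "e > 0" for e n :: real
  proof (rule ccontr)
    assume a: "\<not> (\<exists>z. n \<le> cmod z \<and> exp (- e * cmod z) < cmod (p z))"
    have "compact (p ` cball 0 n)" by (intro compact_continuous_image entire_continuous p compact_cball)
    then have "bounded (p ` cball 0 n \<union> cball 0 1)" by (simp add: compact_imp_bounded)
    moreover have "range p \<subseteq> p ` cball 0 n \<union> cball 0 1"
    proof (clarify)
      fix z assume "p z \<notin> cball 0 1"
      then have 1: "1 < cmod (p z)" by simp
      have "\<not> n \<le> cmod z"
      proof
        assume "n \<le> cmod z"
        then have "cmod (p z) \<le> exp (- e * cmod z)" using a by (meson not_le)
        moreover have "exp (- e * cmod z) \<le> 1" using e by simp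
        ultimately show False using 1 by linarith
      qed
      then show "p z \<in> p ` cball 0 n" by simp
    qed
    ultimately have "bounded (range p)" by (rule bounded_subset)
    then show False using Liouville_theorem[OF p(1)] nc by blast
  qed
  then have "\<exists>z :: nat \<Rightarrow> complex. \<forall>n. real n \<le> cmod (z n) \<and> exp (- e * cmod (z n)) < cmod (p (z n))" if "e > 0" for e
    using that by (intro choice) blast
  moreover have "filterlim z at_infinity sequentially" if "\<And>n. real n \<le> cmod (z n)" for z :: "nat \<Rightarrow> complex"
    unfolding filterlim_at_infinity_conv_norm_at_top
    by (rule filterlim_at_top_mono[OF filterlim_real_sequentially]) (use that in simp)
  ultimately have "\<exists>z :: nat \<Rightarrow> complex. filterlim z at_infinity sequentially \<and> (\<forall>n. exp ((0 - e) * cmod (z n)) < cmod (p (z n)))"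
    if "e > 0" for e using that by (metis diff_0)
  then show ?thesis using p by (simp add: has_exp_type_def type0_def)
qed

lemma Omega_points_iff_double_zero:
  assumes g: "g holomorphic_on UNIV"
  shows "x \<in> Omega_points g \<longleftrightarrow> double_zero g (of_real x)"
proof (cases "\<forall>z. g z = 0")
  case True
  then have "double_zero g (of_real x)" unfolding double_zero_def by (intro exI[of _ "\<lambda>_. 0"]) auto
  then show ?thesis using True by (simp add: Omega_points_def Omega_def)
next
  case False
  then obtain w where w: "g w \<noteq> 0" by blast
  obtain n q where q: "q holomorphic_on UNIV" "q (of_real x) \<noteq> 0" "\<And>z. g z = (z - of_real x) ^ n * q z"
    using entire_factor_zero[OF g w, of "of_real x"] by metis
  have "zorder g (of_real x) = int n"
    by (rule zorder_eqI[of UNIV _ q]) (use q in \<open>auto simp: mult.commute\<close>)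
  then have "x \<in> Omega_points g \<longleftrightarrow> n \<ge> 2"
    unfolding Omega_points_def Omega_def using False by (auto simp: zero_enat_def)
  also have "\<dots> \<longleftrightarrow> double_zero g (of_real x)"
  proof
    assume "n \<ge> 2"
    then have "(z - of_real x) ^ n = (z - of_real x)\<^sup>2 * (z - of_real x) ^ (n - 2)" for z :: complex
      by (simp only: power_add[symmetric] le_add_diff_inverse)
    then have "g z = (z - of_real x)\<^sup>2 * ((z - of_real x) ^ (n - 2) * q z)" for z
      using q(3)[of z] by (simp only: mult.assoc)
    moreover have "(\<lambda>z. (z - of_real x) ^ (n - 2) * q z) holomorphic_on UNIV" by (intro holomorphic_intros q)
    ultimately show "double_zero g (of_real x)" unfolding double_zero_def by blast
  next
    assume "double_zero g (of_real x)"
    then obtain H where H: "H holomorphic_on UNIV" "\<And>z. g z = (z - of_real x)\<^sup>2 * H z" by (auto simp: double_zero_def)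
    show "n \<ge> 2"
    proof (rule ccontr)
      assume n: "\<not> n \<ge> 2"
      have "q (of_real x) = (of_real x - of_real x) ^ (2 - n) * H (of_real x)"
      proof (rule entire_cancel_power[where m = n and y = "of_real x" and p = q and q = "\<lambda>z. (z - of_real x) ^ (2 - n) * H z"])
        show "(z - of_real x) ^ n * q z = (z - of_real x) ^ n * ((z - of_real x) ^ (2 - n) * H z)" for z
          using q(3)[of z] H(2)[of z] n unfolding mult.assoc[symmetric] power_add[symmetric] by simp
      qed (intro holomorphic_intros q H)+
      then show False using q(2) n by simp
    qed
  qed
  finally show ?thesis .
qed

text \<open>Near \<open>y\<close> compactness bounds the quotient, and elsewhere division by \<open>z - y\<close> does not increase the modulus.\<close>

lemma decays_divide_linear:
  assumes q: "q holomorphic_on UNIV" and d: "decays a (\<lambda>z. (z - y) * q z)"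
  shows "decays a q"
proof -
  obtain C where C: "C \<ge> 0" "\<And>z. 0 \<le> Im z \<Longrightarrow> cmod ((z - y) * q z) \<le> C * exp (- a * Im z)" using d by (elim decaysE) auto
  obtain M where M: "\<And>z. z \<in> cball y 1 \<Longrightarrow> cmod (q z) \<le> M"
  proof -
    have "compact (q ` cball y 1)" by (intro compact_continuous_image entire_continuous q compact_cball)
    then have "bounded (q ` cball y 1)" by (rule compact_imp_bounded)
    then show ?thesis using that unfolding bounded_iff by blast
  qed
  have M0: "M \<ge> 0" using order_trans[OF norm_ge_zero M[of y]] by simp
  define K where "K = exp (\<bar>a\<bar> * (cmod y + 1))"
  show ?thesis
  proof (rule decaysI[of _ "C + M * K"])
    fix z assume z: "0 \<le> Im z"
    show "cmod (q z) \<le> (C + M * K) * exp (- a * Im z)"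
    proof (cases "z \<in> cball y 1")
      case True
      have "cmod z \<le> cmod y + cmod (z - y)" using norm_triangle_ineq[of y "z - y"] by simp
      then have zb: "cmod z \<le> cmod y + 1" using True by (simp add: dist_norm norm_minus_commute)
      have "a * Im z \<le> \<bar>a * Im z\<bar>" by simp
      also have "\<dots> \<le> \<bar>a\<bar> * (cmod y + 1)"
        unfolding abs_mult using abs_Im_le_cmod[of z] zb by (intro mult_left_mono) auto
      finally have "1 \<le> K * exp (- a * Im z)" unfolding K_def exp_add[symmetric] by simp
      then have "M * 1 \<le> M * (K * exp (- a * Im z))" using M0 by (intro mult_left_mono)
      moreover have "0 \<le> C * exp (- a * Im z)" using C by simp
      ultimately show ?thesis using M[OF True] by (simp add: distrib_right mult.assoc)
    next
      case False
      then have "1 * cmod (q z) \<le> cmod (z - y) * cmod (q z)" by (intro mult_right_mono) (auto simp: dist_norm norm_minus_commute)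
      moreover have "0 \<le> M * K * exp (- a * Im z)" using M0 by (simp add: K_def)
      ultimately show ?thesis using C(2)[OF z] by (simp add: norm_mult distrib_right)
    qed
  qed
qed

lemma decays_divide_conjugate_pair:
  assumes "q holomorphic_on UNIV" "decays a (\<lambda>z. (z - y) * (z - cnj y) * q z)"
  shows "decays a q"
proof -
  have "decays a (\<lambda>z. (z - cnj y) * q z)"
    by (rule decays_divide_linear[of _ _ y]) (use assms in \<open>auto intro!: holomorphic_intros simp: mult.assoc\<close>)
  then show ?thesis using assms(1) by (rule decays_divide_linear[rotated])
qed

lemma integrable_divide_conjugate_pair:
  assumes q: "q holomorphic_on UNIV"
    and i: "integrable lborel (\<lambda>x. (of_real x - y) * (of_real x - cnj y) * q (of_real x))"
  shows "integrable lborel (\<lambda>x. q (of_real x))"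
proof -
  define R where "R = cmod y + 1"
  have "compact ((\<lambda>x::real. q (of_real x)) ` {- R..R})" by (intro compact_continuous_image entire_real_continuous q compact_Icc)
  then have "bounded ((\<lambda>x::real. q (of_real x)) ` {- R..R})" by (rule compact_imp_bounded)
  then obtain M where M: "\<And>x. x \<in> {- R..R} \<Longrightarrow> cmod (q (of_real x)) \<le> M" unfolding bounded_iff by blast
  have bd: "cmod (q (of_real x)) \<le> cmod ((of_real x - y) * (of_real x - cnj y) * q (of_real x)) + \<bar>M\<bar> * indicator {- R..R} x" for x
  proof (cases "x \<in> {- R..R}")
    case True
    then have ind: "indicator {- R..R} x = (1::real)" by simp
    show ?thesis
      unfolding ind mult_1_right
      using M[OF True] abs_ge_self[of M] norm_ge_zero[of "(of_real x - y) * (of_real x - cnj y) * q (of_real x)"] by linarith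
  next
    case False
    then have "R \<le> \<bar>x\<bar>" by auto
    then have 1: "1 \<le> cmod (of_real x - y)" "1 \<le> cmod (of_real x - cnj y)"
      using norm_triangle_ineq2[of "of_real x" y] norm_triangle_ineq2[of "of_real x" "cnj y"] by (simp_all add: R_def)
    have "1 * 1 \<le> cmod (of_real x - y) * cmod (of_real x - cnj y)" using 1 by (intro mult_mono) auto
    then have "1 * cmod (q (of_real x)) \<le> cmod (of_real x - y) * cmod (of_real x - cnj y) * cmod (q (of_real x))"
      by (intro mult_right_mono) auto
    then show ?thesis using False by (simp add: norm_mult)
  qed
  show ?thesis
  proof (rule Bochner_Integration.integrable_bound)
    have "integrable lborel (indicator {- R..R} :: real \<Rightarrow> real)"
      by (rule integrable_real_indicator) (auto simp: emeasure_lborel_Icc_eq)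
    then show "integrable lborel (\<lambda>x. cmod ((of_real x - y) * (of_real x - cnj y) * q (of_real x)) + \<bar>M\<bar> * indicator {- R..R} x)"
      by (intro Bochner_Integration.integrable_add integrable_norm i integrable_mult_right)
    show "AE x in lborel. norm (q (of_real x)) \<le> norm (cmod ((of_real x - y) * (of_real x - cnj y) * q (of_real x)) + \<bar>M\<bar> * indicator {- R..R} x)"
      using order_trans[OF bd abs_ge_self] by (intro AE_I2) (simp only: real_norm_def)
  qed (use entire_real_measurable[OF q] in simp)
qed

lemma parts_nonzero:
  assumes f: "f \<in> PW1 ({-\<sigma>..-\<rho>} \<union> {\<rho>..\<sigma>})" and \<rho>: "0 < \<rho>" "\<rho> \<le> \<sigma>" and "f \<noteq> 0"
  obtains w where "pos_part \<rho> \<sigma> f w + neg_part \<rho> \<sigma> f w \<noteq> 0"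
proof -
  have "\<not> (\<forall>w. pos_part \<rho> \<sigma> f w + neg_part \<rho> \<sigma> f w = 0)"
  proof
    assume z: "\<forall>w. pos_part \<rho> \<sigma> f w + neg_part \<rho> \<sigma> f w = 0"
    have "AE x in lborel. rep_L1 f x = rep_L1 0 x"
      using spectral_parts_entire(7)[OF f \<rho>] rep_zero by eventually_elim (simp add: z)
    then show False using L1_eqI \<open>f \<noteq> 0\<close> by blast
  qed
  then show ?thesis using that by blast
qed

text \<open>Dividing both parts of \<open>f\<close> by \<open>(z - y) * (z - cnj y)\<close> preserves their decay and amounts to the multiplier
  \<open>1 / \<bar>x - y\<bar>\<^sup>2\<close> on the line. This covers a pair of conjugate zeros as well as a double real zero.\<close>

lemma divide_common_zeros:
  assumes f: "f \<in> PW1 ({-\<sigma>..-\<rho>} \<union> {\<rho>..\<sigma>})" "f \<noteq> 0" and \<rho>: "0 < \<rho>" "\<rho> \<le> \<sigma>"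
    and P1: "P1 holomorphic_on UNIV" "\<And>z. pos_part \<rho> \<sigma> f z = (z - y) * (z - cnj y) * P1 z"
    and N1: "N1 holomorphic_on UNIV" "\<And>z. neg_part \<rho> \<sigma> f z = (z - y) * (z - cnj y) * N1 z"
  shows "\<exists>g. g \<in> PW1 ({-\<sigma>..-\<rho>} \<union> {\<rho>..\<sigma>}) \<and> (\<forall>c. g \<noteq> c *\<^sub>R f) \<and>
    (AE x in lborel. (cmod (of_real x - y))\<^sup>2 *\<^sub>R rep_L1 g x = rep_L1 f x)"
proof -
  note pf = spectral_parts_entire[OF f(1) \<rho>]
  define Q where "Q z = P1 z + N1 z" for z
  have Qh: "Q holomorphic_on UNIV" unfolding Q_def by (intro holomorphic_intros P1 N1)
  have F: "pos_part \<rho> \<sigma> f z + neg_part \<rho> \<sigma> f z = (z - y) * (z - cnj y) * Q z" for z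
    by (simp add: P1(2) N1(2) Q_def distrib_left)
  have ae: "AE x in lborel. rep_L1 f x = (of_real x - y) * (of_real x - cnj y) * Q (of_real x)"
    using pf(7) by eventually_elim (simp add: F)
  have sP: "star (pos_part \<rho> \<sigma> f) = (\<lambda>z. (z - y) * (z - cnj y) * star P1 z)"
    and sN: "star (neg_part \<rho> \<sigma> f) = (\<lambda>z. (z - y) * (z - cnj y) * star N1 z)"
    by (rule ext, simp add: star_def P1(2) N1(2) mult_ac)+
  have P: "pos_part \<rho> \<sigma> f = (\<lambda>z. (z - y) * (z - cnj y) * P1 z)"
    and N: "neg_part \<rho> \<sigma> f = (\<lambda>z. (z - y) * (z - cnj y) * N1 z)" using P1 N1 by auto
  have "integrable lborel (\<lambda>x. pos_part \<rho> \<sigma> f (of_real x) + neg_part \<rho> \<sigma> f (of_real x))" using pf(8,9) by simp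
  then have Qi: "integrable lborel (\<lambda>x. Q (of_real x))"
    unfolding F by (rule integrable_divide_conjugate_pair[OF Qh])
  define g where "g = abs_L1 (\<lambda>x. Q (of_real x))"
  have rg: "AE x in lborel. rep_L1 g x = Q (of_real x)" unfolding g_def by (rule rep_abs_AE[OF Qi])
  have "g \<in> PW1 ({-\<sigma>..-\<rho>} \<union> {\<rho>..\<sigma>})"
    unfolding g_def Q_def
  proof (rule abs_L1_in_PW1[OF _ P1(1) _ _ N1(1) _ _ \<rho>])
    show "integrable lborel (\<lambda>x. P1 (of_real x) + N1 (of_real x))" using Qi by (simp add: Q_def)
    show "decays (2 * pi * \<rho>) P1" by (rule decays_divide_conjugate_pair[OF P1(1)]) (rule pf(2)[unfolded P])
    show "decays (- (2 * pi * \<sigma>)) (star P1)"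
      by (rule decays_divide_conjugate_pair[OF holomorphic_star[OF P1(1)]]) (rule pf(3)[unfolded sP])
    show "decays (2 * pi * \<rho>) (star N1)"
      by (rule decays_divide_conjugate_pair[OF holomorphic_star[OF N1(1)]]) (rule pf(5)[unfolded sN])
    show "decays (- (2 * pi * \<sigma>)) N1" by (rule decays_divide_conjugate_pair[OF N1(1)]) (rule pf(6)[unfolded N])
  qed
  moreover have "g \<noteq> c *\<^sub>R f" for c
  proof
    assume gc: "g = c *\<^sub>R f"
    have "AE x in lborel. Q (of_real x) = of_real c * ((of_real x - y) * (of_real x - cnj y) * Q (of_real x))"
      using rep_scaleR[of c f] rg ae by eventually_elim (simp add: gc scaleR_conv_of_real)
    then have "Q = (\<lambda>z. of_real c * ((z - y) * (z - cnj y) * Q z))"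
      by (rule entire_unique_AE[OF Qh, rotated]) (intro holomorphic_intros Qh)
    then have Qz: "Q z * (1 - of_real c * ((z - y) * (z - cnj y))) = 0" for z
    proof -
      have "Q z = of_real c * ((z - y) * (z - cnj y) * Q z)" by (rule fun_cong[OF \<open>Q = _\<close>])
      moreover have "Q z * (1 - of_real c * u) = Q z - of_real c * (u * Q z)" for u by (simp add: algebra_simps)
      ultimately show ?thesis by simp
    qed
    obtain w where w: "Q w \<noteq> 0"
      using parts_nonzero[OF f(1) \<rho> f(2)] unfolding F by auto
    have "1 - of_real c * ((y - y) * (y - cnj y)) = 0"
      by (rule entire_mult_eq_0[OF Qh _ Qz w]) (intro holomorphic_intros)
    then show False by simp
  qed
  moreover have "AE x in lborel. (cmod (of_real x - y))\<^sup>2 *\<^sub>R rep_L1 g x = rep_L1 f x"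
    using rg ae
  proof eventually_elim
    case (elim x)
    have "complex_of_real ((cmod (of_real x - y))\<^sup>2) = (of_real x - y) * (of_real x - cnj y)"
      unfolding complex_norm_square by simp
    then show ?case unfolding elim scaleR_conv_of_real by simp
  qed
  ultimately show ?thesis by blast
qed

text \<open>The square of \<open>csinc\<close>, scaled to the width of one interval of the spectrum and modulated to its centre.\<close>

lemma PW1_nontrivial:
  assumes \<rho>: "0 < \<rho>" "\<rho> < \<sigma>"
  obtains v where "v \<in> PW1 ({-\<sigma>..-\<rho>} \<union> {\<rho>..\<sigma>})" "v \<noteq> 0"
proof -
  define e where "e = pi * (\<sigma> - \<rho>) / 2"
  define c where "c = pi * (\<sigma> + \<rho>)"
  have e: "e > 0" using \<rho> by (simp add: e_def)
  have ce: "c - 2 * e = 2 * pi * \<rho>" "c + 2 * e = 2 * pi * \<sigma>"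
    by (simp_all add: e_def c_def field_simps)
  define V where "V z = exp (\<i> * of_real c * z) * csinc (of_real e * z) ^ 2" for z
  have Vh: "V holomorphic_on UNIV" unfolding V_def by (intro holomorphic_intros holomorphic_csinc_power)
  have csq: "cmod (csinc (of_real e * z) ^ 2) \<le> 4 * exp (2 * e * \<bar>Im z\<bar>) / (1 + e * cmod z) ^ 2" for z
    using cmod_csinc_power_le[OF e, of z 2] by simp
  have csq': "cmod (csinc (of_real e * z) ^ 2) \<le> 4 * exp (2 * e * \<bar>Im z\<bar>)" for z
  proof -
    have "1 \<le> (1 + e * cmod z) ^ 2" using e by (intro one_le_power) simp
    then have "4 * exp (2 * e * \<bar>Im z\<bar>) / (1 + e * cmod z) ^ 2 \<le> 4 * exp (2 * e * \<bar>Im z\<bar>)" by (simp add: divide_le_eq)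
    then show ?thesis using csq[of z] by linarith
  qed
  have Vb: "cmod (V z) \<le> 4 * exp (- c * Im z + 2 * e * \<bar>Im z\<bar>)" for z
  proof -
    have "cmod (V z) = exp (- c * Im z) * cmod (csinc (of_real e * z) ^ 2)" by (simp add: V_def norm_mult)
    also have "\<dots> \<le> exp (- c * Im z) * (4 * exp (2 * e * \<bar>Im z\<bar>))" by (intro mult_left_mono csq') simp
    finally show ?thesis by (simp only: exp_add mult_ac)
  qed
  have d1: "decays (2 * pi * \<rho>) V"
  proof (rule decaysI[of _ 4])
    fix z assume z: "0 \<le> Im z"
    have "- c * Im z + 2 * e * \<bar>Im z\<bar> = - (c - 2 * e) * Im z" using z by (simp add: algebra_simps)
    then show "cmod (V z) \<le> 4 * exp (- (2 * pi * \<rho>) * Im z)" using Vb[of z] unfolding ce by simp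
  qed
  have d2: "decays (- (2 * pi * \<sigma>)) (star V)"
  proof (rule decaysI[of _ 4])
    fix z assume z: "0 \<le> Im z"
    have "- c * Im (cnj z) + 2 * e * \<bar>Im (cnj z)\<bar> = (c + 2 * e) * Im z" using z by (simp add: algebra_simps)
    then show "cmod (star V z) \<le> 4 * exp (- (- (2 * pi * \<sigma>)) * Im z)" using Vb[of "cnj z"] unfolding ce star_def by simp
  qed
  have Vi: "integrable lborel (\<lambda>x. V (of_real x))"
  proof (rule Bochner_Integration.integrable_bound[OF integrable_inverse_quadratic[of "4 * (1 + 1 / e\<^sup>2)"]])
    show "AE x in lborel. norm (V (of_real x)) \<le> norm (4 * (1 + 1 / e\<^sup>2) / (1 + x\<^sup>2))"
    proof (rule AE_I2)
      fix x :: real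
      have "norm (V (of_real x)) \<le> 4 * (1 / (1 + e * \<bar>x\<bar>)\<^sup>2)" using csq[of "of_real x"] by (simp add: V_def norm_mult)
      also have "\<dots> \<le> 4 * ((1 + 1 / e\<^sup>2) / (1 + \<bar>x\<bar>\<^sup>2))" by (intro mult_left_mono one_plus_square_le e) auto
      also have "\<dots> = 4 * (1 + 1 / e\<^sup>2) / (1 + x\<^sup>2)" by simp
      finally show "norm (V (of_real x)) \<le> norm (4 * (1 + 1 / e\<^sup>2) / (1 + x\<^sup>2))" using abs_ge_self order_trans unfolding real_norm_def by blast
    qed
  qed (use entire_real_measurable[OF Vh] in simp)
  define v where "v = abs_L1 (\<lambda>x. V (of_real x) + (\<lambda>_. 0) (complex_of_real x))"
  have "v \<in> PW1 ({-\<sigma>..-\<rho>} \<union> {\<rho>..\<sigma>})"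
    unfolding v_def
    by (rule abs_L1_in_PW1[OF _ Vh d1 d2 _ _ _ \<rho>(1) less_imp_le[OF \<rho>(2)]])
      (use Vi in \<open>auto simp: star_def decays_def intro!: exI[of _ 0]\<close>)
  moreover have "v \<noteq> 0"
  proof
    assume "v = 0"
    then have "AE x in lborel. V (of_real x) = (\<lambda>_. 0) (complex_of_real x)"
      using rep_abs_AE[of "\<lambda>x. V (of_real x)"] Vi rep_zero unfolding v_def by (simp del: of_real_eq_0_iff) (auto elim: AE_mp)
    then have "V = (\<lambda>_. 0)" by (rule entire_unique_AE[OF Vh holomorphic_on_const])
    then have "V 0 = 0" by simp
    then show False by (simp add: V_def csinc_def)
  qed
  ultimately show ?thesis using that by blast
qed

text \<open>If the spectrum keeps a distance \<open>d\<close> from the endpoints, then shifts by \<open>d\<close>, that is, multiplication by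
  \<open>cos (2 * pi * d * x)\<close>, do not move it out of the two intervals.\<close>

lemma extreme_imp_endpoint:
  assumes f: "f \<in> PW1 ({-\<sigma>..-\<rho>} \<union> {\<rho>..\<sigma>})" "f \<noteq> 0" and \<rho>: "0 < \<rho>" "\<rho> \<le> \<sigma>"
    and ext: "f \<in> Ext (PW1 ({-\<sigma>..-\<rho>} \<union> {\<rho>..\<sigma>}))"
  shows "\<sigma> \<in> Sp f \<or> - \<sigma> \<in> Sp f \<or> \<rho> \<in> Sp f \<or> - \<rho> \<in> Sp f"
proof (rule ccontr)
  let ?S = "{-\<sigma>..-\<rho>} \<union> {\<rho>..\<sigma>}"
  assume "\<not> (\<sigma> \<in> Sp f \<or> - \<sigma> \<in> Sp f \<or> \<rho> \<in> Sp f \<or> - \<rho> \<in> Sp f)"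
  then have out: "{\<sigma>, - \<sigma>, \<rho>, - \<rho>} \<subseteq> - Sp f" by auto
  have op: "open (- Sp f)" unfolding Sp_def by (intro open_Compl closed_closure)
  have nb: "\<exists>d>0. \<forall>t. \<bar>t - s\<bar> < d \<longrightarrow> fourier f t = 0" if "s \<in> {\<sigma>, - \<sigma>, \<rho>, - \<rho>}" for s
  proof -
    have "s \<in> - Sp f" using that out by blast
    then obtain d where d: "d > 0" "ball s d \<subseteq> - Sp f" using op by (meson open_contains_ball)
    have "fourier f t = 0" if "\<bar>t - s\<bar> < d" for t
    proof -
      have "t \<in> ball s d" using that by (simp add: dist_real_def abs_minus_commute)
      then have "t \<notin> Sp f" using d by auto
      moreover have "{t. fourier f t \<noteq> 0} \<subseteq> Sp f" unfolding Sp_def by (rule closure_subset)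
      ultimately show ?thesis by blast
    qed
    then show ?thesis using d by blast
  qed
  obtain d1 d2 d3 d4 where ds: "d1 > 0" "\<And>t. \<bar>t - \<sigma>\<bar> < d1 \<Longrightarrow> fourier f t = 0" "d2 > 0" "\<And>t. \<bar>t - (- \<sigma>)\<bar> < d2 \<Longrightarrow> fourier f t = 0"
    "d3 > 0" "\<And>t. \<bar>t - \<rho>\<bar> < d3 \<Longrightarrow> fourier f t = 0" "d4 > 0" "\<And>t. \<bar>t - (- \<rho>)\<bar> < d4 \<Longrightarrow> fourier f t = 0"
    using nb[of \<sigma>] nb[of "- \<sigma>"] nb[of \<rho>] nb[of "- \<rho>"] by auto
  define d where "d = min (min d1 d2) (min d3 d4)"
  have d: "d > 0" using ds by (simp add: d_def)
  have dz: "fourier f t = 0" if "\<bar>t - \<sigma>\<bar> < d \<or> \<bar>t + \<sigma>\<bar> < d \<or> \<bar>t - \<rho>\<bar> < d \<or> \<bar>t + \<rho>\<bar> < d" for t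
    using that ds(2)[of t] ds(4)[of t] ds(6)[of t] ds(8)[of t] by (auto simp: d_def)
  have f0: "fourier f t = 0" if "t \<notin> ?S" for t using f(1) that by (simp add: PW1_iff[OF closed_band])
  have shift: "fourier f (t - d) = 0" "fourier f (t + d) = 0" if t: "t \<notin> ?S" for t
  proof -
    show "fourier f (t - d) = 0"
    proof (cases "t - d \<in> ?S")
      case True
      then have "\<bar>(t - d) - \<sigma>\<bar> < d \<or> \<bar>(t - d) + \<rho>\<bar> < d" using t d by auto
      then show ?thesis using dz by blast
    qed (rule f0)
    show "fourier f (t + d) = 0"
    proof (cases "t + d \<in> ?S")
      case True
      then have "\<bar>(t + d) + \<sigma>\<bar> < d \<or> \<bar>(t + d) - \<rho>\<bar> < d" using t d by auto
      then show ?thesis using dz by blast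
    qed (rule f0)
  qed
  define h where "h x = cos (2 * pi * d * x)" for x :: real
  have hm: "h \<in> borel_measurable borel" unfolding h_def [abs_def] by measurable
  have hb: "\<bar>h x\<bar> \<le> 1" for x by (simp add: h_def)
  have gi: "integrable lborel (\<lambda>x. h x *\<^sub>R rep_L1 f x)"
  proof (rule Bochner_Integration.integrable_bound[OF integrable_rep[of f]])
    show "AE x in lborel. norm (h x *\<^sub>R rep_L1 f x) \<le> norm (rep_L1 f x)"
      using mult_right_mono[OF hb norm_ge_zero] by (intro AE_I2) simp
  qed (use hm in measurable)
  define g where "g = abs_L1 (\<lambda>x. h x *\<^sub>R rep_L1 f x)"
  have rg: "AE x in lborel. rep_L1 g x = h x *\<^sub>R rep_L1 f x" unfolding g_def by (rule rep_abs_AE[OF gi])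
  have "fourier g t = 0" if t: "t \<notin> ?S" for t
  proof -
    have "fourier g t = (LINT x|lborel. (exp (- 2 * pi * \<i> * of_real (t - d) * of_real x) * rep_L1 f x
        + exp (- 2 * pi * \<i> * of_real (t + d) * of_real x) * rep_L1 f x) / 2)"
      unfolding g_def fourier_abs[OF gi] ft_def
    proof (rule Bochner_Integration.integral_cong)
      fix x :: real
      let ?E = "\<lambda>t. exp (- 2 * pi * \<i> * of_real t * of_real x)"
      have "complex_of_real (h x) = cos (of_real (2 * pi * d * x))" unfolding h_def by (rule cos_of_real[symmetric])
      then have h: "complex_of_real (h x) = (?E (- d) + ?E d) / 2" unfolding cos_exp_eq by (simp add: mult_ac)
      have "?E t * ?E (- d) = ?E (t - d)" "?E t * ?E d = ?E (t + d)" unfolding exp_add[symmetric] by (simp_all add: algebra_simps)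
      then have E: "?E t * complex_of_real (h x) = (?E (t - d) + ?E (t + d)) / 2" unfolding h times_divide_eq_right distrib_left by simp
      have "?E t * (h x *\<^sub>R rep_L1 f x) = ?E t * complex_of_real (h x) * rep_L1 f x"
        by (simp only: scaleR_conv_of_real mult.assoc)
      also have "\<dots> = (?E (t - d) * rep_L1 f x + ?E (t + d) * rep_L1 f x) / 2"
        unfolding E by (simp only: times_divide_eq_left distrib_right)
      finally show "?E t * (h x *\<^sub>R rep_L1 f x) = (?E (t - d) * rep_L1 f x + ?E (t + d) * rep_L1 f x) / 2" .
    qed simp
    also have "\<dots> = (fourier f (t - d) + fourier f (t + d)) / 2"
      unfolding fourier_eq_ft ft_def integral_divide_zero
      by (subst Bochner_Integration.integral_add[OF ft_integrand[OF integrable_rep] ft_integrand[OF integrable_rep]]) simp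
    finally show ?thesis using shift[OF t] by simp
  qed
  then have gX: "g \<in> PW1 ?S" by (simp add: PW1_iff[OF closed_band])
  have "g \<noteq> c *\<^sub>R f" for c
  proof
    assume gc: "g = c *\<^sub>R f"
    define F where "F z = pos_part \<rho> \<sigma> f z + neg_part \<rho> \<sigma> f z" for z
    note pf = spectral_parts_entire[OF f(1) \<rho>]
    have Fh: "F holomorphic_on UNIV" unfolding F_def by (intro holomorphic_intros pf)
    have "AE x in lborel. cos (of_real (2 * pi * d) * of_real x) * F (of_real x) = of_real c * F (of_real x)"
      using rg rep_scaleR[of c f] pf(7)
    proof eventually_elim
      case (elim x)
      have "complex_of_real (h x) = cos (of_real (2 * pi * d) * of_real x)" unfolding h_def of_real_mult[symmetric] by (rule cos_of_real[symmetric])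
      then show ?case using elim by (auto simp: gc F_def scaleR_conv_of_real)
    qed
    then have eq: "(\<lambda>z. cos (of_real (2 * pi * d) * z) * F z) = (\<lambda>z. of_real c * F z)"
      by (rule entire_unique_AE[rotated 2]) (intro holomorphic_intros Fh)+
    have z0: "F z * (cos (of_real (2 * pi * d) * z) - of_real c) = 0" for z
      using fun_cong[OF eq, of z] by (simp add: algebra_simps)
    obtain w where w: "F w \<noteq> 0" using parts_nonzero[OF f(1) \<rho> f(2)] unfolding F_def by blast
    have cc: "cos (of_real (2 * pi * d) * z) - of_real c = 0" for z :: complex
      by (rule entire_mult_eq_0[OF Fh _ z0 w]) (intro holomorphic_intros)
    have "complex_of_real (2 * pi * d) * of_real (1 / (2 * d)) = of_real pi" unfolding of_real_mult[symmetric] using d by simp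
    then have "cos (complex_of_real pi) = of_real c" using cc[of "of_real (1 / (2 * d))"] by simp
    moreover have "of_real c = (1::complex)" using cc[of 0] by simp
    moreover have "cos (complex_of_real pi) = - 1" unfolding cos_of_real by simp
    ultimately show False by simp
  qed
  then have "f \<notin> Ext (PW1 ?S)"
    by (rule real_multiplier_not_extreme[OF complex_subspace_PW1[OF closed_band] f(1) gX rg hb hm])
  then show False using ext by blast
qed

text \<open>At a nonreal point \<open>y\<close> the multiplier \<open>1 / \<bar>x - y\<bar>\<^sup>2\<close> is bounded on the line.\<close>

lemma extreme_imp_no_common_nonreal_zeros:
  assumes f: "f \<in> PW1 ({-\<sigma>..-\<rho>} \<union> {\<rho>..\<sigma>})" "f \<noteq> 0" and \<rho>: "0 < \<rho>" "\<rho> \<le> \<sigma>"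
    and ext: "f \<in> Ext (PW1 ({-\<sigma>..-\<rho>} \<union> {\<rho>..\<sigma>}))"
  shows "Lambda (neg_part \<rho> \<sigma> f) \<inter> Lambda (pos_part \<rho> \<sigma> f) = {}"
proof (rule ccontr)
  let ?S = "{-\<sigma>..-\<rho>} \<union> {\<rho>..\<sigma>}"
  note pf = spectral_parts_entire[OF f(1) \<rho>]
  assume "Lambda (neg_part \<rho> \<sigma> f) \<inter> Lambda (pos_part \<rho> \<sigma> f) \<noteq> {}"
  then obtain y where y: "y \<notin> \<real>" "neg_part \<rho> \<sigma> f y = 0" "neg_part \<rho> \<sigma> f (cnj y) = 0"
    "pos_part \<rho> \<sigma> f y = 0" "pos_part \<rho> \<sigma> f (cnj y) = 0" by (auto simp: Lambda_def)
  have ny: "cnj y \<noteq> y" "Im y \<noteq> 0" using y(1) by (auto simp: complex_eq_iff complex_is_Real_iff)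
  have dv: "\<exists>q. q holomorphic_on UNIV \<and> (\<forall>z. p z = (z - y) * (z - cnj y) * q z)"
    if p: "p holomorphic_on UNIV" "p y = 0" "p (cnj y) = 0" for p
  proof -
    obtain q where q: "q holomorphic_on UNIV" "\<And>z. p z = (z - y) * q z" using entire_divide_zero[OF p(1,2)] by blast
    have "q (cnj y) = 0" using q(2)[of "cnj y"] p(3) ny by simp
    then obtain r where "r holomorphic_on UNIV" "\<And>z. q z = (z - cnj y) * r z" using entire_divide_zero[OF q(1)] by blast
    then show ?thesis using q(2) by (auto simp: mult.assoc)
  qed
  obtain P1 N1 where PN: "P1 holomorphic_on UNIV" "\<And>z. pos_part \<rho> \<sigma> f z = (z - y) * (z - cnj y) * P1 z"
    "N1 holomorphic_on UNIV" "\<And>z. neg_part \<rho> \<sigma> f z = (z - y) * (z - cnj y) * N1 z"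
    using dv[OF pf(1) y(4,5)] dv[OF pf(4) y(2,3)] by blast
  obtain g where g: "g \<in> PW1 ?S" "\<And>c. g \<noteq> c *\<^sub>R f"
    "AE x in lborel. (cmod (of_real x - y))\<^sup>2 *\<^sub>R rep_L1 g x = rep_L1 f x"
    using divide_common_zeros[OF f \<rho> PN] by blast
  define h where "h x = 1 / (cmod (of_real x - y))\<^sup>2" for x :: real
  have im: "\<bar>Im y\<bar> \<le> cmod (of_real x - y)" for x :: real using abs_Im_le_cmod[of "of_real x - y"] by simp
  have hb: "\<bar>h x\<bar> \<le> 1 / \<bar>Im y\<bar>\<^sup>2" for x
  proof -
    have "h x \<le> 1 / \<bar>Im y\<bar>\<^sup>2" unfolding h_def 
    proof (rule frac_le)
      show "0 < \<bar>Im y\<bar>\<^sup>2" using ny by simp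
      show "\<bar>Im y\<bar>\<^sup>2 \<le> (cmod (of_real x - y))\<^sup>2" by (rule power_mono[OF im abs_ge_zero])
    qed simp_all
    then show ?thesis by (simp add: h_def)
  qed
  have hm: "h \<in> borel_measurable borel" unfolding h_def [abs_def] by measurable
  have "AE x in lborel. rep_L1 g x = h x *\<^sub>R rep_L1 f x"
    using g(3)
  proof eventually_elim
    case (elim x)
    have "cmod (of_real x - y) > 0" using im[of x] ny by linarith
    then show ?case unfolding elim[symmetric] by (simp add: h_def)
  qed
  then have "f \<notin> Ext (PW1 ?S)"
    by (rule real_multiplier_not_extreme[OF complex_subspace_PW1[OF closed_band] f(1) g(1) _ hb hm g(2)])
  then show False using ext by blast
qed

lemma exposed_multiple:
  assumes X: "complex_subspace X" and f: "f \<in> Exp X" and g: "g \<in> X" "g \<noteq> 0"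
    and pos: "AE x in lborel. rep_L1 g x * cnj (rep_L1 f x) \<in> \<real>\<^sub>\<ge>\<^sub>0"
    and zero: "AE x in lborel. rep_L1 f x = 0 \<longrightarrow> rep_L1 g x = 0"
  shows "g = norm g *\<^sub>R f"
proof -
  have n: "norm g > 0" using g by simp
  define g' where "g' = (1 / norm g) *\<^sub>R g"
  have r: "AE x in lborel. rep_L1 g' x = (1 / norm g) *\<^sub>R rep_L1 g x" unfolding g'_def by (rule rep_scaleR)
  have "g' = f"
  proof (rule exposed_imp_rigid[OF X f])
    show "g' \<in> X" unfolding g'_def by (rule complex_subspaceD(3)[OF X g(1)])
    show "norm g' = 1" using n by (simp add: g'_def)
    show "AE x in lborel. rep_L1 g' x * cnj (rep_L1 f x) \<in> \<real>\<^sub>\<ge>\<^sub>0"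
      using r pos
    proof eventually_elim
      case (elim x)
      have "complex_of_real (1 / norm g) \<in> \<real>\<^sub>\<ge>\<^sub>0" using n by (subst nonneg_Reals_of_real_iff) simp
      from nonneg_Reals_mult_I[OF this elim(2)] show ?case unfolding elim(1) scaleR_conv_of_real by (simp only: mult.assoc)
    qed
    show "AE x in lborel. rep_L1 f x = 0 \<longrightarrow> rep_L1 g' x = 0" using r zero by eventually_elim simp
  qed
  then show ?thesis using n by (auto simp: g'_def)
qed

text \<open>At a real point the multiplier \<open>1 / \<bar>x - y\<bar>\<^sup>2\<close> is unbounded, but the quotient is still integrable.\<close>

lemma exposed_imp_no_common_double_zeros:
  assumes f: "f \<in> PW1 ({-\<sigma>..-\<rho>} \<union> {\<rho>..\<sigma>})" "f \<noteq> 0" and \<rho>: "0 < \<rho>" "\<rho> \<le> \<sigma>"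
    and ex: "f \<in> Exp (PW1 ({-\<sigma>..-\<rho>} \<union> {\<rho>..\<sigma>}))"
  shows "Omega_points (neg_part \<rho> \<sigma> f) \<inter> Omega_points (pos_part \<rho> \<sigma> f) = {}"
proof (rule ccontr)
  let ?S = "{-\<sigma>..-\<rho>} \<union> {\<rho>..\<sigma>}"
  note pf = spectral_parts_entire[OF f(1) \<rho>]
  assume "Omega_points (neg_part \<rho> \<sigma> f) \<inter> Omega_points (pos_part \<rho> \<sigma> f) \<noteq> {}"
  then obtain y where "double_zero (neg_part \<rho> \<sigma> f) (of_real y)" "double_zero (pos_part \<rho> \<sigma> f) (of_real y)"
    by (auto simp: Omega_points_iff_double_zero[OF pf(1)] Omega_points_iff_double_zero[OF pf(4)])
  then obtain P1 N1 where PN: "P1 holomorphic_on UNIV" "\<And>z. pos_part \<rho> \<sigma> f z = (z - of_real y) * (z - cnj (of_real y)) * P1 z"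
    "N1 holomorphic_on UNIV" "\<And>z. neg_part \<rho> \<sigma> f z = (z - of_real y) * (z - cnj (of_real y)) * N1 z"
    by (auto simp: double_zero_def power2_eq_square)
  obtain g where g: "g \<in> PW1 ?S" "\<And>c. g \<noteq> c *\<^sub>R f"
    "AE x in lborel. (cmod (of_real x - of_real y))\<^sup>2 *\<^sub>R rep_L1 g x = rep_L1 f x"
    using divide_common_zeros[OF f \<rho> PN] by blast
  have "g \<noteq> 0" using g(2)[of 0] by simp
  moreover have "AE x in lborel. rep_L1 g x * cnj (rep_L1 f x) \<in> \<real>\<^sub>\<ge>\<^sub>0"
    using g(3)
  proof eventually_elim
    case (elim x)
    have "rep_L1 g x * cnj (rep_L1 f x) = of_real ((cmod (of_real x - of_real y))\<^sup>2 * (cmod (rep_L1 g x))\<^sup>2)"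
      unfolding elim[symmetric] of_real_mult complex_norm_square[of "rep_L1 g x"] by (simp add: scaleR_conv_of_real)
    then show ?case by (simp del: of_real_mult of_real_power)
  qed
  moreover have "AE x in lborel. rep_L1 f x = 0 \<longrightarrow> rep_L1 g x = 0"
    using g(3) AE_lborel_singleton[of y]
  proof eventually_elim
    case (elim x)
    have "of_real x - complex_of_real y \<noteq> 0" using elim(2) by simp
    then show ?case unfolding elim(1)[symmetric] by simp
  qed
  ultimately have "g = norm g *\<^sub>R f" by (rule exposed_multiple[OF complex_subspace_PW1[OF closed_band] ex g(1)])
  then show False using g(2) by blast
qed

lemma exposed_imp_weights_diverge:
  assumes f: "f \<in> PW1 ({-\<sigma>..-\<rho>} \<union> {\<rho>..\<sigma>})" "f \<noteq> 0" and \<rho>: "0 < \<rho>" "\<rho> \<le> \<sigma>"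
    and ex: "f \<in> Exp (PW1 ({-\<sigma>..-\<rho>} \<union> {\<rho>..\<sigma>}))"
    and w: "w holomorphic_on UNIV" "\<not> w constant_on UNIV" "type0 w" "\<And>x::real. w (of_real x) \<in> \<real>\<^sub>\<ge>\<^sub>0"
  shows "(\<integral>\<^sup>+ x. ennreal (cmod (rep_L1 f x) * Re (w (of_real x))) \<partial>lborel) = \<infinity>"
proof (rule ccontr)
  let ?S = "{-\<sigma>..-\<rho>} \<union> {\<rho>..\<sigma>}"
  let ?P = "pos_part \<rho> \<sigma> f" and ?N = "neg_part \<rho> \<sigma> f"
  note pf = spectral_parts_entire[OF f(1) \<rho>]
  assume fin: "(\<integral>\<^sup>+ x. ennreal (cmod (rep_L1 f x) * Re (w (of_real x))) \<partial>lborel) \<noteq> \<infinity>"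
  have wr: "w (of_real x) = of_real (Re (w (of_real x)))" "Re (w (of_real x)) \<ge> 0" for x :: real
    using w(4)[of x] by (auto simp: complex_nonneg_Reals_iff complex_eq_iff)
  have wn: "cmod (w (of_real x)) = Re (w (of_real x))" for x :: real
    by (subst wr(1)) (simp only: norm_of_real abs_of_nonneg[OF wr(2)])
  have [measurable]: "(\<lambda>x::real. w (of_real x)) \<in> borel_measurable borel" by (rule entire_real_measurable[OF w(1)])
  have i: "integrable lborel (\<lambda>x. w (of_real x) * rep_L1 f x)"
  proof (rule integrableI_bounded)
    have "(\<integral>\<^sup>+ x. ennreal (norm (w (of_real x) * rep_L1 f x)) \<partial>lborel) = (\<integral>\<^sup>+ x. ennreal (cmod (rep_L1 f x) * Re (w (of_real x))) \<partial>lborel)"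
      by (simp only: norm_mult wn mult.commute)
    then show "(\<integral>\<^sup>+ x. ennreal (norm (w (of_real x) * rep_L1 f x)) \<partial>lborel) < \<infinity>" using fin by (simp add: top.not_eq_extremum)
  qed measurable
  have [measurable]: "(\<lambda>x::real. ?P (of_real x)) \<in> borel_measurable borel" "(\<lambda>x::real. ?N (of_real x)) \<in> borel_measurable borel"
    by (intro entire_real_measurable pf)+
  have ae: "AE x in lborel. w (of_real x) * rep_L1 f x = w (of_real x) * ?P (of_real x) + w (of_real x) * ?N (of_real x)"
    using pf(7) by eventually_elim (simp add: distrib_left)
  have i2: "integrable lborel (\<lambda>x. w (of_real x) * ?P (of_real x) + w (of_real x) * ?N (of_real x))"
    by (rule integrable_cong_AE_imp[OF i]) (use ae in \<open>auto elim: AE_mp\<close>)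
  define g where "g = abs_L1 (\<lambda>x. w (of_real x) * ?P (of_real x) + w (of_real x) * ?N (of_real x))"
  have gX: "g \<in> PW1 ?S" unfolding g_def
    by (rule type0_multiplier_in_PW1[OF pf(1-6) \<rho> w(1,3) i2])
  have rg: "AE x in lborel. rep_L1 g x = w (of_real x) * rep_L1 f x"
    using rep_abs_AE[OF i2] ae unfolding g_def by eventually_elim simp
  define F where "F z = ?P z + ?N z" for z
  have Fh: "F holomorphic_on UNIV" unfolding F_def by (intro holomorphic_intros pf)
  have nc: "g \<noteq> c *\<^sub>R f" for c
  proof
    assume gc: "g = c *\<^sub>R f"
    have "AE x in lborel. w (of_real x) * F (of_real x) = of_real c * F (of_real x)"
      using rg rep_scaleR[of c f] pf(7) by eventually_elim (auto simp: gc F_def scaleR_conv_of_real)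
    then have eq: "(\<lambda>z. w z * F z) = (\<lambda>z. of_real c * F z)"
      by (rule entire_unique_AE[rotated 2]) (intro holomorphic_intros Fh w)+
    have z0: "F z * (w z - of_real c) = 0" for z
      using fun_cong[OF eq, of z] by (simp add: algebra_simps)
    obtain v where v: "F v \<noteq> 0" using parts_nonzero[OF f(1) \<rho> f(2)] unfolding F_def by blast
    have "w z - of_real c = 0" for z
      by (rule entire_mult_eq_0[OF Fh _ z0 v]) (intro holomorphic_intros w)
    then have "w z = of_real c" for z by simp
    then have "w constant_on UNIV" unfolding constant_on_def by blast
    then show False using w by blast
  qed
  have "g \<noteq> 0" using nc[of 0] by simp
  moreover have "AE x in lborel. rep_L1 g x * cnj (rep_L1 f x) \<in> \<real>\<^sub>\<ge>\<^sub>0"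
    using rg
  proof eventually_elim
    case (elim x)
    have "rep_L1 g x * cnj (rep_L1 f x) = w (of_real x) * (rep_L1 f x * cnj (rep_L1 f x))" unfolding elim by (simp only: mult.assoc)
    also have "\<dots> = of_real (Re (w (of_real x)) * (cmod (rep_L1 f x))\<^sup>2)"
      unfolding complex_norm_square[symmetric] of_real_mult wr(1)[symmetric] ..
    finally show ?case using wr(2)[of x] by (simp del: of_real_mult of_real_power)
  qed
  moreover have "AE x in lborel. rep_L1 f x = 0 \<longrightarrow> rep_L1 g x = 0" using rg by eventually_elim simp
  ultimately have "g = norm g *\<^sub>R f" by (rule exposed_multiple[OF complex_subspace_PW1[OF closed_band] ex gX])
  then show False using nc by blast
qed

section \<open>Rigidity and the characterization\<close>

text \<open>The quotient of \<open>g\<close> and \<open>f\<close> is an entire function of type zero that is nonnegative on the line. It is constant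
  if it is bounded there, and otherwise because it would be a weight with a finite integral, namely the norm of \<open>g\<close>.\<close>

lemma same_argument_rigidity:
  assumes f: "f \<in> PW1 ({-\<sigma>..-\<rho>} \<union> {\<rho>..\<sigma>})" "norm f = 1"
    and g: "g \<in> PW1 ({-\<sigma>..-\<rho>} \<union> {\<rho>..\<sigma>})" "norm g = 1"
    and \<rho>: "0 < \<rho>" "\<rho> < \<sigma>" "\<sigma> < 2 * \<rho>"
    and ends: "\<sigma> \<in> Sp f \<or> - \<sigma> \<in> Sp f \<or> \<rho> \<in> Sp f \<or> - \<rho> \<in> Sp f"
    and Lam: "Lambda (neg_part \<rho> \<sigma> f) \<inter> Lambda (pos_part \<rho> \<sigma> f) = {}"
    and pos: "AE x in lborel. rep_L1 g x * cnj (rep_L1 f x) \<in> \<real>\<^sub>\<ge>\<^sub>0"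
    and alt: "(AE x in lborel. cmod (rep_L1 g x) \<le> M * cmod (rep_L1 f x)) \<or>
      (Omega_points (neg_part \<rho> \<sigma> f) \<inter> Omega_points (pos_part \<rho> \<sigma> f) = {} \<and>
      (\<forall>w. w holomorphic_on UNIV \<and> \<not> w constant_on UNIV \<and> has_exp_type w 0 \<and> (\<forall>x::real. w (of_real x) \<in> \<real>\<^sub>\<ge>\<^sub>0) \<longrightarrow>
        (\<integral>\<^sup>+ x. ennreal (cmod (rep_L1 f x) * Re (w (of_real x))) \<partial>lborel) = \<infinity>))"
  shows "g = f"
proof -
  note pf = spectral_parts_entire[OF f(1) \<rho>(1) less_imp_le[OF \<rho>(2)]]
  note pg = spectral_parts_entire[OF g(1) \<rho>(1) less_imp_le[OF \<rho>(2)]]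
  let ?P = "pos_part \<rho> \<sigma> f" and ?N = "neg_part \<rho> \<sigma> f"
  define F where "F z = ?P z + ?N z" for z
  define G where "G z = pos_part \<rho> \<sigma> g z + neg_part \<rho> \<sigma> g z" for z
  have Fh: "F holomorphic_on UNIV" and Gh: "G holomorphic_on UNIV" unfolding F_def G_def by (intro holomorphic_intros pf pg)+
  have rf: "AE x in lborel. rep_L1 f x = F (of_real x)" and rg: "AE x in lborel. rep_L1 g x = G (of_real x)"
    using pf(7) pg(7) by (simp_all add: F_def G_def)
  have f0: "f \<noteq> 0" using f(2) by auto
  obtain v where v: "F v \<noteq> 0" using parts_nonzero[OF f(1) \<rho>(1) less_imp_le[OF \<rho>(2)] f0] unfolding F_def by blast
  have everywhere: "x \<in> C" if C: "closed C" and ae: "AE x in lborel. x \<in> C" for C and x :: real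
    using mem_closed_if_AE_lebesgue[OF C AE_completion[OF ae]] .
  have posx: "G (of_real x) * cnj (F (of_real x)) \<in> \<real>\<^sub>\<ge>\<^sub>0" for x :: real
  proof -
    have "closed ((\<lambda>x::real. G (of_real x) * cnj (F (of_real x))) -` \<real>\<^sub>\<ge>\<^sub>0)"
      by (intro closed_vimage closed_nonneg_Reals_complex continuous_intros entire_real_continuous Fh Gh)
    moreover have "AE x in lborel. x \<in> (\<lambda>x::real. G (of_real x) * cnj (F (of_real x))) -` \<real>\<^sub>\<ge>\<^sub>0"
      using rf rg pos by eventually_elim simp
    ultimately show ?thesis using everywhere by blast
  qed
  have bdd: "cmod (G (of_real x)) \<le> M * cmod (F (of_real x))"
    if "AE x in lborel. cmod (rep_L1 g x) \<le> M * cmod (rep_L1 f x)" for x :: real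
  proof -
    have "closed {x::real. cmod (G (of_real x)) \<le> M * cmod (F (of_real x))}"
      by (intro closed_Collect_le continuous_intros entire_real_continuous Fh Gh)
    moreover have "AE x in lborel. x \<in> {x::real. cmod (G (of_real x)) \<le> M * cmod (F (of_real x))}"
      using rf rg that by eventually_elim simp
    ultimately show ?thesis using everywhere by blast
  qed
  have twopi: "2 * pi * \<rho> \<le> 2 * pi * \<sigma>" "2 * pi * \<sigma> < 2 * (2 * pi * \<rho>)" "0 < 2 * pi * \<rho>" using \<rho> by simp_all
  have real: "(\<exists>M. \<forall>x::real. cmod (G (of_real x)) \<le> M * cmod (F (of_real x))) \<or>
      (\<forall>x::real. \<not> (double_zero ?P (of_real x) \<and> double_zero ?N (of_real x)))"
    using alt
  proof (elim disjE conjE)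
    assume "AE x in lborel. cmod (rep_L1 g x) \<le> M * cmod (rep_L1 f x)"
    then show ?thesis using bdd by blast
  next
    assume "Omega_points ?N \<inter> Omega_points ?P = {}"
    then show ?thesis using Omega_points_iff_double_zero[OF pf(1)] Omega_points_iff_double_zero[OF pf(4)] by blast
  qed
  have nonreal: "\<not> (?P y = 0 \<and> ?P (cnj y) = 0 \<and> ?N y = 0 \<and> ?N (cnj y) = 0)" if "y \<notin> \<real>" for y
    using Lam that by (auto simp: Lambda_def)
  obtain \<phi> where ph: "\<phi> holomorphic_on UNIV" "star \<phi> = \<phi>" "\<And>z. G z = \<phi> z * F z"
    "\<And>z. pos_part \<rho> \<sigma> g z = \<phi> z * ?P z" "\<And>z. neg_part \<rho> \<sigma> g z = \<phi> z * ?N z" "\<And>x::real. \<phi> (of_real x) \<in> \<real>\<^sub>\<ge>\<^sub>0"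
    using same_argument_quotient[OF pf(1-6) pg(1-6) F_def G_def twopi posx v nonreal real] by blast
  have t0: "type0 \<phi>"
    by (rule quotient_type0_of_spectrum[OF f(1) \<rho>(1,2) ends ph(1,2) pg(2,3) ph(4) pg(5,6) ph(5)])
  obtain c where c: "\<And>z. \<phi> z = c"
  proof (cases "AE x in lborel. cmod (rep_L1 g x) \<le> M * cmod (rep_L1 f x)")
    case True
    have "cmod (\<phi> (of_real y)) \<le> M" for y :: real
    proof (rule ccontr)
      assume y: "\<not> cmod (\<phi> (of_real y)) \<le> M"
      \<comment> \<open>\<open>\<phi>\<close> can exceed \<open>M\<close> only at zeros of \<open>F\<close>, which do not fill an interval.\<close>
      let ?U = "{x::real. M < cmod (\<phi> (of_real x))}"
      have "open ?U" by (intro open_Collect_less continuous_intros entire_real_continuous ph)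
      moreover have "y \<in> ?U" using y by simp
      ultimately obtain e where e: "e > 0" "cball y e \<subseteq> ?U" by (meson open_contains_cball)
      have F0: "F (of_real x) = 0" if x: "x \<in> {y - e..y + e}" for x
      proof (rule ccontr)
        assume F0: "F (of_real x) \<noteq> 0"
        have "x \<in> ?U" using e x by (auto simp: cball_eq_atLeastAtMost)
        then have "M * cmod (F (of_real x)) < cmod (\<phi> (of_real x)) * cmod (F (of_real x))" using F0 by simp
        then show False using bdd[OF True, of x] by (simp add: ph(3) norm_mult)
      qed
      have lim: "complex_of_real y islimpt of_real ` {y - e..y + e}" by (rule of_real_islimpt) (use e in auto)
      have "F v = 0"
        by (rule analytic_continuation[OF Fh open_UNIV connected_UNIV subset_UNIV UNIV_I lim _ UNIV_I]) (use F0 in blast)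
      then show False using v by simp
    qed
    then show ?thesis using type0_bounded_constant[OF ph(1) t0] that by blast
  next
    case False
    have "\<phi> constant_on UNIV"
    proof (rule ccontr)
      assume nc: "\<not> \<phi> constant_on UNIV"
      have "(\<integral>\<^sup>+ x. ennreal (cmod (rep_L1 f x) * Re (\<phi> (of_real x))) \<partial>lborel) = \<infinity>"
        using alt False nc ph(1,6) has_exp_type_0_of_type0[OF ph(1) t0 nc] by blast
      moreover have "(\<integral>\<^sup>+ x. ennreal (cmod (rep_L1 f x) * Re (\<phi> (of_real x))) \<partial>lborel) = (\<integral>\<^sup>+ x. ennreal (norm (rep_L1 g x)) \<partial>lborel)"
      proof (rule nn_integral_cong_AE)
        show "AE x in lborel. ennreal (cmod (rep_L1 f x) * Re (\<phi> (of_real x))) = ennreal (norm (rep_L1 g x))"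
          using rf rg
        proof eventually_elim
          case (elim x)
          obtain r where r: "\<phi> (of_real x) = of_real r" "r \<ge> 0" using ph(6)[of x] by (auto elim: nonneg_Reals_cases)
          then show ?case unfolding elim ph(3) by (simp add: norm_mult mult.commute)
        qed
      qed
      moreover have "(\<integral>\<^sup>+ x. ennreal (norm (rep_L1 g x)) \<partial>lborel) < \<infinity>"
        using integrable_rep[of g] unfolding integrable_iff_bounded by blast
      ultimately show False by simp
    qed
    then show ?thesis using that by (auto simp: constant_on_def)
  qed
  have "c \<in> \<real>\<^sub>\<ge>\<^sub>0" using ph(6)[of 0] by (simp add: c)
  then obtain r where r: "c = of_real r" "r \<ge> 0" by (auto elim: nonneg_Reals_cases)
  have "g = r *\<^sub>R f"
  proof (rule L1_eqI)
    show "AE x in lborel. rep_L1 g x = rep_L1 (r *\<^sub>R f) x"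
      using rf rg rep_scaleR[of r f] by eventually_elim (simp add: ph(3) c r scaleR_conv_of_real)
  qed
  moreover from this have "r = 1" using f(2) g(2) r(2) by simp
  ultimately show ?thesis by simp
qed

theorem theorem2:
  fixes \<sigma> \<rho> :: real and S :: "real set"
  assumes "\<sigma> / 2 < \<rho>" and "\<rho> < \<sigma>"
    and "S = {-\<sigma>..-\<rho>} \<union> {\<rho>..\<sigma>}"
  shows "Ext (PW1 S) = {f \<in> PW1 S. norm f = 1 \<and>
      (\<sigma> \<in> Sp f \<or> -\<sigma> \<in> Sp f \<or> \<rho> \<in> Sp f \<or> -\<rho> \<in> Sp f) \<and>
      Lambda (neg_part \<rho> \<sigma> f) \<inter> Lambda (pos_part \<rho> \<sigma> f) = {}}
    \<and> Exp (PW1 S) = {f \<in> Ext (PW1 S).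
      Omega_points (neg_part \<rho> \<sigma> f) \<inter> Omega_points (pos_part \<rho> \<sigma> f) = {} \<and>
      (\<forall>w. w holomorphic_on UNIV \<and> \<not> w constant_on UNIV \<and> has_exp_type w 0 \<and>
          (\<forall>x::real. w (of_real x) \<in> \<real>\<^sub>\<ge>\<^sub>0) \<longrightarrow>
        (\<integral>\<^sup>+ x. ennreal (cmod (rep_L1 f x) * Re (w (of_real x))) \<partial>lborel) = \<infinity>)}"
proof -
  have \<rho>: "0 < \<rho>" "\<rho> < \<sigma>" "\<sigma> < 2 * \<rho>" "\<rho> \<le> \<sigma>" using assms(1,2) by auto
  let ?A = "\<lambda>f. norm f = 1 \<and> (\<sigma> \<in> Sp f \<or> -\<sigma> \<in> Sp f \<or> \<rho> \<in> Sp f \<or> -\<rho> \<in> Sp f) \<and>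
      Lambda (neg_part \<rho> \<sigma> f) \<inter> Lambda (pos_part \<rho> \<sigma> f) = {}"
  let ?B = "\<lambda>f. Omega_points (neg_part \<rho> \<sigma> f) \<inter> Omega_points (pos_part \<rho> \<sigma> f) = {} \<and>
      (\<forall>w. w holomorphic_on UNIV \<and> \<not> w constant_on UNIV \<and> has_exp_type w 0 \<and>
          (\<forall>x::real. w (of_real x) \<in> \<real>\<^sub>\<ge>\<^sub>0) \<longrightarrow>
        (\<integral>\<^sup>+ x. ennreal (cmod (rep_L1 f x) * Re (w (of_real x))) \<partial>lborel) = \<infinity>)"
  note S = assms(3)
  have X: "complex_subspace (PW1 S)" unfolding S by (rule complex_subspace_PW1[OF closed_band])
  obtain v where v: "v \<in> PW1 S" "v \<noteq> 0" using PW1_nontrivial[OF \<rho>(1,2)] unfolding S by blast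
  have mem: "f \<in> PW1 S" if "f \<in> Ext (PW1 S)" for f
    using that by (auto simp: Ext_def extreme_point_of_def unit_ball_def)
  have ext1: "?A f" if f: "f \<in> Ext (PW1 S)" for f
  proof -
    have n: "norm f = 1" by (rule extreme_imp_norm_1[OF X v f])
    then have f0: "f \<noteq> 0" by auto
    show ?thesis
      using n extreme_imp_endpoint[OF mem[OF f, unfolded S] f0 \<rho>(1,4) f[unfolded S]]
        extreme_imp_no_common_nonreal_zeros[OF mem[OF f, unfolded S] f0 \<rho>(1,4) f[unfolded S]] by blast
  qed
  have ext2: "f \<in> Ext (PW1 S)" if f: "f \<in> PW1 S" "?A f" for f
  proof (rule extreme_if_rigid[OF X f(1)])
    show "norm f = 1" using f by blast
    fix g M assume g: "g \<in> PW1 S" "norm g = 1" "AE x in lborel. rep_L1 g x * cnj (rep_L1 f x) \<in> \<real>\<^sub>\<ge>\<^sub>0"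
      "AE x in lborel. cmod (rep_L1 g x) \<le> M * cmod (rep_L1 f x)"
    show "g = f"
      using same_argument_rigidity[OF f(1)[unfolded S] _ g(1)[unfolded S] g(2) \<rho>(1-3) _ _ g(3) disjI1[OF g(4)]] f(2) by blast
  qed
  have exp1: "f \<in> Ext (PW1 S) \<and> ?B f" if f: "f \<in> Exp (PW1 S)" for f
  proof -
    have e: "f \<in> Ext (PW1 S)" by (rule exposed_imp_extreme[OF X f])
    have f0: "f \<noteq> 0" using ext1[OF e] by auto
    have "Omega_points (neg_part \<rho> \<sigma> f) \<inter> Omega_points (pos_part \<rho> \<sigma> f) = {}"
      by (rule exposed_imp_no_common_double_zeros[OF mem[OF e, unfolded S] f0 \<rho>(1,4) f[unfolded S]])
    moreover have "(\<integral>\<^sup>+ x. ennreal (cmod (rep_L1 f x) * Re (w (of_real x))) \<partial>lborel) = \<infinity>"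
      if "w holomorphic_on UNIV \<and> \<not> w constant_on UNIV \<and> has_exp_type w 0 \<and> (\<forall>x::real. w (of_real x) \<in> \<real>\<^sub>\<ge>\<^sub>0)" for w
      by (rule exposed_imp_weights_diverge[OF mem[OF e, unfolded S] f0 \<rho>(1,4) f[unfolded S]])
        (use that type0_of_has_exp_type in auto)
    ultimately show ?thesis using e by blast
  qed
  have exp2: "f \<in> Exp (PW1 S)" if e: "f \<in> Ext (PW1 S)" and B: "?B f" for f
  proof (rule exposed_if_rigid[OF X mem[OF e]])
    show "norm f = 1" using ext1[OF e] by blast
    fix g assume g: "g \<in> PW1 S" "norm g = 1" "AE x in lborel. rep_L1 g x * cnj (rep_L1 f x) \<in> \<real>\<^sub>\<ge>\<^sub>0"
    show "g = f"
      using same_argument_rigidity[OF mem[OF e, unfolded S] _ g(1)[unfolded S] g(2) \<rho>(1-3) _ _ g(3) disjI2[OF B]] ext1[OF e] by blast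
  qed
  have "Ext (PW1 S) = {f \<in> PW1 S. ?A f}" using ext1 ext2 mem by blast
  moreover have "Exp (PW1 S) = {f \<in> Ext (PW1 S). ?B f}" using exp1 exp2 by blast
  ultimately show ?thesis by (rule conjI)
qed

end
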